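(* Fix $\theta>0$. Let $T=(T(s),s>0)$ be a non-decreasing self-similar additive (SSA) process with no drift component. Then $\mathrm{range}(T):=\{T(s):s>0\}$ (regarded as a random subset of $(0,\infty)$) is a scale invariant Poisson point process on $(0,\infty)$ with rate $\theta$ if and only if the distribution of $T(1)$ is gamma$(\theta,\lambda)$ for some $\lambda>0$, i.e. $T(1)$ has probability density $$\frac{d}{dx}\mathbb{P}(T(1)\le x)=\frac{\lambda^\theta}{\Gamma(\theta)}x^{\theta-1}e^{-\lambda x}1(x>0).$$
   Context: A stochastic process $T=(T(s),s>0)$ is self-similar additive (SSA) if (i) for all $c>0$, $(T(cs),s>0)$ and $(cT(s),s>0)$ have the same finite-dimensional distributions; and (ii) $T$ has independent increments, is stochastically continuous, has càdlàg paths, and $\lim_{s\to0+}T(s)=0$. For a non-decreasing SSA process, "no drift component" means that $T(s)$ is the sum of its jumps up to time $s$. A simple point process on $(0,\infty)$ is identified with the random countable set of its points. A scale invariant Poisson point process with rate $\theta$ is a Poisson point process on $(0,\infty)$ with intensity measure $\theta x^{-1}dx$. *)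

theory Defs
  imports "HOL-Probability.Probability"
begin

section \<open>Self-similar additive processes\<close>

text \<open>
  A real-valued process indexed by the positive reals is a family \<open>T :: real \<Rightarrow> 'a \<Rightarrow> real\<close>,
  of which only the variables \<open>T s\<close> with \<open>s > 0\<close> matter. Path properties are required almost
  surely, with one exceptional null set for the whole path.
\<close>

definition self_similar :: "'a measure \<Rightarrow> (real \<Rightarrow> 'a \<Rightarrow> real) \<Rightarrow> bool" where
  "self_similar M T \<longleftrightarrow>
     (\<forall>c>0. \<forall>J. finite J \<and> J \<subseteq> {0<..} \<longrightarrow>
        distr M (\<Pi>\<^sub>M s\<in>J. borel) (\<lambda>\<omega>. \<lambda>s\<in>J. T (c * s) \<omega>) =
        distr M (\<Pi>\<^sub>M s\<in>J. borel) (\<lambda>\<omega>. \<lambda>s\<in>J. c * T s \<omega>))"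

definition independent_increments :: "'a measure \<Rightarrow> (real \<Rightarrow> 'a \<Rightarrow> real) \<Rightarrow> bool" where
  "independent_increments M T \<longleftrightarrow>
     (\<forall>n. \<forall>t :: nat \<Rightarrow> real. 0 < t 0 \<and> (\<forall>i<n. t i < t (Suc i)) \<longrightarrow>
        prob_space.indep_vars M (\<lambda>_. borel) (\<lambda>i \<omega>. T (t (Suc i)) \<omega> - T (t i) \<omega>) {..<n})"

definition stochastically_continuous :: "'a measure \<Rightarrow> (real \<Rightarrow> 'a \<Rightarrow> real) \<Rightarrow> bool" where
  "stochastically_continuous M T \<longleftrightarrow>
     (\<forall>s>0. \<forall>\<epsilon>>0. ((\<lambda>u. measure M {\<omega>\<in>space M. \<bar>T u \<omega> - T s \<omega>\<bar> > \<epsilon>}) \<longlongrightarrow> 0) (at s))"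

definition cadlag :: "(real \<Rightarrow> real) \<Rightarrow> bool" where
  "cadlag f \<longleftrightarrow> (\<forall>s>0. continuous (at_right s) f \<and> (\<exists>l. (f \<longlongrightarrow> l) (at_left s)))"

definition ssa_process :: "'a measure \<Rightarrow> (real \<Rightarrow> 'a \<Rightarrow> real) \<Rightarrow> bool" where
  "ssa_process M T \<longleftrightarrow>
     (\<forall>s>0. T s \<in> borel_measurable M) \<and>
     self_similar M T \<and>
     independent_increments M T \<and>
     stochastically_continuous M T \<and>
     (AE \<omega> in M. cadlag (\<lambda>s. T s \<omega>)) \<and>
     (AE \<omega> in M. ((\<lambda>s. T s \<omega>) \<longlongrightarrow> 0) (at_right 0))"

definition nondecreasing_process :: "'a measure \<Rightarrow> (real \<Rightarrow> 'a \<Rightarrow> real) \<Rightarrow> bool" where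
  "nondecreasing_process M T \<longleftrightarrow> (AE \<omega> in M. mono_on {0<..} (\<lambda>s. T s \<omega>))"

definition jump :: "(real \<Rightarrow> real) \<Rightarrow> real \<Rightarrow> real" where
  "jump f u = f u - Lim (at_left u) f"

definition no_drift :: "'a measure \<Rightarrow> (real \<Rightarrow> 'a \<Rightarrow> real) \<Rightarrow> bool" where
  "no_drift M T \<longleftrightarrow>
     (AE \<omega> in M. \<forall>s>0. (jump (\<lambda>u. T u \<omega>) has_sum T s \<omega>) {0<..s})"

definition process_range :: "(real \<Rightarrow> 'a \<Rightarrow> real) \<Rightarrow> 'a \<Rightarrow> real set" where
  "process_range T \<omega> = (\<lambda>s. T s \<omega>) ` {0<..}"


section \<open>Poisson point processes\<close>

text \<open>
  A simple point process is identified with the random set \<open>\<Xi>\<close> of its points; the state space is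
  \<open>space \<mu>\<close>.
\<close>

definition point_count :: "('a \<Rightarrow> 'b set) \<Rightarrow> 'b set \<Rightarrow> 'a \<Rightarrow> ennreal" where
  "point_count \<Xi> A \<omega> = emeasure (count_space UNIV) (\<Xi> \<omega> \<inter> A)"

text \<open>
  Random sets that agree outside a null set are to be treated alike, so the counts are random
  variables on the completion of the probability space: on an exceptional null set \<open>\<Xi> \<omega>\<close> may be
  an arbitrary set. The Poisson probabilities are written out because the library's
  \<open>poisson_pmf\<close> is specified only for positive rate, whereas \<open>\<mu> A = 0\<close> is allowed here.
\<close>

definition poisson_point_process :: "'a measure \<Rightarrow> 'b measure \<Rightarrow> ('a \<Rightarrow> 'b set) \<Rightarrow> bool" where
  "poisson_point_process M \<mu> \<Xi> \<longleftrightarrow>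
     (AE \<omega> in M. \<Xi> \<omega> \<subseteq> space \<mu> \<and> countable (\<Xi> \<omega>)) \<and>
     (\<forall>A\<in>sets \<mu>. point_count \<Xi> A \<in> borel_measurable (completion M)) \<and>
     (\<forall>A\<in>sets \<mu>. emeasure \<mu> A < \<infinity> \<longrightarrow>
        (\<forall>k::nat. measure (completion M) {\<omega>\<in>space M. point_count \<Xi> A \<omega> = of_nat k} =
           measure \<mu> A ^ k / fact k * exp (- measure \<mu> A))) \<and>
     (\<forall>A\<in>sets \<mu>. emeasure \<mu> A = \<infinity> \<longrightarrow> (AE \<omega> in M. point_count \<Xi> A \<omega> = \<infinity>)) \<and>
     (\<forall>n. \<forall>A :: nat \<Rightarrow> 'b set. (\<forall>i<n. A i \<in> sets \<mu>) \<and> disjoint_family_on A {..<n} \<longrightarrow>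
        prob_space.indep_vars (completion M) (\<lambda>_. borel) (\<lambda>i. point_count \<Xi> (A i)) {..<n})"

definition scale_invariant_intensity :: "real \<Rightarrow> real measure" where
  "scale_invariant_intensity \<theta> = density (restrict_space lborel {0<..}) (\<lambda>x. ennreal (\<theta> / x))"

definition scale_invariant_poisson_process :: "'a measure \<Rightarrow> real \<Rightarrow> ('a \<Rightarrow> real set) \<Rightarrow> bool" where
  "scale_invariant_poisson_process M \<theta> \<Xi> \<longleftrightarrow>
     poisson_point_process M (scale_invariant_intensity \<theta>) \<Xi>"


section \<open>The gamma distribution\<close>

definition gamma_density :: "real \<Rightarrow> real \<Rightarrow> real \<Rightarrow> real" where
  "gamma_density \<theta> l x =
     (if x > 0 then l powr \<theta> / Gamma \<theta> * x powr (\<theta> - 1) * exp (- l * x) else 0)"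

end

theory Submission
  imports Defs
begin

text \<open>
  Everything is computed along the grids of times \<open>2 powr (k / 2 ^ n)\<close>, whose increments are
  independent and, by self-similarity, have laws that differ only by a scale.

  If \<open>T 1\<close> is a gamma variable, the laws of the increments are determined by division of
  characteristic functions; they are negative binomial mixtures of gamma laws, so that to first
  order an increment is either \<open>0\<close> or exponential. The expected product of \<open>f\<close> over the range
  then satisfies along the grid an approximate linear recursion, solved by
  \<open>exp (- \<integral> \<theta> (1 - f x) / x dx)\<close>, and these generating functionals determine a Poisson process.

  Conversely, let \<open>y = T 1\<close>, let \<open>x\<close> be the increment over the first grid interval after time \<open>1\<close>
  and \<open>z\<close> the first nonzero increment after it; these are independent. Counting the grid intervals
  over which \<open>T\<close> jumps across a gap of its range gives, conditionally on \<open>x \<noteq> 0\<close>, the limit law of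
  \<open>(y / x, z / (x + y))\<close>, which is the same for every process with Poisson range. Since the laws of
  two such ratios determine the laws of the three independent factors up to a common scale, \<open>y\<close>
  has the gamma law.
\<close>

section \<open>Gamma distributions\<close>

text \<open>The range of \<open>T\<close> forgets the times at which its values are taken, so
  nothing about time \<open>1\<close> can be read off it directly. Self-similarity supplies the
  times: the expected number of grid times at which the path crosses a level in a prescribed way
  equals the expected number of grid factors that bring the path near time \<open>1\<close> to that
  level, and the number of factors available is a fixed power of two
  (\<open>emeasure_count_grid\<close>). A statistic of the range thus becomes \<open>2 ^ n\<close>
  times a probability at time \<open>1\<close>. The law of one ratio of two independent variables
  does not determine the two laws, which is why the next jump \<open>z\<close> is included; with
  three variables Kotlarski's argument applies. In the other direction each grid step costs an error
  of second order in its logarithmic length, and only about \<open>2 ^ n\<close> steps are made, so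
  the errors vanish. The candidate \<open>h\<close> fits because it satisfies, in integrated form,
  (y^\<theta> h)' = \<theta> f y^(\<theta> - 1) h. The range is reached only through almost sure
  limits along the grid, hence measurability with respect to the completion.\<close>

definition gamma_measure :: "real \<Rightarrow> real \<Rightarrow> real measure" where
  "gamma_measure a l = density lborel (\<lambda>x. ennreal (gamma_density a l x))"

lemma sets_gamma_measure [simp, measurable_cong]: "sets (gamma_measure a l) = sets borel"
  by (simp add: gamma_measure_def)

lemma space_gamma_measure [simp]: "space (gamma_measure a l) = UNIV"
  by (simp add: gamma_measure_def)

lemma borel_measurable_gamma_density [measurable]: "gamma_density a l \<in> borel_measurable borel"
  unfolding gamma_density_def by measurable

lemma gamma_density_nonneg: "a > 0 \<Longrightarrow> 0 \<le> gamma_density a l x"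
  by (auto simp: gamma_density_def intro!: mult_nonneg_nonneg divide_nonneg_nonneg Gamma_real_nonneg less_imp_le)

lemma gamma_density_scale:
  assumes "c > 0" "l > 0"
  shows "c * gamma_density a l (c * x) = gamma_density a (c * l) x"
  using assms
  by (auto simp: gamma_density_def powr_mult powr_diff zero_less_mult_iff field_simps)

lemma nn_integral_gamma_density:
  assumes a: "a > 0" and l: "l > 0"
  shows "(\<integral>\<^sup>+x. ennreal (gamma_density a l x) \<partial>lborel) = 1"
proof -
  have "ennreal (Gamma a) = (\<integral>\<^sup>+ t. ennreal (indicator {0..} t * t powr (a - 1) / exp t) \<partial>lborel)"
    by (rule Gamma_conv_nn_integral_real[OF a])
  also have "\<dots> = ennreal (Gamma a) * (\<integral>\<^sup>+ t. ennreal (gamma_density a 1 t) \<partial>lborel)"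
    using Gamma_real_pos[OF a]
    by (subst nn_integral_cmult[symmetric], simp)
      (intro nn_integral_cong_AE eventually_mono[OF AE_lborel_singleton[of 0]],
        auto simp: gamma_density_def indicator_def ennreal_mult'[symmetric] exp_minus field_simps)
  finally have 1: "(\<integral>\<^sup>+ t. ennreal (gamma_density a 1 t) \<partial>lborel) = 1"
    using Gamma_real_pos[OF a]
    by (metis ennreal_mult_cancel_left ennreal_neq_top ennreal_eq_0_iff linorder_not_le mult.right_neutral)
  have "(\<integral>\<^sup>+ t. ennreal (gamma_density a 1 t) \<partial>lborel)
      = ennreal l * (\<integral>\<^sup>+ t. ennreal (gamma_density a 1 (0 + l * t)) \<partial>lborel)"
    using l by (subst nn_integral_real_affine[where c = l and t = 0]) auto
  also have "\<dots> = (\<integral>\<^sup>+ t. ennreal (gamma_density a l t) \<partial>lborel)"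
    using l gamma_density_scale[of l 1 a]
    by (subst nn_integral_cmult[symmetric], simp) (simp add: ennreal_mult'[symmetric])
  finally show ?thesis
    using 1 by simp
qed

lemma prob_space_gamma_measure: "a > 0 \<Longrightarrow> l > 0 \<Longrightarrow> prob_space (gamma_measure a l)"
  by (rule prob_spaceI) (simp add: gamma_measure_def emeasure_density nn_integral_gamma_density)

lemma nn_integral_gamma_measure:
  "f \<in> borel_measurable borel \<Longrightarrow>
    (\<integral>\<^sup>+x. f x \<partial>gamma_measure a l) = (\<integral>\<^sup>+x. ennreal (gamma_density a l x) * f x \<partial>lborel)"
  by (simp add: gamma_measure_def nn_integral_density)

lemma AE_gamma_measure_pos: "AE x in gamma_measure a l. x > 0"
  unfolding gamma_measure_def by (subst AE_density) (auto simp: gamma_density_def)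

lemma distr_mult_gamma_measure:
  assumes c: "c > 0" and l: "l > 0" 
  shows "distr (gamma_measure a l) borel (\<lambda>x. c * x) = gamma_measure a (l / c)"
proof (rule measure_eqI)
  fix A :: "real set" assume "A \<in> sets (distr (gamma_measure a l) borel ((*) c))"
  then have [measurable]: "A \<in> sets borel" by simp
  have "emeasure (distr (gamma_measure a l) borel (\<lambda>x. c * x)) A
      = (\<integral>\<^sup>+x. indicator A (c * x) \<partial>gamma_measure a l)"
    by (subst nn_integral_indicator[symmetric], simp, subst nn_integral_distr) auto
  also have "\<dots> = (\<integral>\<^sup>+x. ennreal (gamma_density a l x) * indicator A (c * x) \<partial>lborel)"
    by (simp add: nn_integral_gamma_measure)
  also have "\<dots> = ennreal (1 / c) * (\<integral>\<^sup>+x. ennreal (gamma_density a l (1 / c * x)) * indicator A x \<partial>lborel)"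
    using c by (subst nn_integral_real_affine[where c = "1 / c" and t = 0]) auto
  also have "\<dots> = (\<integral>\<^sup>+x. ennreal (gamma_density a (l / c) x) * indicator A x \<partial>lborel)"
    using c l gamma_density_scale[of "1 / c" l a]
    by (subst nn_integral_cmult[symmetric], simp)
      (simp add: ennreal_mult'[symmetric] mult.assoc[symmetric])
  also have "\<dots> = emeasure (gamma_measure a (l / c)) A"
    by (simp add: gamma_measure_def emeasure_density)
  finally show "emeasure (distr (gamma_measure a l) borel (\<lambda>x. c * x)) A = emeasure (gamma_measure a (l / c)) A" .
qed simp

text \<open>The substitution \<open>y = x * u\<close> reduces this to the Beta integral. It is what
  remains of the convolution of two gamma densities once their exponentials have combined to a
  factor free of \<open>y\<close>.\<close>

lemma nn_integral_Beta:
  assumes a: "a > 0" and b: "b > 0" and x: "x > 0"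
  shows "(\<integral>\<^sup>+y. ennreal (indicator {0<..<x} y * ((x - y) powr (a - 1) * y powr (b - 1))) \<partial>lborel)
    = ennreal (x powr (a + b - 1) * Beta a b)"
proof -
  have 1: "(\<integral>\<^sup>+u. ennreal (indicator {0..1} u * (u powr (b - 1) * (1 - u) powr (a - 1))) \<partial>lborel)
      = ennreal (Beta b a)"
    using nn_integral_has_integral_lebesgue[OF _ has_integral_Beta_real[OF b a]] by simp
  have "(\<integral>\<^sup>+y. ennreal (indicator {0<..<x} y * ((x - y) powr (a - 1) * y powr (b - 1))) \<partial>lborel)
      = ennreal x * (\<integral>\<^sup>+y. ennreal (indicator {0<..<x} (0 + x * y) * ((x - (0 + x * y)) powr (a - 1) * (0 + x * y) powr (b - 1))) \<partial>lborel)"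
    using x by (subst nn_integral_real_affine[where c = x and t = 0]) auto
  also have "\<dots> = (\<integral>\<^sup>+u. ennreal (x powr (a + b - 1)) *
      ennreal (indicator {0..1} u * (u powr (b - 1) * (1 - u) powr (a - 1))) \<partial>lborel)"
  proof (subst nn_integral_cmult[symmetric], simp, rule nn_integral_cong_AE)
    show "AE u in lborel. ennreal x * ennreal (indicator {0<..<x} (0 + x * u) * ((x - (0 + x * u)) powr (a - 1) * (0 + x * u) powr (b - 1)))
      = ennreal (x powr (a + b - 1)) * ennreal (indicator {0..1} u * (u powr (b - 1) * (1 - u) powr (a - 1)))"
      using AE_lborel_singleton[of 0] AE_lborel_singleton[of 1]
    proof eventually_elim
      case (elim u)
      show ?case
      proof (cases "0 < u \<and> u < 1")
        case True
        have "x - x * u = x * (1 - u)" by (simp add: algebra_simps)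
        moreover have "x powr (a + b - 1) = x * (x powr (a - 1) * x powr (b - 1))"
          using x by (simp add: powr_diff powr_add field_simps)
        ultimately show ?thesis
          using True x by (simp add: indicator_def ennreal_mult'[symmetric] powr_mult mult_ac)
      next
        case False
        then show ?thesis using elim x
          by (auto simp: indicator_def zero_less_mult_iff mult_less_cancel_left2)
      qed
    qed
  qed
  also have "\<dots> = ennreal (x powr (a + b - 1) * Beta a b)"
    by (subst nn_integral_cmult, simp, subst 1) (simp add: ennreal_mult' Beta_commute)
  finally show ?thesis .
qed

lemma gamma_density_convolution:
  assumes a: "a > 0" and b: "b > 0" and l: "l > 0"
  shows "(\<integral>\<^sup>+y. ennreal (gamma_density a l (x - y)) * ennreal (gamma_density b l y) \<partial>lborel)
    = ennreal (gamma_density (a + b) l x)"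
proof (cases "x > 0")
  case True
  define C where "C = l powr (a + b) / (Gamma a * Gamma b) * exp (- l * x)"
  have C: "C \<ge> 0"
    unfolding C_def using a b by (auto intro!: mult_nonneg_nonneg divide_nonneg_nonneg Gamma_real_nonneg)
  have "(\<integral>\<^sup>+y. ennreal (gamma_density a l (x - y)) * ennreal (gamma_density b l y) \<partial>lborel)
    = (\<integral>\<^sup>+y. ennreal C * ennreal (indicator {0<..<x} y * ((x - y) powr (a - 1) * y powr (b - 1))) \<partial>lborel)"
  proof (rule nn_integral_cong)
    fix y :: real
    show "ennreal (gamma_density a l (x - y)) * ennreal (gamma_density b l y)
      = ennreal C * ennreal (indicator {0<..<x} y * ((x - y) powr (a - 1) * y powr (b - 1)))"
    proof (cases "0 < y \<and> y < x")
      case True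
      have "gamma_density a l (x - y) * gamma_density b l y = C * ((x - y) powr (a - 1) * y powr (b - 1))"
        using True unfolding gamma_density_def C_def
        by (simp add: powr_add exp_diff exp_minus algebra_simps)
          (simp add: field_simps exp_add[symmetric])
      then show ?thesis
        using True a b C by (simp add: ennreal_mult'[symmetric] gamma_density_nonneg)
    qed (auto simp: gamma_density_def)
  qed
  also have "\<dots> = ennreal (C * (x powr (a + b - 1) * Beta a b))"
    using C by (subst nn_integral_cmult, simp, subst nn_integral_Beta[OF a b True]) (simp add: ennreal_mult')
  also have "C * (x powr (a + b - 1) * Beta a b) = gamma_density (a + b) l x"
    using True Gamma_real_pos[OF a] Gamma_real_pos[OF b]
    by (simp add: C_def gamma_density_def Beta_def)
  finally show ?thesis .
next
  case False
  have *: "ennreal (gamma_density a l (x - y)) * ennreal (gamma_density b l y) = 0" for y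
    using False by (auto simp: gamma_density_def)
  show ?thesis
    unfolding * using False by (simp add: gamma_density_def)
qed

lemma nn_integral_gamma_measure_add:
  assumes a: "a > 0" and b: "b > 0" and l: "l > 0" and [measurable]: "f \<in> borel_measurable borel"
  shows "(\<integral>\<^sup>+y. \<integral>\<^sup>+x. f (y + x) \<partial>gamma_measure b l \<partial>gamma_measure a l) = (\<integral>\<^sup>+z. f z \<partial>gamma_measure (a + b) l)"
proof -
  interpret A: prob_space "gamma_measure a l" using a l by (rule prob_space_gamma_measure)
  interpret B: prob_space "gamma_measure b l" using b l by (rule prob_space_gamma_measure)
  have "(\<integral>\<^sup>+y. \<integral>\<^sup>+x. f (y + x) \<partial>gamma_measure b l \<partial>gamma_measure a l)
      = (\<integral>\<^sup>+z. f z \<partial>convolution (gamma_measure a l) (gamma_measure b l))"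
    by (subst nn_integral_convolution) (auto intro: A.finite_measure_axioms B.finite_measure_axioms)
  also have "convolution (gamma_measure a l) (gamma_measure b l) = gamma_measure (a + b) l"
    using A.finite_measure_axioms B.finite_measure_axioms unfolding gamma_measure_def
    by (subst convolution_density) (auto simp: gamma_density_convolution[OF a b l])
  finally show ?thesis .
qed

lemma real_distribution_gamma_measure: "a > 0 \<Longrightarrow> l > 0 \<Longrightarrow> real_distribution (gamma_measure a l)"
  by (auto simp: real_distribution_def real_distribution_axioms_def prob_space_gamma_measure)

section \<open>Increments of a gamma process\<close>

text \<open>
  The quotient of the Laplace transforms of the gamma laws with shape \<open>a\<close> and rates
  \<open>be < al\<close> is \<open>p * (1 - e * al / (al + q)) powr (- a)\<close> with \<open>p = (be / al) powr a\<close> and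
  \<open>e = 1 - be / al\<close>. Expanding the power shows it to be the transform of a negative binomial
  mixture of gamma laws of rate \<open>al\<close>.
\<close>

definition nb_weight :: "real \<Rightarrow> real \<Rightarrow> nat \<Rightarrow> real" where
  "nb_weight a r n = r powr a * (pochhammer a n / fact n) * (1 - r) ^ n"

text \<open>The law of a sum of \<open>n\<close> independent exponentials of rate \<open>al\<close>;
  the empty sum is the point mass at \<open>0\<close>, for which there is no gamma density.\<close>

definition nb_kernel :: "real \<Rightarrow> nat \<Rightarrow> real measure" where
  "nb_kernel al n = (if n = 0 then return borel 0 else gamma_measure (real n) al)"

definition gamma_increment :: "real \<Rightarrow> real \<Rightarrow> real \<Rightarrow> real measure" where
  "gamma_increment a al be =
     bind (density (count_space UNIV) (\<lambda>n. ennreal (nb_weight a (be / al) n))) (nb_kernel al)"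

lemma nb_weight_nonneg: "a > 0 \<Longrightarrow> 0 < r \<Longrightarrow> r \<le> 1 \<Longrightarrow> 0 \<le> nb_weight a r n"
  unfolding nb_weight_def
  by (intro mult_nonneg_nonneg divide_nonneg_nonneg pochhammer_nonneg) auto

text \<open>\<open>Gamma (a + n)\<close> equals \<open>pochhammer a n * Gamma a\<close>, so the
  Pochhammer symbols cancel and the terms form the exponential series of
  \<open>(al - be) * z\<close>, which changes the rate from \<open>al\<close> to
  \<open>be\<close>.\<close>

lemma nb_weight_gamma_density:
  assumes a: "a > 0" and be: "0 < be" "be \<le> al"
  shows "(\<lambda>n. nb_weight a (be / al) n * gamma_density (a + real n) al z) sums gamma_density a be z"
proof (cases "z > 0")
  case True
  have nz: "a \<notin> \<int>\<^sub>\<le>\<^sub>0" using a by (auto dest: nonpos_Ints_nonpos)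
  have "nb_weight a (be / al) n * gamma_density (a + real n) al z
    = (be powr a / Gamma a * z powr (a - 1) * exp (- al * z)) * (((al - be) * z) ^ n /\<^sub>R fact n)" for n
  proof -
    have "Gamma (a + real n) = pochhammer a n * Gamma a"
      using nz pochhammer_Gamma[of a n] Gamma_real_pos[OF a] by (simp add: field_simps)
    moreover have "pochhammer a n > 0" using a by (simp add: pochhammer_pos)
    moreover have "al powr (a + real n) = al powr a * al ^ n"
      using be by (simp add: powr_add powr_realpow)
    moreover have "z powr (a + real n - 1) = z powr (a - 1) * z ^ n"
      using True by (simp add: powr_add powr_diff powr_realpow)
    moreover have "(1 - be / al) ^ n * al ^ n = (al - be) ^ n"
      using be by (simp add: power_mult_distrib[symmetric] left_diff_distrib)
    moreover have "(be / al) powr a * al powr a = be powr a"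
      using be by (simp add: powr_mult[symmetric])
    ultimately have facts: "Gamma (a + real n) = pochhammer a n * Gamma a" "pochhammer a n \<noteq> 0"
      "al powr (a + real n) = al powr a * al ^ n" "z powr (a + real n - 1) = z powr (a - 1) * z ^ n"
      "((1 - be / al) * al) ^ n = (al - be) ^ n" "(be / al) powr a * al powr a = be powr a"
      by (auto simp: power_mult_distrib)
    have "nb_weight a (be / al) n * gamma_density (a + real n) al z
      = ((be / al) powr a * al powr a) * ((1 - be / al) * al) ^ n * z ^ n * z powr (a - 1) * exp (- al * z) / (Gamma a * fact n)"
      using True facts(2) by (simp add: nb_weight_def gamma_density_def facts(1,3,4) power_mult_distrib mult_ac)
    also have "\<dots> = (be powr a / Gamma a * z powr (a - 1) * exp (- al * z)) * (((al - be) * z) ^ n /\<^sub>R fact n)"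
      unfolding facts(5,6) by (simp add: power_mult_distrib divide_simps)
    finally show ?thesis .
  qed
  moreover have "(\<lambda>n. (be powr a / Gamma a * z powr (a - 1) * exp (- al * z)) * (((al - be) * z) ^ n /\<^sub>R fact n))
      sums ((be powr a / Gamma a * z powr (a - 1) * exp (- al * z)) * exp ((al - be) * z))"
    by (intro sums_mult exp_converges)
  moreover have "(be powr a / Gamma a * z powr (a - 1) * exp (- al * z)) * exp ((al - be) * z) = gamma_density a be z"
    using True by (simp add: gamma_density_def exp_add[symmetric] algebra_simps)
  ultimately show ?thesis by simp
qed (simp add: gamma_density_def)

lemma suminf_nb_weight_gamma_density:
  assumes a: "a > 0" and be: "0 < be" "be \<le> al"
  shows "(\<Sum>n. ennreal (nb_weight a (be / al) n * gamma_density (a + real n) al z)) = ennreal (gamma_density a be z)"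
  using assms
  by (intro suminf_ennreal_eq nb_weight_gamma_density mult_nonneg_nonneg nb_weight_nonneg gamma_density_nonneg) auto

lemma measurable_nb_kernel [measurable]:
  "al > 0 \<Longrightarrow> nb_kernel al \<in> measurable (count_space UNIV) (subprob_algebra borel)"
  by (auto simp: nb_kernel_def space_subprob_algebra intro!: prob_space_imp_subprob_space
      prob_space_gamma_measure prob_space_return split: if_splits)

lemma nn_integral_gamma_increment:
  assumes a: "a > 0" and be: "0 < be" "be \<le> al" and f: "f \<in> borel_measurable borel"
  shows "(\<integral>\<^sup>+x. f x \<partial>gamma_increment a al be)
    = (\<Sum>n. ennreal (nb_weight a (be / al) n) * (\<integral>\<^sup>+x. f x \<partial>nb_kernel al n))"
  using assms unfolding gamma_increment_def
  by (subst nn_integral_bind[where B = borel])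
    (auto simp: nn_integral_density nn_integral_count_space_nat intro: measurable_nb_kernel[THEN measurable_space])

text \<open>Given the index \<open>n\<close> of the mixture, adding \<open>n\<close> exponentials
  raises the shape from \<open>a\<close> to \<open>a + n\<close> at the same rate \<open>al\<close>;
  mixing the shapes with the weights lowers the rate to \<open>be\<close>.\<close>

lemma nn_integral_gamma_measure_increment:
  assumes a: "a > 0" and be: "0 < be" "be \<le> al" and [measurable]: "f \<in> borel_measurable borel"
  shows "(\<integral>\<^sup>+y. \<integral>\<^sup>+x. f (y + x) \<partial>gamma_increment a al be \<partial>gamma_measure a al) = (\<integral>\<^sup>+z. f z \<partial>gamma_measure a be)"
proof -
  have kernel: "(\<integral>\<^sup>+y. \<integral>\<^sup>+x. f (y + x) \<partial>nb_kernel al n \<partial>gamma_measure a al) = (\<integral>\<^sup>+z. f z \<partial>gamma_measure (a + real n) al)" for n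
    using a be by (cases "n = 0") (auto simp: nb_kernel_def nn_integral_return nn_integral_gamma_measure_add)
  have [measurable]: "(\<lambda>y. \<integral>\<^sup>+x. f (y + x) \<partial>nb_kernel al n) \<in> borel_measurable borel" for n
  proof (cases "n = 0")
    case False
    interpret prob_space "gamma_measure (real n) al" using False be by (intro prob_space_gamma_measure) auto
    from False show ?thesis by (simp add: nb_kernel_def)
  qed (simp add: nb_kernel_def nn_integral_return)
  have "(\<integral>\<^sup>+y. \<integral>\<^sup>+x. f (y + x) \<partial>gamma_increment a al be \<partial>gamma_measure a al)
      = (\<integral>\<^sup>+y. (\<Sum>n. ennreal (nb_weight a (be / al) n) * (\<integral>\<^sup>+x. f (y + x) \<partial>nb_kernel al n)) \<partial>gamma_measure a al)"
    using a be by (intro nn_integral_cong nn_integral_gamma_increment) auto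
  also have "\<dots> = (\<Sum>n. ennreal (nb_weight a (be / al) n) * (\<integral>\<^sup>+z. f z \<partial>gamma_measure (a + real n) al))"
    by (subst nn_integral_suminf) (auto simp: nn_integral_cmult kernel)
  also have "\<dots> = (\<Sum>n. (\<integral>\<^sup>+z. ennreal (nb_weight a (be / al) n * gamma_density (a + real n) al z) * f z \<partial>lborel))"
    using a be
    by (intro suminf_cong)
      (simp add: nn_integral_gamma_measure nn_integral_cmult[symmetric] ennreal_mult gamma_density_nonneg nb_weight_nonneg mult.assoc)
  also have "\<dots> = (\<integral>\<^sup>+z. (\<Sum>n. ennreal (nb_weight a (be / al) n * gamma_density (a + real n) al z)) * f z \<partial>lborel)"
    by (subst nn_integral_suminf[symmetric]) (auto simp: ennreal_suminf_multc)
  also have "\<dots> = (\<integral>\<^sup>+z. f z \<partial>gamma_measure a be)"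
    using a be by (simp add: suminf_nb_weight_gamma_density nn_integral_gamma_measure)
  finally show ?thesis .
qed


lemma sets_gamma_increment [simp, measurable_cong]:
  assumes "al > 0"
  shows "sets (gamma_increment a al be) = sets borel"
  unfolding gamma_increment_def
  by (rule sets_bind) (simp_all add: sets_kernel[OF measurable_nb_kernel[OF assms]])

text \<open>Total mass one follows from the convolution identity with the constant test function
  \<open>1\<close>, so the binomial series is never summed.\<close>

lemma real_distribution_gamma_increment:
  assumes a: "a > 0" and be: "0 < be" "be \<le> al"
  shows "real_distribution (gamma_increment a al be)"
proof -
  interpret A: prob_space "gamma_measure a al" using a be by (intro prob_space_gamma_measure) auto
  interpret B: prob_space "gamma_measure a be" using a be by (intro prob_space_gamma_measure) auto
  have al: "al > 0" using be by simp
  have "emeasure (gamma_increment a al be) (space (gamma_increment a al be)) = 1"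
    using nn_integral_gamma_measure_increment[OF a be, of "\<lambda>_. 1"] A.emeasure_space_1 B.emeasure_space_1
    by simp
  with al show ?thesis
    by (auto simp: real_distribution_def real_distribution_axioms_def intro: prob_spaceI)
qed

text \<open>Only the summands \<open>0\<close> and \<open>1\<close> of the mixture are kept: no jump
  and a single exponential jump. What is dropped is nonnegative.\<close>

lemma nn_integral_gamma_increment_ge:
  assumes a: "a > 0" and be: "0 < be" "be \<le> al" and [measurable]: "f \<in> borel_measurable borel"
  shows "ennreal ((be / al) powr a) * f 0
      + ennreal ((be / al) powr a * a * (1 - be / al)) * (\<integral>\<^sup>+x. f x \<partial>gamma_measure 1 al)
    \<le> (\<integral>\<^sup>+x. f x \<partial>gamma_increment a al be)"
proof -
  have "(\<Sum>n<2. ennreal (nb_weight a (be / al) n) * (\<integral>\<^sup>+x. f x \<partial>nb_kernel al n))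
      \<le> (\<integral>\<^sup>+x. f x \<partial>gamma_increment a al be)"
    unfolding nn_integral_gamma_increment[OF a be assms(4)] by (rule sum_le_suminf) auto
  then show ?thesis
    by (simp add: numeral_2_eq_2 nb_kernel_def nn_integral_return nb_weight_def)
qed

lemma emeasure_gamma_increment_0:
  assumes a: "a > 0" and be: "0 < be" "be \<le> al"
  shows "ennreal ((be / al) powr a) \<le> emeasure (gamma_increment a al be) {0}"
proof -
  have al: "al > 0" using be by simp
  have "ennreal ((be / al) powr a) \<le> ennreal ((be / al) powr a) * indicator {0::real} 0
      + ennreal ((be / al) powr a * a * (1 - be / al)) * (\<integral>\<^sup>+x. indicator {0} x \<partial>gamma_measure 1 al)"
    by simp
  also have "\<dots> \<le> (\<integral>\<^sup>+x. indicator {0} x \<partial>gamma_increment a al be)"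
    by (rule nn_integral_gamma_increment_ge[OF a be]) simp
  also have "\<dots> = emeasure (gamma_increment a al be) {0}"
    using al by (intro nn_integral_indicator) simp
  finally show ?thesis .
qed

text \<open>For \<open>r = be / al\<close>, the mass that the mixture gives to two or more
  exponentials; it is of second order in \<open>1 - r\<close>.\<close>

definition gamma_remainder :: "real \<Rightarrow> real \<Rightarrow> real" where
  "gamma_remainder a r = 1 - r powr a - r powr a * a * (1 - r)"

lemma integral_gamma_increment_approx:
  assumes a: "a > 0" and be: "0 < be" "be \<le> al" and [measurable]: "f \<in> borel_measurable borel"
    and f: "\<And>x. \<bar>f x\<bar> \<le> 1"
  shows "\<bar>(\<integral>x. f x \<partial>gamma_increment a al be) - (be / al) powr a * f 0
      - (be / al) powr a * a * (1 - be / al) * (\<integral>x. f x \<partial>gamma_measure 1 al)\<bar> \<le> gamma_remainder a (be / al)"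
proof -
  have al: "al > 0" using be by simp
  interpret V: real_distribution "gamma_increment a al be"
    by (rule real_distribution_gamma_increment[OF a be])
  interpret E: prob_space "gamma_measure 1 al" using al by (intro prob_space_gamma_measure) auto
  define p where "p = (be / al) powr a"
  define q where "q = p * a * (1 - be / al)"
  have q: "q \<ge> 0" "p \<ge> 0" using a be by (auto simp: q_def p_def)
  \<comment> \<open>Both \<open>1 + f\<close> and \<open>1 - f\<close> are nonnegative, so the
    one-sided bound applies to each and yields both directions of the estimate.\<close>
  have key: "p * (1 + s * f 0) + q * (1 + s * (\<integral>x. f x \<partial>gamma_measure 1 al)) \<le> 1 + s * (\<integral>x. f x \<partial>gamma_increment a al be)"
    if s: "s \<in> {1, -1}" for s :: real
  proof -
    have nonneg: "0 \<le> 1 + s * f x" for x using f[of x] s by auto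
    have intV: "integrable (gamma_increment a al be) f"
      by (rule V.integrable_const_bound[where B = 1]) (use f al in auto)
    have intE: "integrable (gamma_measure 1 al) f"
      by (rule E.integrable_const_bound[where B = 1]) (use f in auto)
    have "ennreal p * ennreal (1 + s * f 0) + ennreal q * (\<integral>\<^sup>+x. ennreal (1 + s * f x) \<partial>gamma_measure 1 al)
        \<le> (\<integral>\<^sup>+x. ennreal (1 + s * f x) \<partial>gamma_increment a al be)"
      unfolding p_def q_def by (rule nn_integral_gamma_increment_ge[OF a be]) simp
    also have "(\<integral>\<^sup>+x. ennreal (1 + s * f x) \<partial>gamma_measure 1 al) = ennreal (\<integral>x. 1 + s * f x \<partial>gamma_measure 1 al)"
      using nonneg intE by (intro nn_integral_eq_integral) auto
    also have "(\<integral>x. 1 + s * f x \<partial>gamma_measure 1 al) = 1 + s * (\<integral>x. f x \<partial>gamma_measure 1 al)"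
      using intE E.prob_space by simp
    also have "(\<integral>\<^sup>+x. ennreal (1 + s * f x) \<partial>gamma_increment a al be) = ennreal (\<integral>x. 1 + s * f x \<partial>gamma_increment a al be)"
      using nonneg intV by (intro nn_integral_eq_integral) auto
    also have "(\<integral>x. 1 + s * f x \<partial>gamma_increment a al be) = 1 + s * (\<integral>x. f x \<partial>gamma_increment a al be)"
      using intV V.prob_space by simp
    finally have le: "ennreal p * ennreal (1 + s * f 0) + ennreal q * ennreal (1 + s * (\<integral>x. f x \<partial>gamma_measure 1 al))
        \<le> ennreal (1 + s * (\<integral>x. f x \<partial>gamma_increment a al be))" .
    have E0: "0 \<le> 1 + s * (\<integral>x. f x \<partial>gamma_measure 1 al)"
      using Bochner_Integration.integral_nonneg[of "gamma_measure 1 al" "\<lambda>x. 1 + s * f x"] nonneg intE E.prob_space by simp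
    have V0: "0 \<le> 1 + s * (\<integral>x. f x \<partial>gamma_increment a al be)"
      using Bochner_Integration.integral_nonneg[of "gamma_increment a al be" "\<lambda>x. 1 + s * f x"] nonneg intV V.prob_space by simp
    from le show ?thesis
      using q nonneg[of 0] E0 V0 by (simp add: ennreal_mult'[symmetric] ennreal_plus[symmetric] del: ennreal_plus)
  qed
  show ?thesis
    using key[of 1] key[of "-1"] unfolding gamma_remainder_def p_def[symmetric] q_def[symmetric]
    by (simp add: algebra_simps)
qed

section \<open>Characteristic functions of gamma laws and division by them\<close>

lemma char_convolution:
  assumes "real_distribution A" "real_distribution B"
  shows "char (A \<star> B) t = char A t * char B t"
proof -
  interpret A: real_distribution A by fact
  interpret B: real_distribution B by fact
  interpret P: pair_prob_space A B ..
  have "char (A \<star> B) t = (CLINT x|A \<Otimes>\<^sub>M B. iexp (t * fst x) * iexp (t * snd x))"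
    unfolding char_def convolution_def
    by (subst integral_distr) (auto simp: case_prod_beta algebra_simps exp_add)
  also have "\<dots> = (CLINT x|A. CLINT y|B. iexp (t * x) * iexp (t * y))"
    by (subst P.integral_fst'[symmetric])
      (auto intro!: P.P.integrable_const_bound[where B = 1] simp: norm_mult)
  finally show ?thesis
    by (simp add: char_def)
qed

lemma gamma_measure_convolution_increment:
  assumes a: "a > 0" and be: "0 < be" "be \<le> al"
  shows "gamma_measure a al \<star> gamma_increment a al be = gamma_measure a be"
proof (rule measure_eqI)
  fix A assume "A \<in> sets (gamma_measure a al \<star> gamma_increment a al be)"
  then have [measurable]: "A \<in> sets borel" by simp
  have al: "al > 0" using be by simp
  interpret V: real_distribution "gamma_increment a al be"
    by (rule real_distribution_gamma_increment[OF a be])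
  interpret G: prob_space "gamma_measure a al" using a al by (intro prob_space_gamma_measure) auto
  show "emeasure (gamma_measure a al \<star> gamma_increment a al be) A = emeasure (gamma_measure a be) A"
    using nn_integral_gamma_measure_increment[OF a be, of "indicator A"] al
    by (subst convolution_emeasure') (auto intro: V.finite_measure_axioms G.finite_measure_axioms)
qed simp

text \<open>An atom at \<open>0\<close> of mass above one half outweighs the rest: the transform
  differs from \<open>1\<close> by at most twice the mass off the atom, which is less than
  \<open>1\<close>.\<close>

lemma char_gamma_increment_nonzero:
  assumes a: "a > 0" and be: "0 < be" "be \<le> al" and half: "(be / al) powr a > 1 / 2"
  shows "char (gamma_increment a al be) t \<noteq> 0"
proof
  assume 0: "char (gamma_increment a al be) t = 0"
  have al: "al > 0" using be by simp
  interpret V: real_distribution "gamma_increment a al be"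
    by (rule real_distribution_gamma_increment[OF a be])
  define Z where "Z = V.prob {0}"
  have "ennreal ((be / al) powr a) \<le> emeasure (gamma_increment a al be) {0}"
    by (rule emeasure_gamma_increment_0[OF a be])
  then have Z: "Z > 1 / 2"
    using half by (simp add: Z_def V.emeasure_eq_measure)
  have "(CLINT x|gamma_increment a al be. iexp (t * x) - 1) = - 1"
    using 0 V.prob_space by (subst Bochner_Integration.integral_diff) (auto simp: char_def V.integrable_iexp)
  moreover have "norm (CLINT x|gamma_increment a al be. iexp (t * x) - 1) \<le> (LINT x|gamma_increment a al be. 2 * indicator (- {0}) x)"
  proof (rule order_trans[OF integral_norm_bound integral_mono])
    show "integrable (gamma_increment a al be) (\<lambda>x. norm (iexp (t * x) - 1))"
      by (intro integrable_norm Bochner_Integration.integrable_diff V.integrable_iexp) auto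
    show "integrable (gamma_increment a al be) (\<lambda>x. 2 * indicator (- {0}) x :: real)"
      using al by (intro V.integrable_const_bound[where B = 2]) (auto simp: indicator_def)
    show "norm (iexp (t * x) - 1) \<le> 2 * indicator (- {0}) x" for x :: real
      using norm_triangle_ineq4[of "iexp (t * x)" 1] by (auto simp: indicator_def)
  qed
  moreover have "(LINT x|gamma_increment a al be. 2 * indicator (- {0}) x :: real) = 2 * (1 - Z)"
    using V.prob_compl[of "{0}"] al by (simp add: Z_def Compl_eq_Diff_UNIV[symmetric])
  ultimately show False
    using Z by simp
qed

lemma char_gamma_measure_scale:
  assumes "c > 0" "l > 0"
  shows "char (gamma_measure a (l / c)) t = char (gamma_measure a l) (c * t)"
  unfolding distr_mult_gamma_measure[OF assms, symmetric] char_def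
  by (subst integral_distr) (auto simp: mult_ac)

text \<open>A zero at \<open>t\<close> would propagate to \<open>c * t\<close>, since passing from
  rate \<open>l / c\<close> to rate \<open>l\<close> multiplies the transform by a factor without
  zeros. Iterating, zeros would accumulate at \<open>0\<close>, where the transform is continuous
  with value \<open>1\<close>.\<close>

lemma char_gamma_measure_nonzero:
  assumes a: "a > 0" and l: "l > 0"
  shows "char (gamma_measure a l) t \<noteq> 0"
proof
  assume 0: "char (gamma_measure a l) t = 0"
  \<comment> \<open>Any \<open>c < 1\<close> with \<open>c powr a > 1 / 2\<close> serves; here
    \<open>c powr a = 3 / 4\<close>.\<close>
  define c where "c = (3 / 4 :: real) powr (1 / a)"
  have c: "0 < c" "c < 1" "c powr a > 1 / 2"
    using a powr_less_mono2[of "1 / a" "3 / 4" 1] by (auto simp: c_def powr_powr)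
  have step: "char (gamma_measure a l) (c * u) = 0" if "char (gamma_measure a l) u = 0" for u
  proof -
    have le: "l \<le> l / c" using c l by (simp add: field_simps)
    have "char (gamma_measure a l) u = char (gamma_measure a (l / c)) u * char (gamma_increment a (l / c) l) u"
      using a c l le gamma_measure_convolution_increment[OF a l le]
        char_convolution[of "gamma_measure a (l / c)" "gamma_increment a (l / c) l" u]
      by (simp add: real_distribution_gamma_measure real_distribution_gamma_increment)
    moreover have "char (gamma_increment a (l / c) l) u \<noteq> 0"
      using c l le by (intro char_gamma_increment_nonzero a) auto
    ultimately show ?thesis
      using that c l by (simp add: char_gamma_measure_scale)
  qed
  have all: "char (gamma_measure a l) (c ^ n * t) = 0" for n
    using 0 step by (induction n) (auto simp: mult.assoc)
  interpret G: real_distribution "gamma_measure a l" using a l by (rule real_distribution_gamma_measure)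
  have "(\<lambda>n. c ^ n * t) \<longlonglongrightarrow> 0 * t"
    using c by (intro tendsto_mult LIMSEQ_power_zero) auto
  then have "(\<lambda>n. char (gamma_measure a l) (c ^ n * t)) \<longlonglongrightarrow> char (gamma_measure a l) 0"
    by (intro isCont_tendsto_compose[OF G.isCont_char]) simp
  then show False
    by (simp add: all G.char_zero LIMSEQ_const_iff)
qed

text \<open>The transform of the gamma law of \<open>X\<close> has no zeros, so it can be cancelled
  from the factorised transform of \<open>X + Y\<close>.\<close>

lemma (in prob_space) distr_gamma_increment:
  assumes a: "a > 0" and be: "0 < be" "be \<le> al" and ind: "indep_var borel X borel Y"
    and X: "distr M borel X = gamma_measure a al"
    and XY: "distr M borel (\<lambda>\<omega>. X \<omega> + Y \<omega>) = gamma_measure a be"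
  shows "distr M borel Y = gamma_increment a al be"
proof (rule Levy_uniqueness)
  have [measurable]: "random_variable borel Y" using ind by (rule indep_var_rv2)
  show "real_distribution (distr M borel Y)"
    by (simp add: real_distribution_def real_distribution_axioms_def prob_space_distr)
  show "real_distribution (gamma_increment a al be)"
    by (rule real_distribution_gamma_increment[OF a be])
  show "char (distr M borel Y) = char (gamma_increment a al be)"
  proof
    fix t
    have "char (gamma_measure a al) t * char (distr M borel Y) t = char (gamma_measure a be) t"
      using char_distr_add[OF ind, of t] by (simp add: X XY)
    also have "\<dots> = char (gamma_measure a al) t * char (gamma_increment a al be) t"
      using a be by (subst gamma_measure_convolution_increment[symmetric, OF a be])
        (simp add: char_convolution real_distribution_gamma_measure real_distribution_gamma_increment)
    finally show "char (distr M borel Y) t = char (gamma_increment a al be) t"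
      using char_gamma_measure_nonzero[of a al t] a be by simp
  qed
qed

section \<open>Paths along dyadic grids\<close>

text \<open>Geometric spacing makes multiplication by a grid time a shift of the index, the form in
  which self-similarity acts; dyadic exponents make each grid a subset of the finer ones.\<close>

definition grid :: "nat \<Rightarrow> int \<Rightarrow> real" where
  "grid n k = 2 powr (real_of_int k / 2 ^ n)"

lemma grid_pos [simp]: "grid n k > 0"
  by (simp add: grid_def)

lemma grid_neq_0 [simp]: "grid n k \<noteq> 0"
  by (simp add: grid_def)

lemma grid_less_iff [simp]: "grid n j < grid n k \<longleftrightarrow> j < k"
  by (simp add: grid_def divide_less_cancel)

lemma grid_le_iff [simp]: "grid n j \<le> grid n k \<longleftrightarrow> j \<le> k"
  by (simp add: grid_def divide_le_cancel)

lemma grid_add: "grid n (j + k) = grid n j * grid n k"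
  by (simp add: grid_def add_divide_distrib powr_add)

lemma grid_0 [simp]: "grid n 0 = 1"
  by (simp add: grid_def)

lemma grid_refine: "grid (n + m) (2 ^ m * k) = grid n k"
  by (simp add: grid_def power_add)

lemma grid_mult_power: "grid n (j * 2 ^ n) = 2 powr real_of_int j"
  by (simp add: grid_def)

lemma tendsto_grid_at_bot: "((\<lambda>i. grid n (k - int i)) \<longlongrightarrow> 0) sequentially"
proof -
  have "grid n (k - int i) = grid n k * (grid n (- 1)) ^ i" for i
  proof (induction i)
    case (Suc i)
    have "k - int (Suc i) = (k - int i) + (- 1)" by simp
    then have "grid n (k - int (Suc i)) = grid n (k - int i) * grid n (- 1)"
      by (simp only: grid_add)
    then show ?case using Suc by simp
  qed simp
  moreover have "(\<lambda>i. grid n k * (grid n (- 1)) ^ i) \<longlonglongrightarrow> grid n k * 0"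
    using grid_less_iff[of n "-1" 0] by (intro tendsto_mult tendsto_const LIMSEQ_power_zero) (auto simp: abs_of_pos)
  ultimately show ?thesis by simp
qed

lemma eventually_grid_between:
  assumes s: "0 < s" "s < t"
  shows "\<forall>\<^sub>F n in sequentially. \<exists>k. s < grid n k \<and> grid n k < t"
proof -
  define d where "d = log 2 t - log 2 s"
  have d: "d > 0" using s by (simp add: d_def)
  have "\<forall>\<^sub>F n in sequentially. inverse d < 2 ^ n"
    by real_asymp
  then show ?thesis
  proof eventually_elim
    case (elim n)
    \<comment> \<open>The least integer strictly above \<open>2 ^ n * log 2 s\<close>; it stays
      below \<open>2 ^ n * log 2 t\<close> because the two bounds are more than \<open>1\<close>
      apart.\<close>
    define k where "k = \<lfloor>2 ^ n * log 2 s\<rfloor> + 1"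
    have "1 < 2 ^ n * d" using elim d by (simp add: field_simps)
    then have "2 ^ n * log 2 s < k" "k < 2 ^ n * log 2 t"
      unfolding k_def d_def by (linarith, simp add: algebra_simps) linarith
    then have "log 2 s < k / 2 ^ n" "k / 2 ^ n < log 2 t"
      by (simp_all add: field_simps)
    then have "s < grid n k" "grid n k < t"
      using s by (simp_all add: grid_def less_powr_iff powr_less_iff)
    then show ?case by blast
  qed
qed

text \<open>The properties that almost every path has once \<open>T 1\<close> is positive
  (\<open>AE_regular_path\<close>); path arguments then concern one fixed function.\<close>

definition regular_path :: "(real \<Rightarrow> real) \<Rightarrow> bool" where
  "regular_path f \<longleftrightarrow> mono_on {0<..} f \<and> (\<forall>s>0. continuous (at_right s) f) \<and>
     (f \<longlongrightarrow> 0) (at_right 0) \<and> filterlim f at_top at_top \<and> (\<forall>s>0. f s > 0)"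

lemma regular_pathD:
  assumes "regular_path f"
  shows "0 < s \<Longrightarrow> s \<le> t \<Longrightarrow> f s \<le> f t" "0 < s \<Longrightarrow> (f \<longlongrightarrow> f s) (at_right s)"
    "(f \<longlongrightarrow> 0) (at_right 0)" "filterlim f at_top at_top" "0 < s \<Longrightarrow> f s > 0"
  using assms by (auto simp: regular_path_def mono_on_def continuous_within)

definition locally_finite_range :: "(real \<Rightarrow> real) \<Rightarrow> bool" where
  "locally_finite_range f \<longleftrightarrow> (\<forall>a>0. \<forall>b. finite (f ` {0<..} \<inter> {a<..b}))"

text \<open>Near \<open>f s\<close> only finitely many values are available, so \<open>f s\<close>
  is isolated among them, and right continuity keeps the path there for a while.\<close>

lemma locally_constant_right:
  assumes f: "regular_path f" and fin: "locally_finite_range f" and s: "s > 0"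
  shows "\<exists>t>s. \<forall>u\<in>{s<..<t}. f u = f s"
proof -
  \<comment> \<open>A neighbourhood of \<open>f s\<close> bounded away from \<open>0\<close>, which
    contains the values taken just after \<open>s\<close>; its size is arbitrary.\<close>
  define S where "S = f ` {0<..} \<inter> {f s / 2<..f s + 1}"
  have "finite S"
    using fin regular_pathD(5)[OF f s] by (simp add: S_def locally_finite_range_def)
  then obtain e where e: "e > 0" "\<And>x. x \<in> S \<Longrightarrow> x \<noteq> f s \<Longrightarrow> e \<le> dist (f s) x"
    using finite_set_avoid[of S "f s"] by blast
  have "\<forall>\<^sub>F u in at_right s. dist (f u) (f s) < min e 1"
    using e by (intro tendstoD[OF regular_pathD(2)[OF f s]]) auto
  then obtain t where t: "t > s" "\<And>u. s < u \<Longrightarrow> u < t \<Longrightarrow> dist (f u) (f s) < min e 1"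
    using s by (auto simp: eventually_at_right_field)
  have "f u = f s" if "u \<in> {s<..<t}" for u
  proof (rule ccontr)
    assume ne: "f u \<noteq> f s"
    have "f s \<le> f u" using regular_pathD(1)[OF f s, of u] that by simp
    moreover have "dist (f u) (f s) < min e 1" using t that by simp
    ultimately have "f u \<in> S"
      using that s regular_pathD(5)[OF f s] by (auto simp: S_def dist_real_def)
    with e(2)[OF this ne] \<open>dist (f u) (f s) < min e 1\<close> show False
      by (simp add: dist_commute)
  qed
  then show ?thesis using t by blast
qed

text \<open>Each of the finitely many values in the window is held on an interval to the right of
  some time, and such an interval eventually contains a grid time.\<close>

lemma eventually_grid_range_eq:
  assumes f: "regular_path f" and fin: "locally_finite_range f" and a: "a > 0"
  shows "\<forall>\<^sub>F n in sequentially. range (\<lambda>k. f (grid n k)) \<inter> {a<..b} = f ` {0<..} \<inter> {a<..b}"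
proof -
  have "\<forall>\<^sub>F n in sequentially. y \<in> range (\<lambda>k. f (grid n k))" if "y \<in> f ` {0<..} \<inter> {a<..b}" for y
  proof -
    from that obtain s where s: "s > 0" "y = f s" by auto
    obtain t where t: "t > s" "\<forall>u\<in>{s<..<t}. f u = f s"
      using locally_constant_right[OF f fin s(1)] by blast
    from eventually_grid_between[OF s(1) t(1)] show ?thesis
    proof eventually_elim
      case (elim n)
      then obtain k where "s < grid n k" "grid n k < t" by blast
      then have "y = f (grid n k)" using t s by simp
      then show ?case by (rule range_eqI)
    qed
  qed
  then have "\<forall>\<^sub>F n in sequentially. \<forall>y\<in>f ` {0<..} \<inter> {a<..b}. y \<in> range (\<lambda>k. f (grid n k))"
    using fin a by (intro eventually_ball_finite) (auto simp: locally_finite_range_def)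
  then show ?thesis
    by eventually_elim auto
qed

lemma eventually_regular_path_window:
  assumes f: "regular_path f" and a: "a > 0"
  shows "\<forall>\<^sub>F j in sequentially. f (2 powr (- real j)) \<le> a \<and> b < f (2 powr real j)"
proof -
  have "filterlim (\<lambda>j. 2 powr (- real j)) (at_right 0) sequentially"
    by real_asymp
  then have "(\<lambda>j. f (2 powr (- real j))) \<longlonglongrightarrow> 0"
    by (rule filterlim_compose[OF regular_pathD(3)[OF f]])
  then have "\<forall>\<^sub>F j in sequentially. f (2 powr (- real j)) < a"
    using a by (auto dest: order_tendstoD)
  moreover have "filterlim (\<lambda>j. 2 powr real j) at_top sequentially"
    by real_asymp
  then have "filterlim (\<lambda>j. f (2 powr real j)) at_top sequentially"
    by (rule filterlim_compose[OF regular_pathD(4)[OF f]])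
  then have "\<forall>\<^sub>F j in sequentially. b < f (2 powr real j)"
    by (auto simp: filterlim_at_top_dense)
  ultimately show ?thesis
    by eventually_elim auto
qed

text \<open>The bound is assumed for infinitely many \<open>n\<close> only, which is what Fatou's
  lemma delivers; nestedness of the grids extends it to all \<open>n\<close>. The grid values then
  form a finite set, and by right continuity every value of the path in the window is one of
  them.\<close>

lemma locally_finite_rangeI:
  assumes f: "regular_path f"
    and card: "\<And>j::nat. \<exists>B. \<forall>N. \<exists>n\<ge>N. card (f ` grid n ` {- int j * 2 ^ n..<int j * 2 ^ n}) \<le> B"
  shows "locally_finite_range f"
  unfolding locally_finite_range_def
proof safe
  fix a b :: real assume a: "a > 0"
  obtain j :: nat where j: "f (2 powr (- real j)) \<le> a" "b < f (2 powr real j)"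
    using eventually_happens'[OF sequentially_bot eventually_regular_path_window[OF f a]] by blast
  define A where "A n = f ` grid n ` {- int j * 2 ^ n..<int j * 2 ^ n}" for n
  have mono: "A n \<subseteq> A m" if "n \<le> m" for n m
  proof -
    have "grid n k \<in> grid m ` {- int j * 2 ^ m..<int j * 2 ^ m}" if "k \<in> {- int j * 2 ^ n..<int j * 2 ^ n}" for k
    proof (rule image_eqI)
      show "grid n k = grid m (2 ^ (m - n) * k)"
        using grid_refine[of n "m - n" k] \<open>n \<le> m\<close> by simp
      have "(2::int) ^ m = 2 ^ (m - n) * 2 ^ n"
        using \<open>n \<le> m\<close> by (simp add: power_add[symmetric])
      then have eq: "2 ^ (m - n) * (int j * 2 ^ n) = int j * 2 ^ m" "2 ^ (m - n) * (- int j * 2 ^ n) = - int j * 2 ^ m"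
        by simp_all
      have "2 ^ (m - n) * (- int j * 2 ^ n) \<le> 2 ^ (m - n) * k"
        by (rule mult_left_mono) (use that in auto)
      moreover have "2 ^ (m - n) * k < 2 ^ (m - n) * (int j * 2 ^ n)"
        by (rule mult_strict_left_mono) (use that in auto)
      ultimately show "2 ^ (m - n) * k \<in> {- int j * 2 ^ m..<int j * 2 ^ m}"
        unfolding eq by simp
    qed
    then show ?thesis by (auto simp: A_def)
  qed
  have finA: "finite (A n)" for n by (simp add: A_def)
  obtain B where B': "\<forall>N. \<exists>n\<ge>N. card (A n) \<le> B"
    using card[of j] by (auto simp: A_def)
  have B: "card (A N) \<le> B" for N
  proof -
    obtain n where "n \<ge> N" "card (A n) \<le> B" using B' by blast
    with card_mono[OF finA mono, of N n] show ?thesis by simp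
  qed
  have fin: "finite (\<Union>n. A n)"
  proof (rule ccontr)
    assume "infinite (\<Union>n. A n)"
    then obtain C where C: "finite C" "card C = Suc B" "C \<subseteq> (\<Union>n. A n)"
      using infinite_arbitrarily_large by blast
    have "\<exists>n. C \<subseteq> A n"
      using C(1,3)
    proof (induction C)
      case (insert x C)
      then obtain n m where "C \<subseteq> A n" "x \<in> A m" by auto
      then have "insert x C \<subseteq> A (max n m)"
        using mono[of n "max n m"] mono[of m "max n m"] by auto
      then show ?case by blast
    qed simp
    then obtain n where "C \<subseteq> A n" by blast
    then have "Suc B \<le> card (A n)" using C(2) finA card_mono by metis
    with B[of n] show False by simp
  qed
  have "f ` {0<..} \<inter> {a<..b} \<subseteq> (\<Union>n. A n)"
  proof (rule subsetI, rule ccontr)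
    fix y assume y: "y \<in> f ` {0<..} \<inter> {a<..b}" "y \<notin> (\<Union>n. A n)"
    from y(1) obtain s where "s > 0" "y = f s" by auto
    with y have s: "s > 0" "a < f s" "f s \<le> b" "f s \<notin> (\<Union>n. A n)" by simp_all
    obtain e where e: "e > 0" "\<And>x. x \<in> (\<Union>n. A n) \<Longrightarrow> x \<noteq> f s \<Longrightarrow> e \<le> dist (f s) x"
      using finite_set_avoid[OF fin, of "f s"] by blast
    have lo: "2 powr (- real j) < s"
      using regular_pathD(1)[OF f s(1), of "2 powr (- real j)"] j s by force
    have hi: "s < 2 powr real j"
      using regular_pathD(1)[OF f _, of "2 powr real j" s] j s by force
    have "\<forall>\<^sub>F u in at_right s. dist (f u) (f s) < e"
      using regular_pathD(2)[OF f s(1)] e by (auto simp: tendsto_iff)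
    then obtain t where t: "t > s" "\<And>u. s < u \<Longrightarrow> u < t \<Longrightarrow> dist (f u) (f s) < e"
      using s by (auto simp: eventually_at_right_field)
    obtain n k where k: "s < grid n k" "grid n k < min t (2 powr real j)"
      using eventually_grid_between[of s "min t (2 powr real j)"] s t hi
      by (auto simp: eventually_sequentially)
    have "grid n (- int j * 2 ^ n) < grid n k" "grid n k < grid n (int j * 2 ^ n)"
      using k lo grid_mult_power[of n "int j"] grid_mult_power[of n "- int j"] by auto
    then have "f (grid n k) \<in> A n"
      by (auto simp: A_def)
    then have "e \<le> dist (f s) (f (grid n k))"
      using s(4) by (intro e(2)) auto
    with t(2)[of "grid n k"] k show False by (simp add: dist_commute)
  qed
  with fin show "finite (f ` {0<..} \<inter> {a<..b})"
    by (rule finite_subset[rotated])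
qed

section \<open>Increments of a self-similar additive process\<close>

locale nondecreasing_ssa = prob_space +
  fixes T :: "real \<Rightarrow> 'a \<Rightarrow> real"
  assumes ssa: "ssa_process M T" and nondecreasing: "nondecreasing_process M T"
begin

lemma measurable_process [measurable]: "s > 0 \<Longrightarrow> T s \<in> borel_measurable M"
  using ssa by (simp add: ssa_process_def)

lemma measurable_grid [measurable]: "T (grid n k) \<in> borel_measurable M"
  by (intro measurable_process) simp

definition dT :: "nat \<Rightarrow> int \<Rightarrow> 'a \<Rightarrow> real" where
  "dT n k \<omega> = T (grid n (k + 1)) \<omega> - T (grid n k) \<omega>"

lemma measurable_dT [measurable]: "dT n k \<in> borel_measurable M"
  unfolding dT_def by measurable

text \<open>Independence is given for finite increasing sequences of times indexed by naturals.
  Finitely many integer indices lie strictly between \<open>- K\<close> and \<open>K\<close>, and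
  shifting by \<open>K\<close> turns them into such a sequence.\<close>

lemma indep_dT: "indep_vars (\<lambda>_. borel) (dT n) UNIV"
  unfolding indep_vars_def2
proof (intro conjI ballI indep_setsI)
  fix A :: "int \<Rightarrow> 'a set" and J
  assume J: "J \<noteq> {}" "finite J" and A: "\<forall>j\<in>J. A j \<in> {dT n j -` B \<inter> space M |B. B \<in> sets borel}"
  define K where "K = Max ((\<lambda>j. nat \<bar>j\<bar>) ` J) + 1"
  have K: "nat \<bar>j\<bar> < K" if "j \<in> J" for j
  proof -
    have "nat \<bar>j\<bar> \<le> Max ((\<lambda>j. nat \<bar>j\<bar>) ` J)"
      using J that by (intro Max_ge) auto
    then show ?thesis unfolding K_def by linarith
  qed
  have "independent_increments M T"
    using ssa by (simp add: ssa_process_def)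
  note this[unfolded independent_increments_def, THEN spec, of "2 * K", THEN spec, of "\<lambda>i. grid n (int i - int K)"]
  then have ind: "indep_vars (\<lambda>_. borel) (\<lambda>i \<omega>. T (grid n (int (Suc i) - int K)) \<omega> - T (grid n (int i - int K)) \<omega>) {..<2 * K}"
    by simp
  then have ind: "indep_vars (\<lambda>_. borel) (\<lambda>i. dT n (int i - int K)) {..<2 * K}"
    by (simp add: dT_def[abs_def] algebra_simps)
  define h where "h j = nat (j + int K)" for j
  have h: "inj_on h J" "h ` J \<subseteq> {..<2 * K}" "\<And>j. j \<in> J \<Longrightarrow> int (h j) - int K = j"
  proof -
    show 3: "int (h j) - int K = j" if "j \<in> J" for j
      using K[OF that] by (simp add: h_def)
    then show "inj_on h J"
      by (metis inj_onI)
    show "h ` J \<subseteq> {..<2 * K}"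
      using K by (fastforce simp: h_def)
  qed
  define A' where "A' i = A (int i - int K)" for i
  have A': "A' (h j) = A j" if "j \<in> J" for j
    using h(3)[OF that] by (simp add: A'_def)
  have "prob (\<Inter>i\<in>h ` J. A' i) = (\<Prod>i\<in>h ` J. prob (A' i))"
    using ind J h(2) A h(3) A' unfolding indep_vars_def2
    by (intro indep_setsD[where F = "\<lambda>i. {dT n (int i - int K) -` B \<inter> space M |B. B \<in> sets borel}" and I = "{..<2 * K}"]) auto
  then show "prob (\<Inter>j\<in>J. A j) = (\<Prod>j\<in>J. prob (A j))"
    using h(1) A' by (simp add: prod.reindex)
qed (auto simp: measurable_sets)

lemma distr_scaled: 
  assumes c: "c > 0" and J: "finite J" "J \<subseteq> {0<..}" and F: "F \<in> measurable (\<Pi>\<^sub>M s\<in>J. borel) N"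
  shows "distr M N (\<lambda>\<omega>. F (\<lambda>s\<in>J. T (c * s) \<omega>)) = distr M N (\<lambda>\<omega>. F (\<lambda>s\<in>J. c * T s \<omega>))"
proof -
  have pos: "s > 0" if "s \<in> J" for s using J that by auto
  have [measurable]: "(\<lambda>\<omega>. \<lambda>s\<in>J. T (c * s) \<omega>) \<in> measurable M (\<Pi>\<^sub>M s\<in>J. borel)"
    "(\<lambda>\<omega>. \<lambda>s\<in>J. c * T s \<omega>) \<in> measurable M (\<Pi>\<^sub>M s\<in>J. borel)"
    using pos c by (auto intro!: measurable_restrict measurable_process borel_measurable_times)
  have "distr M (\<Pi>\<^sub>M s\<in>J. borel) (\<lambda>\<omega>. \<lambda>s\<in>J. T (c * s) \<omega>) = distr M (\<Pi>\<^sub>M s\<in>J. borel) (\<lambda>\<omega>. \<lambda>s\<in>J. c * T s \<omega>)"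
    using ssa c J by (simp add: ssa_process_def self_similar_def)
  then have "distr (distr M (\<Pi>\<^sub>M s\<in>J. borel) (\<lambda>\<omega>. \<lambda>s\<in>J. T (c * s) \<omega>)) N F
    = distr (distr M (\<Pi>\<^sub>M s\<in>J. borel) (\<lambda>\<omega>. \<lambda>s\<in>J. c * T s \<omega>)) N F" by simp
  then show ?thesis
    using F by (simp add: distr_distr comp_def)
qed

lemma distr_process_scale:
  assumes "s > 0"
  shows "distr M borel (T s) = distr M borel (\<lambda>\<omega>. s * T 1 \<omega>)"
  using distr_scaled[of s "{1}" "\<lambda>x. x 1" borel] assms by simp

lemma AE_basic_path:
  "AE \<omega> in M. mono_on {0<..} (\<lambda>s. T s \<omega>) \<and> (\<forall>s>0. continuous (at_right s) (\<lambda>s. T s \<omega>))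
    \<and> ((\<lambda>s. T s \<omega>) \<longlongrightarrow> 0) (at_right 0)"
  using ssa nondecreasing unfolding ssa_process_def nondecreasing_process_def cadlag_def
  by (auto elim: AE_mp)

text \<open>By self-similarity \<open>T s\<close> has the law of \<open>s * T 1\<close>. This gives
  positivity at the times \<open>1 / n\<close>, hence at all times by monotonicity, and it makes the
  probability of \<open>T m \<le> K\<close> that of \<open>T 1 \<le> K / m\<close>, which tends to
  \<open>0\<close> and so forces divergence.\<close>

lemma AE_regular_path:
  assumes pos: "AE \<omega> in M. T 1 \<omega> > 0"
  shows "AE \<omega> in M. regular_path (\<lambda>s. T s \<omega>)"
proof -
  have pos': "AE \<omega> in M. T s \<omega> > 0" if s: "s > 0" for s
  proof -
    have "AE x in distr M borel (\<lambda>\<omega>. s * T 1 \<omega>). x > 0"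
      using pos s by (subst AE_distr_iff) (auto elim: AE_mp)
    then have "AE x in distr M borel (T s). x > 0"
      unfolding distr_process_scale[OF s] .
    then show ?thesis
      using s by (subst (asm) AE_distr_iff) auto
  qed
  have "AE \<omega> in M. \<forall>n. T (inverse (real (Suc n))) \<omega> > 0"
    by (subst AE_all_countable) (auto intro!: pos')
  moreover have "AE \<omega> in M. \<forall>K::nat. \<exists>m::nat. T (real (Suc m)) \<omega> > real K"
  proof (subst AE_all_countable, rule allI)
    fix K :: nat
    let ?N = "{\<omega> \<in> space M. \<forall>m::nat. T (real (Suc m)) \<omega> \<le> real K}"
    have [measurable]: "T (real (Suc m)) \<in> borel_measurable M" "T 1 \<in> borel_measurable M" for m
      by (auto intro: measurable_process)
    have le: "prob ?N \<le> prob {\<omega>\<in>space M. T 1 \<omega> \<le> real K / real (Suc m)}" for m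
    proof -
      have "prob ?N \<le> prob {\<omega>\<in>space M. T (real (Suc m)) \<omega> \<le> real K}"
        by (rule finite_measure_mono) auto
      also have "\<dots> = measure (distr M borel (T (real (Suc m)))) {..real K}"
        by (subst measure_distr) (auto intro!: arg_cong[where f = prob])
      also have "\<dots> = prob {\<omega>\<in>space M. real (Suc m) * T 1 \<omega> \<le> real K}"
        by (subst distr_process_scale, simp, subst measure_distr) (auto intro!: arg_cong[where f = prob])
      also have "\<dots> = prob {\<omega>\<in>space M. T 1 \<omega> \<le> real K / real (Suc m)}"
        by (intro arg_cong[where f = prob]) (auto simp: field_simps)
      finally show ?thesis .
    qed
    have "(\<lambda>m. prob {\<omega>\<in>space M. T 1 \<omega> \<le> real K / real (Suc m)}) \<longlonglongrightarrow> prob (\<Inter>m. {\<omega>\<in>space M. T 1 \<omega> \<le> real K / real (Suc m)})"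
    proof (rule finite_Lim_measure_decseq)
      show "decseq (\<lambda>m. {\<omega>\<in>space M. T 1 \<omega> \<le> real K / real (Suc m)})"
        by (auto simp: decseq_def elim!: order_trans intro!: divide_left_mono)
    qed auto
    moreover have "prob (\<Inter>m. {\<omega>\<in>space M. T 1 \<omega> \<le> real K / real (Suc m)}) = 0"
    proof -
      have "(\<Inter>m. {\<omega>\<in>space M. T 1 \<omega> \<le> real K / real (Suc m)}) \<subseteq> {\<omega>\<in>space M. \<not> 0 < T 1 \<omega>}"
      proof safe
        fix \<omega> assume *: "\<omega> \<in> (\<Inter>m. {\<omega>\<in>space M. T 1 \<omega> \<le> real K / real (Suc m)})" "0 < T 1 \<omega>"
        have "(\<lambda>m. real K / real (Suc m)) \<longlonglongrightarrow> 0" by real_asymp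
        then have "T 1 \<omega> \<le> 0" using * by (intro LIMSEQ_le_const) auto
        with * show False by simp
      qed auto
      then have "prob (\<Inter>m. {\<omega>\<in>space M. T 1 \<omega> \<le> real K / real (Suc m)}) \<le> prob {\<omega>\<in>space M. \<not> 0 < T 1 \<omega>}"
        by (intro finite_measure_mono) auto
      also have "\<dots> = 0"
        using pos by (subst prob_eq_0) auto
      finally show ?thesis by (simp add: measure_le_0_iff)
    qed
    ultimately have "prob ?N \<le> 0"
      using le by (intro LIMSEQ_le_const) auto
    then have "prob ?N = 0" by (simp add: measure_le_0_iff)
    then have "AE \<omega> in M. \<omega> \<notin> ?N"
      by (subst (asm) prob_eq_0) auto
    with AE_space show "AE \<omega> in M. \<exists>m::nat. T (real (Suc m)) \<omega> > real K"
      by eventually_elim (simp add: not_le)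
  qed
  ultimately show ?thesis
    using AE_basic_path
  proof eventually_elim
    case (elim \<omega>)
    have mono: "T s \<omega> \<le> T t \<omega>" if "0 < s" "s \<le> t" for s t
      using elim(3) that by (auto simp: mono_on_def)
    have "T s \<omega> > 0" if s: "s > 0" for s
    proof -
      obtain n where "inverse (real (Suc n)) < s" using reals_Archimedean[OF s] by blast
      then show ?thesis using elim(1) mono[of "inverse (real (Suc n))" s] by (auto intro: less_le_trans)
    qed
    moreover have "filterlim (\<lambda>s. T s \<omega>) at_top at_top"
      unfolding filterlim_at_top eventually_at_top_linorder
    proof
      fix Z :: real
      obtain K :: nat where "Z \<le> real K" using real_arch_simple by blast
      moreover obtain m where "T (real (Suc m)) \<omega> > real K" using elim(2) by blast
      ultimately have "Z \<le> T s \<omega>" if "s \<ge> real (Suc m)" for s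
        using mono[of "real (Suc m)" s] that by auto
      then show "\<exists>N. \<forall>n\<ge>N. Z \<le> T n \<omega>" by blast
    qed
    ultimately show ?case
      using elim(3) by (simp add: regular_path_def)
  qed
qed

text \<open>Independence is given for increments, not for the path up to a time. Because the path
  tends to \<open>0\<close> at time \<open>0\<close>, \<open>T (grid n k)\<close> is the sum of all
  earlier increments, which makes it independent of the later ones.\<close>

definition past_sum :: "nat \<Rightarrow> int \<Rightarrow> (int \<Rightarrow> real) \<Rightarrow> real" where
  "past_sum n k x = (\<Sum>i. x (k - 1 - int i))"

lemma AE_past_sum: "AE \<omega> in M. \<forall>n k. T (grid n k) \<omega> = past_sum n k (\<lambda>i. dT n i \<omega>)"
  using AE_basic_path
proof eventually_elim
  case (elim \<omega>)
  show ?case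
  proof safe
    fix n k
    have sum: "(\<Sum>i<m. dT n (k - 1 - int i) \<omega>) = T (grid n k) \<omega> - T (grid n (k - int m)) \<omega>" for m
      by (induction m) (simp_all add: dT_def algebra_simps)
    have "filterlim (\<lambda>i. grid n (k - int i)) (at_right 0) sequentially"
      using tendsto_grid_at_bot by (auto simp: filterlim_at)
    then have "(\<lambda>m. T (grid n (k - int m)) \<omega>) \<longlonglongrightarrow> 0"
      using elim by (auto intro: filterlim_compose)
    then have "(\<lambda>m. T (grid n k) \<omega> - T (grid n (k - int m)) \<omega>) \<longlonglongrightarrow> T (grid n k) \<omega> - 0"
      by (intro tendsto_diff tendsto_const)
    then have "(\<lambda>i. dT n (k - 1 - int i) \<omega>) sums T (grid n k) \<omega>"
      by (simp add: sums_def sum)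
    then show "T (grid n k) \<omega> = past_sum n k (\<lambda>i. dT n i \<omega>)"
      by (simp add: past_sum_def sums_iff)
  qed
qed

lemma measurable_past_sum [measurable]:
  "{..<k} \<subseteq> K \<Longrightarrow> past_sum n k \<in> borel_measurable (PiM K (\<lambda>_. borel))"
  unfolding past_sum_def
  by (intro borel_measurable_suminf measurable_component_singleton) auto

lemma past_sum_restrict: "{..<k} \<subseteq> K \<Longrightarrow> past_sum n k (restrict x K) = past_sum n k x"
  unfolding past_sum_def by (intro suminf_cong, subst restrict_apply', erule subsetD) auto

end

section \<open>The weight function of a Poisson process of intensity \<open>\<theta> / x\<close>\<close>

lemma emeasure_lborel_Icc_finite: "emeasure lborel {u..v::real} < \<infinity>"
  by (simp add: emeasure_lborel_Icc_eq)

text \<open>Stands in for the fundamental theorem of calculus when the integrand is merely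
  measurable and its primitive has no pointwise derivative to work with.\<close>

lemma constant_if_quadratic_increments:
  fixes g :: "real \<Rightarrow> real"
  assumes "\<And>u v. a \<le> u \<Longrightarrow> u \<le> v \<Longrightarrow> v \<le> b \<Longrightarrow> \<bar>g v - g u\<bar> \<le> B * (v - u)\<^sup>2" and ab: "a \<le> b"
  shows "g b = g a"
proof -
  have B: "\<bar>g v - g u\<bar> \<le> B * (v - u)\<^sup>2" if "u \<in> {a..b}" "v \<in> {a..b}" for u v
    using assms(1)[of u v] assms(1)[of v u] that
    by (cases "u \<le> v") (auto simp: abs_minus_commute power2_commute)
  have "(g has_field_derivative 0) (at x within {a..b})" if x: "x \<in> {a..b}" for x
    unfolding has_field_derivative_iff
  proof (rule Lim_null_comparison)
    show "\<forall>\<^sub>F y in at x within {a..b}. norm ((g y - g x) / (y - x)) \<le> B * \<bar>y - x\<bar>"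
      unfolding eventually_at_filter
    proof (rule always_eventually, safe)
      fix y assume "y \<noteq> x" "y \<in> {a..b}"
      with B[OF x, of y] show "norm ((g y - g x) / (y - x)) \<le> B * \<bar>y - x\<bar>"
        by (simp add: divide_le_eq power2_eq_square mult.assoc)
    qed
    show "((\<lambda>y. B * \<bar>y - x\<bar>) \<longlongrightarrow> 0) (at x within {a..b})"
      by (auto intro!: tendsto_eq_intros)
  qed
  then obtain c where "\<forall>x\<in>{a..b}. g x = c"
    using has_field_derivative_zero_constant[of "{a..b}" g] by auto
  with ab show ?thesis by auto
qed

text \<open>With \<Delta> = K v - K u, both \<open>exp (K v) - exp (K u)\<close> and the integral of
  \<open>k * exp K\<close> from \<open>u\<close> to \<open>v\<close> lie between \<Delta> exp (K u)
  and \<Delta> exp (K v). They differ by at most a constant times the squared length, so the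
  difference of the two sides is constant.\<close>

lemma exp_primitive:
  fixes k :: "real \<Rightarrow> real"
  assumes [measurable]: "k \<in> borel_measurable borel" and k: "\<And>x. 0 \<le> k x" "\<And>x. k x \<le> C" and ay: "a \<le> y"
  defines "K \<equiv> \<lambda>y. LBINT x:{a<..y}. k x"
  shows "set_integrable lborel {a<..y} (\<lambda>x. k x * exp (K x))"
    and "(LBINT x:{a<..y}. k x * exp (K x)) = exp (K y) - 1"
proof -
  have C: "C \<ge> 0" using k order_trans by blast
  have int_k: "set_integrable lborel {u<..v} k" for u v
    unfolding set_integrable_def
    by (rule Bochner_Integration.integrable_bound[OF integrable_real_indicator[of "{u..v}" lborel, OF _ emeasure_lborel_Icc_finite, THEN integrable_mult_right, of C]])
      (use k C in \<open>auto simp: indicator_def\<close>)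
  have K_diff: "K v - K u = (LBINT x:{u<..v}. k x)" and K_le: "K u \<le> K v" and K_lip: "K v - K u \<le> C * (v - u)"
    if "a \<le> u" "u \<le> v" for u v
  proof -
    have "K v = (LBINT x:{a<..u} \<union> {u<..v}. k x)"
      unfolding K_def using that by (intro arg_cong2[where f = "set_lebesgue_integral lborel"]) auto
    also have "\<dots> = K u + (LBINT x:{u<..v}. k x)"
      unfolding K_def by (intro set_integral_Un int_k) auto
    finally show eq: "K v - K u = (LBINT x:{u<..v}. k x)" by simp
    have "0 \<le> (LBINT x:{u<..v}. k x)"
      unfolding set_lebesgue_integral_def using k by (intro Bochner_Integration.integral_nonneg) auto
    then show "K u \<le> K v" using eq by simp
    have "(LBINT x:{u<..v}. k x) \<le> (LBINT x:{u<..v}. C)"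
    proof (intro set_integral_mono int_k)
      show "set_integrable lborel {u<..v} (\<lambda>_. C)"
        unfolding set_integrable_def using that
        by (intro integrable_scaleR_left integrable_real_indicator) auto
    qed (use k in auto)
    also have "\<dots> = C * (v - u)" using that by (simp add: set_lebesgue_integral_def)
    finally show "K v - K u \<le> C * (v - u)" using eq by simp
  qed
  have Ka: "K a = 0" by (simp add: K_def set_lebesgue_integral_def)
  have K_below: "K u = 0" if "u \<le> a" for u using that by (simp add: K_def set_lebesgue_integral_def)
  have "mono K"
  proof
    fix u v :: real assume "u \<le> v"
    then show "K u \<le> K v"
      using K_le[of u v] K_le[of a v] K_below[of u] K_below[of v] Ka
      by (cases "u \<le> a"; cases "v \<le> a") auto
  qed
  then have [measurable]: "K \<in> borel_measurable borel" by (rule borel_measurable_mono)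
  define R where "R = exp (K y)"
  have R: "exp (K u) \<le> R" if "u \<le> y" for u
    using \<open>mono K\<close> that by (auto simp: R_def mono_def)
  have int: "set_integrable lborel {u<..v} (\<lambda>x. k x * exp (K x))" if "v \<le> y" for u v
    unfolding set_integrable_def
  proof (rule Bochner_Integration.integrable_bound[OF integrable_real_indicator[of "{u..v}" lborel, OF _ emeasure_lborel_Icc_finite, THEN integrable_mult_right, of "C * R"]])
    have "k x * exp (K x) \<le> C * R" if "x \<le> v" for x
      using k[of x] R[of x] that \<open>v \<le> y\<close> C by (intro mult_mono) auto
    then show "AE x in lborel. norm (indicat_real {u<..v} x *\<^sub>R (k x * exp (K x))) \<le> norm (C * R * indicat_real {u..v} x)"
      using k C by (intro AE_I2) (auto simp: indicator_def abs_mult R_def)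
  qed auto
  show "set_integrable lborel {a<..y} (\<lambda>x. k x * exp (K x))" by (rule int) simp
  define g where "g v = exp (K v) - 1 - (LBINT x:{a<..v}. k x * exp (K x))" for v
  have "g y = g a"
  proof (rule constant_if_quadratic_increments[OF _ ay])
    fix u v assume uv: "a \<le> u" "u \<le> v" "v \<le> y"
    define I where "I = (LBINT x:{u<..v}. k x * exp (K x))"
    have "(LBINT x:{a<..v}. k x * exp (K x)) = (LBINT x:{a<..u} \<union> {u<..v}. k x * exp (K x))"
      using uv by (intro arg_cong2[where f = "set_lebesgue_integral lborel"]) auto
    also have "\<dots> = (LBINT x:{a<..u}. k x * exp (K x)) + I"
      unfolding I_def using uv by (intro set_integral_Un int) auto
    finally have g: "g v - g u = exp (K v) - exp (K u) - I" by (simp add: g_def)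
    define \<Delta> where "\<Delta> = K v - K u"
    have \<Delta>: "0 \<le> \<Delta>" "\<Delta> \<le> C * (v - u)" using K_le[of u v] K_lip[of u v] uv by (simp_all add: \<Delta>_def)
    have "I \<le> (LBINT x:{u<..v}. k x * exp (K v))"
      unfolding I_def using uv k \<open>mono K\<close>
      by (intro set_integral_mono int set_integrable_mult_left int_k) (auto intro!: mult_left_mono simp: mono_def)
    also have "\<dots> = \<Delta> * exp (K v)" using K_diff[of u v] uv by (simp add: \<Delta>_def)
    finally have I1: "I \<le> \<Delta> * exp (K v)" .
    have "(LBINT x:{u<..v}. k x * exp (K u)) \<le> I"
      unfolding I_def using uv k \<open>mono K\<close>
      by (intro set_integral_mono int set_integrable_mult_left int_k) (auto intro!: mult_left_mono simp: mono_def)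
    moreover have "(LBINT x:{u<..v}. k x * exp (K u)) = \<Delta> * exp (K u)"
      using K_diff[of u v] uv by (simp add: \<Delta>_def)
    ultimately have I2: "\<Delta> * exp (K u) \<le> I" by simp
    have "exp (K v) = exp (K u) * exp \<Delta>" by (simp add: \<Delta>_def exp_add[symmetric])
    moreover have "1 + \<Delta> \<le> exp \<Delta>" by (rule exp_ge_add_one_self)
    ultimately have D1: "\<Delta> * exp (K u) \<le> exp (K v) - exp (K u)"
      using mult_left_mono[of "1 + \<Delta>" "exp \<Delta>" "exp (K u)"] by (simp add: algebra_simps)
    have "exp (K u) = exp (K v) * exp (- \<Delta>)" by (simp add: \<Delta>_def exp_add[symmetric])
    moreover have "1 - \<Delta> \<le> exp (- \<Delta>)" using exp_ge_add_one_self[of "- \<Delta>"] by simp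
    ultimately have D2: "exp (K v) - exp (K u) \<le> \<Delta> * exp (K v)"
      using mult_left_mono[of "1 - \<Delta>" "exp (- \<Delta>)" "exp (K v)"] by (simp add: algebra_simps)
    have "\<bar>g v - g u\<bar> \<le> \<Delta> * (exp (K v) - exp (K u))"
      unfolding g using I1 I2 D1 D2 by (auto simp: algebra_simps)
    also have "\<dots> \<le> \<Delta> * (\<Delta> * exp (K v))"
      using D2 \<Delta> by (intro mult_left_mono)
    also have "\<dots> \<le> R * (\<Delta> * \<Delta>)"
      using R[of v] uv mult_right_mono[of "exp (K v)" R "\<Delta> * \<Delta>"] by (simp add: mult_ac)
    also have "\<Delta> * \<Delta> \<le> (C * (v - u)) * (C * (v - u))"
      using \<Delta> by (intro mult_mono) auto
    finally show "\<bar>g v - g u\<bar> \<le> (R * C\<^sup>2) * (v - u)\<^sup>2"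
      by (simp add: power2_eq_square mult_ac R_def)
  qed
  then show "(LBINT x:{a<..y}. k x * exp (K x)) = exp (K y) - 1"
    using Ka by (simp add: g_def set_lebesgue_integral_def)
qed

locale weight =
  fixes \<theta> a b :: real and f :: "real \<Rightarrow> real"
  assumes \<theta>: "\<theta> > 0" and ab: "0 < a" "a < b"
    and f_measurable [measurable]: "f \<in> borel_measurable borel"
    and f_bounds: "\<And>x. 0 \<le> f x" "\<And>x. f x \<le> 1" and f_outside: "\<And>x. x \<notin> {a<..b} \<Longrightarrow> f x = 1"
begin

text \<open>
  The expected product of \<open>f\<close> over the points below \<open>y\<close>.
\<close>

definition h :: "real \<Rightarrow> real" where
  "h y = exp (- (LBINT x:{a<..y}. \<theta> * (1 - f x) / x))"

lemma f_abs: "\<bar>f x\<bar> \<le> 1" "\<bar>1 - f x\<bar> \<le> 1"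
  using f_bounds[of x] by auto

lemma set_integrable_density: "set_integrable lborel {a<..y} (\<lambda>x. \<theta> * g x / x)"
  if [measurable]: "g \<in> borel_measurable borel" and g: "\<And>x. \<bar>g x\<bar> \<le> 1"
  unfolding set_integrable_def
proof (rule Bochner_Integration.integrable_bound[OF integrable_real_indicator[of "{a..y}" lborel, OF _ emeasure_lborel_Icc_finite, THEN integrable_mult_right, of "\<theta> / a"]])
  have "\<bar>\<theta> * g x / x\<bar> \<le> \<theta> / a" if "a < x" for x
    unfolding abs_mult abs_divide using ab that g[of x] \<theta>
    by (intro frac_le) (auto intro: mult_left_le)
  then show "AE x in lborel. norm (indicat_real {a<..y} x *\<^sub>R (\<theta> * g x / x)) \<le> norm (\<theta> / a * indicat_real {a..y} x)"
    using \<theta> ab by (intro AE_I2) (auto simp: indicator_def)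
qed auto

lemma exponent_nonneg: "0 \<le> (LBINT x:{a<..y}. \<theta> * (1 - f x) / x)"
  unfolding set_lebesgue_integral_def using \<theta> ab f_bounds
  by (intro Bochner_Integration.integral_nonneg) (auto simp: indicator_def)

lemma exponent_mono: "mono (\<lambda>y. LBINT x:{a<..y}. \<theta> * (1 - f x) / x)"
proof
  fix u v :: real assume uv: "u \<le> v"
  show "(LBINT x:{a<..u}. \<theta> * (1 - f x) / x) \<le> (LBINT x:{a<..v}. \<theta> * (1 - f x) / x)"
    using set_integrable_density[OF _ f_abs(2), where y = u] set_integrable_density[OF _ f_abs(2), where y = v] f_bounds \<theta> ab uv
    unfolding set_lebesgue_integral_def set_integrable_def
    by (intro integral_mono) (auto simp: indicator_def)
qed

lemma h_measurable [measurable]: "h \<in> borel_measurable borel"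
  using borel_measurable_mono[OF exponent_mono] unfolding h_def[abs_def] by measurable

lemma h_pos: "0 < h y" and h_le_1: "h y \<le> 1"
  using exponent_nonneg[of y] by (auto simp: h_def)

lemma h_below: "y \<le> a \<Longrightarrow> h y = 1"
  by (simp add: h_def set_lebesgue_integral_def)

lemma h_above: "y \<ge> b \<Longrightarrow> h y = h b"
  unfolding h_def set_lebesgue_integral_def using f_outside
  by (intro arg_cong[where f = exp] arg_cong[where f = uminus] Bochner_Integration.integral_cong)
    (auto simp: indicator_def)

text \<open>The integrals of \<open>\<theta> * (1 - f x) / x\<close> and
  \<open>\<theta> * f x / x\<close> add up to \<open>\<theta> * ln (y / a)\<close>. This exchanges
  \<open>1 - f\<close> for \<open>f\<close> and leaves a growing exponential of the kind treated by
  \<open>exp_primitive\<close>.\<close>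

lemma powr_h_eq:
  assumes y: "a \<le> y"
  shows "y powr \<theta> * h y = a powr \<theta> * exp (LBINT x:{a<..y}. \<theta> * f x / x)"
proof -
  have "(LBINT x:{a<..y}. \<theta> * (1 - f x) / x) + (LBINT x:{a<..y}. \<theta> * f x / x)
      = (LBINT x:{a<..y}. \<theta> * (1 - f x) / x + \<theta> * f x / x)"
    by (intro set_integral_add(2)[symmetric] set_integrable_density f_abs) auto
  also have "\<dots> = (LBINT x:{a<..y}. \<theta> * 1 / x)"
    by (intro set_lebesgue_integral_cong) (auto simp: add_divide_distrib[symmetric] right_diff_distrib)
  also have "\<dots> = (LBINT x:{a..y}. \<theta> * 1 / x)"
    unfolding set_lebesgue_integral_def
    by (intro integral_cong_AE) (auto simp: indicator_def intro!: eventually_mono[OF AE_lborel_singleton[of a]])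
  also have "\<dots> = \<theta> * ln y - \<theta> * ln a"
  proof -
    have "((\<lambda>x. \<theta> * ln x) has_real_derivative \<theta> * 1 / x) (at x within {a..y})" if "a \<le> x" for x
      using ab that by (auto intro!: derivative_eq_intros)
    moreover have "continuous_on {a..y} (\<lambda>x. \<theta> * 1 / x)"
      using ab by (intro continuous_intros) auto
    ultimately show ?thesis
      unfolding set_lebesgue_integral_def using y
      by (subst integral_FTC_Icc[where F = "\<lambda>x. \<theta> * ln x"])
        (auto simp: has_real_derivative_iff_has_vector_derivative)
  qed
  finally have "- (LBINT x:{a<..y}. \<theta> * (1 - f x) / x) + \<theta> * ln y = \<theta> * ln a + (LBINT x:{a<..y}. \<theta> * f x / x)"
    by simp
  then show ?thesis
    using ab y by (simp add: h_def powr_def exp_add[symmetric] add_ac)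
qed

text \<open>The differential equation that makes \<open>h\<close> solve the recursion, in integrated
  form. Up to \<open>a\<close> both \<open>f\<close> and \<open>h\<close> are \<open>1\<close> and a
  power is integrated; beyond \<open>a\<close> it is \<open>exp_primitive\<close> applied to
  \<theta> f(x) / x.\<close>

lemma nn_integral_powr_h:
  assumes y: "y > 0"
  shows "(\<integral>\<^sup>+x. ennreal (indicator {0<..y} x * (\<theta> * f x * x powr (\<theta> - 1) * h x)) \<partial>lborel) = ennreal (y powr \<theta> * h y)"
proof -
  have below: "(\<integral>\<^sup>+x. ennreal (indicator {0<..z} x * (\<theta> * f x * x powr (\<theta> - 1) * h x)) \<partial>lborel) = ennreal (z powr \<theta>)"
    if z: "0 < z" "z \<le> a" for z
  proof -
    have "((\<lambda>x. x powr (\<theta> - 1)) has_integral (z powr (\<theta> - 1 + 1) / (\<theta> - 1 + 1))) {0..z}"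
      by (rule has_integral_powr_from_0) (use \<theta> z in auto)
    from has_integral_mult_right[OF this, of \<theta>]
    have "((\<lambda>x. \<theta> * x powr (\<theta> - 1)) has_integral (\<theta> * (z powr \<theta> / \<theta>))) {0..z}"
      by simp
    then have "(\<integral>\<^sup>+x. ennreal (indicator {0..z} x * (\<theta> * x powr (\<theta> - 1))) \<partial>lborel) = ennreal (\<theta> * (z powr \<theta> / \<theta>))"
      using \<theta> by (intro nn_integral_has_integral_lebesgue) auto
    moreover have "(\<integral>\<^sup>+x. ennreal (indicator {0<..z} x * (\<theta> * f x * x powr (\<theta> - 1) * h x)) \<partial>lborel)
        = (\<integral>\<^sup>+x. ennreal (indicator {0..z} x * (\<theta> * x powr (\<theta> - 1))) \<partial>lborel)"
      by (intro nn_integral_cong_AE eventually_mono[OF AE_lborel_singleton[of 0]])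
        (use z in \<open>auto simp: indicator_def f_outside h_below\<close>)
    ultimately show ?thesis using \<theta> by simp
  qed
  show ?thesis
  proof (cases "y \<le> a")
    case True
    with below[OF y] show ?thesis by (simp add: h_below)
  next
    case False
    \<comment> \<open>The indicator keeps \<open>k\<close> bounded, by
      \<open>\<theta> / a\<close>.\<close>
    define k where "k x = indicator {a<..} x * (\<theta> * f x / x)" for x
    have [measurable]: "k \<in> borel_measurable borel" unfolding k_def by measurable
    have k: "0 \<le> k x" "k x \<le> \<theta> / a" for x
      using \<theta> ab f_bounds[of x] by (auto simp: k_def indicator_def intro!: frac_le mult_left_le)
    define K where "K y = (LBINT x:{a<..y}. k x)" for y
    have K: "K y = (LBINT x:{a<..y}. \<theta> * f x / x)" for y
      unfolding K_def by (intro set_lebesgue_integral_cong) (auto simp: k_def)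
    have ay: "a \<le> y" using False by simp
    note E = exp_primitive[OF \<open>k \<in> borel_measurable borel\<close> k ay, folded K_def]
    have "(\<integral>\<^sup>+x. ennreal (indicator {a<..y} x * (\<theta> * f x * x powr (\<theta> - 1) * h x)) \<partial>lborel)
        = (\<integral>\<^sup>+x. ennreal (a powr \<theta> * (indicator {a<..y} x * (k x * exp (K x)))) \<partial>lborel)"
    proof (rule nn_integral_cong, goal_cases)
      case (1 x)
      show ?case
      proof (cases "x \<in> {a<..y}")
        case True
        then have "\<theta> * f x * x powr (\<theta> - 1) * h x = \<theta> * f x / x * (x powr \<theta> * h x)"
          using ab by (simp add: powr_diff)
        also have "\<dots> = a powr \<theta> * (k x * exp (K x))"
          using True by (subst powr_h_eq) (auto simp: K k_def)
        finally show ?thesis using True by simp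
      qed simp
    qed
    also have "\<dots> = ennreal (a powr \<theta> * (LBINT x:{a<..y}. k x * exp (K x)))"
      using E(1) k unfolding set_integrable_def set_lebesgue_integral_def
      by (subst nn_integral_eq_integral) (auto intro!: AE_I2)
    also have "\<dots> = ennreal (a powr \<theta> * exp (K y) - a powr \<theta>)"
      by (simp add: E(2) algebra_simps)
    finally have above: "(\<integral>\<^sup>+x. ennreal (indicator {a<..y} x * (\<theta> * f x * x powr (\<theta> - 1) * h x)) \<partial>lborel)
        = ennreal (y powr \<theta> * h y - a powr \<theta>)"
      using powr_h_eq[OF ay] by (simp add: K)
    have K_nonneg: "K y \<ge> 0"
      unfolding K_def set_lebesgue_integral_def using k by (intro Bochner_Integration.integral_nonneg) auto
    have ge: "a powr \<theta> \<le> y powr \<theta> * h y"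
      using powr_h_eq[OF ay] K_nonneg mult_left_mono[of 1 "exp (K y)" "a powr \<theta>"] by (simp add: K)
    have "(\<integral>\<^sup>+x. ennreal (indicator {0<..y} x * (\<theta> * f x * x powr (\<theta> - 1) * h x)) \<partial>lborel)
        = (\<integral>\<^sup>+x. ennreal (indicator {0<..a} x * (\<theta> * f x * x powr (\<theta> - 1) * h x)) +
            ennreal (indicator {a<..y} x * (\<theta> * f x * x powr (\<theta> - 1) * h x)) \<partial>lborel)"
      by (intro nn_integral_cong) (use False ab in \<open>auto simp: indicator_def\<close>)
    also have "\<dots> = ennreal (a powr \<theta>) + ennreal (y powr \<theta> * h y - a powr \<theta>)"
      by (subst nn_integral_add) (use ab in \<open>auto simp: below above\<close>)
    also have "\<dots> = ennreal (y powr \<theta> * h y)"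
      using ge by (subst ennreal_plus[symmetric]) auto
    finally show ?thesis .
  qed
qed

end

section \<open>One step of the thinned gamma process\<close>

text \<open>The first two terms of the expansion in \<open>nb_weight_gamma_density\<close>,
  integrated against \<open>u\<close>; the others are nonnegative.\<close>

lemma gamma_measure_two_terms:
  assumes a: "a > 0" and be: "0 < be" "be \<le> al" and [measurable]: "u \<in> borel_measurable borel"
    and u: "\<And>x. 0 \<le> u x" "\<And>x. u x \<le> 1"
  shows "(be / al) powr a * (\<integral>x. u x \<partial>gamma_measure a al)
      + (be / al) powr a * a * (1 - be / al) * (\<integral>x. u x \<partial>gamma_measure (a + 1) al)
    \<le> (\<integral>x. u x \<partial>gamma_measure a be)"
proof -
  define p where "p = (be / al) powr a"
  define q where "q = p * a * (1 - be / al)"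
  have al: "al > 0" using be by simp
  have pq: "p \<ge> 0" "q \<ge> 0" using a be by (auto simp: p_def q_def)
  have dens: "p * gamma_density a al z + q * gamma_density (a + 1) al z \<le> gamma_density a be z" for z
  proof -
    have "(\<Sum>n<2. nb_weight a (be / al) n * gamma_density (a + real n) al z) \<le> gamma_density a be z"
      unfolding sums_unique[OF nb_weight_gamma_density[OF a be]]
      by (intro sum_le_suminf sums_summable[OF nb_weight_gamma_density[OF a be]])
        (use a be in \<open>auto intro!: mult_nonneg_nonneg nb_weight_nonneg gamma_density_nonneg\<close>)
    then show ?thesis
      by (simp add: numeral_2_eq_2 nb_weight_def p_def q_def)
  qed
  have eq: "ennreal (\<integral>x. u x \<partial>gamma_measure c r) = (\<integral>\<^sup>+x. ennreal (gamma_density c r x * u x) \<partial>lborel)"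
    and nonneg: "0 \<le> (\<integral>x. u x \<partial>gamma_measure c r)" if "c > 0" "r > 0" for c r
  proof -
    interpret prob_space "gamma_measure c r" using that by (rule prob_space_gamma_measure)
    have "integrable (gamma_measure c r) u"
      using u by (intro integrable_const_bound[where B = 1]) auto
    then have "ennreal (\<integral>x. u x \<partial>gamma_measure c r) = (\<integral>\<^sup>+x. ennreal (u x) \<partial>gamma_measure c r)"
      using u by (intro nn_integral_eq_integral[symmetric]) auto
    also have "\<dots> = (\<integral>\<^sup>+x. ennreal (gamma_density c r x * u x) \<partial>lborel)"
      using u that by (simp add: nn_integral_gamma_measure ennreal_mult gamma_density_nonneg)
    finally show "ennreal (\<integral>x. u x \<partial>gamma_measure c r) = (\<integral>\<^sup>+x. ennreal (gamma_density c r x * u x) \<partial>lborel)" .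
    show "0 \<le> (\<integral>x. u x \<partial>gamma_measure c r)" using u by (intro Bochner_Integration.integral_nonneg)
  qed
  have "ennreal (p * (\<integral>x. u x \<partial>gamma_measure a al) + q * (\<integral>x. u x \<partial>gamma_measure (a + 1) al))
      = ennreal p * (\<integral>\<^sup>+x. ennreal (gamma_density a al x * u x) \<partial>lborel)
        + ennreal q * (\<integral>\<^sup>+x. ennreal (gamma_density (a + 1) al x * u x) \<partial>lborel)"
    using pq a al nonneg by (simp add: eq[symmetric] ennreal_mult ennreal_plus)
  also have "\<dots> = (\<integral>\<^sup>+x. ennreal p * ennreal (gamma_density a al x * u x)
        + ennreal q * ennreal (gamma_density (a + 1) al x * u x) \<partial>lborel)"
    by (subst nn_integral_add) (auto simp: nn_integral_cmult)
  also have "\<dots> \<le> (\<integral>\<^sup>+x. ennreal (gamma_density a be x * u x) \<partial>lborel)"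
  proof (rule nn_integral_mono)
    fix x
    have "ennreal p * ennreal (gamma_density a al x * u x) + ennreal q * ennreal (gamma_density (a + 1) al x * u x)
      = ennreal ((p * gamma_density a al x + q * gamma_density (a + 1) al x) * u x)"
      using pq a u[of x] by (simp add: ennreal_mult'[symmetric] ennreal_plus[symmetric] gamma_density_nonneg distrib_right mult.assoc del: ennreal_plus)
    also have "\<dots> \<le> ennreal (gamma_density a be x * u x)"
      using dens[of x] u by (intro ennreal_leI mult_right_mono)
    finally show "ennreal p * ennreal (gamma_density a al x * u x) + ennreal q * ennreal (gamma_density (a + 1) al x * u x)
      \<le> ennreal (gamma_density a be x * u x)" .
  qed
  also have "\<dots> = ennreal (\<integral>x. u x \<partial>gamma_measure a be)"
    using a be by (simp add: eq)
  finally show ?thesis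
    using a be nonneg unfolding p_def q_def by (subst (asm) ennreal_le_iff) auto
qed

context weight
begin

text \<open>When the path leaves \<open>y\<close> by an exponential jump, \<open>y\<close> enters
  the product and the weight \<open>h y\<close> becomes \<open>f y * h y\<close>. Averaging over the
  jump reproduces \<open>h\<close> at the new point: the exponentials combine, and the integral over
  \<open>y\<close> is \<open>nn_integral_powr_h\<close>.\<close>

lemma nn_integral_weight_convolution:
  assumes al: "al > 0" and [measurable]: "\<phi> \<in> borel_measurable borel"
  shows "(\<integral>\<^sup>+y. ennreal (f y * h y) * (\<integral>\<^sup>+x. \<phi> (y + x) \<partial>gamma_measure 1 al) \<partial>gamma_measure \<theta> al)
    = (\<integral>\<^sup>+z. ennreal (h z) * \<phi> z \<partial>gamma_measure (\<theta> + 1) al)"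
proof -
  have fh: "0 \<le> f y * h y" for y using f_bounds[of y] h_pos[of y] by simp
  have inner: "(\<integral>\<^sup>+y. ennreal (gamma_density \<theta> al y * (f y * h y) * gamma_density 1 al (z - y)) \<partial>lborel)
      = ennreal (gamma_density (\<theta> + 1) al z * h z)" for z
  proof (cases "z > 0")
    case True
    define C where "C = al powr (\<theta> + 1) / Gamma (\<theta> + 1) * exp (- al * z)"
    have C: "C \<ge> 0" using \<theta> by (auto simp: C_def intro!: mult_nonneg_nonneg divide_nonneg_nonneg Gamma_real_nonneg)
    have G: "Gamma (\<theta> + 1) = \<theta> * Gamma \<theta>" "Gamma \<theta> > 0"
      using \<theta> Gamma_plus1[of \<theta>] nonpos_Ints_nonpos[of \<theta>] by (auto simp: not_le)
    have "(\<integral>\<^sup>+y. ennreal (gamma_density \<theta> al y * (f y * h y) * gamma_density 1 al (z - y)) \<partial>lborel)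
        = (\<integral>\<^sup>+y. ennreal (C * (indicator {0<..z} y * (\<theta> * f y * y powr (\<theta> - 1) * h y))) \<partial>lborel)"
    proof (rule nn_integral_cong_AE, rule eventually_mono[OF AE_lborel_singleton[of z]])
      fix y assume "y \<noteq> z"
      show "ennreal (gamma_density \<theta> al y * (f y * h y) * gamma_density 1 al (z - y))
        = ennreal (C * (indicator {0<..z} y * (\<theta> * f y * y powr (\<theta> - 1) * h y)))"
      proof (cases "0 < y \<and> y < z")
        case True
        have "exp (- (al * y)) * exp (- (al * (z - y))) = exp (- (al * z))"
          by (simp add: exp_add[symmetric] algebra_simps)
        then have eq: "gamma_density \<theta> al y * (f y * h y) * gamma_density 1 al (z - y)
          = C * (\<theta> * f y * y powr (\<theta> - 1) * h y)"
          using True \<theta> al G by (simp add: gamma_density_def C_def powr_add)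
        show ?thesis unfolding eq using True by simp
      qed (use \<open>y \<noteq> z\<close> in \<open>auto simp: gamma_density_def indicator_def\<close>)
    qed
    also have "\<dots> = ennreal C * ennreal (z powr \<theta> * h z)"
      unfolding nn_integral_powr_h[OF True, symmetric]
      using C by (subst nn_integral_cmult[symmetric]) (auto simp: ennreal_mult'[symmetric])
    also have "\<dots> = ennreal (C * (z powr \<theta> * h z))"
      by (rule ennreal_mult'[OF C, symmetric])
    also have "C * (z powr \<theta> * h z) = gamma_density (\<theta> + 1) al z * h z"
      using True by (simp add: gamma_density_def C_def)
    finally show ?thesis .
  next
    case False
    then have *: "gamma_density \<theta> al y * (f y * h y) * gamma_density 1 al (z - y) = 0" for y
      by (auto simp: gamma_density_def)
    show ?thesis unfolding * using False by (simp add: gamma_density_def)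
  qed
  have "(\<integral>\<^sup>+y. ennreal (f y * h y) * (\<integral>\<^sup>+x. \<phi> (y + x) \<partial>gamma_measure 1 al) \<partial>gamma_measure \<theta> al)
      = (\<integral>\<^sup>+y. ennreal (gamma_density \<theta> al y) * (ennreal (f y * h y) * (\<integral>\<^sup>+x. ennreal (gamma_density 1 al x) * \<phi> (y + x) \<partial>lborel)) \<partial>lborel)"
    by (simp add: nn_integral_gamma_measure)
  also have "\<dots> = (\<integral>\<^sup>+y. \<integral>\<^sup>+z. ennreal (gamma_density \<theta> al y * (f y * h y) * gamma_density 1 al (z - y)) * \<phi> z \<partial>lborel \<partial>lborel)"
  proof (rule nn_integral_cong)
    fix y
    have "(\<integral>\<^sup>+x. ennreal (gamma_density 1 al x) * \<phi> (y + x) \<partial>lborel)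
        = (\<integral>\<^sup>+z. ennreal (gamma_density 1 al (z - y)) * \<phi> z \<partial>lborel)"
      by (subst (2) nn_integral_real_affine[where c = 1 and t = y]) auto
    moreover have "ennreal (gamma_density \<theta> al y * (f y * h y) * gamma_density 1 al (z - y))
        = ennreal (gamma_density \<theta> al y) * (ennreal (f y * h y) * ennreal (gamma_density 1 al (z - y)))" for z
    proof -
      have "gamma_density \<theta> al y * (f y * h y) * gamma_density 1 al (z - y)
          = gamma_density \<theta> al y * ((f y * h y) * gamma_density 1 al (z - y))" by simp
      then show ?thesis
        by (simp only: ennreal_mult'[OF fh] ennreal_mult'[OF gamma_density_nonneg[OF \<theta>]])
    qed
    ultimately show "ennreal (gamma_density \<theta> al y) * (ennreal (f y * h y) * (\<integral>\<^sup>+x. ennreal (gamma_density 1 al x) * \<phi> (y + x) \<partial>lborel))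
      = (\<integral>\<^sup>+z. ennreal (gamma_density \<theta> al y * (f y * h y) * gamma_density 1 al (z - y)) * \<phi> z \<partial>lborel)"
      by (simp only: mult.assoc) (simp add: nn_integral_cmult)
  qed
  also have "\<dots> = (\<integral>\<^sup>+z. \<integral>\<^sup>+y. ennreal (gamma_density \<theta> al y * (f y * h y) * gamma_density 1 al (z - y)) * \<phi> z \<partial>lborel \<partial>lborel)"
    by (subst lborel_pair.Fubini') auto
  also have "\<dots> = (\<integral>\<^sup>+z. ennreal (gamma_density (\<theta> + 1) al z * h z) * \<phi> z \<partial>lborel)"
    by (simp add: nn_integral_multc inner)
  also have "\<dots> = (\<integral>\<^sup>+z. ennreal (h z) * \<phi> z \<partial>gamma_measure (\<theta> + 1) al)"
    using \<theta> h_pos by (simp add: nn_integral_gamma_measure ennreal_mult gamma_density_nonneg less_imp_le mult.assoc)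
  finally show ?thesis .
qed

text \<open>The two-term transition turns the weighted gamma law of shape \<theta> into
  \<open>p\<close> times itself plus \<open>q\<close> times the weighted law of shape \<theta> + 1,
  and these are the first two terms of the weighted law of rate \<open>be\<close>. The remaining
  terms have total mass \<open>gamma_remainder\<close>.\<close>

lemma weight_step:
  assumes be: "0 < be" "be \<le> al" and [measurable]: "\<phi> \<in> borel_measurable borel"
    and \<phi>: "\<And>x. 0 \<le> \<phi> x" "\<And>x. \<phi> x \<le> 1"
  defines "p \<equiv> (be / al) powr \<theta>" and "q \<equiv> (be / al) powr \<theta> * \<theta> * (1 - be / al)"
  shows "\<bar>(\<integral>y. (p * \<phi> y + q * (f y * (\<integral>x. \<phi> (y + x) \<partial>gamma_measure 1 al))) * h y \<partial>gamma_measure \<theta> al)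
      - (\<integral>y. \<phi> y * h y \<partial>gamma_measure \<theta> be)\<bar> \<le> gamma_remainder \<theta> (be / al)"
proof -
  have al: "al > 0" using be by simp
  interpret A: prob_space "gamma_measure \<theta> al" using \<theta> al by (rule prob_space_gamma_measure)
  interpret A1: prob_space "gamma_measure (\<theta> + 1) al" using \<theta> al by (intro prob_space_gamma_measure) auto
  interpret B: prob_space "gamma_measure \<theta> be" using \<theta> be by (intro prob_space_gamma_measure) auto
  interpret E: prob_space "gamma_measure 1 al" using al by (intro prob_space_gamma_measure) auto
  define I where "I y = (\<integral>x. \<phi> (y + x) \<partial>gamma_measure 1 al)" for y
  have I_meas [measurable]: "I \<in> borel_measurable borel" unfolding I_def by measurable
  have int\<phi>: "integrable (gamma_measure 1 al) (\<lambda>x. \<phi> (y + x))" for y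
    using \<phi> by (intro E.integrable_const_bound[where B = 1]) auto
  have I: "0 \<le> I y" "I y \<le> 1" for y
    unfolding I_def using \<phi> by (auto intro!: Bochner_Integration.integral_nonneg E.integral_le_const int\<phi>)
  define u where "u y = \<phi> y * h y" for y
  have [measurable]: "u \<in> borel_measurable borel" unfolding u_def by measurable
  have u: "0 \<le> u y" "u y \<le> 1" for y
    using \<phi>[of y] h_pos[of y] h_le_1[of y] by (auto simp: u_def intro: mult_le_one)
  have fIh: "0 \<le> f y * I y * h y" "f y * I y * h y \<le> 1" for y
    using f_bounds[of y] I[of y] h_pos[of y] h_le_1[of y] by (auto intro!: mult_le_one)
  have intA: "integrable (gamma_measure \<theta> al) u" "integrable (gamma_measure \<theta> al) (\<lambda>y. f y * I y * h y)"
    and intA1: "integrable (gamma_measure (\<theta> + 1) al) u" and intB: "integrable (gamma_measure \<theta> be) u"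
    using u fIh
    by (auto intro!: A.integrable_const_bound[where B = 1] A1.integrable_const_bound[where B = 1] B.integrable_const_bound[where B = 1])
  have "ennreal (\<integral>y. f y * I y * h y \<partial>gamma_measure \<theta> al) = (\<integral>\<^sup>+y. ennreal (f y * I y * h y) \<partial>gamma_measure \<theta> al)"
    using intA fIh by (intro nn_integral_eq_integral[symmetric]) auto
  also have "\<dots> = (\<integral>\<^sup>+y. ennreal (f y * h y) * (\<integral>\<^sup>+x. ennreal (\<phi> (y + x)) \<partial>gamma_measure 1 al) \<partial>gamma_measure \<theta> al)"
  proof (rule nn_integral_cong)
    fix y
    have "(\<integral>\<^sup>+x. ennreal (\<phi> (y + x)) \<partial>gamma_measure 1 al) = ennreal (I y)"
      unfolding I_def using int\<phi> \<phi> by (intro nn_integral_eq_integral) auto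
    then show "ennreal (f y * I y * h y) = ennreal (f y * h y) * (\<integral>\<^sup>+x. ennreal (\<phi> (y + x)) \<partial>gamma_measure 1 al)"
      using f_bounds[of y] h_pos[of y] I[of y] by (simp add: ennreal_mult'[symmetric] mult_ac)
  qed
  also have "\<dots> = (\<integral>\<^sup>+z. ennreal (h z) * ennreal (\<phi> z) \<partial>gamma_measure (\<theta> + 1) al)"
    by (rule nn_integral_weight_convolution[OF al]) simp
  also have "\<dots> = (\<integral>\<^sup>+z. ennreal (u z) \<partial>gamma_measure (\<theta> + 1) al)"
    using h_pos \<phi> by (simp add: u_def ennreal_mult'[symmetric] less_imp_le mult.commute)
  also have "\<dots> = ennreal (\<integral>z. u z \<partial>gamma_measure (\<theta> + 1) al)"
    using intA1 u by (intro nn_integral_eq_integral) auto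
  finally have conv: "(\<integral>y. f y * I y * h y \<partial>gamma_measure \<theta> al) = (\<integral>z. u z \<partial>gamma_measure (\<theta> + 1) al)"
    using u fIh by (subst (asm) ennreal_inj) (auto intro!: Bochner_Integration.integral_nonneg)
  have "(\<integral>y. (p * \<phi> y + q * (f y * I y)) * h y \<partial>gamma_measure \<theta> al)
      = (\<integral>y. p * u y + q * (f y * I y * h y) \<partial>gamma_measure \<theta> al)"
    by (simp add: u_def algebra_simps)
  also have "\<dots> = p * (\<integral>y. u y \<partial>gamma_measure \<theta> al) + q * (\<integral>z. u z \<partial>gamma_measure (\<theta> + 1) al)"
    using intA by (simp add: conv)
  finally have eq: "(\<integral>y. (p * \<phi> y + q * (f y * I y)) * h y \<partial>gamma_measure \<theta> al)
      = p * (\<integral>y. u y \<partial>gamma_measure \<theta> al) + q * (\<integral>z. u z \<partial>gamma_measure (\<theta> + 1) al)" .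
  have le1: "p * (\<integral>y. u y \<partial>gamma_measure \<theta> al) + q * (\<integral>z. u z \<partial>gamma_measure (\<theta> + 1) al) \<le> (\<integral>y. u y \<partial>gamma_measure \<theta> be)"
    unfolding p_def q_def by (rule gamma_measure_two_terms[OF \<theta> be]) (use u in auto)
  \<comment> \<open>Taking \<open>1 - u\<close> in place of \<open>u\<close> bounds the omitted
    terms from above by their total mass.\<close>
  have compl_le: "p * (\<integral>y. 1 - u y \<partial>gamma_measure \<theta> al) + q * (\<integral>z. 1 - u z \<partial>gamma_measure (\<theta> + 1) al) \<le> (\<integral>y. 1 - u y \<partial>gamma_measure \<theta> be)"
    unfolding p_def q_def by (rule gamma_measure_two_terms[OF \<theta> be]) (use u in auto)
  have compl: "(\<integral>y. 1 - u y \<partial>gamma_measure \<theta> al) = 1 - (\<integral>y. u y \<partial>gamma_measure \<theta> al)"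
    "(\<integral>y. 1 - u y \<partial>gamma_measure (\<theta> + 1) al) = 1 - (\<integral>y. u y \<partial>gamma_measure (\<theta> + 1) al)"
    "(\<integral>y. 1 - u y \<partial>gamma_measure \<theta> be) = 1 - (\<integral>y. u y \<partial>gamma_measure \<theta> be)"
    using intA intA1 intB A.prob_space A1.prob_space B.prob_space by simp_all
  have le2: "(\<integral>y. u y \<partial>gamma_measure \<theta> be) - (p * (\<integral>y. u y \<partial>gamma_measure \<theta> al) + q * (\<integral>z. u z \<partial>gamma_measure (\<theta> + 1) al)) \<le> 1 - p - q"
    using compl_le unfolding compl by (simp add: algebra_simps)
  have "1 - p - q = gamma_remainder \<theta> (be / al)"
    by (simp add: p_def q_def gamma_remainder_def)
  with le1 le2 eq show ?thesis
    unfolding I_def[symmetric] u_def[symmetric] by simp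
qed

end

section \<open>The range of a gamma process\<close>

lemma card_image_le_changes:
  fixes x :: "int \<Rightarrow> 'b"
  assumes "i \<le> j"
  shows "card (x ` {i..j}) \<le> Suc (card {k\<in>{i..<j}. x (k + 1) \<noteq> x k})"
  using assms
proof (induction j rule: int_ge_induct)
  case (step j)
  have ins: "x ` {i..j + 1} = insert (x (j + 1)) (x ` {i..j})" using step by (auto simp: image_def) (metis zle_add1_eq_le order.order_iff_strict atLeastAtMost_iff)
  show ?case
  proof (cases "x (j + 1) = x j")
    case True
    then have "x ` {i..j + 1} = x ` {i..j}" using step ins by auto
    moreover have "card {k\<in>{i..<j}. x (k + 1) \<noteq> x k} \<le> card {k\<in>{i..<j + 1}. x (k + 1) \<noteq> x k}"
      by (rule card_mono, rule finite_subset[of _ "{i..j}"]) auto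
    ultimately show ?thesis using step by simp
  next
    case False
    then have "{k\<in>{i..<j + 1}. x (k + 1) \<noteq> x k} = insert j {k\<in>{i..<j}. x (k + 1) \<noteq> x k}"
      using step by auto
    then have "card {k\<in>{i..<j + 1}. x (k + 1) \<noteq> x k} = Suc (card {k\<in>{i..<j}. x (k + 1) \<noteq> x k})"
      by (simp only:) (rule card_insert_disjoint, rule finite_subset[of _ "{i..j}"], auto)
    moreover have "card (x ` {i..j + 1}) \<le> Suc (card (x ` {i..j}))"
      unfolding ins by (rule card_insert_le_m1) auto
    ultimately show ?thesis using step by simp
  qed
qed simp

section \<open>Integrating out the newest increment\<close>

lemma (in prob_space) indep_var_integral:
  fixes F :: "'b \<times> 'b \<Rightarrow> real"
  assumes ind: "indep_var S X N Y" and [measurable]: "F \<in> borel_measurable (S \<Otimes>\<^sub>M N)" and F: "\<And>z. \<bar>F z\<bar> \<le> B"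
  shows "(\<integral>\<omega>. F (X \<omega>, Y \<omega>) \<partial>M) = (\<integral>\<omega>. (\<integral>y. F (X \<omega>, y) \<partial>distr M N Y) \<partial>M)"
proof -
  have [measurable]: "X \<in> measurable M S" "Y \<in> measurable M N"
    using ind by (auto dest: indep_var_rv1 indep_var_rv2)
  interpret X: prob_space "distr M S X" by (rule prob_space_distr) simp
  interpret Y: prob_space "distr M N Y" by (rule prob_space_distr) simp
  interpret P: pair_prob_space "distr M S X" "distr M N Y" ..
  have "(\<integral>\<omega>. F (X \<omega>, Y \<omega>) \<partial>M) = (\<integral>z. F z \<partial>distr M (S \<Otimes>\<^sub>M N) (\<lambda>\<omega>. (X \<omega>, Y \<omega>)))"
    by (subst integral_distr) auto
  also have "\<dots> = (\<integral>z. F z \<partial>(distr M S X \<Otimes>\<^sub>M distr M N Y))"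
    using ind by (simp add: indep_var_distribution_eq)
  also have "\<dots> = (\<integral>x. (\<integral>y. F (x, y) \<partial>distr M N Y) \<partial>distr M S X)"
    using F by (intro P.integral_fst'[symmetric] P.P.integrable_const_bound[where B = B]) auto
  also have "\<dots> = (\<integral>\<omega>. (\<integral>y. F (X \<omega>, y) \<partial>distr M N Y) \<partial>M)"
    by (subst integral_distr) auto
  finally show ?thesis .
qed

lemma (in nondecreasing_ssa) indep_past:
  assumes "\<Phi> \<in> measurable (PiM {..<k} (\<lambda>_. borel)) N"
  shows "indep_var N (\<lambda>\<omega>. \<Phi> (\<lambda>i\<in>{..<k}. dT n i \<omega>)) borel (dT n k)"
proof -
  have "indep_var N (\<Phi> \<circ> (\<lambda>\<omega>. \<lambda>i\<in>{..<k}. dT n i \<omega>)) borel ((\<lambda>x. x k) \<circ> (\<lambda>\<omega>. \<lambda>i\<in>{k}. dT n i \<omega>))"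
    by (rule indep_var_compose[OF indep_var_restrict[OF indep_dT] assms]) auto
  then show ?thesis by (simp add: comp_def)
qed

lemma (in nondecreasing_ssa) indep_past_integral:
  fixes F :: "(int \<Rightarrow> real) \<times> real \<Rightarrow> real"
  assumes [measurable]: "F \<in> borel_measurable (PiM {..<k} (\<lambda>_. borel) \<Otimes>\<^sub>M borel)" and F: "\<And>z. \<bar>F z\<bar> \<le> B"
  shows "(\<integral>\<omega>. F (\<lambda>i\<in>{..<k}. dT n i \<omega>, dT n k \<omega>) \<partial>M)
    = (\<integral>\<omega>. (\<integral>x. F (\<lambda>i\<in>{..<k}. dT n i \<omega>, x) \<partial>distr M borel (dT n k)) \<partial>M)"
proof -
  let ?X = "\<lambda>\<omega>. \<lambda>i\<in>{..<k}. dT n i \<omega>" and ?Y = "\<lambda>\<omega>. \<lambda>i\<in>{k}. dT n i \<omega>"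
  have ind: "indep_var (PiM {..<k} (\<lambda>_. borel)) ?X (PiM {k} (\<lambda>_. borel)) ?Y"
    by (rule indep_var_restrict[OF indep_dT]) auto
  have [measurable]: "?Y \<in> measurable M (PiM {k} (\<lambda>_. borel))" "?X \<in> measurable M (PiM {..<k} (\<lambda>_. borel))"
    using ind by (auto dest: indep_var_rv1 indep_var_rv2)
  have "(\<integral>\<omega>. F (?X \<omega>, ?Y \<omega> k) \<partial>M) = (\<integral>\<omega>. (\<integral>y. F (?X \<omega>, y k) \<partial>distr M (PiM {k} (\<lambda>_. borel)) ?Y) \<partial>M)"
    using indep_var_integral[OF ind, of "\<lambda>z. F (fst z, snd z k)" B] F by simp
  also have "(\<integral>y. F (?X \<omega>, y k) \<partial>distr M (PiM {k} (\<lambda>_. borel)) ?Y) = (\<integral>x. F (?X \<omega>, x) \<partial>distr M borel (dT n k))"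
    if "\<omega> \<in> space M" for \<omega>
    using measurable_space[OF \<open>?X \<in> measurable M (PiM {..<k} (\<lambda>_. borel))\<close> that]
    by (simp add: integral_distr)
  then have "(\<integral>\<omega>. (\<integral>y. F (?X \<omega>, y k) \<partial>distr M (PiM {k} (\<lambda>_. borel)) ?Y) \<partial>M)
    = (\<integral>\<omega>. (\<integral>x. F (?X \<omega>, x) \<partial>distr M borel (dT n k)) \<partial>M)"
    by (intro Bochner_Integration.integral_cong) auto
  finally show ?thesis by simp
qed

lemma (in nondecreasing_ssa) AE_past_sum_restrict:
  "AE \<omega> in M. \<forall>i\<le>k. T (grid n i) \<omega> = past_sum n i (\<lambda>i\<in>{..<k}. dT n i \<omega>)"
  using AE_past_sum by eventually_elim (auto simp: past_sum_restrict)

locale gamma_ssa = nondecreasing_ssa +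
  fixes \<theta> l :: real
  assumes shape: "\<theta> > 0" and rate: "l > 0" and law: "distr M borel (T 1) = gamma_measure \<theta> l"
begin

lemma distr_T:
  assumes s: "s > 0"
  shows "distr M borel (T s) = gamma_measure \<theta> (l / s)"
proof -
  have [measurable]: "T 1 \<in> borel_measurable M" by (rule measurable_process) simp
  have "distr M borel (T s) = distr (distr M borel (T 1)) borel (\<lambda>x. s * x)"
    unfolding distr_process_scale[OF s] by (subst distr_distr) (auto simp: comp_def)
  then show ?thesis
    unfolding law using distr_mult_gamma_measure[OF s rate] by simp
qed

lemma AE_T_regular: "AE \<omega> in M. regular_path (\<lambda>s. T s \<omega>)"
proof (rule AE_regular_path)
  have "AE x in distr M borel (T 1). x > 0"
    unfolding law by (rule AE_gamma_measure_pos)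
  then show "AE \<omega> in M. T 1 \<omega> > 0"
    by (subst (asm) AE_distr_iff) auto
qed

lemma rate_grid: "0 < l / grid n (k + 1)" "l / grid n (k + 1) \<le> l / grid n k"
  and rate_ratio: "(l / grid n (k + 1)) / (l / grid n k) = grid n (- 1)"
proof -
  show "0 < l / grid n (k + 1)" "l / grid n (k + 1) \<le> l / grid n k"
    using rate by (auto intro!: divide_left_mono mult_pos_pos)
  have "grid n (k + 1) * grid n (- 1) = grid n k"
    by (simp add: grid_add[symmetric])
  then show "(l / grid n (k + 1)) / (l / grid n k) = grid n (- 1)"
    using rate by (simp add: field_simps)
qed

lemma distr_dT: "distr M borel (dT n k) = gamma_increment \<theta> (l / grid n k) (l / grid n (k + 1))"
proof (rule distr_gamma_increment[OF shape rate_grid])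
  \<comment> \<open>This is \<open>T (grid n k)\<close> almost surely, written in the earlier
    increments so that independence from \<open>dT n k\<close> is available.\<close>
  let ?Y = "\<lambda>\<omega>. past_sum n k (\<lambda>i\<in>{..<k}. dT n i \<omega>)"
  show ind: "indep_var borel ?Y borel (dT n k)"
    by (rule indep_past) simp
  then have [measurable]: "?Y \<in> borel_measurable M" by (rule indep_var_rv1)
  have "distr M borel ?Y = distr M borel (T (grid n k))"
    by (rule distr_cong_AE) (use AE_past_sum_restrict[of k n] in \<open>auto elim: AE_mp\<close>)
  then show "distr M borel ?Y = gamma_measure \<theta> (l / grid n k)"
    by (simp add: distr_T)
  have "AE \<omega> in M. ?Y \<omega> + dT n k \<omega> = T (grid n (k + 1)) \<omega>"
    using AE_past_sum_restrict[of k n]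
  proof eventually_elim
    case (elim \<omega>)
    then have "T (grid n k) \<omega> = ?Y \<omega>" by blast
    then show ?case by (simp add: dT_def[of n k])
  qed
  then have "distr M borel (\<lambda>\<omega>. ?Y \<omega> + dT n k \<omega>) = distr M borel (T (grid n (k + 1)))"
    by (intro distr_cong_AE) auto
  then show "distr M borel (\<lambda>\<omega>. ?Y \<omega> + dT n k \<omega>) = gamma_measure \<theta> (l / grid n (k + 1))"
    by (simp add: distr_T)
qed

text \<open>The atom of the increment law at \<open>0\<close> has mass at least exp (- \<theta> ln 2
  / 2^n), and 1 - exp (- x) is at most x.\<close>

lemma prob_dT_neq_0: "prob {\<omega>\<in>space M. dT n k \<omega> \<noteq> 0} \<le> \<theta> * ln 2 / 2 ^ n"
proof -
  have "ennreal (grid n (- 1) powr \<theta>) \<le> emeasure (distr M borel (dT n k)) {0}"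
    using emeasure_gamma_increment_0[OF shape rate_grid, of n k]
    unfolding rate_ratio distr_dT[symmetric] .
  also have "\<dots> = emeasure M {\<omega>\<in>space M. dT n k \<omega> = 0}"
    by (subst emeasure_distr) (auto intro!: arg_cong[where f = "emeasure M"])
  finally have "grid n (- 1) powr \<theta> \<le> prob {\<omega>\<in>space M. dT n k \<omega> = 0}"
    by (simp add: emeasure_eq_measure)
  moreover have "prob {\<omega>\<in>space M. dT n k \<omega> \<noteq> 0} = 1 - prob {\<omega>\<in>space M. dT n k \<omega> = 0}"
    by (subst prob_compl[symmetric]) (auto intro!: arg_cong[where f = prob])
  moreover have "grid n (- 1) powr \<theta> = exp (- (\<theta> * ln 2 / 2 ^ n))"
    by (simp add: grid_def powr_def)
  then have "1 - \<theta> * ln 2 / 2 ^ n \<le> grid n (- 1) powr \<theta>"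
    using exp_ge_add_one_self[of "- (\<theta> * ln 2 / 2 ^ n)"] by simp
  ultimately show ?thesis by simp
qed

text \<open>Between the times \<open>2 powr (- j)\<close> and \<open>2 powr j\<close> there are
  \<open>2 * j * 2 ^ n\<close> increments, each nonzero with probability at most
  \<open>\<theta> * ln 2 / 2 ^ n\<close>. The expected number of changes is thus bounded in
  \<open>n\<close>, and by Fatou's lemma its lower limit is almost surely finite.\<close>

lemma AE_locally_finite: "AE \<omega> in M. locally_finite_range (\<lambda>s. T s \<omega>)"
proof -
  define C where "C j n \<omega> = card {k\<in>{- int j * 2 ^ n..<int j * 2 ^ n}. dT n k \<omega> \<noteq> 0}" for j n \<omega>
  have C_sum: "C j n \<omega> = (\<Sum>k\<in>{- int j * 2 ^ n..<int j * 2 ^ n}. if dT n k \<omega> \<noteq> 0 then 1 else 0)" for j n \<omega>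
    unfolding C_def by (simp only: card_eq_sum sum.inter_filter[OF finite_atLeastLessThan_int])
  have C_indicator: "ennreal (real (C j n \<omega>)) = (\<Sum>k\<in>{- int j * 2 ^ n..<int j * 2 ^ n}. indicator {\<omega>\<in>space M. dT n k \<omega> \<noteq> 0} \<omega>)"
    if "\<omega> \<in> space M" for j n \<omega>
    unfolding C_sum of_nat_sum
    by (subst sum_ennreal[symmetric], simp, intro sum.cong refl) (use that in \<open>auto simp: indicator_def\<close>)
  have C_meas [measurable]: "(\<lambda>\<omega>. real (C j n \<omega>)) \<in> borel_measurable M" for j n
    unfolding C_sum of_nat_sum by measurable
  have bound: "(\<integral>\<^sup>+\<omega>. ennreal (real (C j n \<omega>)) \<partial>M) \<le> ennreal (2 * real j * (\<theta> * ln 2))" for j n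
  proof -
    have "(\<integral>\<^sup>+\<omega>. ennreal (real (C j n \<omega>)) \<partial>M)
      = (\<integral>\<^sup>+\<omega>. (\<Sum>k\<in>{- int j * 2 ^ n..<int j * 2 ^ n}. indicator {\<omega>\<in>space M. dT n k \<omega> \<noteq> 0} \<omega>) \<partial>M)"
      by (intro nn_integral_cong) (simp add: C_indicator)
    also have "\<dots> = (\<Sum>k\<in>{- int j * 2 ^ n..<int j * 2 ^ n}. ennreal (prob {\<omega>\<in>space M. dT n k \<omega> \<noteq> 0}))"
      by (subst nn_integral_sum) (auto simp: emeasure_eq_measure)
    also have "\<dots> \<le> (\<Sum>k\<in>{- int j * 2 ^ n..<int j * 2 ^ n}. ennreal (\<theta> * ln 2 / 2 ^ n))"
      by (intro sum_mono ennreal_leI prob_dT_neq_0)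
    also have "\<dots> = ennreal (\<Sum>k\<in>{- int j * 2 ^ n..<int j * 2 ^ n}. \<theta> * ln 2 / 2 ^ n)"
      by (rule sum_ennreal) (use shape in auto)
    also have "(\<Sum>k\<in>{- int j * 2 ^ n..<int j * 2 ^ n}. \<theta> * ln 2 / 2 ^ n) = 2 * real j * (\<theta> * ln 2)"
      by (simp add: nat_mult_distrib nat_power_eq)
    finally show ?thesis .
  qed
  have "AE \<omega> in M. liminf (\<lambda>n. ennreal (real (C j n \<omega>))) \<noteq> \<infinity>" for j
  proof (rule nn_integral_noteq_infinite)
    have "(\<integral>\<^sup>+\<omega>. liminf (\<lambda>n. ennreal (real (C j n \<omega>))) \<partial>M) \<le> liminf (\<lambda>n. \<integral>\<^sup>+\<omega>. ennreal (real (C j n \<omega>)) \<partial>M)"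
      by (rule nn_integral_liminf) simp
    also have "\<dots> \<le> limsup (\<lambda>n. \<integral>\<^sup>+\<omega>. ennreal (real (C j n \<omega>)) \<partial>M)"
      by (rule Liminf_le_Limsup) simp
    also have "\<dots> \<le> ennreal (2 * real j * (\<theta> * ln 2))"
      by (rule Limsup_bounded) (simp add: bound)
    also have "\<dots> < \<infinity>" by simp
    finally show "(\<integral>\<^sup>+\<omega>. liminf (\<lambda>n. ennreal (real (C j n \<omega>))) \<partial>M) \<noteq> \<infinity>"
      by simp
  qed simp
  then have "AE \<omega> in M. \<forall>j. liminf (\<lambda>n. ennreal (real (C j n \<omega>))) \<noteq> \<infinity>"
    by (simp add: AE_all_countable)
  then show ?thesis
    using AE_T_regular
  proof eventually_elim
    case (elim \<omega>)
    show ?case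
    proof (rule locally_finite_rangeI[OF elim(2)])
      fix j :: nat
      have "\<exists>B. \<forall>N. \<exists>n\<ge>N. C j n \<omega> \<le> B"
      proof (rule ccontr)
        assume ne: "\<nexists>B. \<forall>N. \<exists>n\<ge>N. C j n \<omega> \<le> B"
        have ev: "\<exists>N. \<forall>n\<ge>N. B < C j n \<omega>" for B
        proof -
          from ne have "\<not> (\<forall>N. \<exists>n\<ge>N. C j n \<omega> \<le> B)" by blast
          then obtain N where "\<forall>n\<ge>N. \<not> C j n \<omega> \<le> B" by blast
          then show ?thesis by (intro exI[of _ N]) (simp add: not_le)
        qed
        have ge: "of_nat B \<le> liminf (\<lambda>n. ennreal (real (C j n \<omega>)))" for B
        proof (rule Liminf_bounded)
          obtain N where "\<forall>n\<ge>N. B < C j n \<omega>" using ev by blast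
          then show "\<forall>\<^sub>F n in sequentially. of_nat B \<le> ennreal (real (C j n \<omega>))"
            unfolding ennreal_of_nat_eq_real_of_nat eventually_sequentially
            by (intro exI[of _ N]) (auto intro!: ennreal_leI)
        qed
        have "liminf (\<lambda>n. ennreal (real (C j n \<omega>))) < top"
          using elim(1) by (simp add: less_top)
        then obtain B where "liminf (\<lambda>n. ennreal (real (C j n \<omega>))) < of_nat B"
          using ennreal_Ex_less_of_nat by blast
        with ge[of B] show False by simp
      qed
      then obtain B where B: "\<forall>N. \<exists>n\<ge>N. C j n \<omega> \<le> B" by blast
      have card_le: "card ((\<lambda>s. T s \<omega>) ` grid n ` {- int j * 2 ^ n..<int j * 2 ^ n}) \<le> Suc (C j n \<omega>)" for n
      proof -
        have "card ((\<lambda>s. T s \<omega>) ` grid n ` {- int j * 2 ^ n..<int j * 2 ^ n})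
            \<le> card ((\<lambda>k. T (grid n k) \<omega>) ` {- int j * 2 ^ n..int j * 2 ^ n})"
          by (intro card_mono) auto
        also have "\<dots> \<le> Suc (card {k\<in>{- int j * 2 ^ n..<int j * 2 ^ n}. T (grid n (k + 1)) \<omega> \<noteq> T (grid n k) \<omega>})"
          by (rule card_image_le_changes) (rule order_trans[of _ 0], auto)
        finally show ?thesis by (simp add: C_def dT_def)
      qed
      show "\<exists>B. \<forall>N. \<exists>n\<ge>N. card ((\<lambda>s. T s \<omega>) ` grid n ` {- int j * 2 ^ n..<int j * 2 ^ n}) \<le> B"
      proof (rule exI[of _ "Suc B"], rule allI)
        fix N
        obtain n where "n \<ge> N" "C j n \<omega> \<le> B" using B by blast
        then show "\<exists>n\<ge>N. card ((\<lambda>s. T s \<omega>) ` grid n ` {- int j * 2 ^ n..<int j * 2 ^ n}) \<le> Suc B"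
          using le_trans[OF card_le] by (intro exI[of _ n]) simp
      qed
    qed
  qed
qed

end

text \<open>Each value is recorded at the last index that carries it, when the path leaves it; the
  final value \<open>x j\<close> has not been left.\<close>

lemma prod_changes:
  fixes x :: "int \<Rightarrow> real" and f :: "real \<Rightarrow> real"
  assumes "i \<le> j" and mono: "\<And>u v. u \<le> v \<Longrightarrow> x u \<le> x v"
  shows "(\<Prod>k\<in>{i..<j}. if x (k + 1) = x k then 1 else f (x k)) = (\<Prod>y\<in>x ` {i..j} - {x j}. f y)"
  using assms(1)
proof (induction j rule: int_ge_induct)
  case (step j)
  have ins: "{i..<j + 1} = insert j {i..<j}" "{i..j + 1} = insert (j + 1) {i..j}"
    using step by auto
  have j: "x j \<in> x ` {i..j}" using step by auto
  show ?case
  proof (cases "x (j + 1) = x j")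
    case True
    have "x ` {i..j + 1} - {x (j + 1)} = x ` {i..j} - {x j}"
      unfolding ins using True by auto
    then show ?thesis using step True by (simp add: ins(1))
  next
    case False
    then have less: "x j < x (j + 1)" using mono[of j "j + 1"] by simp
    have "x u \<noteq> x (j + 1)" if "u \<le> j" for u
      using mono[OF that] less by simp
    then have "x ` {i..j + 1} - {x (j + 1)} = insert (x j) (x ` {i..j} - {x j})"
      unfolding ins using j by auto
    then show ?thesis using step False j prod.remove[of "x ` {i..j}" "x j" f] by (simp add: ins(1))
  qed
qed simp

text \<open>The conditions at the ends ensure that every value inside \<open>{a<..b}\<close> is
  reached after \<open>i\<close> and left before \<open>j\<close>; values outside contribute
  \<open>1\<close>.\<close>

lemma prod_changes_window:
  fixes x :: "int \<Rightarrow> real" and f :: "real \<Rightarrow> real"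
  assumes ij: "i \<le> j" and mono: "\<And>u v. u \<le> v \<Longrightarrow> x u \<le> x v" and f: "\<And>y. y \<notin> {a<..b} \<Longrightarrow> f y = 1"
    and ends: "x i \<le> a" "b < x j"
  shows "(\<Prod>k\<in>{i..<j}. if x (k + 1) = x k then 1 else f (x k)) = (\<Prod>y\<in>range x \<inter> {a<..b}. f y)"
proof -
  have "range x \<inter> {a<..b} \<subseteq> x ` {i..j} - {x j}"
  proof safe
    fix k assume k: "x k \<in> {a<..b}"
    have "i \<le> k" using mono[of k i] ends k by (cases "i \<le> k") auto
    moreover have "k \<le> j" using mono[of j k] ends k by (cases "k \<le> j") auto
    ultimately show "x k \<in> x ` {i..j}" by auto
  qed (use ends in auto)
  then have "(\<Prod>y\<in>range x \<inter> {a<..b}. f y) = (\<Prod>y\<in>x ` {i..j} - {x j}. f y)"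
    by (intro prod.mono_neutral_left) (use f in auto)
  then show ?thesis
    using prod_changes[OF ij, of x f] mono by simp
qed

text \<open>The remainder is of order \<open>1 / 4 ^ n\<close>, so it still vanishes when
  accumulated over a number of steps proportional to \<open>2 ^ n\<close>.\<close>

lemma tendsto_gamma_remainder:
  assumes \<theta>: "\<theta> > 0"
  shows "(\<lambda>n. 2 ^ n * gamma_remainder \<theta> (grid n (- 1))) \<longlonglongrightarrow> 0"
proof -
  have "((\<lambda>x::real. (1 - 2 powr (- x * \<theta>) - 2 powr (- x * \<theta>) * \<theta> * (1 - 2 powr (- x))) / x) \<longlongrightarrow> 0) (at_right 0)"
    using \<theta> by real_asymp
  moreover have "filterlim (\<lambda>n. 1 / 2 ^ n :: real) (at_right 0) sequentially"
    by real_asymp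
  ultimately have "(\<lambda>n. (1 - 2 powr (- (1 / 2 ^ n) * \<theta>) - 2 powr (- (1 / 2 ^ n) * \<theta>) * \<theta> * (1 - 2 powr (- (1 / 2 ^ n :: real)))) / (1 / 2 ^ n)) \<longlonglongrightarrow> 0"
    by (rule filterlim_compose)
  then show ?thesis
    by (simp add: gamma_remainder_def grid_def powr_powr mult.commute)
qed

locale gamma_weight = gamma_ssa M T \<theta> l + weight \<theta> a b f for M T \<theta> l a b f
begin

text \<open>A value enters the product when the path leaves it, so the current value is still
  missing. The next factor then depends only on the current value and on whether the next increment
  vanishes.\<close>

definition V :: "nat \<Rightarrow> int \<Rightarrow> int \<Rightarrow> 'a \<Rightarrow> real" where
  "V n i k \<omega> = (\<Prod>j\<in>{i..<k}. if dT n j \<omega> = 0 then 1 else f (T (grid n j) \<omega>))"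

lemma V_measurable [measurable]: "V n i k \<in> borel_measurable M"
  unfolding V_def by measurable

lemma V_bounds: "0 \<le> V n i k \<omega>" "V n i k \<omega> \<le> 1"
  unfolding V_def using f_bounds by (auto intro!: prod_nonneg prod_le_1)

text \<open>The increments before \<open>k\<close> almost surely determine both
  \<open>V n i k\<close> and the current value, so the independent increment \<open>dT n k\<close>
  can be integrated out.\<close>

lemma V_step:
  assumes ik: "i \<le> k" and [measurable]: "\<phi> \<in> borel_measurable borel" and \<phi>: "\<And>x. 0 \<le> \<phi> x" "\<And>x. \<phi> x \<le> 1"
  shows "(\<integral>\<omega>. V n i (k + 1) \<omega> * \<phi> (T (grid n (k + 1)) \<omega>) \<partial>M)
    = (\<integral>\<omega>. V n i k \<omega> * (\<integral>x. (if x = 0 then 1 else f (T (grid n k) \<omega>)) * \<phi> (T (grid n k) \<omega> + x) \<partial>distr M borel (dT n k)) \<partial>M)"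
proof -
  define V' where "V' x = (\<Prod>j\<in>{i..<k}. if x j = 0 then 1 else f (past_sum n j x))" for x :: "int \<Rightarrow> real"
  define F where "F z = V' (fst z) * ((if snd z = 0 then 1 else f (past_sum n k (fst z))) * \<phi> (past_sum n k (fst z) + snd z))" for z
  have V'_meas [measurable]: "V' \<in> borel_measurable (PiM {..<k} (\<lambda>_. borel))"
    unfolding V'_def
  proof (intro borel_measurable_prod)
    fix j assume "j \<in> {i..<k}"
    then have [measurable]: "(\<lambda>x. x j) \<in> borel_measurable (PiM {..<k} (\<lambda>_. borel))"
      "past_sum n j \<in> borel_measurable (PiM {..<k} (\<lambda>_. borel))"
      by (auto intro: measurable_component_singleton)
    show "(\<lambda>x. if x j = 0 then 1 else f (past_sum n j x)) \<in> borel_measurable (PiM {..<k} (\<lambda>_. borel))"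
      by measurable
  qed
  have [measurable]: "past_sum n k \<in> borel_measurable (PiM {..<k} (\<lambda>_. borel))" by simp
  have F_meas: "F \<in> borel_measurable (PiM {..<k} (\<lambda>_. borel) \<Otimes>\<^sub>M borel)"
    unfolding F_def by measurable
  have V'_bounds: "0 \<le> V' x" "V' x \<le> 1" for x
    unfolding V'_def using f_bounds by (auto intro!: prod_nonneg prod_le_1)
  have F_bound: "\<bar>F z\<bar> \<le> 1" for z
    unfolding F_def abs_mult using V'_bounds f_bounds \<phi> by (auto intro!: mult_le_one)
  define R where "R \<omega> = (\<lambda>i\<in>{..<k}. dT n i \<omega>)" for \<omega>
  have R_meas [measurable]: "R \<in> measurable M (PiM {..<k} (\<lambda>_. borel))"
    unfolding R_def by (intro measurable_restrict) simp
  have eq: "AE \<omega> in M. V n i k \<omega> = V' (R \<omega>) \<and> T (grid n k) \<omega> = past_sum n k (R \<omega>) \<and> T (grid n (k + 1)) \<omega> = past_sum n k (R \<omega>) + dT n k \<omega>"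
    using AE_past_sum_restrict[of k n]
  proof eventually_elim
    case (elim \<omega>)
    then have past: "T (grid n j) \<omega> = past_sum n j (R \<omega>)" if "j \<le> k" for j
      using that by (simp add: R_def)
    have "V n i k \<omega> = V' (R \<omega>)"
      unfolding V_def V'_def by (intro prod.cong refl) (auto simp: past[symmetric], auto simp: R_def)
    moreover have "T (grid n (k + 1)) \<omega> = T (grid n k) \<omega> + dT n k \<omega>"
      by (simp add: dT_def[of n k])
    ultimately show ?case using past[of k] by simp
  qed
  have split: "V n i (k + 1) \<omega> = V n i k \<omega> * (if dT n k \<omega> = 0 then 1 else f (T (grid n k) \<omega>))" for \<omega>
  proof -
    have "{i..<k + 1} = insert k {i..<k}" using ik by auto
    then show ?thesis by (simp add: V_def)
  qed
  have "(\<integral>\<omega>. V n i (k + 1) \<omega> * \<phi> (T (grid n (k + 1)) \<omega>) \<partial>M) = (\<integral>\<omega>. F (R \<omega>, dT n k \<omega>) \<partial>M)"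
  proof (rule integral_cong_AE)
    show "(\<lambda>\<omega>. F (R \<omega>, dT n k \<omega>)) \<in> borel_measurable M"
      using F_meas by measurable
    show "AE \<omega> in M. V n i (k + 1) \<omega> * \<phi> (T (grid n (k + 1)) \<omega>) = F (R \<omega>, dT n k \<omega>)"
      using eq by eventually_elim (simp add: split F_def)
  qed simp
  also have "\<dots> = (\<integral>\<omega>. (\<integral>x. F (R \<omega>, x) \<partial>distr M borel (dT n k)) \<partial>M)"
    unfolding R_def by (rule indep_past_integral[OF F_meas F_bound])
  also have "\<dots> = (\<integral>\<omega>. V n i k \<omega> * (\<integral>x. (if x = 0 then 1 else f (T (grid n k) \<omega>)) * \<phi> (T (grid n k) \<omega> + x) \<partial>distr M borel (dT n k)) \<partial>M)"
  proof (rule integral_cong_AE)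
    interpret D: prob_space "distr M borel (dT n k)" by (rule prob_space_distr) simp
    show "(\<lambda>\<omega>. \<integral>x. F (R \<omega>, x) \<partial>distr M borel (dT n k)) \<in> borel_measurable M"
      by (rule D.borel_measurable_lebesgue_integral) (use F_meas in measurable)
    show "(\<lambda>\<omega>. V n i k \<omega> * (\<integral>x. (if x = 0 then 1 else f (T (grid n k) \<omega>)) * \<phi> (T (grid n k) \<omega> + x) \<partial>distr M borel (dT n k))) \<in> borel_measurable M"
      by measurable
    show "AE \<omega> in M. (\<integral>x. F (R \<omega>, x) \<partial>distr M borel (dT n k))
      = V n i k \<omega> * (\<integral>x. (if x = 0 then 1 else f (T (grid n k) \<omega>)) * \<phi> (T (grid n k) \<omega> + x) \<partial>distr M borel (dT n k))"
      using eq by eventually_elim (simp add: F_def cong: if_cong)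
  qed
  finally show ?thesis .
qed

text \<open>Induction over the grid steps with an arbitrary test function of the current value,
  since a step replaces \<phi> by its conditional expectation \<Psi>. Each step costs the remainder
  twice: for truncating the increment law and for \<open>weight_step\<close>. At the start the
  product is empty, while \<open>h\<close> differs from \<open>1\<close> only above
  \<open>a\<close>.\<close>

lemma V_estimate:
  assumes "i \<le> k" and "\<phi> \<in> borel_measurable borel" and "\<And>x. 0 \<le> \<phi> x" "\<And>x. \<phi> x \<le> 1"
  shows "\<bar>(\<integral>\<omega>. V n i k \<omega> * \<phi> (T (grid n k) \<omega>) \<partial>M) - (\<integral>y. \<phi> y * h y \<partial>gamma_measure \<theta> (l / grid n k))\<bar>
    \<le> prob {\<omega>\<in>space M. a < T (grid n i) \<omega>} + 2 * real_of_int (k - i) * gamma_remainder \<theta> (grid n (- 1))"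
  using assms
proof (induction k arbitrary: \<phi> rule: int_ge_induct)
  case base
  note [measurable] = base(1) and \<phi> = base(2,3)
  define u where "u y = \<phi> y * (1 - h y)" for y
  have [measurable]: "u \<in> borel_measurable borel" unfolding u_def by measurable
  have u: "0 \<le> u y" "u y \<le> indicator {a<..} y" for y
    using \<phi>[of y] h_pos[of y] h_le_1[of y] h_below[of y] by (auto simp: u_def indicator_def not_less intro: mult_le_one)
  have "\<phi> y * h y \<le> 1" "u y \<le> 1" for y
    using \<phi>[of y] h_pos[of y] h_le_1[of y]
    by (auto intro: mult_le_one order_trans[OF u(2)] simp: indicator_def)
  then have int: "integrable M (\<lambda>\<omega>. \<phi> (T (grid n i) \<omega>))" "integrable M (\<lambda>\<omega>. \<phi> (T (grid n i) \<omega>) * h (T (grid n i) \<omega>))"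
    "integrable M (\<lambda>\<omega>. u (T (grid n i) \<omega>))"
    using \<phi> h_pos u(1)
    by (auto intro!: integrable_const_bound[where B = 1] simp: less_imp_le abs_mult)
  have "(\<integral>y. \<phi> y * h y \<partial>gamma_measure \<theta> (l / grid n i)) = (\<integral>\<omega>. \<phi> (T (grid n i) \<omega>) * h (T (grid n i) \<omega>) \<partial>M)"
    unfolding distr_T[OF grid_pos, symmetric] by (subst integral_distr) auto
  then have "(\<integral>\<omega>. V n i i \<omega> * \<phi> (T (grid n i) \<omega>) \<partial>M) - (\<integral>y. \<phi> y * h y \<partial>gamma_measure \<theta> (l / grid n i))
      = (\<integral>\<omega>. u (T (grid n i) \<omega>) \<partial>M)"
    using int by (simp add: V_def u_def right_diff_distrib)
  moreover have "0 \<le> (\<integral>\<omega>. u (T (grid n i) \<omega>) \<partial>M)"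
    using u by (intro Bochner_Integration.integral_nonneg) auto
  moreover have "(\<integral>\<omega>. u (T (grid n i) \<omega>) \<partial>M) \<le> (\<integral>\<omega>. indicator {\<omega>\<in>space M. a < T (grid n i) \<omega>} \<omega> \<partial>M)"
  proof (rule integral_mono)
    show "integrable M (\<lambda>\<omega>. indicator {\<omega>\<in>space M. a < T (grid n i) \<omega>} \<omega> :: real)"
      by (intro integrable_const_bound[where B = 1]) auto
    show "u (T (grid n i) \<omega>) \<le> indicator {\<omega>\<in>space M. a < T (grid n i) \<omega>} \<omega>" if "\<omega> \<in> space M" for \<omega>
      using u(2)[of "T (grid n i) \<omega>"] that by (auto simp: indicator_def)
  qed (rule int)
  ultimately show ?case by simp
next
  case (step k)
  note [measurable] = step(3) and \<phi> = step(4,5)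
  define al where "al = l / grid n k"
  define be where "be = l / grid n (k + 1)"
  have be: "0 < be" "be \<le> al" and ratio: "be / al = grid n (- 1)"
    unfolding al_def be_def by (rule rate_grid, rule rate_grid, rule rate_ratio)
  have al: "al > 0" using be by simp
  interpret D: real_distribution "gamma_increment \<theta> al be" by (rule real_distribution_gamma_increment[OF shape be])
  interpret E: prob_space "gamma_measure 1 al" using al by (intro prob_space_gamma_measure) auto
  interpret A: prob_space "gamma_measure \<theta> al" using shape al by (intro prob_space_gamma_measure) auto
  define r where "r = gamma_remainder \<theta> (grid n (- 1))"
  define p where "p = (be / al) powr \<theta>"
  define q where "q = (be / al) powr \<theta> * \<theta> * (1 - be / al)"
  have D: "distr M borel (dT n k) = gamma_increment \<theta> al be"
    by (simp add: distr_dT al_def be_def)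
  define \<Psi> where "\<Psi> y = (\<integral>x. (if x = 0 then 1 else f y) * \<phi> (y + x) \<partial>gamma_increment \<theta> al be)" for y
  \<comment> \<open>The two-term approximation of \<Psi>: no jump, or one exponential jump away from
    \<open>y\<close>.\<close>
  define \<Psi>' where "\<Psi>' y = p * \<phi> y + q * (f y * (\<integral>x. \<phi> (y + x) \<partial>gamma_measure 1 al))" for y
  have \<Psi>_meas [measurable]: "\<Psi> \<in> borel_measurable borel"
    unfolding \<Psi>_def using al by measurable
  have \<Psi>'_meas [measurable]: "\<Psi>' \<in> borel_measurable borel"
    unfolding \<Psi>'_def by measurable
  have w: "0 \<le> (if x = 0 then 1 else f y) * \<phi> (y + x)" "(if x = 0 then 1 else f y) * \<phi> (y + x) \<le> 1" for x y
    using f_bounds[of y] \<phi>[of "y + x"] by (auto intro: mult_le_one)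
  have \<Psi>: "0 \<le> \<Psi> y" "\<Psi> y \<le> 1" for y
    unfolding \<Psi>_def using w al
    by (auto intro!: Bochner_Integration.integral_nonneg D.integral_le_const D.integrable_const_bound[where B = 1])
  have diff: "\<bar>\<Psi> y - \<Psi>' y\<bar> \<le> r" for y
  proof -
    define g where "g x = (if x = 0 then 1 else f y) * \<phi> (y + x)" for x
    have [measurable]: "g \<in> borel_measurable borel" unfolding g_def by measurable
    have g: "\<bar>g x\<bar> \<le> 1" for x using w[of x y] by (auto simp: g_def)
    have "(\<integral>x. g x \<partial>gamma_measure 1 al) = (\<integral>x. f y * \<phi> (y + x) \<partial>gamma_measure 1 al)"
    proof (rule integral_cong_AE)
      show "AE x in gamma_measure 1 al. g x = f y * \<phi> (y + x)"
        using AE_gamma_measure_pos[of 1 al] by eventually_elim (simp add: g_def)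
    qed auto
    moreover have "g 0 = \<phi> y" by (simp add: g_def)
    ultimately show ?thesis
      using integral_gamma_increment_approx[OF shape be \<open>g \<in> borel_measurable borel\<close> g]
      unfolding \<Psi>_def \<Psi>'_def g_def[symmetric] p_def q_def r_def ratio[symmetric]
      by (simp add: algebra_simps)
  qed
  have \<Psi>'_bound: "\<bar>\<Psi>' y\<bar> \<le> 1 + r" for y using diff[of y] \<Psi>[of y] by linarith
  have int: "integrable (gamma_measure \<theta> al) (\<lambda>y. \<Psi> y * h y)" "integrable (gamma_measure \<theta> al) (\<lambda>y. \<Psi>' y * h y)"
  proof -
    show "integrable (gamma_measure \<theta> al) (\<lambda>y. \<Psi> y * h y)"
      using \<Psi> h_pos h_le_1 by (intro A.integrable_const_bound[where B = 1]) (auto simp: abs_mult less_imp_le intro!: mult_le_one)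
    have "\<bar>\<Psi>' y * h y\<bar> \<le> 1 + r" for y
      using mult_mono[OF \<Psi>'_bound[of y] h_le_1[of y]] h_pos[of y] \<Psi>'_bound[of y]
      by (simp add: abs_mult less_imp_le)
    then show "integrable (gamma_measure \<theta> al) (\<lambda>y. \<Psi>' y * h y)"
      by (intro A.integrable_const_bound[where B = "1 + r"]) auto
  qed
  have r: "0 \<le> r" using diff[of 0] by simp
  have "\<bar>(\<integral>y. \<Psi> y * h y \<partial>gamma_measure \<theta> al) - (\<integral>y. \<Psi>' y * h y \<partial>gamma_measure \<theta> al)\<bar>
      = \<bar>\<integral>y. \<Psi> y * h y - \<Psi>' y * h y \<partial>gamma_measure \<theta> al\<bar>"
    using int by simp
  also have "\<dots> \<le> (\<integral>y. \<bar>\<Psi> y * h y - \<Psi>' y * h y\<bar> \<partial>gamma_measure \<theta> al)"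
    by (rule integral_abs_bound)
  also have "\<dots> \<le> r"
  proof (rule A.integral_le_const)
    have "\<bar>\<Psi> y * h y - \<Psi>' y * h y\<bar> \<le> r" for y
      using mult_mono[OF diff[of y] h_le_1[of y]] h_pos[of y] r
      by (simp add: abs_mult left_diff_distrib[symmetric] less_imp_le)
    then show "AE y in gamma_measure \<theta> al. \<bar>\<Psi> y * h y - \<Psi>' y * h y\<bar> \<le> r" by simp
  qed (use int in simp)
  finally have 2: "\<bar>(\<integral>y. \<Psi> y * h y \<partial>gamma_measure \<theta> al) - (\<integral>y. \<Psi>' y * h y \<partial>gamma_measure \<theta> al)\<bar> \<le> r" .
  have 3: "\<bar>(\<integral>y. \<Psi>' y * h y \<partial>gamma_measure \<theta> al) - (\<integral>y. \<phi> y * h y \<partial>gamma_measure \<theta> be)\<bar> \<le> r"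
    unfolding \<Psi>'_def p_def q_def r_def ratio[symmetric] by (rule weight_step[OF be step(3) \<phi>])
  have 1: "\<bar>(\<integral>\<omega>. V n i k \<omega> * \<Psi> (T (grid n k) \<omega>) \<partial>M) - (\<integral>y. \<Psi> y * h y \<partial>gamma_measure \<theta> al)\<bar>
    \<le> prob {\<omega>\<in>space M. a < T (grid n i) \<omega>} + 2 * real_of_int (k - i) * r"
    unfolding al_def r_def by (rule step(2)) (use \<Psi> in auto)
  have "(\<integral>\<omega>. V n i (k + 1) \<omega> * \<phi> (T (grid n (k + 1)) \<omega>) \<partial>M) = (\<integral>\<omega>. V n i k \<omega> * \<Psi> (T (grid n k) \<omega>) \<partial>M)"
    unfolding V_step[OF step(1,3) \<phi>] D \<Psi>_def ..
  moreover have "2 * real_of_int (k + 1 - i) * r = 2 * real_of_int (k - i) * r + 2 * r"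
    by (simp add: algebra_simps)
  ultimately show ?case
    using 1 2 3 unfolding be_def[symmetric] r_def[symmetric] by linarith
qed

end

section \<open>From products along the grid to products over the range\<close>

lemma measurable_completion_AE:
  assumes g: "g \<in> measurable (completion M) N" and f: "\<And>x. x \<in> space M \<Longrightarrow> f x \<in> space N" and ae: "AE x in M. f x = g x"
  shows "f \<in> measurable (completion M) N"
proof (rule measurableI)
  show "f x \<in> space N" if "x \<in> space (completion M)" for x using f that by simp
  fix A assume A: "A \<in> sets N"
  have "AE x in completion M. f x = g x"
    using ae by (rule AE_completion)
  then have "AE x in completion M. x \<in> g -` A \<inter> space M \<longleftrightarrow> x \<in> f -` A \<inter> space M"
    by eventually_elim auto
  moreover have "g -` A \<inter> space M \<in> sets (completion M)"
    using measurable_sets[OF g A] by simp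
  ultimately have "f -` A \<inter> space M \<in> sets (completion M)"
    by (rule completion.in_sets_AE) simp
  then show "f -` A \<inter> space (completion M) \<in> sets (completion M)" by simp
qed

lemma borel_measurable_completion_AE_LIMSEQ:
  fixes u :: "nat \<Rightarrow> 'a \<Rightarrow> real"
  assumes u: "\<And>n. u n \<in> borel_measurable (completion M)" and lim: "AE x in M. (\<lambda>n. u n x) \<longlonglongrightarrow> f x"
  shows "f \<in> borel_measurable (completion M)"
proof -
  have "(\<lambda>x. lim (\<lambda>n. u n x)) \<in> borel_measurable (completion M)"
    using u by (rule borel_measurable_lim_metric)
  then show ?thesis
    by (rule measurable_completion_AE) (use lim in \<open>auto elim!: eventually_mono simp: limI\<close>)
qed

context gamma_weight
begin

lemma AE_window: "AE \<omega> in M. \<forall>\<^sub>F j in sequentially. T (2 powr (- real j)) \<omega> \<le> c \<and> d < T (2 powr real j) \<omega>"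
  if "c > 0"
  using AE_T_regular by eventually_elim (rule eventually_regular_path_window[OF _ that])

text \<open>The limits are taken in a fixed order. With \<open>j\<close> fixed, letting
  \<open>n\<close> tend to infinity removes the remainders accumulated between the times
  \<open>2 powr (- j)\<close> and \<open>2 powr j\<close>; then \<open>j\<close> tends to infinity,
  which removes the errors from the two ends of the path.\<close>

theorem probability_generating_functional:
  shows "(\<lambda>\<omega>. \<Prod>y\<in>process_range T \<omega> \<inter> {a<..b}. f y) \<in> borel_measurable (completion M)"
    and "(\<integral>\<omega>. (\<Prod>y\<in>process_range T \<omega> \<inter> {a<..b}. f y) \<partial>completion M) = h b"
proof -
  interpret C: prob_space "completion M" by (rule prob_space_completion)
  have [measurable]: "T (2 powr u) \<in> borel_measurable M" for u by (rule measurable_process) simp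
  define P where "P \<omega> = (\<Prod>y\<in>process_range T \<omega> \<inter> {a<..b}. f y)" for \<omega>
  \<comment> \<open>On this event all of \<open>{a<..b}\<close> is crossed between the times
    \<open>2 powr (- j)\<close> and \<open>2 powr j\<close>, so the grid product eventually equals
    the product over the range.\<close>
  define A where "A j = {\<omega>\<in>space M. T (2 powr (- real j)) \<omega> \<le> a \<and> b < T (2 powr real j) \<omega>}" for j :: nat
  define W where "W n j \<omega> = indicator (A j) \<omega> * V n (- int j * 2 ^ n) (int j * 2 ^ n) \<omega>" for n j \<omega>
  have [measurable]: "A j \<in> sets M" for j unfolding A_def by measurable
  have W_meas [measurable]: "W n j \<in> borel_measurable M" for n j unfolding W_def by measurable
  have P_bounds: "0 \<le> P \<omega>" "P \<omega> \<le> 1" for \<omega>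
    unfolding P_def using f_bounds by (auto intro!: prod_nonneg prod_le_1)
  have W_bounds: "0 \<le> W n j \<omega>" "W n j \<omega> \<le> 1" for n j \<omega>
    unfolding W_def using V_bounds by (auto simp: indicator_def)
  have grid_ends: "grid n (- int j * 2 ^ n) = 2 powr (- real j)" "grid n (int j * 2 ^ n) = 2 powr real j" for n j
    using grid_mult_power[of n "- int j"] grid_mult_power[of n "int j"] by simp_all
  have W_lim: "AE \<omega> in M. \<forall>j. (\<lambda>n. W n j \<omega>) \<longlonglongrightarrow> indicator (A j) \<omega> * P \<omega>"
    using AE_T_regular AE_locally_finite AE_space
  proof eventually_elim
    case (elim \<omega>)
    show ?case
    proof
      fix j
      have "\<forall>\<^sub>F n in sequentially. W n j \<omega> = indicator (A j) \<omega> * P \<omega>"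
        using eventually_grid_range_eq[OF elim(1,2) ab(1), of b]
      proof eventually_elim
        case (elim n)
        note eq = this
        show ?case
        proof (cases "\<omega> \<in> A j")
          case True
          have mono: "T (grid n u) \<omega> \<le> T (grid n v) \<omega>" if "u \<le> v" for u v
            using regular_pathD(1)[OF \<open>regular_path (\<lambda>s. T s \<omega>)\<close>, of "grid n u" "grid n v"] that by simp
          have "V n (- int j * 2 ^ n) (int j * 2 ^ n) \<omega>
            = (\<Prod>k\<in>{- int j * 2 ^ n..<int j * 2 ^ n}. if T (grid n (k + 1)) \<omega> = T (grid n k) \<omega> then 1 else f (T (grid n k) \<omega>))"
            by (simp add: V_def dT_def)
          also have "\<dots> = (\<Prod>y\<in>range (\<lambda>k. T (grid n k) \<omega>) \<inter> {a<..b}. f y)"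
          proof (rule prod_changes_window)
            show "- int j * 2 ^ n \<le> int j * 2 ^ n" by (rule order_trans[of _ 0]) auto
          qed (use mono f_outside True grid_ends in \<open>auto simp: A_def\<close>)
          also have "\<dots> = P \<omega>" by (simp add: P_def process_range_def eq)
          finally show ?thesis by (simp add: W_def)
        qed (simp add: W_def)
      qed
      then show "(\<lambda>n. W n j \<omega>) \<longlonglongrightarrow> indicator (A j) \<omega> * P \<omega>" by (rule tendsto_eventually)
    qed
  qed
  have Q_meas [measurable]: "(\<lambda>\<omega>. indicator (A j) \<omega> * P \<omega>) \<in> borel_measurable (completion M)" for j
    by (rule borel_measurable_completion_AE_LIMSEQ[of "\<lambda>n. W n j"])
      (use W_lim in \<open>auto intro: measurable_completion elim: AE_mp\<close>)
  have Q_lim: "AE \<omega> in M. (\<lambda>j. indicator (A j) \<omega> * P \<omega>) \<longlonglongrightarrow> P \<omega>"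
    using AE_window[OF ab(1), of b] AE_space
  proof eventually_elim
    case (elim \<omega>)
    have "\<forall>\<^sub>F j in sequentially. indicator (A j) \<omega> * P \<omega> = P \<omega>"
      using elim(1) by (rule eventually_mono) (use elim(2) in \<open>simp add: A_def\<close>)
    then show ?case by (rule tendsto_eventually)
  qed
  show P_meas: "P \<in> borel_measurable (completion M)"
    by (rule borel_measurable_completion_AE_LIMSEQ[OF Q_meas Q_lim])
  define e where "e j = prob {\<omega>\<in>space M. a < T (2 powr (- real j)) \<omega>}" for j :: nat
  define s where "s j = prob {\<omega>\<in>space M. b < T (2 powr real j) \<omega>}" for j :: nat
  define r where "r n = 2 ^ n * gamma_remainder \<theta> (grid n (- 1))" for n
  have W_est: "\<bar>(\<integral>\<omega>. W n j \<omega> \<partial>M) - h b * s j\<bar> \<le> 2 * e j + 4 * real j * r n" for n j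
  proof -
    let ?i = "- int j * 2 ^ n" and ?k = "int j * 2 ^ n"
    \<comment> \<open>Restricting to final values above \<open>b\<close> puts the test function
      where \<open>h\<close> has the constant value \<open>h b\<close>.\<close>
    define \<phi> where "\<phi> = (indicator {b<..} :: real \<Rightarrow> real)"
    have [measurable]: "\<phi> \<in> borel_measurable borel" by (simp add: \<phi>_def)
    have "(\<integral>y. \<phi> y * h y \<partial>gamma_measure \<theta> (l / grid n ?k)) = (\<integral>y. h b * \<phi> y \<partial>gamma_measure \<theta> (l / grid n ?k))"
    proof (rule Bochner_Integration.integral_cong[OF refl])
      show "\<phi> y * h y = h b * \<phi> y" for y
        using h_above[of y] by (cases "b < y") (simp_all add: \<phi>_def)
    qed
    also have "\<dots> = h b * (\<integral>\<omega>. \<phi> (T (grid n ?k) \<omega>) \<partial>M)"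
      unfolding distr_T[OF grid_pos, symmetric] by (subst integral_distr) auto
    also have "(\<integral>\<omega>. \<phi> (T (grid n ?k) \<omega>) \<partial>M) = (\<integral>\<omega>. indicator {\<omega>\<in>space M. b < T (2 powr real j) \<omega>} \<omega> \<partial>M)"
      by (intro Bochner_Integration.integral_cong) (auto simp: \<phi>_def indicator_def grid_ends)
    finally have 1: "(\<integral>y. \<phi> y * h y \<partial>gamma_measure \<theta> (l / grid n ?k)) = h b * s j"
      by (simp add: s_def)
    have 2: "\<bar>(\<integral>\<omega>. V n ?i ?k \<omega> * \<phi> (T (grid n ?k) \<omega>) \<partial>M) - h b * s j\<bar> \<le> e j + 4 * real j * r n"
    proof -
      have "?i \<le> ?k" by (rule order_trans[of _ 0]) auto
      then have "\<bar>(\<integral>\<omega>. V n ?i ?k \<omega> * \<phi> (T (grid n ?k) \<omega>) \<partial>M) - (\<integral>y. \<phi> y * h y \<partial>gamma_measure \<theta> (l / grid n ?k))\<bar>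
        \<le> prob {\<omega>\<in>space M. a < T (grid n ?i) \<omega>} + 2 * real_of_int (?k - ?i) * gamma_remainder \<theta> (grid n (- 1))"
        by (rule V_estimate) (auto simp: \<phi>_def indicator_def)
      also have "\<dots> = e j + 4 * real j * r n"
        unfolding grid_ends e_def r_def by simp
      finally show ?thesis by (simp only: 1)
    qed
    have int: "integrable M (\<lambda>\<omega>. V n ?i ?k \<omega> * \<phi> (T (grid n ?k) \<omega>))" "integrable M (W n j)"
      using V_bounds W_bounds
      by (auto intro!: integrable_const_bound[where B = 1] mult_le_one simp: abs_mult \<phi>_def indicator_def)
    have "\<bar>(\<integral>\<omega>. V n ?i ?k \<omega> * \<phi> (T (grid n ?k) \<omega>) \<partial>M) - (\<integral>\<omega>. W n j \<omega> \<partial>M)\<bar>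
      = \<bar>\<integral>\<omega>. V n ?i ?k \<omega> * \<phi> (T (grid n ?k) \<omega>) - W n j \<omega> \<partial>M\<bar>"
      using int by simp
    also have "\<dots> \<le> (\<integral>\<omega>. \<bar>V n ?i ?k \<omega> * \<phi> (T (grid n ?k) \<omega>) - W n j \<omega>\<bar> \<partial>M)"
      by (rule integral_abs_bound)
    also have "\<dots> \<le> (\<integral>\<omega>. indicator {\<omega>\<in>space M. a < T (2 powr (- real j)) \<omega>} \<omega> \<partial>M)"
    proof (rule integral_mono)
      show "integrable M (\<lambda>\<omega>. indicator {\<omega>\<in>space M. a < T (2 powr (- real j)) \<omega>} \<omega> :: real)"
        by (intro integrable_const_bound[where B = 1]) auto
      show "\<bar>V n ?i ?k \<omega> * \<phi> (T (grid n ?k) \<omega>) - W n j \<omega>\<bar> \<le> indicator {\<omega>\<in>space M. a < T (2 powr (- real j)) \<omega>} \<omega>"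
        if "\<omega> \<in> space M" for \<omega>
        unfolding W_def A_def \<phi>_def using that V_bounds[of n ?i ?k \<omega>] by (auto simp: indicator_def grid_ends)
    qed (use int in simp)
    also have "\<dots> = e j" by (simp add: e_def)
    finally show ?thesis using 2 by linarith
  qed
  have lim_n: "(\<lambda>n. \<integral>\<omega>. W n j \<omega> \<partial>M) \<longlonglongrightarrow> (\<integral>\<omega>. indicator (A j) \<omega> * P \<omega> \<partial>completion M)" for j
  proof -
    have "(\<lambda>n. \<integral>\<omega>. W n j \<omega> \<partial>completion M) \<longlonglongrightarrow> (\<integral>\<omega>. indicator (A j) \<omega> * P \<omega> \<partial>completion M)"
    proof (rule integral_dominated_convergence[where w = "\<lambda>_. 1"])
      show "AE \<omega> in completion M. (\<lambda>n. W n j \<omega>) \<longlonglongrightarrow> indicator (A j) \<omega> * P \<omega>"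
        using AE_completion[OF W_lim] by eventually_elim blast
    qed (use W_bounds in \<open>auto intro: measurable_completion\<close>)
    then show ?thesis by (simp add: integral_completion)
  qed
  have Q_est: "\<bar>(\<integral>\<omega>. indicator (A j) \<omega> * P \<omega> \<partial>completion M) - h b * s j\<bar> \<le> 2 * e j" for j
  proof (rule LIMSEQ_le)
    show "(\<lambda>n. \<bar>(\<integral>\<omega>. W n j \<omega> \<partial>M) - h b * s j\<bar>) \<longlonglongrightarrow> \<bar>(\<integral>\<omega>. indicator (A j) \<omega> * P \<omega> \<partial>completion M) - h b * s j\<bar>"
      by (intro tendsto_intros lim_n)
    have "(\<lambda>n. 2 * e j + 4 * real j * r n) \<longlonglongrightarrow> 2 * e j + 4 * real j * 0"
      unfolding r_def by (intro tendsto_intros tendsto_gamma_remainder \<theta>)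
    then show "(\<lambda>n. 2 * e j + 4 * real j * r n) \<longlonglongrightarrow> 2 * e j" by simp
  qed (use W_est in blast)
  have lim_Q: "(\<lambda>j. \<integral>\<omega>. indicator (A j) \<omega> * P \<omega> \<partial>completion M) \<longlonglongrightarrow> (\<integral>\<omega>. P \<omega> \<partial>completion M)"
  proof (rule integral_dominated_convergence[where w = "\<lambda>_. 1"])
    show "AE \<omega> in completion M. (\<lambda>j. indicator (A j) \<omega> * P \<omega>) \<longlonglongrightarrow> P \<omega>"
      by (rule AE_completion[OF Q_lim])
    show "AE \<omega> in completion M. norm (indicator (A j) \<omega> * P \<omega>) \<le> 1" for j
      using P_bounds by (auto simp: indicator_def)
  qed (use P_meas Q_meas in simp_all)
  have lim_s: "s \<longlonglongrightarrow> 1"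
  proof -
    have "(\<lambda>j. \<integral>\<omega>. indicator {\<omega>\<in>space M. b < T (2 powr real j) \<omega>} \<omega> \<partial>M) \<longlonglongrightarrow> (\<integral>\<omega>. 1 \<partial>M :: real)"
    proof (rule integral_dominated_convergence[where w = "\<lambda>_. 1"])
      show "AE \<omega> in M. (\<lambda>j. indicator {\<omega>\<in>space M. b < T (2 powr real j) \<omega>} \<omega> :: real) \<longlonglongrightarrow> 1"
        using AE_window[OF ab(1), of b] AE_space
        by eventually_elim (auto intro!: tendsto_eventually elim!: eventually_mono)
    qed (auto simp: indicator_def)
    then show ?thesis by (simp add: s_def[abs_def] prob_space)
  qed
  have lim_e: "e \<longlonglongrightarrow> 0"
  proof -
    have "(\<lambda>j. \<integral>\<omega>. indicator {\<omega>\<in>space M. a < T (2 powr (- real j)) \<omega>} \<omega> \<partial>M) \<longlonglongrightarrow> (\<integral>\<omega>. 0 \<partial>M :: real)"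
    proof (rule integral_dominated_convergence[where w = "\<lambda>_. 1"])
      show "AE \<omega> in M. (\<lambda>j. indicator {\<omega>\<in>space M. a < T (2 powr (- real j)) \<omega>} \<omega> :: real) \<longlonglongrightarrow> 0"
        using AE_window[OF ab(1), of b] AE_space
        by eventually_elim (auto intro!: tendsto_eventually elim!: eventually_mono)
    qed (auto simp: indicator_def)
    then show ?thesis by (simp add: e_def[abs_def])
  qed
  have "\<bar>(\<integral>\<omega>. P \<omega> \<partial>completion M) - h b * 1\<bar> \<le> 2 * 0"
  proof (rule LIMSEQ_le)
    show "(\<lambda>j. \<bar>(\<integral>\<omega>. indicator (A j) \<omega> * P \<omega> \<partial>completion M) - h b * s j\<bar>) \<longlonglongrightarrow> \<bar>(\<integral>\<omega>. P \<omega> \<partial>completion M) - h b * 1\<bar>"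
      by (intro tendsto_intros lim_Q lim_s)
    show "(\<lambda>j. 2 * e j) \<longlonglongrightarrow> 2 * 0" by (intro tendsto_intros lim_e)
  qed (use Q_est in blast)
  then show "(\<integral>\<omega>. P \<omega> \<partial>completion M) = h b" by simp
qed

end

section \<open>Poisson processes from their generating functionals\<close>

lemma integral_indicator_Collect:
  assumes "X = space N"
  shows "(\<integral>\<omega>. indicator {\<omega>\<in>X. P \<omega>} \<omega> \<partial>N) = measure N {\<omega>\<in>X. P \<omega>}"
proof -
  have "{\<omega>\<in>X. P \<omega>} \<inter> space N = {\<omega>\<in>X. P \<omega>}"
    using assms by (intro Int_absorb2) auto
  then show ?thesis
    using Bochner_Integration.integral_indicator[of N "{\<omega>\<in>X. P \<omega>}"] by (simp only:)
qed

definition poisson_mass :: "real \<Rightarrow> nat set \<Rightarrow> real" where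
  "poisson_mass m S = (\<Sum>k. indicator S k * (m ^ k / fact k * exp (- m)))"

lemma poisson_mass_sums: 
  assumes "m \<ge> 0"
  shows "(\<lambda>k. indicator S k * (m ^ k / fact k * exp (- m))) sums poisson_mass m S"
  unfolding poisson_mass_def
proof (rule summable_sums, rule summable_comparison_test)
  have "(\<lambda>k. m ^ k /\<^sub>R fact k) sums exp m" by (rule exp_converges)
  then show "summable (\<lambda>k. m ^ k / fact k * exp (- m))"
    by (intro summable_mult2) (auto simp: sums_iff divide_inverse mult.commute)
  show "\<exists>N. \<forall>k\<ge>N. norm (indicator S k * (m ^ k / fact k * exp (- m))) \<le> m ^ k / fact k * exp (- m)"
    using assms by (intro exI[of _ 0]) (auto simp: indicator_def)
qed

lemma poisson_mass_finite: "finite S \<Longrightarrow> poisson_mass m S = (\<Sum>k\<in>S. m ^ k / fact k * exp (- m))"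
  unfolding poisson_mass_def by (subst suminf_finite[of S]) (auto simp: indicator_def)

text \<open>The series is known to vanish on the unit interval only, so the first coefficient not
  yet treated is obtained as a limit at \<open>0\<close> from the right, after division by
  \<open>t ^ m\<close>.\<close>

lemma power_series_zero_imp:
  fixes d :: "nat \<Rightarrow> real"
  assumes d: "\<And>t. 0 \<le> t \<Longrightarrow> t \<le> 1 \<Longrightarrow> (\<lambda>k. d k * t ^ k) sums 0"
  shows "d k = 0"
proof (induction k rule: less_induct)
  case (less m)
  define g where "g t = (\<Sum>k. d (k + m) * t ^ k)" for t
  have summable: "summable (\<lambda>k. d (k + m) * t ^ k)" if "\<bar>t\<bar> < 1" for t
    by (rule powser_inside[of "\<lambda>k. d (k + m)" 1])
      (use d[of 1] that in \<open>auto simp: sums_iff intro: summable_ignore_initial_segment\<close>)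
  have g0: "g t = 0" if t: "0 < t" "t < 1" for t
  proof -
    have "(\<lambda>k. d (k + m) * t ^ (k + m)) sums (0 - (\<Sum>k<m. d k * t ^ k))"
      using d[of t] t by (intro sums_split_initial_segment) auto
    then have "(\<lambda>k. t ^ m * (d (k + m) * t ^ k)) sums 0"
      using less by (simp add: power_add mult_ac)
    moreover have "(\<lambda>k. t ^ m * (d (k + m) * t ^ k)) sums (t ^ m * g t)"
      unfolding g_def using t by (intro sums_mult summable_sums summable) auto
    ultimately have "t ^ m * g t = 0" by (rule sums_unique2[symmetric])
    with t show ?thesis by simp
  qed
  have "(g \<longlongrightarrow> d (0 + m)) (at 0)"
    by (rule powser_limit_0[of 1]) (auto simp: g_def intro: summable_sums summable)
  then have "(g \<longlongrightarrow> d m) (at_right 0)"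
    by (simp add: filterlim_at_split)
  moreover have "(g \<longlongrightarrow> 0) (at_right 0)"
    by (rule tendsto_eventually) (auto simp: eventually_at_right_field intro!: exI[of _ 1] g0)
  ultimately show ?case
    by (intro tendsto_unique[of "at_right (0::real)" g]) auto
qed

text \<open>The weight \<open>X\<close> stands for the other counts in a joint law, so that
  generating variables can be inverted one at a time. The inversion compares coefficients of
  \<open>t ^ k\<close>.\<close>

lemma (in prob_space) poisson_mass_of_generating_function:
  fixes c :: "'a \<Rightarrow> nat"
  assumes [measurable]: "X \<in> borel_measurable M" "c \<in> measurable M (count_space UNIV)"
    and X: "\<And>\<omega>. 0 \<le> X \<omega>" "\<And>\<omega>. X \<omega> \<le> 1" and m: "m \<ge> 0"
    and gf: "\<And>t. 0 \<le> t \<Longrightarrow> t \<le> 1 \<Longrightarrow> (\<integral>\<omega>. X \<omega> * t ^ c \<omega> \<partial>M) = B * exp (- (1 - t) * m)"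
  shows "(\<integral>\<omega>. X \<omega> * indicator S (c \<omega>) \<partial>M) = B * poisson_mass m S"
proof -
  define a where "a k = (\<integral>\<omega>. X \<omega> * indicator {k} (c \<omega>) \<partial>M)" for k
  have sums: "(\<lambda>k. w k * a k) sums (\<integral>\<omega>. X \<omega> * w (c \<omega>) \<partial>M)" if w: "\<And>k. \<bar>w k\<bar> \<le> 1" for w :: "nat \<Rightarrow> real"
  proof -
    have int: "integrable M (\<lambda>\<omega>. X \<omega> * indicator {k} (c \<omega>))" for k
      using X by (intro integrable_const_bound[where B = 1]) (auto simp: indicator_def)
    have pt: "(\<Sum>k<n. w k * (X \<omega> * indicator {k} (c \<omega>))) = X \<omega> * (if c \<omega> < n then w (c \<omega>) else 0)" for n \<omega>
    proof -
      have "(\<Sum>k<n. w k * (X \<omega> * indicator {k} (c \<omega>))) = (\<Sum>k<n. if k = c \<omega> then w k * X \<omega> else 0)"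
        by (intro sum.cong) (auto simp: indicator_def)
      then show ?thesis by (simp add: mult.commute)
    qed
    have eq: "(\<Sum>k<n. w k * a k) = (\<integral>\<omega>. X \<omega> * (if c \<omega> < n then w (c \<omega>) else 0) \<partial>M)" for n
      unfolding a_def pt[symmetric] using int by (subst Bochner_Integration.integral_sum) auto
    have "(\<lambda>n. \<integral>\<omega>. X \<omega> * (if c \<omega> < n then w (c \<omega>) else 0) \<partial>M) \<longlonglongrightarrow> (\<integral>\<omega>. X \<omega> * w (c \<omega>) \<partial>M)"
    proof (rule integral_dominated_convergence[where w = "\<lambda>_. 1"])
      show "AE \<omega> in M. (\<lambda>n. X \<omega> * (if c \<omega> < n then w (c \<omega>) else 0)) \<longlonglongrightarrow> X \<omega> * w (c \<omega>)"
      proof (rule AE_I2)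
        fix \<omega>
        have "\<forall>\<^sub>F n in sequentially. X \<omega> * (if c \<omega> < n then w (c \<omega>) else 0) = X \<omega> * w (c \<omega>)"
          using eventually_gt_at_top[of "c \<omega>"] by eventually_elim simp
        then show "(\<lambda>n. X \<omega> * (if c \<omega> < n then w (c \<omega>) else 0)) \<longlonglongrightarrow> X \<omega> * w (c \<omega>)"
          by (rule tendsto_eventually)
      qed
      have "\<bar>X \<omega> * (if c \<omega> < n then w (c \<omega>) else 0)\<bar> \<le> 1" for n \<omega>
        unfolding abs_mult using X[of \<omega>] w[of "c \<omega>"] by (auto intro!: mult_le_one)
      then show "AE \<omega> in M. norm (X \<omega> * (if c \<omega> < n then w (c \<omega>) else 0)) \<le> 1" for n by simp
    qed auto
    then show ?thesis by (simp add: sums_def eq)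
  qed
  have "a k - B * (m ^ k / fact k * exp (- m)) = 0" for k
  proof (rule power_series_zero_imp)
    fix t :: real assume t: "0 \<le> t" "t \<le> 1"
    have "(\<lambda>k. t ^ k * a k) sums (B * exp (- (1 - t) * m))"
      using sums[of "\<lambda>k. t ^ k"] t gf[OF t] by (simp add: power_le_one)
    moreover have "(\<lambda>k. B * exp (- m) * ((t * m) ^ k /\<^sub>R fact k)) sums (B * exp (- m) * exp (t * m))"
      by (intro sums_mult exp_converges)
    moreover have "B * exp (- m) * exp (t * m) = B * exp (- (1 - t) * m)"
      by (simp add: exp_add[symmetric] algebra_simps)
    ultimately have "(\<lambda>k. t ^ k * a k - B * exp (- m) * ((t * m) ^ k /\<^sub>R fact k)) sums 0"
      using sums_diff by fastforce
    then show "(\<lambda>k. (a k - B * (m ^ k / fact k * exp (- m))) * t ^ k) sums 0"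
      by (simp add: algebra_simps power_mult_distrib divide_inverse)
  qed
  then have a: "a k = B * (m ^ k / fact k * exp (- m))" for k by (metis eq_iff_diff_eq_0)
  have "(\<lambda>k. indicator S k * a k) sums (\<integral>\<omega>. X \<omega> * indicator S (c \<omega>) \<partial>M)"
    by (rule sums) (simp add: indicator_def)
  moreover have "(\<lambda>k. B * (indicator S k * (m ^ k / fact k * exp (- m)))) sums (B * poisson_mass m S)"
    by (intro sums_mult poisson_mass_sums m)
  then have "(\<lambda>k. indicator S k * a k) sums (B * poisson_mass m S)"
    by (simp add: a mult_ac)
  ultimately show ?thesis by (rule sums_unique2)
qed

lemma sets_scale_invariant_intensity: "A \<in> sets (scale_invariant_intensity \<theta>) \<longleftrightarrow> A \<in> sets borel \<and> A \<subseteq> {0<..}"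
  by (auto simp: scale_invariant_intensity_def sets_restrict_space_iff)

lemma space_scale_invariant_intensity: "space (scale_invariant_intensity \<theta>) = {0<..}"
  by (simp add: scale_invariant_intensity_def space_restrict_space)

lemma emeasure_scale_invariant_intensity:
  assumes "A \<in> sets borel" "A \<subseteq> {0<..}"
  shows "emeasure (scale_invariant_intensity \<theta>) A = (\<integral>\<^sup>+x. ennreal (\<theta> / x) * indicator A x \<partial>lborel)"
proof -
  have "emeasure (scale_invariant_intensity \<theta>) A = (\<integral>\<^sup>+x. ennreal (\<theta> / x) * indicator A x \<partial>restrict_space lborel {0<..})"
    unfolding scale_invariant_intensity_def
    by (rule emeasure_density) (use assms in \<open>auto simp: sets_restrict_space_iff intro!: measurable_restrict_space1\<close>)
  also have "\<dots> = (\<integral>\<^sup>+x. ennreal (\<theta> / x) * indicator A x * indicator {0<..} x \<partial>lborel)"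
    by (rule nn_integral_restrict_space) simp
  also have "\<dots> = (\<integral>\<^sup>+x. ennreal (\<theta> / x) * indicator A x \<partial>lborel)"
    by (intro nn_integral_cong) (use assms in \<open>auto simp: indicator_def\<close>)
  finally show ?thesis .
qed

text \<open>The Poisson property is derived from the generating functionals of the random set alone,
  so the process is left behind here.\<close>

locale generating_functional = prob_space M for M :: "'a measure" +
  fixes \<Xi> :: "'a \<Rightarrow> real set" and \<theta> :: real
  assumes \<theta>: "\<theta> > 0"
    and AE_subset: "AE \<omega> in M. \<Xi> \<omega> \<subseteq> {0<..}"
    and AE_finite: "AE \<omega> in M. \<forall>a>0. \<forall>b. finite (\<Xi> \<omega> \<inter> {a<..b})"
    and functional: "\<And>a b f. 0 < a \<Longrightarrow> a < b \<Longrightarrow> f \<in> borel_measurable borel \<Longrightarrow> (\<And>x. 0 \<le> f x) \<Longrightarrow> (\<And>x. f x \<le> 1) \<Longrightarrow>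
        (\<And>x. x \<notin> {a<..b} \<Longrightarrow> f x = 1) \<Longrightarrow>
        (\<lambda>\<omega>. \<Prod>y\<in>\<Xi> \<omega> \<inter> {a<..b}. f y) \<in> borel_measurable (completion M) \<and>
        (\<integral>\<omega>. (\<Prod>y\<in>\<Xi> \<omega> \<inter> {a<..b}. f y) \<partial>completion M) = exp (- (LBINT x:{a<..b}. \<theta> * (1 - f x) / x))"
begin

sublocale C: prob_space "completion M" by (rule prob_space_completion)

definition cnt :: "real set \<Rightarrow> 'a \<Rightarrow> nat" where
  "cnt A \<omega> = card (\<Xi> \<omega> \<inter> A)"

definition intensity :: "real set \<Rightarrow> real" where
  "intensity A = (LBINT x:A. \<theta> / x)"

lemma AE_finite_subset:
  assumes "0 < a" "A \<subseteq> {a<..b}"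
  shows "AE \<omega> in completion M. finite (\<Xi> \<omega> \<inter> A)"
  using AE_completion[OF AE_finite]
proof eventually_elim
  case (elim \<omega>)
  then have "finite (\<Xi> \<omega> \<inter> {a<..b})" using assms by blast
  then show ?case by (rule finite_subset[rotated]) (use assms in auto)
qed

lemma set_integrable_intensity:
  assumes "0 < a" "A \<in> sets borel" "A \<subseteq> {a<..b}"
  shows "set_integrable lborel A (\<lambda>x. \<theta> / x)"
  unfolding set_integrable_def
proof (rule Bochner_Integration.integrable_bound[OF integrable_real_indicator[of "{a..b}" lborel, OF _ emeasure_lborel_Icc_finite, THEN integrable_mult_right, of "\<theta> / a"]])
  show "(\<lambda>x. indicat_real A x *\<^sub>R (\<theta> / x)) \<in> borel_measurable lborel" using assms by simp
  have "\<theta> / x \<le> \<theta> / a" if "x \<in> A" for x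
    using assms that \<theta> by (intro divide_left_mono) auto
  then show "AE x in lborel. norm (indicat_real A x *\<^sub>R (\<theta> / x)) \<le> norm (\<theta> / a * indicat_real {a..b} x)"
    using assms \<theta> by (intro AE_I2) (force simp: indicator_def)
qed simp

lemma intensity_nonneg: "A \<subseteq> {0<..} \<Longrightarrow> 0 \<le> intensity A"
  unfolding intensity_def set_lebesgue_integral_def using \<theta>
  by (intro Bochner_Integration.integral_nonneg) (auto simp: indicator_def)

lemma emeasure_eq_intensity:
  assumes "0 < a" "A \<in> sets borel" "A \<subseteq> {a<..b}"
  shows "emeasure (scale_invariant_intensity \<theta>) A = ennreal (intensity A)"
proof -
  have "emeasure (scale_invariant_intensity \<theta>) A = (\<integral>\<^sup>+x. ennreal (indicator A x * (\<theta> / x)) \<partial>lborel)"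
    using assms by (subst emeasure_scale_invariant_intensity) (auto intro!: nn_integral_cong simp: indicator_def)
  also have "\<dots> = ennreal (intensity A)"
    unfolding intensity_def set_lebesgue_integral_def
    using set_integrable_intensity[OF assms] assms \<theta>
    by (subst nn_integral_eq_integral) (auto simp: set_integrable_def indicator_def intro!: AE_I2 divide_nonneg_nonneg less_imp_le)
  finally show ?thesis .
qed

context
  fixes a b :: real and n :: nat and A :: "nat \<Rightarrow> real set"
  assumes ab: "0 < a" "a < b" and A: "\<And>i. i < n \<Longrightarrow> A i \<in> sets borel" "\<And>i. i < n \<Longrightarrow> A i \<subseteq> {a<..b}"
    and disj: "disjoint_family_on A {..<n}"
begin

text \<open>By disjointness at most one factor differs from \<open>1\<close>. The product of this
  function over the points is therefore the joint generating function of the counts.\<close>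

definition mix :: "(nat \<Rightarrow> real) \<Rightarrow> real \<Rightarrow> real" where
  "mix z y = (\<Prod>i<n. if y \<in> A i then z i else 1)"

lemma mix_measurable [measurable]: "mix z \<in> borel_measurable borel"
  unfolding mix_def
proof (intro borel_measurable_prod)
  fix i assume "i \<in> {..<n}"
  then have [measurable]: "A i \<in> sets borel" using A by simp
  show "(\<lambda>y. if y \<in> A i then z i else 1) \<in> borel_measurable borel" by measurable
qed

lemma mix_eq: "j < n \<Longrightarrow> y \<in> A j \<Longrightarrow> mix z y = z j"
proof -
  assume j: "j < n" "y \<in> A j"
  have "y \<notin> A i" if "i < n" "i \<noteq> j" for i
    using disj j that by (auto simp: disjoint_family_on_def)
  then have "mix z y = (\<Prod>i<n. if i = j then z j else 1)"
    unfolding mix_def using j by (intro prod.cong) auto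
  then show ?thesis using j by simp
qed

lemma mix_outside: "(\<And>i. i < n \<Longrightarrow> y \<notin> A i) \<Longrightarrow> mix z y = 1"
  unfolding mix_def by (intro prod.neutral) auto

lemma prod_mix:
  assumes fin: "finite (\<Xi> \<omega> \<inter> {a<..b})"
  shows "(\<Prod>y\<in>\<Xi> \<omega> \<inter> {a<..b}. mix z y) = (\<Prod>i<n. z i ^ cnt (A i) \<omega>)"
proof -
  have "(\<Prod>y\<in>\<Xi> \<omega> \<inter> {a<..b}. mix z y) = (\<Prod>i<n. \<Prod>y\<in>\<Xi> \<omega> \<inter> {a<..b}. if y \<in> A i then z i else 1)"
    unfolding mix_def by (rule prod.swap)
  also have "\<dots> = (\<Prod>i<n. z i ^ cnt (A i) \<omega>)"
  proof (rule prod.cong[OF refl])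
    fix i assume i: "i \<in> {..<n}"
    have "(\<Prod>y\<in>\<Xi> \<omega> \<inter> {a<..b}. if y \<in> A i then z i else 1) = (\<Prod>y\<in>\<Xi> \<omega> \<inter> {a<..b} \<inter> A i. z i)"
      by (rule prod.inter_restrict[OF fin, symmetric])
    also have "\<Xi> \<omega> \<inter> {a<..b} \<inter> A i = \<Xi> \<omega> \<inter> A i" using A(2)[of i] i by auto
    finally show "(\<Prod>y\<in>\<Xi> \<omega> \<inter> {a<..b}. if y \<in> A i then z i else 1) = z i ^ cnt (A i) \<omega>"
      by (simp add: cnt_def)
  qed
  finally show ?thesis .
qed

lemma joint_generating_function:
  assumes z: "\<And>i. 0 \<le> z i" "\<And>i. z i \<le> 1"
  shows "(\<lambda>\<omega>. \<Prod>i<n. z i ^ cnt (A i) \<omega>) \<in> borel_measurable (completion M)"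
    and "(\<integral>\<omega>. (\<Prod>i<n. z i ^ cnt (A i) \<omega>) \<partial>completion M) = (\<Prod>i<n. exp (- (1 - z i) * intensity (A i)))"
proof -
  have mix: "0 \<le> mix z y" "mix z y \<le> 1" for y
    unfolding mix_def using z by (auto intro!: prod_nonneg prod_le_1)
  have out: "mix z y = 1" if "y \<notin> {a<..b}" for y
    using A(2) that by (intro mix_outside) blast
  note F = functional[OF ab mix_measurable mix out]
  have ae: "AE \<omega> in completion M. (\<Prod>i<n. z i ^ cnt (A i) \<omega>) = (\<Prod>y\<in>\<Xi> \<omega> \<inter> {a<..b}. mix z y)"
    using AE_finite_subset[OF ab(1) order_refl] by eventually_elim (rule prod_mix[symmetric])
  show meas: "(\<lambda>\<omega>. \<Prod>i<n. z i ^ cnt (A i) \<omega>) \<in> borel_measurable (completion M)"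
    by (rule measurable_completion_AE[OF F[THEN conjunct1]]) (use ae in \<open>auto simp: AE_completion_iff\<close>)
  have "(\<integral>\<omega>. (\<Prod>i<n. z i ^ cnt (A i) \<omega>) \<partial>completion M) = exp (- (LBINT x:{a<..b}. \<theta> * (1 - mix z x) / x))"
    using integral_cong_AE[OF meas F[THEN conjunct1] ae] F[THEN conjunct2] by simp
  also have "(LBINT x:{a<..b}. \<theta> * (1 - mix z x) / x) = (\<integral>x. (\<Sum>i<n. (1 - z i) * (indicator (A i) x * (\<theta> / x))) \<partial>lborel)"
    unfolding set_lebesgue_integral_def
  proof (intro Bochner_Integration.integral_cong refl)
    fix x
    show "indicator {a<..b} x *\<^sub>R (\<theta> * (1 - mix z x) / x) = (\<Sum>i<n. (1 - z i) * (indicator (A i) x * (\<theta> / x)))"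
    proof (cases "\<exists>j<n. x \<in> A j")
      case True
      then obtain j where j: "j < n" "x \<in> A j" by blast
      have "x \<notin> A i" if "i < n" "i \<noteq> j" for i
        using disj j that by (auto simp: disjoint_family_on_def)
      then have "(\<Sum>i<n. (1 - z i) * (indicator (A i) x * (\<theta> / x))) = (\<Sum>i<n. if i = j then (1 - z j) * (\<theta> / x) else 0)"
        using j by (intro sum.cong) auto
      moreover have "x \<in> {a<..b}" using A(2) j by blast
      ultimately show ?thesis using j by (simp add: mix_eq)
    next
      case False
      then have "mix z x = 1" by (intro mix_outside) blast
      moreover have "(\<Sum>i<n. (1 - z i) * (indicator (A i) x * (\<theta> / x))) = 0"
        using False by (intro sum.neutral) auto
      ultimately show ?thesis by simp
    qed
  qed
  also have "\<dots> = (\<Sum>i<n. (\<integral>x. (1 - z i) * (indicator (A i) x * (\<theta> / x)) \<partial>lborel))"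
  proof (rule Bochner_Integration.integral_sum, rule integrable_mult_right)
    fix i assume "i \<in> {..<n}"
    then show "integrable lborel (\<lambda>x. indicator (A i) x * (\<theta> / x))"
      using set_integrable_intensity[OF ab(1) A(1) A(2), of i] by (simp add: set_integrable_def)
  qed
  also have "\<dots> = (\<Sum>i<n. (1 - z i) * intensity (A i))"
    by (simp only: integral_mult_right_zero intensity_def set_lebesgue_integral_def real_scaleR_def)
  also have "exp (- \<dots>) = (\<Prod>i<n. exp (- (1 - z i) * intensity (A i)))"
    by (simp only: sum_negf[symmetric] exp_sum[OF finite_lessThan] mult_minus_left)
  finally show "(\<integral>\<omega>. (\<Prod>i<n. z i ^ cnt (A i) \<omega>) \<partial>completion M) = (\<Prod>i<n. exp (- (1 - z i) * intensity (A i)))" .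
qed

text \<open>Measurability is known for generating functions, and \<open>k\<close> can be recovered
  from \<open>(1 / 2) ^ k\<close>.\<close>

lemma measurable_cnt_family:
  assumes j: "j < n"
  shows "cnt (A j) \<in> measurable (completion M) (count_space UNIV)"
proof -
  define z where "z i = (if i = j then 1 / 2 else 1 :: real)" for i
  have "(\<Prod>i<n. z i ^ cnt (A i) \<omega>) = (\<Prod>i<n. if i = j then (1 / 2) ^ cnt (A j) \<omega> else 1)" for \<omega>
    by (intro prod.cong) (auto simp: z_def)
  then have eq: "(\<Prod>i<n. z i ^ cnt (A i) \<omega>) = (1 / 2) ^ cnt (A j) \<omega>" for \<omega>
    using j by simp
  have [measurable]: "(\<lambda>\<omega>. (1 / 2 :: real) ^ cnt (A j) \<omega>) \<in> borel_measurable (completion M)"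
    using joint_generating_function(1)[of z] by (simp add: eq) (simp add: z_def)
  have half: "(1 / 2 :: real) ^ i = (1 / 2) ^ k \<longleftrightarrow> i = k" for i k
    by (simp add: power_divide)
  have "cnt (A j) -` {k} \<inter> space (completion M) \<in> sets (completion M)" for k
  proof -
    have "cnt (A j) -` {k} \<inter> space (completion M) = {\<omega>\<in>space (completion M). (1 / 2 :: real) ^ cnt (A j) \<omega> = (1 / 2) ^ k}"
      unfolding half by auto
    also have "\<dots> \<in> sets (completion M)" by measurable
    finally show ?thesis .
  qed
  then show ?thesis by (intro measurable_count_space_eq2_countable[THEN iffD2]) auto
qed

text \<open>Going from \<open>j\<close> to \<open>j + 1\<close> trades the generating variable of
  \<open>A j\<close> for the event that its count lies in \<open>S j\<close>;
  \<open>joint_generating_function\<close> is the case \<open>j = 0\<close> and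
  \<open>joint_law\<close> the case \<open>j = n\<close>.\<close>

lemma joint_law_aux:
  assumes "j \<le> n" and z: "\<And>i. 0 \<le> z i" "\<And>i. z i \<le> 1"
  shows "(\<integral>\<omega>. (\<Prod>i<j. indicator (S i) (cnt (A i) \<omega>)) * (\<Prod>i=j..<n. z i ^ cnt (A i) \<omega>) \<partial>completion M)
    = (\<Prod>i<j. poisson_mass (intensity (A i)) (S i)) * (\<Prod>i=j..<n. exp (- (1 - z i) * intensity (A i)))"
  using assms
proof (induction j arbitrary: z)
  case 0
  then show ?case using joint_generating_function(2)[of z] by (simp add: atLeast0LessThan)
next
  case (Suc j)
  then have j: "j < n" by simp
  note [measurable] = measurable_cnt_family
  define X where "X \<omega> = (\<Prod>i<j. indicator (S i) (cnt (A i) \<omega>)) * (\<Prod>i=Suc j..<n. z i ^ cnt (A i) \<omega>)" for \<omega>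
  define B where "B = (\<Prod>i<j. poisson_mass (intensity (A i)) (S i)) * (\<Prod>i=Suc j..<n. exp (- (1 - z i) * intensity (A i)))"
  have "(\<integral>\<omega>. X \<omega> * indicator (S j) (cnt (A j) \<omega>) \<partial>completion M) = B * poisson_mass (intensity (A j)) (S j)"
  proof (rule C.poisson_mass_of_generating_function)
    have cnt_meas: "(\<lambda>\<omega>. g (cnt (A i) \<omega>)) \<in> borel_measurable (completion M)" if "i < n" for i and g :: "nat \<Rightarrow> real"
      using measurable_compose[OF measurable_cnt_family[OF that], of g borel] by simp
    show "X \<in> borel_measurable (completion M)"
      unfolding X_def using j
      by (intro borel_measurable_times borel_measurable_prod cnt_meas) auto
    show "cnt (A j) \<in> measurable (completion M) (count_space UNIV)" by (rule measurable_cnt_family[OF j])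
    show "0 \<le> X \<omega>" "X \<omega> \<le> 1" for \<omega>
      unfolding X_def using Suc.prems
      by (auto intro!: mult_nonneg_nonneg prod_nonneg mult_le_one prod_le_1 power_le_one)
    show "0 \<le> intensity (A j)" using A(2)[OF j] ab by (intro intensity_nonneg) auto
    fix t :: real assume t: "0 \<le> t" "t \<le> 1"
    have split: "{j..<n} = insert j {Suc j..<n}" using j by auto
    have "(\<integral>\<omega>. (\<Prod>i<j. indicator (S i) (cnt (A i) \<omega>)) * (\<Prod>i=j..<n. (z(j := t)) i ^ cnt (A i) \<omega>) \<partial>completion M)
      = (\<Prod>i<j. poisson_mass (intensity (A i)) (S i)) * (\<Prod>i=j..<n. exp (- (1 - (z(j := t)) i) * intensity (A i)))"
      by (rule Suc.IH) (use Suc.prems t in auto)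
    also have "(\<Prod>i=j..<n. exp (- (1 - (z(j := t)) i) * intensity (A i)))
        = exp (- (1 - t) * intensity (A j)) * (\<Prod>i=Suc j..<n. exp (- (1 - z i) * intensity (A i)))"
      unfolding split by simp
    also have "(\<lambda>\<omega>. (\<Prod>i<j. indicator (S i) (cnt (A i) \<omega>)) * (\<Prod>i=j..<n. (z(j := t)) i ^ cnt (A i) \<omega>))
        = (\<lambda>\<omega>. X \<omega> * t ^ cnt (A j) \<omega>)"
      unfolding split X_def by (simp add: fun_eq_iff mult_ac)
    finally show "(\<integral>\<omega>. X \<omega> * t ^ cnt (A j) \<omega> \<partial>completion M) = B * exp (- (1 - t) * intensity (A j))"
      by (simp add: B_def mult_ac)
  qed
  moreover have "X \<omega> * indicator (S j) (cnt (A j) \<omega>)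
      = (\<Prod>i<Suc j. indicator (S i) (cnt (A i) \<omega>)) * (\<Prod>i=Suc j..<n. z i ^ cnt (A i) \<omega>)" for \<omega>
    by (simp add: X_def mult_ac)
  moreover have "B * poisson_mass (intensity (A j)) (S j)
      = (\<Prod>i<Suc j. poisson_mass (intensity (A i)) (S i)) * (\<Prod>i=Suc j..<n. exp (- (1 - z i) * intensity (A i)))"
    by (simp add: B_def mult_ac)
  ultimately show ?case by (simp only:)
qed

lemma joint_law:
  "C.prob {\<omega>\<in>space M. \<forall>i<n. cnt (A i) \<omega> \<in> S i} = (\<Prod>i<n. poisson_mass (intensity (A i)) (S i))"
proof -
  define E where "E = {\<omega>\<in>space M. \<forall>i<n. cnt (A i) \<omega> \<in> S i}"
  have "C.prob E = (\<integral>\<omega>. indicator E \<omega> \<partial>completion M)"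
    unfolding E_def by (rule integral_indicator_Collect[symmetric]) simp
  also have "\<dots> = (\<integral>\<omega>. (\<Prod>i<n. indicator (S i) (cnt (A i) \<omega>)) \<partial>completion M)"
  proof (rule Bochner_Integration.integral_cong[OF refl])
    fix \<omega> assume \<omega>: "\<omega> \<in> space (completion M)"
    show "indicator E \<omega> = (\<Prod>i<n. indicator (S i) (cnt (A i) \<omega>) :: real)"
    proof (cases "\<omega> \<in> E")
      case True
      then have "(\<Prod>i<n. indicator (S i) (cnt (A i) \<omega>) :: real) = 1"
        by (intro prod.neutral) (simp add: E_def)
      with True show ?thesis by simp
    next
      case False
      then obtain i where "i < n" "cnt (A i) \<omega> \<notin> S i" using \<omega> by (auto simp: E_def)
      then have "(\<Prod>i<n. indicator (S i) (cnt (A i) \<omega>) :: real) = 0"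
        by (intro prod_zero) (auto intro!: bexI[of _ i])
      with False show ?thesis by simp
    qed
  qed
  also have "\<dots> = (\<Prod>i<n. poisson_mass (intensity (A i)) (S i))"
    using joint_law_aux[of n "\<lambda>_. 1" S, OF order_refl zero_le_one order_refl]
    by (simp only: atLeastLessThan_empty[OF order_refl] prod.empty mult_1_right)
  finally show ?thesis by (simp only: E_def)
qed

end

end

text \<open>If the supremum is \<open>k\<close>, it is attained and kept; otherwise the sequence
  avoids \<open>k\<close> or passes it for good. This gives pointwise convergence of the indicators
  of \<open>c m = k\<close>.\<close>

lemma eventually_eq_SUP_nat:
  fixes c :: "nat \<Rightarrow> nat"
  assumes "incseq c"
  shows "\<forall>\<^sub>F m in sequentially. c m = k \<longleftrightarrow> (SUP m. of_nat (c m) :: ennreal) = of_nat k"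
proof (cases "(SUP m. of_nat (c m) :: ennreal) = of_nat k")
  case True
  have le: "c m \<le> k" for m
    using SUP_upper[of m UNIV "\<lambda>m. of_nat (c m) :: ennreal"] True by simp
  have "\<exists>m0. k \<le> c m0"
  proof (rule ccontr)
    assume "\<not> ?thesis"
    then have less: "c m \<le> k - 1" "k > 0" for m by (auto simp: not_le dest: spec[of _ m])
    then have "(SUP m. of_nat (c m) :: ennreal) \<le> of_nat (k - 1)" by (intro SUP_least) simp
    with True less show False by simp
  qed
  then obtain m0 where "k \<le> c m0" by blast
  then have "c m = k" if "m \<ge> m0" for m
    using le[of m] incseqD[OF assms that] by simp
  then show ?thesis
    using True by (auto simp: eventually_sequentially)
next
  case False
  have "\<exists>m1. \<forall>m\<ge>m1. c m \<noteq> k"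
  proof (cases "\<exists>m0. c m0 = k")
    case True
    then obtain m0 where m0: "c m0 = k" by blast
    have "\<exists>m1\<ge>m0. c m1 \<noteq> k"
    proof (rule ccontr)
      assume "\<not> ?thesis"
      then have const: "c m = k" if "m \<ge> m0" for m using that by blast
      have "c m \<le> k" for m
        using const[of "max m m0"] incseqD[OF assms, of m "max m m0"] by simp
      then have "(SUP m. of_nat (c m) :: ennreal) \<le> of_nat k" by (intro SUP_least) simp
      moreover have "of_nat k \<le> (SUP m. of_nat (c m) :: ennreal)"
        using SUP_upper[of m0 UNIV "\<lambda>m. of_nat (c m) :: ennreal"] m0 by simp
      ultimately show False using False by simp
    qed
    then obtain m1 where m1: "m1 \<ge> m0" "c m1 \<noteq> k" by blast
    then have "k < c m1" using incseqD[OF assms m1(1)] m0 by simp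
    then have "k < c m" if "m \<ge> m1" for m using incseqD[OF assms that] by simp
    then show ?thesis by blast
  qed blast
  then show ?thesis using False by (simp add: eventually_sequentially)
qed

text \<open>Open rays are closed upwards, which suits counts that grow with the window.
  \<open>UNIV\<close> is included because the criterion for independence wants the whole space in
  the generator.\<close>

lemma sets_borel_ennreal_greaterThan: "sets (borel :: ennreal measure) = sigma_sets UNIV (range greaterThan \<union> {UNIV})"
proof
  have "sets (borel :: ennreal measure) = sigma_sets UNIV (range greaterThan)"
    by (subst borel_Ioi) simp
  also have "\<dots> \<subseteq> sigma_sets UNIV (range greaterThan \<union> {UNIV})"
    by (rule sigma_sets_mono') auto
  finally show "sets (borel :: ennreal measure) \<subseteq> sigma_sets UNIV (range greaterThan \<union> {UNIV})" .
  show "sigma_sets UNIV (range greaterThan \<union> {UNIV}) \<subseteq> sets (borel :: ennreal measure)"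
  proof -
    have "range greaterThan \<union> {UNIV} \<subseteq> sets (borel :: ennreal measure)" by auto
    from sets.sigma_sets_subset[OF this] show ?thesis by simp
  qed
qed

section \<open>Counts in arbitrary Borel sets by exhaustion with windows\<close>

context generating_functional
begin

text \<open>The \<open>+ 1\<close> makes the window for \<open>m = 0\<close> nondegenerate, as
  \<open>functional\<close> requires \<open>a < b\<close>.\<close>

definition window :: "nat \<Rightarrow> real set" where
  "window m = {inverse (real (Suc m))<..real (Suc m) + 1}"

lemma window_bounds: "0 < inverse (real (Suc m))" "inverse (real (Suc m)) < real (Suc m) + 1"
proof -
  have "inverse (real (Suc m)) \<le> 1" by (simp add: field_simps)
  then show "inverse (real (Suc m)) < real (Suc m) + 1" by simp
qed simp

lemma window_mono:
  assumes "m \<le> m'"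
  shows "window m \<subseteq> window m'"
proof
  have *: "inverse (real (Suc m')) \<le> inverse (real (Suc m))"
    using assms by (intro le_imp_inverse_le) auto
  fix x assume x: "x \<in> window m"
  have "inverse (real (Suc m')) < x"
    by (rule le_less_trans[OF *]) (use x in \<open>simp add: window_def\<close>)
  then show "x \<in> window m'" using x assms by (simp add: window_def)
qed

lemma UN_window: "(\<Union>m. window m) = {0<..}"
proof safe
  fix x :: real assume "x > 0"
  obtain m1 where m1: "inverse (real (Suc m1)) < x" using reals_Archimedean[OF \<open>x > 0\<close>] by blast
  obtain m2 :: nat where m2: "x \<le> real m2" using real_arch_simple by blast
  have "inverse (real (Suc (m1 + m2))) \<le> inverse (real (Suc m1))" by (intro le_imp_inverse_le) auto
  then have "inverse (real (Suc (m1 + m2))) < x" using m1 by (rule le_less_trans)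
  then have "x \<in> window (m1 + m2)" using m2 by (simp add: window_def)
  then show "x \<in> (\<Union>m. window m)" by blast
next
  fix x m assume "x \<in> window m"
  then show "0 < x" using less_trans[OF window_bounds(1)[of m]] by (simp add: window_def)
qed

lemma window_sets [measurable]: "window m \<in> sets borel"
  by (simp add: window_def)

lemma AE_point_count_window:
  "AE \<omega> in completion M. \<forall>m A. point_count \<Xi> (A \<inter> window m) \<omega> = of_nat (cnt (A \<inter> window m) \<omega>)"
  using AE_completion[OF AE_finite]
proof eventually_elim
  case (elim \<omega>)
  have "finite (\<Xi> \<omega> \<inter> (A \<inter> window m))" for A m
    by (rule finite_subset[of _ "\<Xi> \<omega> \<inter> window m"]) (use elim window_bounds in \<open>auto simp: window_def\<close>)
  then show ?case by (auto simp: point_count_def cnt_def)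
qed

lemma measurable_cnt_window:
  assumes "A \<in> sets borel"
  shows "cnt (A \<inter> window m) \<in> measurable (completion M) (count_space UNIV)"
  using measurable_cnt_family[OF window_bounds, of 1 "\<lambda>_. A \<inter> window m" m 0] assms
  by (auto simp: disjoint_family_on_def window_def)

lemma measurable_point_count_window:
  assumes "A \<in> sets borel"
  shows "point_count \<Xi> (A \<inter> window m) \<in> borel_measurable (completion M)"
proof (rule measurable_completion_AE)
  show "(\<lambda>\<omega>. of_nat (cnt (A \<inter> window m) \<omega>)) \<in> borel_measurable (completion M)"
    using measurable_compose[OF measurable_cnt_window[OF assms], of "\<lambda>k. of_nat k" borel] by simp
qed (use AE_point_count_window in \<open>auto simp: AE_completion_iff elim!: eventually_mono\<close>)

lemma point_count_SUP:
  assumes "A \<subseteq> {0<..}"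
  shows "point_count \<Xi> A \<omega> = (SUP m. point_count \<Xi> (A \<inter> window m) \<omega>)"
proof -
  have "(SUP m. emeasure (count_space UNIV) (\<Xi> \<omega> \<inter> (A \<inter> window m))) = emeasure (count_space UNIV) (\<Union>m. \<Xi> \<omega> \<inter> (A \<inter> window m))"
    by (rule SUP_emeasure_incseq) (use window_mono in \<open>auto simp: incseq_def\<close>)
  also have "(\<Union>m. \<Xi> \<omega> \<inter> (A \<inter> window m)) = \<Xi> \<omega> \<inter> A"
    using UN_window assms by blast
  finally show ?thesis by (simp add: point_count_def)
qed

lemma measurable_point_count:
  assumes "A \<in> sets borel" "A \<subseteq> {0<..}"
  shows "point_count \<Xi> A \<in> borel_measurable (completion M)"
proof -
  have "(\<lambda>\<omega>. SUP m. point_count \<Xi> (A \<inter> window m) \<omega>) \<in> borel_measurable (completion M)"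
    by (intro borel_measurable_SUP measurable_point_count_window assms) simp
  then show ?thesis by (simp add: point_count_SUP[OF assms(2)] cong: measurable_cong)
qed

lemma joint_law_window:
  fixes n :: nat
  assumes A: "\<And>i. i < n \<Longrightarrow> A i \<in> sets borel" and disj: "disjoint_family_on A {..<n}"
  shows "C.prob {\<omega>\<in>space M. \<forall>i<n. cnt (A i \<inter> window m) \<omega> \<in> S i} = (\<Prod>i<n. poisson_mass (intensity (A i \<inter> window m)) (S i))"
proof (rule joint_law[OF window_bounds[of m], where n = n and A = "\<lambda>i. A i \<inter> window m" and S = S])
  show "A i \<inter> window m \<in> sets borel" if "i < n" for i using A[OF that] by simp
  show "A i \<inter> window m \<subseteq> {inverse (real (Suc m))<..real (Suc m) + 1}" for i by (auto simp: window_def)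
  show "disjoint_family_on (\<lambda>i. A i \<inter> window m) {..<n}"
    using disj unfolding disjoint_family_on_def by blast
qed

lemma law_window:
  assumes "A \<in> sets borel"
  shows "C.prob {\<omega>\<in>space M. cnt (A \<inter> window m) \<omega> \<in> S} = poisson_mass (intensity (A \<inter> window m)) S"
  using joint_law_window[of 1 "\<lambda>_. A" m "\<lambda>_. S"] assms by (simp add: disjoint_family_on_def)

lemma emeasure_window_SUP:
  assumes "A \<in> sets borel" "A \<subseteq> {0<..}"
  shows "(\<lambda>m. ennreal (intensity (A \<inter> window m))) \<longlonglongrightarrow> emeasure (scale_invariant_intensity \<theta>) A"
proof -
  have "(\<lambda>m. emeasure (scale_invariant_intensity \<theta>) (A \<inter> window m)) \<longlonglongrightarrow> emeasure (scale_invariant_intensity \<theta>) (\<Union>m. A \<inter> window m)"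
  proof (rule Lim_emeasure_incseq)
    show "incseq (\<lambda>m. A \<inter> window m)" unfolding incseq_def using window_mono by blast
  qed (use assms in \<open>auto simp: sets_scale_invariant_intensity\<close>)
  moreover have "emeasure (scale_invariant_intensity \<theta>) (A \<inter> window m) = ennreal (intensity (A \<inter> window m))" for m
    by (rule emeasure_eq_intensity[OF window_bounds(1)[of m]]) (use assms in \<open>auto simp: window_def\<close>)
  moreover have "(\<Union>m. A \<inter> window m) = A" using UN_window assms by blast
  ultimately show ?thesis by simp
qed

text \<open>Counts over growing windows increase to the count of \<open>A\<close>, so the indicators
  of the events converge pointwise. Sets of infinite intensity are covered: there both the terms'
  limit and the probability are \<open>0\<close>.\<close>

lemma prob_point_count_lim:
  assumes A: "A \<in> sets borel" "A \<subseteq> {0<..}"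
  shows "(\<lambda>m. intensity (A \<inter> window m) ^ k / fact k * exp (- intensity (A \<inter> window m)))
    \<longlonglongrightarrow> C.prob {\<omega>\<in>space M. point_count \<Xi> A \<omega> = of_nat k}"
proof -
  define E where "E = {\<omega>\<in>space M. point_count \<Xi> A \<omega> = of_nat k}"
  define F where "F m = {\<omega>\<in>space M. cnt (A \<inter> window m) \<omega> \<in> {k}}" for m
  have [measurable]: "point_count \<Xi> A \<in> borel_measurable (completion M)" by (rule measurable_point_count[OF A])
  have "E = {\<omega>\<in>space (completion M). point_count \<Xi> A \<omega> = of_nat k}" by (simp add: E_def)
  also have "\<dots> \<in> sets (completion M)" by measurable
  finally have E: "E \<in> sets (completion M)" .
  have "F m = cnt (A \<inter> window m) -` {k} \<inter> space (completion M)" for m by (auto simp: F_def)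
  then have F: "F m \<in> sets (completion M)" for m
    using measurable_sets[OF measurable_cnt_window[OF A(1), of m], of "{k}"] by simp
  have "(\<lambda>m. \<integral>\<omega>. indicator (F m) \<omega> \<partial>completion M :: real) \<longlonglongrightarrow> (\<integral>\<omega>. indicator E \<omega> \<partial>completion M)"
  proof (rule integral_dominated_convergence[where w = "\<lambda>_. 1"])
    show "AE \<omega> in completion M. (\<lambda>m. indicator (F m) \<omega> :: real) \<longlonglongrightarrow> indicator E \<omega>"
      using AE_point_count_window AE_space AE_completion[OF AE_finite]
    proof eventually_elim
      case (elim \<omega>)
      have "finite (\<Xi> \<omega> \<inter> (A \<inter> window m))" for m
        by (rule finite_subset[of _ "\<Xi> \<omega> \<inter> window m"]) (use elim(3) window_bounds in \<open>auto simp: window_def\<close>)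
      then have "incseq (\<lambda>m. cnt (A \<inter> window m) \<omega>)"
        using window_mono unfolding incseq_def cnt_def by (intro allI impI card_mono) auto
      from eventually_eq_SUP_nat[OF this, of k]
      have "\<forall>\<^sub>F m in sequentially. indicator (F m) \<omega> = (indicator E \<omega> :: real)"
      proof eventually_elim
        case (elim m)
        have "point_count \<Xi> A \<omega> = (SUP m. of_nat (cnt (A \<inter> window m) \<omega>))"
          using \<open>\<forall>m A. point_count \<Xi> (A \<inter> window m) \<omega> = of_nat (cnt (A \<inter> window m) \<omega>)\<close>
          by (simp add: point_count_SUP[OF A(2)])
        with elim show ?case by (simp add: F_def E_def indicator_def)
      qed
      then show ?case by (rule tendsto_eventually)
    qed
  qed (use E F in auto)
  moreover have "(\<integral>\<omega>. indicator (F m) \<omega> \<partial>completion M :: real) = intensity (A \<inter> window m) ^ k / fact k * exp (- intensity (A \<inter> window m))" for m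
  proof -
    have "(\<integral>\<omega>. indicator (F m) \<omega> \<partial>completion M :: real) = C.prob (F m)"
      unfolding F_def by (rule integral_indicator_Collect) simp
    also have "\<dots> = poisson_mass (intensity (A \<inter> window m)) {k}"
      unfolding F_def by (rule law_window[OF A(1)])
    finally show ?thesis by (simp add: poisson_mass_finite)
  qed
  moreover have "(\<integral>\<omega>. indicator E \<omega> \<partial>completion M :: real) = C.prob E"
    unfolding E_def by (rule integral_indicator_Collect) simp
  ultimately show ?thesis by (simp add: E_def)
qed

text \<open>For upward closed \<open>B i\<close> the events grow with the window, and whether a
  supremum lies in an open ray is decided at a finite stage.\<close>

lemma prob_joint_upward:
  fixes n :: nat
  assumes A: "\<And>i. i < n \<Longrightarrow> A i \<in> sets borel" "\<And>i. i < n \<Longrightarrow> A i \<subseteq> {0<..}" and disj: "disjoint_family_on A {..<n}"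
    and B: "\<And>i. i < n \<Longrightarrow> B i \<in> range greaterThan \<union> {UNIV}"
  shows "(\<lambda>m. \<Prod>i<n. poisson_mass (intensity (A i \<inter> window m)) {k. of_nat k \<in> B i})
    \<longlonglongrightarrow> C.prob {\<omega>\<in>space M. \<forall>i<n. point_count \<Xi> (A i) \<omega> \<in> B i}"
proof -
  define F where "F m = {\<omega>\<in>space M. \<forall>i<n. point_count \<Xi> (A i \<inter> window m) \<omega> \<in> B i}" for m
  have B_cases: "B i = UNIV \<or> (\<exists>x. B i = {x<..})" if "i < n" for i
    using B[OF that] by (simp add: image_iff)
  have B_borel: "B i \<in> sets borel" if "i < n" for i
    using B_cases[OF that] by (elim disjE exE) simp_all
  have up: "y \<in> B i" if "i < n" "x \<in> B i" "x \<le> y" for i x y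
    using B_cases[OF that(1)] that(2,3) by (elim disjE exE) (simp_all add: less_le_trans)
  have F_sets: "F m \<in> sets (completion M)" for m
  proof -
    have "F m = {\<omega>\<in>space (completion M). \<forall>i\<in>{..<n}. point_count \<Xi> (A i \<inter> window m) \<omega> \<in> B i}" by (auto simp: F_def)
    also have "\<dots> \<in> sets (completion M)"
      by (intro sets.sets_Collect_finite_All predE pred_sets2[OF B_borel] measurable_point_count_window A) auto
    finally show ?thesis .
  qed
  have prob_eq: "C.prob (F m) = C.prob {\<omega>\<in>space M. \<forall>i<n. cnt (A i \<inter> window m) \<omega> \<in> {k. of_nat k \<in> B i}}" for m
  proof (rule C.finite_measure_eq_AE)
    show "AE \<omega> in completion M. \<omega> \<in> F m \<longleftrightarrow> \<omega> \<in> {\<omega>\<in>space M. \<forall>i<n. cnt (A i \<inter> window m) \<omega> \<in> {k. of_nat k \<in> B i}}"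
      using AE_point_count_window by eventually_elim (simp add: F_def)
    have "{\<omega>\<in>space M. \<forall>i<n. cnt (A i \<inter> window m) \<omega> \<in> {k. of_nat k \<in> B i}}
      = {\<omega>\<in>space (completion M). \<forall>i\<in>{..<n}. cnt (A i \<inter> window m) \<omega> \<in> {k. of_nat k \<in> B i}}" by auto
    also have "\<dots> \<in> sets (completion M)"
      by (intro sets.sets_Collect_finite_All predE pred_sets2[OF _ measurable_cnt_window] A) auto
    finally show "{\<omega>\<in>space M. \<forall>i<n. cnt (A i \<inter> window m) \<omega> \<in> {k. of_nat k \<in> B i}} \<in> sets (completion M)" .
  qed (rule F_sets)
  have eq: "C.prob (F m) = (\<Prod>i<n. poisson_mass (intensity (A i \<inter> window m)) {k. of_nat k \<in> B i})" for m
    unfolding prob_eq by (rule joint_law_window[OF A(1) disj])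
  have pc_mono: "point_count \<Xi> (A i \<inter> window m) \<omega> \<le> point_count \<Xi> (A i \<inter> window m') \<omega>" if "m \<le> m'" for m m' i \<omega>
    unfolding point_count_def using window_mono[OF that] by (intro emeasure_mono) auto
  have "(\<lambda>m. C.prob (F m)) \<longlonglongrightarrow> C.prob (\<Union>m. F m)"
  proof (rule C.finite_Lim_measure_incseq)
    show "range F \<subseteq> sets (completion M)" using F_sets by auto
    show "incseq F" unfolding incseq_def F_def using up pc_mono by blast
  qed
  also have "(\<Union>m. F m) = {\<omega>\<in>space M. \<forall>i<n. point_count \<Xi> (A i) \<omega> \<in> B i}"
  proof safe
    fix m \<omega> i assume "\<omega> \<in> F m" "i < n"
    moreover have "point_count \<Xi> (A i \<inter> window m) \<omega> \<le> point_count \<Xi> (A i) \<omega>"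
      unfolding point_count_def by (intro emeasure_mono) auto
    ultimately show "point_count \<Xi> (A i) \<omega> \<in> B i" using up by (auto simp: F_def)
  next
    fix \<omega> assume \<omega>: "\<omega> \<in> space M" "\<forall>i<n. point_count \<Xi> (A i) \<omega> \<in> B i"
    have "\<exists>m. point_count \<Xi> (A i \<inter> window m) \<omega> \<in> B i" if "i < n" for i
      using B_cases[OF that] \<omega>(2)[rule_format, OF that]
      by (elim disjE exE) (simp_all add: point_count_SUP[OF A(2)[OF that]] less_SUP_iff)
    then obtain g where g: "\<And>i. i < n \<Longrightarrow> point_count \<Xi> (A i \<inter> window (g i)) \<omega> \<in> B i" by metis
    define G where "G = Max (g ` {..<n} \<union> {0})"
    have "point_count \<Xi> (A i \<inter> window G) \<omega> \<in> B i" if "i < n" for i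
    proof (rule up[OF that g[OF that] pc_mono])
      show "g i \<le> G" unfolding G_def using that by (intro Max_ge) auto
    qed
    then have "\<omega> \<in> F G" using \<omega>(1) by (simp add: F_def)
    then show "\<omega> \<in> (\<Union>m. F m)" by blast
  qed (simp_all add: F_def)
  finally show ?thesis unfolding eq .
qed

text \<open>The joint probability and the product of the marginal ones are limits of the same
  products over windows.\<close>

lemma indep_point_counts:
  fixes n :: nat
  assumes A: "\<And>i. i < n \<Longrightarrow> A i \<in> sets borel" "\<And>i. i < n \<Longrightarrow> A i \<subseteq> {0<..}" and disj: "disjoint_family_on A {..<n}"
  shows "C.indep_vars (\<lambda>_. borel) (\<lambda>i. point_count \<Xi> (A i)) {..<n}"
proof (cases "n = 0")
  case True
  then show ?thesis by (simp add: C.indep_vars_def C.indep_sets_def)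
next
  case False
  show ?thesis
  proof (subst C.indep_vars_finite[where E = "\<lambda>_. range greaterThan \<union> {UNIV}"])
    show "Int_stable (range greaterThan \<union> {UNIV :: ennreal set})"
    proof (rule Int_stableI)
      fix X Y :: "ennreal set" assume XY: "X \<in> range greaterThan \<union> {UNIV}" "Y \<in> range greaterThan \<union> {UNIV}"
      have "{x<..} \<inter> {y<..} = {max x y<..}" for x y :: ennreal by auto
      then have "{x<..} \<inter> {y<..} \<in> range greaterThan" for x y :: ennreal by (metis rangeI)
      with XY show "X \<inter> Y \<in> range greaterThan \<union> {UNIV}" by (elim UnE imageE) simp_all
    qed
    show "\<forall>B\<in>{..<n} \<rightarrow> range greaterThan \<union> {UNIV}.
      C.prob (\<Inter>j\<in>{..<n}. point_count \<Xi> (A j) -` B j \<inter> space (completion M)) =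
      (\<Prod>j\<in>{..<n}. C.prob (point_count \<Xi> (A j) -` B j \<inter> space (completion M)))"
    proof
      fix B assume B: "B \<in> {..<n} \<rightarrow> range greaterThan \<union> {UNIV :: ennreal set}"
      have "(\<lambda>m. \<Prod>i<n. poisson_mass (intensity (A i \<inter> window m)) {k. of_nat k \<in> B i})
        \<longlonglongrightarrow> (\<Prod>i<n. C.prob {\<omega>\<in>space M. point_count \<Xi> (A i) \<omega> \<in> B i})"
      proof (rule tendsto_prod)
        fix i assume i: "i \<in> {..<n}"
        show "(\<lambda>m. poisson_mass (intensity (A i \<inter> window m)) {k. of_nat k \<in> B i}) \<longlonglongrightarrow> C.prob {\<omega>\<in>space M. point_count \<Xi> (A i) \<omega> \<in> B i}"
          using prob_joint_upward[of 1 "\<lambda>_. A i" "\<lambda>_. B i"] A i Pi_mem[OF B i]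
          by (simp add: disjoint_family_on_def)
      qed
      moreover have "(\<lambda>m. \<Prod>i<n. poisson_mass (intensity (A i \<inter> window m)) {k. of_nat k \<in> B i})
        \<longlonglongrightarrow> C.prob {\<omega>\<in>space M. \<forall>i<n. point_count \<Xi> (A i) \<omega> \<in> B i}"
        by (rule prob_joint_upward) (use A disj B in auto)
      ultimately have "C.prob {\<omega>\<in>space M. \<forall>i<n. point_count \<Xi> (A i) \<omega> \<in> B i} = (\<Prod>i<n. C.prob {\<omega>\<in>space M. point_count \<Xi> (A i) \<omega> \<in> B i})"
        by (rule LIMSEQ_unique[rotated])
      moreover have "(\<Inter>j\<in>{..<n}. point_count \<Xi> (A j) -` B j \<inter> space (completion M)) = {\<omega>\<in>space M. \<forall>i<n. point_count \<Xi> (A i) \<omega> \<in> B i}"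
        using False by auto
      moreover have "point_count \<Xi> (A j) -` B j \<inter> space (completion M) = {\<omega>\<in>space M. point_count \<Xi> (A j) \<omega> \<in> B j}" for j
        by auto
      ultimately show "C.prob (\<Inter>j\<in>{..<n}. point_count \<Xi> (A j) -` B j \<inter> space (completion M)) =
        (\<Prod>j\<in>{..<n}. C.prob (point_count \<Xi> (A j) -` B j \<inter> space (completion M)))"
        by (simp only:)
    qed
  qed (use False A sets_borel_ennreal_greaterThan measurable_point_count in auto)
qed

theorem scale_invariant_poisson_process: "scale_invariant_poisson_process M \<theta> \<Xi>"
  unfolding scale_invariant_poisson_process_def poisson_point_process_def
  unfolding sets_scale_invariant_intensity space_scale_invariant_intensity
proof (intro conjI ballI allI impI)
  show "AE \<omega> in M. \<Xi> \<omega> \<subseteq> {0<..} \<and> countable (\<Xi> \<omega>)"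
    using AE_subset AE_finite
  proof eventually_elim
    case (elim \<omega>)
    have "finite (\<Xi> \<omega> \<inter> window m)" for m
      using elim(2) window_bounds(1)[of m] unfolding window_def by blast
    then have "countable (\<Union>m. \<Xi> \<omega> \<inter> window m)"
      by (intro countable_UN) (auto intro: countable_finite)
    moreover have "(\<Union>m. \<Xi> \<omega> \<inter> window m) = \<Xi> \<omega>" using UN_window elim(1) by blast
    ultimately show ?case using elim(1) by simp
  qed
next
  fix A assume "A \<in> sets (scale_invariant_intensity \<theta>)"
  then have A: "A \<in> sets borel" "A \<subseteq> {0<..}" by (auto simp: sets_scale_invariant_intensity)
  show "point_count \<Xi> A \<in> borel_measurable (completion M)" by (rule measurable_point_count[OF A])
  let ?I = "\<lambda>m. intensity (A \<inter> window m)"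
  have nonneg: "0 \<le> ?I m" for m using A by (intro intensity_nonneg) auto
  {
    assume fin: "emeasure (scale_invariant_intensity \<theta>) A < \<infinity>"
    fix k :: nat
    have "emeasure (scale_invariant_intensity \<theta>) A = ennreal (measure (scale_invariant_intensity \<theta>) A)"
      using fin by (intro emeasure_eq_ennreal_measure) auto
    then have lim: "?I \<longlonglongrightarrow> measure (scale_invariant_intensity \<theta>) A"
      using emeasure_window_SUP[OF A] nonneg by (simp add: tendsto_ennreal_iff)
    have "(\<lambda>m. ?I m ^ k / fact k * exp (- ?I m)) \<longlonglongrightarrow>
      measure (scale_invariant_intensity \<theta>) A ^ k / fact k * exp (- measure (scale_invariant_intensity \<theta>) A)"
      by (intro tendsto_intros lim) simp
    then show "C.prob {\<omega>\<in>space M. point_count \<Xi> A \<omega> = of_nat k}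
      = measure (scale_invariant_intensity \<theta>) A ^ k / fact k * exp (- measure (scale_invariant_intensity \<theta>) A)"
      using prob_point_count_lim[OF A, of k] by (rule LIMSEQ_unique[rotated])
  }
  {
    \<comment> \<open>The intensities of the windows tend to infinity, so each Poisson probability
      tends to \<open>0\<close> and the count almost surely equals no natural number.\<close>
    assume inf: "emeasure (scale_invariant_intensity \<theta>) A = \<infinity>"
    have lim: "filterlim ?I at_top sequentially"
      unfolding filterlim_at_top_dense
    proof
      fix Z :: real
      have "\<forall>\<^sub>F m in sequentially. ennreal (max Z 0) < ennreal (?I m)"
        using emeasure_window_SUP[OF A] unfolding inf by (rule order_tendstoD(1)) simp
      then show "\<forall>\<^sub>F m in sequentially. Z < ?I m"
      proof eventually_elim
        case (elim m)
        then have "max Z 0 < ?I m" by (subst (asm) ennreal_less_iff) auto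
        then show ?case by simp
      qed
    qed
    have zero: "C.prob {\<omega>\<in>space M. point_count \<Xi> A \<omega> = of_nat k} = 0" for k
    proof -
      have "((\<lambda>x::real. x ^ k / fact k * exp (- x)) \<longlongrightarrow> 0) at_top"
        by real_asymp
      from filterlim_compose[OF this lim]
      show ?thesis using prob_point_count_lim[OF A, of k] by (rule LIMSEQ_unique[rotated])
    qed
    have [measurable]: "point_count \<Xi> A \<in> borel_measurable (completion M)" by (rule measurable_point_count[OF A])
    have "AE \<omega> in completion M. point_count \<Xi> A \<omega> \<noteq> of_nat k" for k
    proof -
      have "{\<omega>\<in>space (completion M). point_count \<Xi> A \<omega> = of_nat k} \<in> sets (completion M)" by measurable
      then show ?thesis
        using zero[of k] by (subst (asm) C.prob_eq_0) auto
    qed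
    then have "AE \<omega> in completion M. \<forall>k. point_count \<Xi> A \<omega> \<noteq> of_nat k"
      by (simp add: AE_all_countable)
    then have "AE \<omega> in completion M. point_count \<Xi> A \<omega> = \<infinity>"
    proof eventually_elim
      case (elim \<omega>)
      then show ?case by (cases "finite (\<Xi> \<omega> \<inter> A)") (auto simp: point_count_def)
    qed
    then show "AE \<omega> in M. point_count \<Xi> A \<omega> = \<infinity>" by (simp add: AE_completion_iff)
  }
next
  fix n and A :: "nat \<Rightarrow> real set"
  assume "(\<forall>i<n. A i \<in> sets borel \<and> A i \<subseteq> {0<..}) \<and> disjoint_family_on A {..<n}"
  then show "C.indep_vars (\<lambda>_. borel) (\<lambda>i. point_count \<Xi> (A i)) {..<n}"
    by (intro indep_point_counts) auto
qed

end

theorem (in gamma_ssa) range_poisson: "scale_invariant_poisson_process M \<theta> (process_range T)"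
proof -
  interpret generating_functional M "process_range T" \<theta>
  proof
    show "AE \<omega> in M. process_range T \<omega> \<subseteq> {0<..}"
      using AE_T_regular by eventually_elim (auto simp: process_range_def regular_path_def)
    show "AE \<omega> in M. \<forall>a>0. \<forall>b. finite (process_range T \<omega> \<inter> {a<..b})"
      using AE_locally_finite by eventually_elim (simp add: locally_finite_range_def process_range_def)
    fix a b :: real and f :: "real \<Rightarrow> real"
    assume "0 < a" "a < b" "f \<in> borel_measurable borel" "\<And>x. 0 \<le> f x" "\<And>x. f x \<le> 1" "\<And>x. x \<notin> {a<..b} \<Longrightarrow> f x = 1"
    then interpret gamma_weight M T \<theta> l a b f
      by unfold_locales (auto intro: shape)
    show "(\<lambda>\<omega>. \<Prod>y\<in>process_range T \<omega> \<inter> {a<..b}. f y) \<in> borel_measurable (completion M) \<and>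
        (\<integral>\<omega>. (\<Prod>y\<in>process_range T \<omega> \<inter> {a<..b}. f y) \<partial>completion M) = exp (- (LBINT x:{a<..b}. \<theta> * (1 - f x) / x))"
      using probability_generating_functional by (simp add: h_def)
  qed (rule shape)
  show ?thesis by (rule scale_invariant_poisson_process)
qed

section \<open>Counting along the grid\<close>

text \<open>Enumerating the integers turns the count into a series, which can be measured and
  integrated term by term.\<close>

lemma emeasure_count_int:
  "emeasure (count_space UNIV) {k::int. P k} = (\<Sum>i. indicator {k. P k} (int_decode i))"
proof -
  have "emeasure (count_space UNIV) {k. P k} = (\<integral>\<^sup>+k. indicator {k. P k} k \<partial>count_space UNIV)"
    by simp
  also have "\<dots> = (\<integral>\<^sup>+i. indicator {k. P k} (int_decode i) \<partial>count_space UNIV)"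
    by (rule nn_integral_bij_count_space[OF bij_int_decode, symmetric])
  finally show ?thesis
    by (simp add: nn_integral_count_space_nat)
qed

lemma emeasure_count_int_Ioc: "emeasure (count_space UNIV) {k::int. u < real_of_int k \<and> real_of_int k \<le> u + real m} = of_nat m"
proof -
  have "{k::int. u < real_of_int k \<and> real_of_int k \<le> u + real m} = {\<lfloor>u\<rfloor><..\<lfloor>u\<rfloor> + int m}"
    by (auto; linarith)
  then show ?thesis by simp
qed

text \<open>In base \<open>2\<close> logarithms the condition places \<open>k / 2 ^ (l + m)\<close>
  in a half-open interval of length \<open>1 / 2 ^ l\<close>, which contains exactly
  \<open>2 ^ m\<close> lattice points wherever it starts. That the answer is free of
  \<open>y\<close> is what makes the counting useful.\<close>

lemma emeasure_count_grid:
  assumes y: "y > 0"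
  shows "emeasure (count_space UNIV) {k. 1 < grid (l + m) k * y \<and> grid (l + m) k * y \<le> grid l 1} = 2 ^ m"
proof -
  have "{k. 1 < grid (l + m) k * y \<and> grid (l + m) k * y \<le> grid l 1}
    = {k. - (2 ^ (l + m) * log 2 y) < real_of_int k \<and> real_of_int k \<le> - (2 ^ (l + m) * log 2 y) + real (2 ^ m)}"
  proof (rule Collect_cong)
    fix k
    have eq: "grid (l + m) k * y = 2 powr (real_of_int k / 2 ^ (l + m) + log 2 y)"
      using y by (simp add: grid_def powr_add)
    have "1 < grid (l + m) k * y \<longleftrightarrow> 0 < real_of_int k / 2 ^ (l + m) + log 2 y"
      unfolding eq using powr_less_cancel_iff[of 2 0 "real_of_int k / 2 ^ (l + m) + log 2 y"] by simp
    moreover have "grid (l + m) k * y \<le> grid l 1 \<longleftrightarrow> real_of_int k / 2 ^ (l + m) + log 2 y \<le> 1 / 2 ^ l"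
      unfolding eq by (simp add: grid_def)
    moreover have "0 < real_of_int k / 2 ^ (l + m) + log 2 y \<longleftrightarrow> - (2 ^ (l + m) * log 2 y) < real_of_int k"
      by (auto simp: field_simps)
    moreover have "real_of_int k / 2 ^ (l + m) + log 2 y \<le> 1 / 2 ^ l \<longleftrightarrow> real_of_int k \<le> - (2 ^ (l + m) * log 2 y) + real (2 ^ m)"
    proof -
      have e: "1 / 2 ^ l = (2 ^ m :: real) / 2 ^ (l + m)" by (simp add: power_add)
      have "real_of_int k / 2 ^ (l + m) + log 2 y = (real_of_int k + 2 ^ (l + m) * log 2 y) / 2 ^ (l + m)"
        by (simp add: add_divide_distrib)
      then show ?thesis unfolding e by (simp only: divide_le_cancel) auto
    qed
    ultimately show "1 < grid (l + m) k * y \<and> grid (l + m) k * y \<le> grid l 1 \<longleftrightarrow>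
      - (2 ^ (l + m) * log 2 y) < real_of_int k \<and> real_of_int k \<le> - (2 ^ (l + m) * log 2 y) + real (2 ^ m)"
      by simp
  qed
  then show ?thesis by (simp only: emeasure_count_int_Ioc) simp
qed

context nondecreasing_ssa
begin

definition future :: "nat \<Rightarrow> int \<Rightarrow> 'a \<Rightarrow> nat \<Rightarrow> real" where
  "future n k \<omega> j = T (grid n (k + int j)) \<omega>"

definition scaled_future :: "nat \<Rightarrow> int \<Rightarrow> 'a \<Rightarrow> nat \<Rightarrow> real" where
  "scaled_future n k \<omega> j = grid n k * T (grid n (int j)) \<omega>"

lemma measurable_future [measurable]: "future n k \<in> measurable M (PiM UNIV (\<lambda>_. borel))"
  unfolding future_def[abs_def] by (rule measurable_PiM_single') auto

lemma measurable_scaled_future [measurable]: "scaled_future n k \<in> measurable M (PiM UNIV (\<lambda>_. borel))"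
  unfolding scaled_future_def[abs_def] by (rule measurable_PiM_single') auto

text \<open>Self-similarity speaks of finitely many times; cylinder sets carry it over to whole
  sequences.\<close>

lemma distr_future: "distr M (PiM UNIV (\<lambda>_. borel)) (future n k) = distr M (PiM UNIV (\<lambda>_. borel)) (scaled_future n k)"
proof (rule measure_eqI_PiM_infinite)
  fix J :: "nat set" and A :: "nat \<Rightarrow> real set"
  assume J: "finite J" and A: "\<And>i. i \<in> J \<Longrightarrow> A i \<in> sets borel"
  define E where "E = prod_emb UNIV (\<lambda>_. borel) J (Pi\<^sub>E J A)"
  have E: "E \<in> sets (PiM UNIV (\<lambda>_. borel))"
    unfolding E_def using J A by (intro sets_PiM_I) auto
  have mem: "x \<in> E \<longleftrightarrow> (\<forall>j\<in>J. x j \<in> A j)" for x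
    unfolding E_def prod_emb_def by (auto simp: PiE_iff)
  define Js where "Js = (\<lambda>j. grid n (int j)) ` J"
  define F where "F x = (\<forall>j\<in>J. x (grid n (int j)) \<in> A j)" for x :: "real \<Rightarrow> real"
  have F: "F \<in> measurable (PiM Js (\<lambda>_. borel)) (count_space UNIV)"
    unfolding F_def
    by (intro pred_intros_finite J pred_sets2[OF A] measurable_component_singleton) (auto simp: Js_def)
  have "distr M (count_space UNIV) (\<lambda>\<omega>. F (\<lambda>s\<in>Js. T (grid n k * s) \<omega>)) = distr M (count_space UNIV) (\<lambda>\<omega>. F (\<lambda>s\<in>Js. grid n k * T s \<omega>))"
    by (rule distr_scaled[OF _ _ _ F]) (use J in \<open>auto simp: Js_def\<close>)
  moreover have "F (\<lambda>s\<in>Js. T (grid n k * s) \<omega>) \<longleftrightarrow> future n k \<omega> \<in> E" for \<omega>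
    by (auto simp: F_def mem Js_def future_def grid_add)
  moreover have "F (\<lambda>s\<in>Js. grid n k * T s \<omega>) \<longleftrightarrow> scaled_future n k \<omega> \<in> E" for \<omega>
    by (auto simp: F_def mem Js_def scaled_future_def)
  ultimately have "distr M (count_space UNIV) (\<lambda>\<omega>. future n k \<omega> \<in> E) = distr M (count_space UNIV) (\<lambda>\<omega>. scaled_future n k \<omega> \<in> E)"
    by simp
  then have "emeasure (distr M (count_space UNIV) (\<lambda>\<omega>. future n k \<omega> \<in> E)) {True} = emeasure (distr M (count_space UNIV) (\<lambda>\<omega>. scaled_future n k \<omega> \<in> E)) {True}"
    by simp
  moreover have "(\<lambda>\<omega>. future n k \<omega> \<in> E) \<in> measurable M (count_space UNIV)" "(\<lambda>\<omega>. scaled_future n k \<omega> \<in> E) \<in> measurable M (count_space UNIV)"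
    using E by measurable
  ultimately have "emeasure M {\<omega>\<in>space M. future n k \<omega> \<in> E} = emeasure M {\<omega>\<in>space M. scaled_future n k \<omega> \<in> E}"
    by (simp add: emeasure_distr vimage_def Int_def conj_commute)
  then show "emeasure (distr M (PiM UNIV (\<lambda>_. borel)) (future n k)) (prod_emb UNIV (\<lambda>_. borel) J (Pi\<^sub>E J A))
    = emeasure (distr M (PiM UNIV (\<lambda>_. borel)) (scaled_future n k)) (prod_emb UNIV (\<lambda>_. borel) J (Pi\<^sub>E J A))"
    unfolding E_def[symmetric] using E by (simp add: emeasure_distr vimage_def Int_def conj_commute)
next
  interpret D: prob_space "distr M (PiM UNIV (\<lambda>_. borel)) (future n k)" by (rule prob_space_distr) simp
  show "finite_measure (distr M (PiM UNIV (\<lambda>_. borel)) (future n k))" by (rule D.finite_measure_axioms)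
qed simp_all

lemma measurable_count_future:
  assumes A: "A \<in> sets (PiM UNIV (\<lambda>_. borel))"
  shows "(\<lambda>\<omega>. emeasure (count_space UNIV) {k. future n k \<omega> \<in> A}) \<in> borel_measurable M"
proof -
  have [measurable]: "(\<lambda>\<omega>. indicator A (future n k \<omega>) :: ennreal) \<in> borel_measurable M" for k
    by (rule measurable_compose[OF measurable_future borel_measurable_indicator[OF A]])
  have "(\<lambda>\<omega>. \<Sum>i. indicator A (future n (int_decode i) \<omega>) :: ennreal) \<in> borel_measurable M"
    by measurable
  then show ?thesis by (simp add: emeasure_count_int indicator_def)
qed

text \<open>
  By self-similarity, shifting the grid by \<open>k\<close> amounts to multiplying the path by \<open>grid n k\<close>. The
  expected number of hits along a path thus becomes that of the scales at which the fixed path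
  \<open>T (grid n j)\<close>, \<open>j \<ge> 0\<close>, hits.
\<close>

lemma nn_integral_count_future:
  assumes A: "A \<in> sets (PiM UNIV (\<lambda>_. borel))"
  shows "(\<integral>\<^sup>+\<omega>. emeasure (count_space UNIV) {k. future n k \<omega> \<in> A} \<partial>M)
    = (\<integral>\<^sup>+\<omega>. emeasure (count_space UNIV) {k. scaled_future n k \<omega> \<in> A} \<partial>M)"
proof -
  have swap: "(\<integral>\<^sup>+\<omega>. emeasure (count_space UNIV) {k. S k \<omega> \<in> A} \<partial>M) = (\<Sum>i. emeasure (distr M (PiM UNIV (\<lambda>_. borel)) (S (int_decode i))) A)"
    if [measurable]: "\<And>k. S k \<in> measurable M (PiM UNIV (\<lambda>_. borel))" for S :: "int \<Rightarrow> 'a \<Rightarrow> nat \<Rightarrow> real"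
  proof -
    have "(\<integral>\<^sup>+\<omega>. emeasure (count_space UNIV) {k. S k \<omega> \<in> A} \<partial>M) = (\<integral>\<^sup>+\<omega>. (\<Sum>i. indicator A (S (int_decode i) \<omega>)) \<partial>M)"
      by (intro nn_integral_cong) (simp add: emeasure_count_int indicator_def)
    also have "\<dots> = (\<Sum>i. \<integral>\<^sup>+\<omega>. indicator A (S (int_decode i) \<omega>) \<partial>M)"
      by (intro nn_integral_suminf measurable_compose[OF that borel_measurable_indicator[OF A]])
    also have "\<dots> = (\<Sum>i. emeasure (distr M (PiM UNIV (\<lambda>_. borel)) (S (int_decode i))) A)"
    proof (rule suminf_cong)
      fix i
      let ?k = "int_decode i"
      have "(\<integral>\<^sup>+\<omega>. indicator A (S ?k \<omega>) \<partial>M) = (\<integral>\<^sup>+x. indicator A x \<partial>distr M (PiM UNIV (\<lambda>_. borel)) (S ?k))"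
        using A by (subst nn_integral_distr) auto
      also have "\<dots> = emeasure (distr M (PiM UNIV (\<lambda>_. borel)) (S ?k)) A"
        using A by (intro nn_integral_indicator) simp
      finally show "(\<integral>\<^sup>+\<omega>. indicator A (S ?k \<omega>) \<partial>M) = emeasure (distr M (PiM UNIV (\<lambda>_. borel)) (S ?k)) A" .
    qed
    finally show ?thesis .
  qed
  show ?thesis
    unfolding swap[of "future n", OF measurable_future] swap[of "scaled_future n", OF measurable_scaled_future] distr_future ..
qed

end

section \<open>Processes whose range is a scale invariant Poisson process\<close>

lemma emeasure_count_space_bij:
  assumes "bij_betw f A B"
  shows "emeasure (count_space UNIV) A = emeasure (count_space UNIV) B"
  using bij_betw_finite[OF assms] bij_betw_same_card[OF assms] by (simp add: emeasure_count_space)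

lemma emeasure_scale_invariant_intensity_Ioc:
  assumes \<theta>: "\<theta> > 0" and ab: "0 < a" "a \<le> b"
  shows "emeasure (scale_invariant_intensity \<theta>) {a<..b} = ennreal (\<theta> * ln (b / a))"
proof -
  have "emeasure (scale_invariant_intensity \<theta>) {a<..b} = (\<integral>\<^sup>+x. ennreal (\<theta> / x) * indicator {a<..b} x \<partial>lborel)"
    using ab by (intro emeasure_scale_invariant_intensity) auto
  also have "\<dots> = (\<integral>\<^sup>+x. ennreal (\<theta> / x) * indicator {a..b} x \<partial>lborel)"
    by (intro nn_integral_cong_AE eventually_mono[OF AE_lborel_singleton[of a]]) (auto simp: indicator_def)
  also have "\<dots> = ennreal (\<theta> * ln b - \<theta> * ln a)"
  proof (rule nn_integral_FTC_Icc)
    fix x assume x: "x \<in> {a..b}"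
    then show "((\<lambda>x. \<theta> * ln x) has_real_derivative \<theta> / x) (at x)"
      using ab by (auto intro!: derivative_eq_intros)
    show "0 \<le> \<theta> / x" using x ab \<theta> by (auto intro: divide_nonneg_pos)
  qed (use ab in auto)
  also have "\<theta> * ln b - \<theta> * ln a = \<theta> * ln (b / a)"
    using ab by (simp add: ln_div right_diff_distrib)
  finally show ?thesis .
qed

locale poisson_range = nondecreasing_ssa +
  fixes \<theta> :: real
  assumes \<theta>: "\<theta> > 0" and poisson: "scale_invariant_poisson_process M \<theta> (process_range T)"
begin

sublocale C: prob_space "completion M" by (rule prob_space_completion)

abbreviation count :: "real set \<Rightarrow> 'a \<Rightarrow> ennreal" where
  "count \<equiv> point_count (process_range T)"

lemma AE_range_pos: "AE \<omega> in M. process_range T \<omega> \<subseteq> {0<..}"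
  using poisson unfolding scale_invariant_poisson_process_def poisson_point_process_def space_scale_invariant_intensity
  by (auto elim: AE_mp)

lemma AE_regular: "AE \<omega> in M. regular_path (\<lambda>s. T s \<omega>)"
proof (rule AE_regular_path)
  show "AE \<omega> in M. T 1 \<omega> > 0"
    using AE_range_pos by eventually_elim (simp add: process_range_def image_subset_iff)
qed

lemma measurable_count:
  assumes "A \<in> sets borel" "A \<subseteq> {0<..}"
  shows "count A \<in> borel_measurable (completion M)"
proof -
  have "A \<in> sets (scale_invariant_intensity \<theta>)" using assms by (simp add: sets_scale_invariant_intensity)
  then show ?thesis
    using poisson unfolding scale_invariant_poisson_process_def poisson_point_process_def by blast
qed

lemma prob_count:
  assumes ab: "0 < a" "a \<le> b"
  shows "C.prob {\<omega>\<in>space M. count {a<..b} \<omega> = of_nat k} = (\<theta> * ln (b / a)) ^ k / fact k * exp (- (\<theta> * ln (b / a)))"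
proof -
  have 1: "{a<..b} \<in> sets (scale_invariant_intensity \<theta>)" using ab by (auto simp: sets_scale_invariant_intensity)
  have 2: "emeasure (scale_invariant_intensity \<theta>) {a<..b} < \<infinity>"
    using emeasure_scale_invariant_intensity_Ioc[OF \<theta> ab] by simp
  have 3: "measure (scale_invariant_intensity \<theta>) {a<..b} = \<theta> * ln (b / a)"
    unfolding measure_def emeasure_scale_invariant_intensity_Ioc[OF \<theta> ab] using \<theta> ab by simp
  have "\<forall>A\<in>sets (scale_invariant_intensity \<theta>). emeasure (scale_invariant_intensity \<theta>) A < \<infinity> \<longrightarrow>
      (\<forall>k::nat. C.prob {\<omega>\<in>space M. count A \<omega> = of_nat k} =
         measure (scale_invariant_intensity \<theta>) A ^ k / fact k * exp (- measure (scale_invariant_intensity \<theta>) A))"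
    using poisson unfolding scale_invariant_poisson_process_def poisson_point_process_def by (elim conjE)
  from this[rule_format, OF 1 2, of k] show ?thesis unfolding 3 .
qed

lemma sets_count:
  assumes "0 < a"
  shows "{\<omega>\<in>space M. count {a<..b} \<omega> = c} \<in> sets (completion M)"
proof -
  have [measurable]: "count {a<..b} \<in> borel_measurable (completion M)"
    by (rule measurable_count) (use assms in auto)
  have "{\<omega>\<in>space (completion M). count {a<..b} \<omega> = c} \<in> sets (completion M)" by measurable
  then show ?thesis by simp
qed

text \<open>The Poisson probabilities of the finite counts add up to \<open>1\<close>, so an
  infinite count in a bounded window has probability \<open>0\<close>. Local finiteness of the range
  follows.\<close>

lemma AE_count_nat:
  assumes ab: "0 < a" "a \<le> b"
  shows "AE \<omega> in completion M. \<exists>k::nat. count {a<..b} \<omega> = of_nat k"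
proof -
  define m where "m = \<theta> * ln (b / a)"
  define E where "E k = {\<omega>\<in>space M. count {a<..b} \<omega> = of_nat k}" for k :: nat
  have E: "range E \<subseteq> sets (completion M)" unfolding E_def using sets_count[OF ab(1)] by blast
  have "disjoint_family E" by (auto simp: E_def disjoint_family_on_def)
  with E have "(\<lambda>k. C.prob (E k)) sums C.prob (\<Union>k. E k)" by (rule C.finite_measure_UNION)
  moreover have "(\<lambda>k. (m ^ k /\<^sub>R fact k) * exp (- m)) sums (exp m * exp (- m))"
    by (intro sums_mult2 exp_converges)
  then have "(\<lambda>k. C.prob (E k)) sums 1"
    unfolding E_def prob_count[OF ab] m_def[symmetric] by (simp add: exp_add[symmetric] divide_inverse mult.commute)
  ultimately have "C.prob (\<Union>k. E k) = 1" by (rule sums_unique2)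
  then have "AE \<omega> in completion M. \<omega> \<in> (\<Union>k. E k)"
    using E by (subst (asm) C.prob_eq_1) auto
  then show ?thesis by eventually_elim (auto simp: E_def)
qed

lemma AE_locally_finite: "AE \<omega> in M. locally_finite_range (\<lambda>s. T s \<omega>)"
proof -
  have "AE \<omega> in M. \<exists>k::nat. count {inverse (real (Suc m))<..real (Suc m)} \<omega> = of_nat k" for m
  proof -
    have "inverse (real (Suc m)) \<le> 1" by (simp add: field_simps)
    also have "1 \<le> real (Suc m)" by simp
    finally show ?thesis using AE_count_nat[of "inverse (real (Suc m))" "real (Suc m)"] by (simp add: AE_completion_iff)
  qed
  then have "AE \<omega> in M. \<forall>m. \<exists>k::nat. count {inverse (real (Suc m))<..real (Suc m)} \<omega> = of_nat k"
    by (simp add: AE_all_countable)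
  then show ?thesis
  proof eventually_elim
    case (elim \<omega>)
    show ?case
      unfolding locally_finite_range_def
    proof safe
      fix a b :: real assume "a > 0"
      obtain m1 where m1: "inverse (real (Suc m1)) < a" using reals_Archimedean[OF \<open>a > 0\<close>] by blast
      obtain m2 :: nat where m2: "b \<le> real m2" using real_arch_simple by blast
      define m where "m = m1 + m2"
      have "inverse (real (Suc m)) \<le> inverse (real (Suc m1))" unfolding m_def by (intro le_imp_inverse_le) auto
      then have *: "inverse (real (Suc m)) < a" using m1 by (rule le_less_trans)
      obtain k :: nat where "count {inverse (real (Suc m))<..real (Suc m)} \<omega> = of_nat k" using elim by blast
      then have "finite (process_range T \<omega> \<inter> {inverse (real (Suc m))<..real (Suc m)})"
        by (cases "finite (process_range T \<omega> \<inter> {inverse (real (Suc m))<..real (Suc m)})") (auto simp: point_count_def)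
      then show "finite ((\<lambda>s. T s \<omega>) ` {0<..} \<inter> {a<..b})"
        by (rule finite_subset[rotated]) (use * m2 in \<open>auto simp: process_range_def m_def\<close>)
    qed
  qed
qed

lemma nn_integral_count:
  assumes ab: "0 < a" "a \<le> b"
  shows "(\<integral>\<^sup>+\<omega>. count {a<..b} \<omega> \<partial>completion M) = ennreal (\<theta> * ln (b / a))"
proof -
  define m where "m = \<theta> * ln (b / a)"
  have m: "m \<ge> 0" using \<theta> ab by (simp add: m_def)
  define E where "E k = {\<omega>\<in>space M. count {a<..b} \<omega> = of_nat k}" for k :: nat
  have E: "E k \<in> sets (completion M)" for k unfolding E_def by (rule sets_count[OF ab(1)])
  have "(\<integral>\<^sup>+\<omega>. count {a<..b} \<omega> \<partial>completion M) = (\<integral>\<^sup>+\<omega>. (\<Sum>k. of_nat k * indicator (E k) \<omega>) \<partial>completion M)"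
  proof (rule nn_integral_cong_AE)
    show "AE \<omega> in completion M. count {a<..b} \<omega> = (\<Sum>k. of_nat k * indicator (E k) \<omega>)"
      using AE_count_nat[OF ab] AE_space
    proof eventually_elim
      case (elim \<omega>)
      then obtain j :: nat where j: "count {a<..b} \<omega> = of_nat j" by blast
      have "(\<Sum>k. of_nat k * indicator (E k) \<omega> :: ennreal) = (\<Sum>k\<in>{j}. of_nat k * indicator (E k) \<omega>)"
        using j by (intro suminf_finite) (auto simp: E_def indicator_def)
      also have "\<dots> = of_nat j"
        using j elim(2) by (simp add: E_def)
      finally show ?case by (simp only: j)
    qed
  qed
  also have "\<dots> = (\<Sum>k. of_nat k * emeasure (completion M) (E k))"
    using E by (subst nn_integral_suminf) (auto simp: nn_integral_cmult_indicator)
  also have "\<dots> = (\<Sum>k. ennreal (real k * (m ^ k / fact k * exp (- m))))"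
  proof (rule suminf_cong)
    fix k
    have "emeasure (completion M) (E k) = ennreal (m ^ k / fact k * exp (- m))"
      unfolding C.emeasure_eq_measure E_def prob_count[OF ab] m_def ..
    then show "of_nat k * emeasure (completion M) (E k) = ennreal (real k * (m ^ k / fact k * exp (- m)))"
      using m by (simp add: ennreal_of_nat_eq_real_of_nat ennreal_mult'[symmetric])
  qed
  also have "\<dots> = ennreal m"
  proof (rule suminf_ennreal_eq)
    have "(\<lambda>k. m * exp (- m) * (m ^ k /\<^sub>R fact k)) sums (m * exp (- m) * exp m)"
      by (intro sums_mult exp_converges)
    moreover have "m * exp (- m) * exp m = m" by (simp add: mult.assoc exp_add[symmetric])
    moreover have "m * exp (- m) * (m ^ k /\<^sub>R fact k) = real (Suc k) * (m ^ Suc k / fact (Suc k) * exp (- m))" for k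
      unfolding fact_Suc by (simp add: divide_simps del: of_nat_Suc)
    ultimately have "(\<lambda>k. real (Suc k) * (m ^ Suc k / fact (Suc k) * exp (- m))) sums m" by simp
    then show "(\<lambda>k. real k * (m ^ k / fact k * exp (- m))) sums m"
      by (subst (asm) sums_Suc_iff) simp
  qed (use m in simp)
  finally show ?thesis by (simp add: m_def)
qed

text \<open>A jump between the first two indices that lands in \<open>{1<..2}\<close>; this is one
  octave, so that \<open>emeasure_count_grid\<close> applies with \<open>l = 0\<close>.\<close>

definition jump_set :: "(nat \<Rightarrow> real) set" where
  "jump_set = {x \<in> space (PiM UNIV (\<lambda>_. borel)). 1 < x 1 \<and> x 1 \<le> 2 \<and> x 0 \<noteq> x 1}"

lemma sets_jump_set: "jump_set \<in> sets (PiM UNIV (\<lambda>_. borel))"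
proof -
  have [measurable]: "(\<lambda>x::nat \<Rightarrow> real. x i) \<in> borel_measurable (PiM UNIV (\<lambda>_. borel))" for i :: nat
    by (rule measurable_component_singleton) simp
  show ?thesis unfolding jump_set_def neq_iff by measurable
qed

lemma mem_jump_set: "x \<in> jump_set \<longleftrightarrow> 1 < x 1 \<and> x 1 \<le> 2 \<and> x 0 \<noteq> x 1"
  by (auto simp: jump_set_def space_PiM)

text \<open>Each grid value in the octave is entered at exactly one index. Were it never entered, it
  would persist at all earlier grid times, against the limit \<open>0\<close> at time
  \<open>0\<close>.\<close>

lemma count_jumps:
  assumes f: "regular_path (\<lambda>s. T s \<omega>)"
  shows "emeasure (count_space UNIV) {k. future n k \<omega> \<in> jump_set}
    = emeasure (count_space UNIV) (range (\<lambda>k. T (grid n k) \<omega>) \<inter> {1<..2})"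
proof (rule emeasure_count_space_bij)
  let ?x = "\<lambda>k. T (grid n k) \<omega>"
  have mono: "?x j \<le> ?x k" if "j \<le> k" for j k
    using regular_pathD(1)[OF f, of "grid n j" "grid n k"] that by simp
  have mem: "future n k \<omega> \<in> jump_set \<longleftrightarrow> 1 < ?x (k + 1) \<and> ?x (k + 1) \<le> 2 \<and> ?x k \<noteq> ?x (k + 1)" for k
    by (simp add: mem_jump_set future_def)
  show "bij_betw (\<lambda>k. ?x (k + 1)) {k. future n k \<omega> \<in> jump_set} (range ?x \<inter> {1<..2})"
    unfolding bij_betw_def
  proof
    show "inj_on (\<lambda>k. ?x (k + 1)) {k. future n k \<omega> \<in> jump_set}"
    proof (rule linorder_inj_onI)
      fix j k assume jk: "j < k" "j \<in> {k. future n k \<omega> \<in> jump_set}" "k \<in> {k. future n k \<omega> \<in> jump_set}"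
      have "?x (j + 1) \<le> ?x k" using jk by (intro mono) simp
      moreover have "?x k < ?x (k + 1)" using jk(3) mono[of k "k + 1"] by (auto simp: mem)
      ultimately show "?x (j + 1) \<noteq> ?x (k + 1)" by simp
    qed auto
    show "(\<lambda>k. ?x (k + 1)) ` {k. future n k \<omega> \<in> jump_set} = range ?x \<inter> {1<..2}"
    proof (intro equalityI subsetI)
      fix y assume "y \<in> range ?x \<inter> {1<..2}"
      then obtain k0 where y: "y = ?x k0" "1 < y" "y \<le> 2" by auto
      have "\<exists>k. ?x k \<noteq> y \<and> ?x (k + 1) = y"
      proof (rule ccontr)
        assume "\<not> ?thesis"
        then have down: "?x k = y" if "?x (k + 1) = y" for k using that by blast
        have "?x (k0 - int i) = y" for i
        proof (induction i)
          case (Suc i)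
          show ?case by (rule down) (use Suc in simp)
        qed (simp add: y)
        moreover have "(\<lambda>i. ?x (k0 - int i)) \<longlonglongrightarrow> 0"
        proof -
          have "filterlim (\<lambda>i. grid n (k0 - int i)) (at_right 0) sequentially"
            using tendsto_grid_at_bot by (auto simp: filterlim_at)
          then show ?thesis by (rule filterlim_compose[OF regular_pathD(3)[OF f]])
        qed
        ultimately have "y = 0" by (simp add: LIMSEQ_const_iff)
        with y show False by simp
      qed
      then obtain k where "?x k \<noteq> y" "?x (k + 1) = y" by blast
      then show "y \<in> (\<lambda>k. ?x (k + 1)) ` {k. future n k \<omega> \<in> jump_set}"
        using y by (auto simp: mem image_iff intro!: exI[of _ k])
    qed (auto simp: mem)
  qed
qed

lemma dT_0: "dT n 0 \<omega> = T (grid n 1) \<omega> - T 1 \<omega>"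
  by (simp add: dT_def)

text \<open>The expected number of grid values in \<open>{1<..2}\<close> tends to the Poisson mean
  \<open>\<theta> * ln 2\<close>; by self-similarity it equals \<open>2 ^ n\<close> times the
  probability of a jump over the first grid interval after time \<open>1\<close>.\<close>

lemma tendsto_prob_jump: "(\<lambda>n. 2 ^ n * prob {\<omega>\<in>space M. dT n 0 \<omega> \<noteq> 0}) \<longlonglongrightarrow> \<theta> * ln 2"
proof -
  have [measurable]: "count {1<..2} \<in> borel_measurable (completion M)" by (rule measurable_count) auto
  have lhs: "(\<lambda>n. \<integral>\<^sup>+\<omega>. emeasure (count_space UNIV) {k. future n k \<omega> \<in> jump_set} \<partial>completion M)
    \<longlonglongrightarrow> (\<integral>\<^sup>+\<omega>. count {1<..2} \<omega> \<partial>completion M)"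
  proof (rule nn_integral_dominated_convergence[where w = "count {1<..2}"])
    show "(\<lambda>\<omega>. emeasure (count_space UNIV) {k. future n k \<omega> \<in> jump_set}) \<in> borel_measurable (completion M)" for n
      by (intro measurable_completion measurable_count_future sets_jump_set)
    show "AE \<omega> in completion M. emeasure (count_space UNIV) {k. future n k \<omega> \<in> jump_set} \<le> count {1<..2} \<omega>" for n
      using AE_completion[OF AE_regular]
    proof eventually_elim
      case (elim \<omega>)
      show ?case unfolding count_jumps[OF elim] point_count_def
        by (intro emeasure_mono) (auto simp: process_range_def)
    qed
    show "(\<integral>\<^sup>+\<omega>. count {1<..2} \<omega> \<partial>completion M) < \<infinity>"
      using nn_integral_count[of 1 2] by simp
    show "AE \<omega> in completion M. (\<lambda>n. emeasure (count_space UNIV) {k. future n k \<omega> \<in> jump_set}) \<longlonglongrightarrow> count {1<..2} \<omega>"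
      using AE_completion[OF AE_regular] AE_completion[OF AE_locally_finite]
    proof eventually_elim
      case (elim \<omega>)
      have "\<forall>\<^sub>F n in sequentially. emeasure (count_space UNIV) {k. future n k \<omega> \<in> jump_set} = count {1<..2} \<omega>"
        using eventually_grid_range_eq[OF elim, of 1 2, OF zero_less_one]
        by eventually_elim (simp add: count_jumps[OF elim(1)] point_count_def process_range_def)
      then show ?case by (rule tendsto_eventually)
    qed
  qed simp_all
  have rhs: "(\<integral>\<^sup>+\<omega>. emeasure (count_space UNIV) {k. scaled_future n k \<omega> \<in> jump_set} \<partial>M)
    = ennreal (2 ^ n * prob {\<omega>\<in>space M. dT n 0 \<omega> \<noteq> 0})" for n
  proof -
    have "(\<integral>\<^sup>+\<omega>. emeasure (count_space UNIV) {k. scaled_future n k \<omega> \<in> jump_set} \<partial>M)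
      = (\<integral>\<^sup>+\<omega>. 2 ^ n * indicator {\<omega>\<in>space M. dT n 0 \<omega> \<noteq> 0} \<omega> \<partial>M)"
    proof (rule nn_integral_cong_AE)
      show "AE \<omega> in M. emeasure (count_space UNIV) {k. scaled_future n k \<omega> \<in> jump_set} = 2 ^ n * indicator {\<omega>\<in>space M. dT n 0 \<omega> \<noteq> 0} \<omega>"
        using AE_regular AE_space
      proof eventually_elim
        case (elim \<omega>)
        have "{k. scaled_future n k \<omega> \<in> jump_set} = (if dT n 0 \<omega> \<noteq> 0 then {k. 1 < grid (0 + n) k * T (grid n 1) \<omega> \<and> grid (0 + n) k * T (grid n 1) \<omega> \<le> grid 0 1} else {})"
          by (auto simp: mem_jump_set scaled_future_def dT_0 grid_def[of 0])
        then show ?case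
          using emeasure_count_grid[of "T (grid n 1) \<omega>" 0 n] regular_pathD(5)[OF elim(1), of "grid n 1"] elim(2)
          by (auto simp: indicator_def)
      qed
    qed
    also have "\<dots> = 2 ^ n * emeasure M {\<omega>\<in>space M. dT n 0 \<omega> \<noteq> 0}"
      by (rule nn_integral_cmult_indicator) measurable
    finally show ?thesis
      by (simp add: emeasure_eq_measure ennreal_mult' ennreal_power[symmetric])
  qed
  have "(\<lambda>n. ennreal (2 ^ n * prob {\<omega>\<in>space M. dT n 0 \<omega> \<noteq> 0})) \<longlonglongrightarrow> ennreal (\<theta> * ln 2)"
    using lhs nn_integral_count[of 1 2]
    by (simp add: nn_integral_completion nn_integral_count_future[OF sets_jump_set] rhs)
  then show ?thesis
    using \<theta> by (subst (asm) tendsto_ennreal_iff) auto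
qed

end

section \<open>Convergence of characteristic functions of pairs\<close>

lemma weighted_distribution:
  fixes h A :: "'a \<Rightarrow> real" and g :: "real \<Rightarrow> complex"
  assumes P: "prob_space P" and h: "h \<in> borel_measurable P" "\<And>x. 0 \<le> h x" "\<And>x. h x \<le> 1"
    and A: "A \<in> borel_measurable P" and c: "c = (\<integral>x. h x \<partial>P)" "c > 0"
  defines "D \<equiv> distr (density P (\<lambda>x. ennreal (h x / c))) borel A"
  shows "real_distribution D" "cdf D a = (\<integral>x. h x * indicator {..a} (A x) \<partial>P) / c"
    "g \<in> borel_measurable borel \<Longrightarrow> (\<integral>y. g y \<partial>D) = (\<integral>x. h x *\<^sub>R g (A x) \<partial>P) /\<^sub>R c"
proof -
  interpret P: prob_space P by (rule P)
  note [measurable] = h(1) A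
  have int_h: "integrable P h" by (rule P.integrable_const_bound[of _ 1]) (use h in auto)
  have "emeasure (density P (\<lambda>x. ennreal (h x / c))) (space P) = (\<integral>\<^sup>+x. ennreal (h x / c) \<partial>P)"
    by (subst emeasure_density) (auto intro!: nn_integral_cong)
  also have "\<dots> = ennreal (\<integral>x. h x / c \<partial>P)"
    using int_h h c by (intro nn_integral_eq_integral) auto
  also have "(\<integral>x. h x / c \<partial>P) = 1" using c by simp
  finally have D0: "prob_space (density P (\<lambda>x. ennreal (h x / c)))"
    by (intro prob_spaceI) simp
  show D: "real_distribution D"
    unfolding D_def real_distribution_def real_distribution_axioms_def
    using prob_space.prob_space_distr[OF D0, of A borel] by simp
  interpret D: real_distribution D by (rule D)
  have int: "(\<integral>y. f y \<partial>D) = (\<integral>x. h x *\<^sub>R f (A x) \<partial>P) /\<^sub>R c"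
    if [measurable]: "f \<in> borel_measurable borel" for f :: "real \<Rightarrow> 'c::{banach, second_countable_topology}"
  proof -
    have "(\<integral>y. f y \<partial>D) = (\<integral>x. f (A x) \<partial>density P (\<lambda>x. ennreal (h x / c)))"
      unfolding D_def by (subst integral_distr) auto
    also have "\<dots> = (\<integral>x. (h x / c) *\<^sub>R f (A x) \<partial>P)"
      by (subst integral_density) (use h c in auto)
    also have "\<dots> = (\<integral>x. inverse c *\<^sub>R (h x *\<^sub>R f (A x)) \<partial>P)"
      by (simp add: divide_inverse mult.commute)
    also have "\<dots> = inverse c *\<^sub>R (\<integral>x. h x *\<^sub>R f (A x) \<partial>P)"
      by (rule integral_scaleR_right)
    finally show ?thesis .
  qed
  then show "g \<in> borel_measurable borel \<Longrightarrow> (\<integral>y. g y \<partial>D) = (\<integral>x. h x *\<^sub>R g (A x) \<partial>P) /\<^sub>R c" .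
  have "cdf D a = (\<integral>y. indicator {..a} y \<partial>D)" by (simp add: cdf_def D.space_eq_univ)
  also have "\<dots> = (\<integral>x. h x * indicator {..a} (A x) \<partial>P) / c"
    by (subst int) (auto simp: divide_inverse mult.commute)
  finally show "cdf D a = (\<integral>x. h x * indicator {..a} (A x) \<partial>P) / c" .
qed

text \<open>Dividing by the total weights gives probability laws on the line, to which weak
  convergence applies; multiplying back removes the normalisation.\<close>

lemma weighted_weak_conv:
  fixes P :: "nat \<Rightarrow> 'a measure" and Q :: "'b measure" and h :: "nat \<Rightarrow> 'a \<Rightarrow> real" and g :: "real \<Rightarrow> complex"
  assumes P: "\<And>n. prob_space (P n)" and h: "\<And>n. h n \<in> borel_measurable (P n)" "\<And>n x. 0 \<le> h n x" "\<And>n x. h n x \<le> 1"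
    and A: "\<And>n. A n \<in> borel_measurable (P n)"
    and Q: "prob_space Q" and k: "k \<in> borel_measurable Q" "\<And>x. 0 \<le> k x" "\<And>x. k x \<le> 1" "(\<integral>x. k x \<partial>Q) > 0"
    and B: "B \<in> borel_measurable Q"
    and total: "(\<lambda>n. \<integral>x. h n x \<partial>P n) \<longlonglongrightarrow> (\<integral>x. k x \<partial>Q)"
    and cdf: "\<And>a. (\<lambda>n. \<integral>x. h n x * indicator {..a} (A n x) \<partial>P n) \<longlonglongrightarrow> (\<integral>x. k x * indicator {..a} (B x) \<partial>Q)"
    and g: "\<And>x. isCont g x" "\<And>x. norm (g x) \<le> 1"
  shows "(\<lambda>n. \<integral>x. h n x *\<^sub>R g (A n x) \<partial>P n) \<longlonglongrightarrow> (\<integral>x. k x *\<^sub>R g (B x) \<partial>Q)"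
proof -
  define c where "c n = (\<integral>x. h n x \<partial>P n)" for n
  define d where "d = (\<integral>x. k x \<partial>Q)"
  have d: "d > 0" and cd: "c \<longlonglongrightarrow> d" using k(4) total unfolding c_def[abs_def] d_def by simp_all
  \<comment> \<open>The total weights are positive only eventually, so the sequence is shifted by
    \<open>N\<close>.\<close>
  then obtain N where N: "\<And>n. n \<ge> N \<Longrightarrow> c n > 0"
    using order_tendstoD(1)[OF cd d] unfolding eventually_sequentially by blast
  define \<mu> where "\<mu> n = distr (density (P (n + N)) (\<lambda>x. ennreal (h (n + N) x / c (n + N)))) borel (A (n + N))" for n
  define \<nu> where "\<nu> = distr (density Q (\<lambda>x. ennreal (k x / d))) borel B"
  note \<mu> = weighted_distribution[OF P h A c_def N[OF le_add2], folded \<mu>_def]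
  note \<nu> = weighted_distribution[OF Q k(1-3) B d_def d, folded \<nu>_def]
  have g_meas: "g \<in> borel_measurable borel"
    by (intro borel_measurable_continuous_onI continuous_at_imp_continuous_on) (simp add: g)
  have cN: "(\<lambda>n. c (n + N)) \<longlonglongrightarrow> d" using cd by (rule LIMSEQ_ignore_initial_segment)
  have "weak_conv_m \<mu> \<nu>"
    unfolding weak_conv_m_def weak_conv_def
  proof (intro allI impI)
    fix a
    show "(\<lambda>n. cdf (\<mu> n) a) \<longlonglongrightarrow> cdf \<nu> a"
      unfolding \<mu>(2) \<nu>(2)
      by (intro tendsto_divide cN LIMSEQ_ignore_initial_segment[OF cdf]) (use d in simp)
  qed
  then have "(\<lambda>n. integral\<^sup>L (\<mu> n) g) \<longlonglongrightarrow> integral\<^sup>L \<nu> g"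
    using weak_conv_imp_bdd_ae_continuous_conv[of \<mu> \<nu> g 1] g_meas \<mu>(1) \<nu>(1) g
    by simp
  then have "(\<lambda>n. c (n + N) *\<^sub>R integral\<^sup>L (\<mu> n) g) \<longlonglongrightarrow> d *\<^sub>R integral\<^sup>L \<nu> g"
    by (intro tendsto_scaleR cN)
  moreover have "c (n + N) *\<^sub>R integral\<^sup>L (\<mu> n) g = (\<integral>x. h (n + N) x *\<^sub>R g (A (n + N) x) \<partial>P (n + N))" for n
  proof -
    have c0: "c (n + N) \<noteq> 0" using N[of "n + N"] by simp
    show ?thesis unfolding \<mu>(3)[OF g_meas] scaleR_scaleR right_inverse[OF c0] scaleR_one ..
  qed
  moreover have "d *\<^sub>R integral\<^sup>L \<nu> g = (\<integral>x. k x *\<^sub>R g (B x) \<partial>Q)"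
  proof -
    have d0: "d \<noteq> 0" using d by simp
    show ?thesis unfolding \<nu>(3)[OF g_meas] scaleR_scaleR right_inverse[OF d0] scaleR_one ..
  qed
  ultimately have "(\<lambda>n. \<integral>x. h (n + N) x *\<^sub>R g (A (n + N) x) \<partial>P (n + N)) \<longlonglongrightarrow> (\<integral>x. k x *\<^sub>R g (B x) \<partial>Q)"
    by (simp only:)
  then show ?thesis by (rule LIMSEQ_offset)
qed

lemma integral_indicator_event:
  "(\<integral>x. indicator {x. R x} x \<partial>N) = measure N {x\<in>space N. R x}"
  by (subst Bochner_Integration.integral_indicator) (simp add: Int_def conj_commute)

lemma integral_indicator_event_atMost:
  fixes C :: "'a \<Rightarrow> real"
  shows "(\<integral>x. indicator {x. R x} x * indicator {..a} (C x) \<partial>N) = measure N {x\<in>space N. C x \<le> a \<and> R x}"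
  by (subst integral_indicator_event[symmetric], intro Bochner_Integration.integral_cong) (auto simp: indicator_def)

text \<open>The map taking \<open>t\<close> to \<open>(2 + t) / 3\<close> sends [-1, 1] into
  [1/3, 1]. It turns the real or imaginary part of a bounded function into a weight of positive
  total, and being affine it can be undone.\<close>

lemma integral_affine_weight:
  fixes C D :: "'a \<Rightarrow> real" and f :: "real \<Rightarrow> real" and g :: "real \<Rightarrow> complex"
  assumes N: "prob_space N" and [measurable]: "C \<in> borel_measurable N" "D \<in> borel_measurable N"
    and [measurable]: "f \<in> borel_measurable borel" and f: "\<And>x. norm (f x) \<le> 1"
    and [measurable]: "g \<in> borel_measurable borel" and g: "\<And>x. norm (g x) \<le> 1"
    and \<phi>: "bounded_linear \<phi>"
  shows "(\<integral>x. ((2 + \<phi> (g (C x))) / 3) *\<^sub>R f (D x) \<partial>N) = (2 * (\<integral>x. f (D x) \<partial>N) + \<phi> (\<integral>x. f (D x) *\<^sub>R g (C x) \<partial>N)) / 3"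
proof -
  interpret N: prob_space N by (rule N)
  interpret \<phi>: bounded_linear \<phi> by (rule \<phi>)
  have i1: "integrable N (\<lambda>x. f (D x))"
    by (rule N.integrable_const_bound[of _ 1]) (use f in auto)
  have i2: "integrable N (\<lambda>x. f (D x) *\<^sub>R g (C x))"
    by (rule N.integrable_const_bound[of _ 1]) (use f g in \<open>auto intro!: mult_le_one\<close>)
  have i3: "integrable N (\<lambda>x. \<phi> (f (D x) *\<^sub>R g (C x)))"
    by (rule integrable_bounded_linear[OF \<phi> i2])
  have "(\<integral>x. ((2 + \<phi> (g (C x))) / 3) *\<^sub>R f (D x) \<partial>N) = (\<integral>x. (2 * f (D x) + \<phi> (f (D x) *\<^sub>R g (C x))) / 3 \<partial>N)"
    by (intro Bochner_Integration.integral_cong refl) (simp add: \<phi>.scaleR field_simps)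
  also have "\<dots> = (2 * (\<integral>x. f (D x) \<partial>N) + (\<integral>x. \<phi> (f (D x) *\<^sub>R g (C x)) \<partial>N)) / 3"
    using i1 i3 by simp
  also have "(\<integral>x. \<phi> (f (D x) *\<^sub>R g (C x)) \<partial>N) = \<phi> (\<integral>x. f (D x) *\<^sub>R g (C x) \<partial>N)"
    by (rule integral_bounded_linear[OF \<phi> i2])
  finally show ?thesis .
qed

lemma integral_weight_atMost:
  fixes w D :: "'a \<Rightarrow> real"
  assumes N: "prob_space N" and [measurable]: "D \<in> borel_measurable N" "w \<in> borel_measurable N"
    and w: "\<And>x. 1/3 \<le> w x" "\<And>x. w x \<le> 1"
  shows "(\<integral>x. w x * indicator {..b} (D x) \<partial>N) = (\<integral>x. w x \<partial>N) - (\<integral>x. w x * indicator {b<..} (D x) \<partial>N)"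
proof -
  interpret N: prob_space N by (rule N)
  have bd: "\<bar>w x\<bar> \<le> 1" for x using w(1)[of x] w(2)[of x] by linarith
  have "integrable N w" "integrable N (\<lambda>x. w x * indicator {b<..} (D x))"
    by (rule N.integrable_const_bound[of _ 1]; use bd in \<open>auto simp: indicator_def\<close>)+
  then have "(\<integral>x. w x \<partial>N) - (\<integral>x. w x * indicator {b<..} (D x) \<partial>N) = (\<integral>x. w x - w x * indicator {b<..} (D x) \<partial>N)"
    by simp
  also have "\<dots> = (\<integral>x. w x * indicator {..b} (D x) \<partial>N)"
    by (intro Bochner_Integration.integral_cong) (auto simp: indicator_def)
  finally show ?thesis by simp
qed

lemma integral_affine_weight_complex:
  fixes C D :: "'a \<Rightarrow> real" and g1 g2 :: "real \<Rightarrow> complex"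
  assumes N: "prob_space N" and [measurable]: "C \<in> borel_measurable N" "D \<in> borel_measurable N"
    and [measurable]: "g1 \<in> borel_measurable borel" "g2 \<in> borel_measurable borel"
    and g1: "\<And>x. norm (g1 x) \<le> 1" and g2: "\<And>x. norm (g2 x) \<le> 1"
    and \<phi>: "bounded_linear \<phi>" "\<And>z. \<bar>\<phi> z\<bar> \<le> norm z"
  shows "3 * (\<integral>x. ((2 + \<phi> (g1 (C x))) / 3) *\<^sub>R g2 (D x) \<partial>N) - 2 * (\<integral>x. g2 (D x) \<partial>N) = (\<integral>x. \<phi> (g1 (C x)) *\<^sub>R g2 (D x) \<partial>N)"
proof -
  interpret N: prob_space N by (rule N)
  interpret \<phi>: bounded_linear \<phi> by (rule \<phi>(1))
  have [measurable]: "\<phi> \<in> borel_measurable borel"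
    by (intro borel_measurable_continuous_onI \<phi>.continuous_on continuous_on_id)
  have bd: "\<bar>\<phi> (g1 x)\<bar> \<le> 1" for x using \<phi>(2)[of "g1 x"] g1[of x] by linarith
  have i1: "integrable N (\<lambda>x. g2 (D x))"
    by (rule N.integrable_const_bound[of _ 1]) (use g2 in auto)
  have i2: "integrable N (\<lambda>x. \<phi> (g1 (C x)) *\<^sub>R g2 (D x))"
    by (rule N.integrable_const_bound[of _ 1]) (use bd g2 in \<open>auto intro!: mult_le_one\<close>)
  have "(\<integral>x. ((2 + \<phi> (g1 (C x))) / 3) *\<^sub>R g2 (D x) \<partial>N) = (\<integral>x. (2 * g2 (D x) + \<phi> (g1 (C x)) *\<^sub>R g2 (D x)) / 3 \<partial>N)"
    by (intro Bochner_Integration.integral_cong refl) (simp add: scaleR_conv_of_real algebra_simps add_divide_distrib)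
  also have "\<dots> = (2 * (\<integral>x. g2 (D x) \<partial>N) + (\<integral>x. \<phi> (g1 (C x)) *\<^sub>R g2 (D x) \<partial>N)) / 3"
    using i1 i2 by simp
  finally show ?thesis by (simp add: mult.commute)
qed

lemma integral_mult_Re_Im:
  fixes C D :: "'a \<Rightarrow> real" and g1 g2 :: "real \<Rightarrow> complex"
  assumes N: "prob_space N" and [measurable]: "C \<in> borel_measurable N" "D \<in> borel_measurable N"
    and [measurable]: "g1 \<in> borel_measurable borel" "g2 \<in> borel_measurable borel"
    and g1: "\<And>x. norm (g1 x) \<le> 1" and g2: "\<And>x. norm (g2 x) \<le> 1"
  shows "(\<integral>x. g1 (C x) * g2 (D x) \<partial>N) = (\<integral>x. Re (g1 (C x)) *\<^sub>R g2 (D x) \<partial>N) + \<i> * (\<integral>x. Im (g1 (C x)) *\<^sub>R g2 (D x) \<partial>N)"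
proof -
  interpret N: prob_space N by (rule N)
  have bd: "\<bar>Re (g1 x)\<bar> \<le> 1" "\<bar>Im (g1 x)\<bar> \<le> 1" for x
    using abs_Re_le_cmod[of "g1 x"] abs_Im_le_cmod[of "g1 x"] g1[of x] by linarith+
  have i: "integrable N (\<lambda>x. Re (g1 (C x)) *\<^sub>R g2 (D x))" "integrable N (\<lambda>x. Im (g1 (C x)) *\<^sub>R g2 (D x))"
    by (rule N.integrable_const_bound[of _ 1]; use bd g2 in \<open>auto intro!: mult_le_one\<close>)+
  have "(\<integral>x. g1 (C x) * g2 (D x) \<partial>N) = (\<integral>x. Re (g1 (C x)) *\<^sub>R g2 (D x) + \<i> * (Im (g1 (C x)) *\<^sub>R g2 (D x)) \<partial>N)"
  proof (intro Bochner_Integration.integral_cong refl)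
    fix x
    have "g1 (C x) = of_real (Re (g1 (C x))) + \<i> * of_real (Im (g1 (C x)))" by (rule complex_eq)
    then have "g1 (C x) * g2 (D x) = (of_real (Re (g1 (C x))) + \<i> * of_real (Im (g1 (C x)))) * g2 (D x)" by (rule arg_cong)
    then show "g1 (C x) * g2 (D x) = Re (g1 (C x)) *\<^sub>R g2 (D x) + \<i> * (Im (g1 (C x)) *\<^sub>R g2 (D x))"
      by (simp only: scaleR_conv_of_real distrib_right mult.assoc)
  qed
  also have "\<dots> = (\<integral>x. Re (g1 (C x)) *\<^sub>R g2 (D x) \<partial>N) + (\<integral>x. \<i> * (Im (g1 (C x)) *\<^sub>R g2 (D x)) \<partial>N)"
    by (rule Bochner_Integration.integral_add[OF i(1) integrable_mult_right[OF i(2)]])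
  also have "(\<integral>x. \<i> * (Im (g1 (C x)) *\<^sub>R g2 (D x)) \<partial>N) = \<i> * (\<integral>x. Im (g1 (C x)) *\<^sub>R g2 (D x) \<partial>N)"
    by (rule integral_mult_right_zero)
  finally show ?thesis .
qed

text \<open>Convergence in the plane from weak convergence on the line, used twice: for
  \<open>A n\<close> with the weight \<open>b < B n x\<close>, which gives the mixed integrals with
  \<open>g1\<close>, and then for \<open>B n\<close> with a weight built from
  \<open>g1 (A n x)\<close>.\<close>

lemma tendsto_integral_product:
  fixes P :: "nat \<Rightarrow> 'a measure" and Q :: "'b measure" and g1 g2 :: "real \<Rightarrow> complex"
  assumes P: "\<And>n. prob_space (P n)"
    and A: "\<And>n. A n \<in> borel_measurable (P n)" and B: "\<And>n. B n \<in> borel_measurable (P n)"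
    and Q: "prob_space Q" and A0: "A0 \<in> borel_measurable Q" and B0: "B0 \<in> borel_measurable Q"
    and conv: "\<And>a b. (\<lambda>n. measure (P n) {x\<in>space (P n). A n x \<le> a \<and> b < B n x}) \<longlonglongrightarrow> measure Q {x\<in>space Q. A0 x \<le> a \<and> b < B0 x}"
    and pos: "\<And>b. measure Q {x\<in>space Q. b < B0 x} > 0"
    and g1: "\<And>x. isCont g1 x" "\<And>x. norm (g1 x) \<le> 1"
    and g2: "\<And>x. isCont g2 x" "\<And>x. norm (g2 x) \<le> 1"
  shows "(\<lambda>n. \<integral>x. g1 (A n x) * g2 (B n x) \<partial>P n) \<longlonglongrightarrow> (\<integral>x. g1 (A0 x) * g2 (B0 x) \<partial>Q)"
proof -
  interpret P: prob_space "P n" for n by (rule P)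
  interpret Q: prob_space Q by (rule Q)
  note [measurable] = A B A0 B0
  have g1_meas [measurable]: "g1 \<in> borel_measurable borel" and g2_meas [measurable]: "g2 \<in> borel_measurable borel"
    by (intro borel_measurable_continuous_onI continuous_at_imp_continuous_on; simp add: g1 g2)+
  define F where "F a b = Q.prob {x\<in>space Q. A0 x \<le> a \<and> b < B0 x}" for a b
  define G where "G n a b = P.prob n {x\<in>space (P n). A n x \<le> a \<and> b < B n x}" for n a b
  have FG: "(\<lambda>n. G n a b) \<longlonglongrightarrow> F a b" for a b unfolding F_def G_def by (rule conv)
  have limA: "(\<lambda>j::nat. Q.prob {x\<in>space Q. A0 x \<le> real j \<and> b < B0 x}) \<longlonglongrightarrow> Q.prob {x\<in>space Q. b < B0 x}" for b
  proof -
    have "(\<lambda>j::nat. Q.prob {x\<in>space Q. A0 x \<le> real j \<and> b < B0 x}) \<longlonglongrightarrow> Q.prob (\<Union>j::nat. {x\<in>space Q. A0 x \<le> real j \<and> b < B0 x})"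
      by (intro Q.finite_Lim_measure_incseq) (auto simp: incseq_def)
    also have "(\<Union>j::nat. {x\<in>space Q. A0 x \<le> real j \<and> b < B0 x}) = {x\<in>space Q. b < B0 x}"
      using real_arch_simple by auto
    finally show ?thesis .
  qed
  have limB: "(\<lambda>j::nat. Q.prob {x\<in>space Q. A0 x \<le> a \<and> - real j < B0 x}) \<longlonglongrightarrow> Q.prob {x\<in>space Q. A0 x \<le> a}" for a
  proof -
    have "(\<lambda>j::nat. Q.prob {x\<in>space Q. A0 x \<le> a \<and> - real j < B0 x}) \<longlonglongrightarrow> Q.prob (\<Union>j::nat. {x\<in>space Q. A0 x \<le> a \<and> - real j < B0 x})"
      by (intro Q.finite_Lim_measure_incseq) (auto simp: incseq_def)
    also have "(\<Union>j::nat. {x\<in>space Q. A0 x \<le> a \<and> - real j < B0 x}) = {x\<in>space Q. A0 x \<le> a}"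
    proof (intro equalityI subsetI)
      fix x assume "x \<in> {x\<in>space Q. A0 x \<le> a}"
      moreover obtain j :: nat where "- B0 x < real j" using reals_Archimedean2 by blast
      ultimately show "x \<in> (\<Union>j::nat. {x\<in>space Q. A0 x \<le> a \<and> - real j < B0 x})"
        by (auto intro!: exI[of _ j])
    qed auto
    finally show ?thesis .
  qed
  have full: "(\<lambda>j::nat. Q.prob {x\<in>space Q. - real j < B0 x}) \<longlonglongrightarrow> 1" "(\<lambda>j::nat. Q.prob {x\<in>space Q. A0 x \<le> real j}) \<longlonglongrightarrow> 1"
  proof -
    have "(\<lambda>j::nat. Q.prob {x\<in>space Q. - real j < B0 x}) \<longlonglongrightarrow> Q.prob (\<Union>j::nat. {x\<in>space Q. - real j < B0 x})"
      by (intro Q.finite_Lim_measure_incseq) (auto simp: incseq_def)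
    also have "(\<Union>j::nat. {x\<in>space Q. - real j < B0 x}) = space Q"
    proof (intro equalityI subsetI)
      fix x assume "x \<in> space Q"
      moreover obtain j :: nat where "- B0 x < real j" using reals_Archimedean2 by blast
      ultimately show "x \<in> (\<Union>j::nat. {x\<in>space Q. - real j < B0 x})" by (auto intro!: exI[of _ j])
    qed auto
    finally show "(\<lambda>j::nat. Q.prob {x\<in>space Q. - real j < B0 x}) \<longlonglongrightarrow> 1" by (simp add: Q.prob_space)
    have "(\<lambda>j::nat. Q.prob {x\<in>space Q. A0 x \<le> real j}) \<longlonglongrightarrow> Q.prob (\<Union>j::nat. {x\<in>space Q. A0 x \<le> real j})"
      by (intro Q.finite_Lim_measure_incseq) (auto simp: incseq_def)
    also have "(\<Union>j::nat. {x\<in>space Q. A0 x \<le> real j}) = space Q"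
      using real_arch_simple by auto
    finally show "(\<lambda>j::nat. Q.prob {x\<in>space Q. A0 x \<le> real j}) \<longlonglongrightarrow> 1" by (simp add: Q.prob_space)
  qed
  \<comment> \<open>Passes from joint to marginal probabilities: the joint event exhausts the
    marginal one as the other variable is freed, and the mass outside a large quadrant is small for
    all large \<open>n\<close>.\<close>
  have sandwich: "(\<lambda>n. p n) \<longlonglongrightarrow> q"
    if p: "\<And>n j. G n (u j) (v j) \<le> p n" "\<And>n j i. p n \<le> G n (u j) (v j) + (1 - G n (u' j i) (v' j i))"
      and q: "(\<lambda>j::nat. F (u j) (v j)) \<longlonglongrightarrow> q" and q': "\<And>j. (\<lambda>i::nat. F (u' j i) (v' j i)) \<longlonglongrightarrow> r j" and r: "r \<longlonglongrightarrow> 1"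
    for p q u v u' v' r
  proof (rule LIMSEQ_I)
    fix e :: real assume e: "e > 0"
    have "\<forall>\<^sub>F j in sequentially. \<bar>F (u j) (v j) - q\<bar> < e / 6 \<and> \<bar>r j - 1\<bar> < e / 6"
      using tendstoD[OF q, of "e/6"] tendstoD[OF r, of "e/6"] e by (auto simp: dist_real_def elim: eventually_elim2)
    then obtain j where j: "\<bar>F (u j) (v j) - q\<bar> < e / 6" "\<bar>r j - 1\<bar> < e / 6"
      by (metis (mono_tags, lifting) eventually_sequentially order_refl)
    obtain i where i: "\<bar>F (u' j i) (v' j i) - r j\<bar> < e / 6"
      using LIMSEQ_D[OF q'[of j], of "e/6"] e by (auto)
    have "\<forall>\<^sub>F n in sequentially. \<bar>G n (u j) (v j) - F (u j) (v j)\<bar> < e / 6 \<and> \<bar>G n (u' j i) (v' j i) - F (u' j i) (v' j i)\<bar> < e / 6"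
      using tendstoD[OF FG, of "e/6"] tendstoD[OF FG, of "e/6"] e by (auto simp: dist_real_def intro: eventually_conj)
    then have "\<forall>\<^sub>F n in sequentially. norm (p n - q) < e"
    proof eventually_elim
      case (elim n)
      then show ?case using p(1)[of n j] p(2)[of n j i] j i by (simp only: real_norm_def) linarith
    qed
    then show "\<exists>N. \<forall>n\<ge>N. norm (p n - q) < e" unfolding eventually_sequentially .
  qed
  have margB: "(\<lambda>n. P.prob n {x\<in>space (P n). b < B n x}) \<longlonglongrightarrow> Q.prob {x\<in>space Q. b < B0 x}" for b
  proof (rule sandwich[of real "\<lambda>_. b" _ "\<lambda>j _. real j" "\<lambda>j i. - real i" _ "\<lambda>j. Q.prob {x\<in>space Q. A0 x \<le> real j}"])
    show "G n (real j) b \<le> P.prob n {x\<in>space (P n). b < B n x}" for n j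
      unfolding G_def by (intro P.finite_measure_mono) auto
    show "P.prob n {x\<in>space (P n). b < B n x} \<le> G n (real j) b + (1 - G n (real j) (- real i))" for n j i
    proof -
      have "P.prob n {x\<in>space (P n). b < B n x} \<le> P.prob n ({x\<in>space (P n). A n x \<le> real j \<and> b < B n x} \<union> (space (P n) - {x\<in>space (P n). A n x \<le> real j \<and> - real i < B n x}))"
        by (intro P.finite_measure_mono) auto
      also have "\<dots> \<le> G n (real j) b + P.prob n (space (P n) - {x\<in>space (P n). A n x \<le> real j \<and> - real i < B n x})"
        unfolding G_def by (intro measure_Un_le) auto
      also have "P.prob n (space (P n) - {x\<in>space (P n). A n x \<le> real j \<and> - real i < B n x}) = 1 - G n (real j) (- real i)"
        unfolding G_def by (intro P.prob_compl) measurable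
      finally show ?thesis .
    qed
  qed (use limA limB full in \<open>simp_all add: F_def\<close>)
  have margA: "(\<lambda>n. P.prob n {x\<in>space (P n). A n x \<le> a}) \<longlonglongrightarrow> Q.prob {x\<in>space Q. A0 x \<le> a}" for a
  proof (rule sandwich[of "\<lambda>_. a" "\<lambda>j. - real j" _ "\<lambda>_. real" "\<lambda>j i. - real j" _ "\<lambda>j. Q.prob {x\<in>space Q. - real j < B0 x}"])
    show "G n a (- real j) \<le> P.prob n {x\<in>space (P n). A n x \<le> a}" for n j
      unfolding G_def by (intro P.finite_measure_mono) auto
    show "P.prob n {x\<in>space (P n). A n x \<le> a} \<le> G n a (- real j) + (1 - G n (real i) (- real j))" for n j i
    proof -
      have "P.prob n {x\<in>space (P n). A n x \<le> a} \<le> P.prob n ({x\<in>space (P n). A n x \<le> a \<and> - real j < B n x} \<union> (space (P n) - {x\<in>space (P n). A n x \<le> real i \<and> - real j < B n x}))"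
        by (intro P.finite_measure_mono) auto
      also have "\<dots> \<le> G n a (- real j) + P.prob n (space (P n) - {x\<in>space (P n). A n x \<le> real i \<and> - real j < B n x})"
        unfolding G_def by (intro measure_Un_le) auto
      also have "P.prob n (space (P n) - {x\<in>space (P n). A n x \<le> real i \<and> - real j < B n x}) = 1 - G n (real i) (- real j)"
        unfolding G_def by (intro P.prob_compl) measurable
      finally show ?thesis .
    qed
  qed (use limA limB full in \<open>simp_all add: F_def\<close>)
  have one: "(\<integral>x. 1 \<partial>P n) = (1::real)" "(\<integral>x. 1 \<partial>Q) = (1::real)" for n
    by (simp_all add: P.prob_space Q.prob_space)
  have E1: "(\<lambda>n. \<integral>x. g1 (A n x) \<partial>P n) \<longlonglongrightarrow> (\<integral>x. g1 (A0 x) \<partial>Q)"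
  proof -
    have "(\<lambda>n. \<integral>x. 1 *\<^sub>R g1 (A n x) \<partial>P n) \<longlonglongrightarrow> (\<integral>x. 1 *\<^sub>R g1 (A0 x) \<partial>Q)"
    proof (rule weighted_weak_conv[OF P _ _ _ A Q _ _ _ _ A0 _ _ g1])
      show "(\<lambda>n. \<integral>x. (1::real) * indicator {..a} (A n x) \<partial>P n) \<longlonglongrightarrow> (\<integral>x. (1::real) * indicator {..a} (A0 x) \<partial>Q)" for a
        using margA[of a] by (simp add: integral_indicator_event_atMost[where R = "\<lambda>_. True", simplified])
    qed (simp_all add: one P.prob_space Q.prob_space)
    then show ?thesis by simp
  qed
  have E2: "(\<lambda>n. \<integral>x. g2 (B n x) \<partial>P n) \<longlonglongrightarrow> (\<integral>x. g2 (B0 x) \<partial>Q)"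
  proof -
    have "(\<lambda>n. \<integral>x. 1 *\<^sub>R g2 (B n x) \<partial>P n) \<longlonglongrightarrow> (\<integral>x. 1 *\<^sub>R g2 (B0 x) \<partial>Q)"
    proof (rule weighted_weak_conv[OF P _ _ _ B Q _ _ _ _ B0 _ _ g2])
      fix a
      have "P.prob n {x\<in>space (P n). B n x \<le> a} = 1 - P.prob n {x\<in>space (P n). a < B n x}" for n
        by (subst P.prob_compl[symmetric]) (auto intro!: arg_cong[where f = "measure _"])
      moreover have "Q.prob {x\<in>space Q. B0 x \<le> a} = 1 - Q.prob {x\<in>space Q. a < B0 x}"
        by (subst Q.prob_compl[symmetric]) (auto intro!: arg_cong[where f = "measure _"])
      ultimately have "(\<lambda>n. P.prob n {x\<in>space (P n). B n x \<le> a}) \<longlonglongrightarrow> Q.prob {x\<in>space Q. B0 x \<le> a}"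
        using tendsto_diff[OF tendsto_const margB[of a], of 1] by simp
      then show "(\<lambda>n. \<integral>x. (1::real) * indicator {..a} (B n x) \<partial>P n) \<longlonglongrightarrow> (\<integral>x. (1::real) * indicator {..a} (B0 x) \<partial>Q)"
        by (simp add: integral_indicator_event_atMost[where R = "\<lambda>_. True", simplified])
    qed (simp_all add: one P.prob_space Q.prob_space)
    then show ?thesis by simp
  qed
  have E3: "(\<lambda>n. \<integral>x. indicator {x. b < B n x} x *\<^sub>R g1 (A n x) \<partial>P n) \<longlonglongrightarrow> (\<integral>x. indicator {x. b < B0 x} x *\<^sub>R g1 (A0 x) \<partial>Q)" for b
  proof (rule weighted_weak_conv[OF P _ _ _ A Q _ _ _ _ A0 _ _ g1])
    show "(\<lambda>n. \<integral>x. indicator {x. b < B n x} x \<partial>P n) \<longlonglongrightarrow> (\<integral>x. indicator {x. b < B0 x} x \<partial>Q :: real)"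
      unfolding integral_indicator_event by (rule margB)
    show "0 < (\<integral>x. indicator {x. b < B0 x} x \<partial>Q :: real)" unfolding integral_indicator_event by (rule pos)
    show "(\<lambda>n. \<integral>x. indicator {x. b < B n x} x * indicator {..a} (A n x) \<partial>P n) \<longlonglongrightarrow> (\<integral>x. indicator {x. b < B0 x} x * indicator {..a} (A0 x) \<partial>Q :: real)" for a
      unfolding integral_indicator_event_atMost by (rule conv)
  qed (auto simp: indicator_def)
  have main: "(\<lambda>n. \<integral>x. \<phi> (g1 (A n x)) *\<^sub>R g2 (B n x) \<partial>P n) \<longlonglongrightarrow> (\<integral>x. \<phi> (g1 (A0 x)) *\<^sub>R g2 (B0 x) \<partial>Q)"
    if \<phi>: "bounded_linear \<phi>" "\<And>z. \<bar>\<phi> z\<bar> \<le> norm z" for \<phi> :: "complex \<Rightarrow> real"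
  proof -
    interpret \<phi>: bounded_linear \<phi> by (rule \<phi>)
    have [measurable]: "\<phi> \<in> borel_measurable borel"
      by (intro borel_measurable_continuous_onI \<phi>.continuous_on continuous_on_id)
    have bd: "\<bar>\<phi> (g1 x)\<bar> \<le> 1" for x using \<phi>(2)[of "g1 x"] g1(2)[of x] by linarith
    define h where "h n x = (2 + \<phi> (g1 (A n x))) / 3" for n x
    define k where "k x = (2 + \<phi> (g1 (A0 x))) / 3" for x
    have h: "1/3 \<le> h n x" "h n x \<le> 1" for n x using bd[of "A n x"] by (auto simp: h_def)
    have k: "1/3 \<le> k x" "k x \<le> 1" for x using bd[of "A0 x"] by (auto simp: k_def)
    have hk [measurable]: "h n \<in> borel_measurable (P n)" "k \<in> borel_measurable Q" for n
      unfolding h_def[abs_def] k_def[abs_def] by measurable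
    have lim: "(\<lambda>n. \<integral>x. h n x *\<^sub>R f (B n x) \<partial>P n) \<longlonglongrightarrow> (\<integral>x. k x *\<^sub>R f (B0 x) \<partial>Q)"
      if f_meas: "f \<in> borel_measurable borel" and f: "\<And>x. norm (f x) \<le> 1"
        and f0: "(\<lambda>n. \<integral>x. f (B n x) \<partial>P n) \<longlonglongrightarrow> (\<integral>x. f (B0 x) \<partial>Q)"
        and f1: "(\<lambda>n. \<integral>x. f (B n x) *\<^sub>R g1 (A n x) \<partial>P n) \<longlonglongrightarrow> (\<integral>x. f (B0 x) *\<^sub>R g1 (A0 x) \<partial>Q)"
      for f :: "real \<Rightarrow> real"
    proof -
      show ?thesis
        unfolding h_def k_def integral_affine_weight[OF P A B f_meas f g1_meas g1(2) \<phi>(1)]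
          integral_affine_weight[OF Q A0 B0 f_meas f g1_meas g1(2) \<phi>(1)]
        by (intro tendsto_intros f0 \<phi>.tendsto f1) simp
    qed
    have "(\<lambda>n. \<integral>x. h n x *\<^sub>R g2 (B n x) \<partial>P n) \<longlonglongrightarrow> (\<integral>x. k x *\<^sub>R g2 (B0 x) \<partial>Q)"
    proof (rule weighted_weak_conv[OF P _ _ _ B Q _ _ _ _ B0 _ _ g2])
      have l1: "(\<lambda>n. \<integral>x. h n x \<partial>P n) \<longlonglongrightarrow> (\<integral>x. k x \<partial>Q)"
        using lim[of "\<lambda>_. 1"] E1 by (simp add: one P.prob_space Q.prob_space)
      then show "(\<lambda>n. \<integral>x. h n x \<partial>P n) \<longlonglongrightarrow> (\<integral>x. k x \<partial>Q)" .
      have "(\<integral>x. 1 / 3 \<partial>Q) \<le> (\<integral>x. k x \<partial>Q)"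
        using k by (intro integral_mono Q.integrable_const_bound[of _ 1]) (auto intro!: AE_I2 simp: abs_le_iff intro: order_trans[of _ "1/3"])
      then show "0 < (\<integral>x. k x \<partial>Q)" by (simp add: Q.prob_space)
      fix b
      have "(\<lambda>n. \<integral>x. indicator {b<..} (B n x) \<partial>P n) \<longlonglongrightarrow> (\<integral>x. indicator {b<..} (B0 x) \<partial>Q :: real)"
        using margB[of b] by (simp add: integral_indicator_event[symmetric] indicator_def)
      then have "(\<lambda>n. \<integral>x. h n x * indicator {b<..} (B n x) \<partial>P n) \<longlonglongrightarrow> (\<integral>x. k x * indicator {b<..} (B0 x) \<partial>Q)"
        using lim[of "indicator {b<..}"] E3[of b] by (simp add: indicator_def)
      with l1 show "(\<lambda>n. \<integral>x. h n x * indicator {..b} (B n x) \<partial>P n) \<longlonglongrightarrow> (\<integral>x. k x * indicator {..b} (B0 x) \<partial>Q)"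
        unfolding integral_weight_atMost[OF P B hk(1) h] integral_weight_atMost[OF Q B0 hk(2) k] by (rule tendsto_diff)
    qed (use h k in \<open>auto intro: order_trans[of _ "1/3"]\<close>)
    then have "(\<lambda>n. 3 * (\<integral>x. h n x *\<^sub>R g2 (B n x) \<partial>P n) - 2 * (\<integral>x. g2 (B n x) \<partial>P n)) \<longlonglongrightarrow> 3 * (\<integral>x. k x *\<^sub>R g2 (B0 x) \<partial>Q) - 2 * (\<integral>x. g2 (B0 x) \<partial>Q)"
      by (intro tendsto_diff tendsto_mult tendsto_const E2)
    then show ?thesis
      unfolding h_def k_def
        integral_affine_weight_complex[OF P A B g1_meas g2_meas g1(2) g2(2) \<phi>]
        integral_affine_weight_complex[OF Q A0 B0 g1_meas g2_meas g1(2) g2(2) \<phi>] .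
  qed
  show ?thesis
    unfolding integral_mult_Re_Im[OF P A B g1_meas g2_meas g1(2) g2(2)]
      integral_mult_Re_Im[OF Q A0 B0 g1_meas g2_meas g1(2) g2(2)]
    by (intro tendsto_add tendsto_mult tendsto_const main bounded_linear_Re bounded_linear_Im abs_Re_le_cmod abs_Im_le_cmod)
qed

section \<open>Characters and logarithms of gamma variables\<close>

text \<open>Near \<open>0\<close> the character has positive real part, so halving its argument
  amounts to taking the principal square root. The angle of \<open>y e\<close> thus fixes the values
  at all dyadic multiples of \<open>e\<close>, and continuity fixes the rest.\<close>

lemma continuous_character:
  fixes y :: "real \<Rightarrow> complex"
  assumes cont: "\<And>u. isCont y u" and mult: "\<And>a b. y (a + b) = y a * y b" and norm: "\<And>u. norm (y u) = 1"
  obtains \<mu> where "\<And>u. y u = iexp (\<mu> * u)"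
proof -
  have y0: "y 0 = 1"
    using mult[of 0 0] norm[of 0] by auto
  obtain d where d: "d > 0" "\<And>u. \<bar>u\<bar> < d \<Longrightarrow> dist (y u) 1 < 1"
    using cont[of 0] unfolding continuous_at_eps_delta y0 dist_real_def by (metis diff_zero y0 zero_less_one)
  define e where "e = d / 2"
  have e: "e > 0" "\<And>n. \<bar>e / 2 ^ n\<bar> < d"
  proof -
    show "e > 0" using d by (simp add: e_def)
    fix n :: nat
    have "e / 2 ^ n \<le> e / 1" using \<open>e > 0\<close> by (intro divide_left_mono) auto
    then show "\<bar>e / 2 ^ n\<bar> < d" using d \<open>e > 0\<close> by (simp add: e_def)
  qed
  have Re_pos: "Re (y (e / 2 ^ n)) > 0" for n
  proof -
    have "\<bar>Re (y (e / 2 ^ n) - 1)\<bar> < 1"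
      using d(2)[OF e(2)[of n]] abs_Re_le_cmod[of "y (e / 2 ^ n) - 1"] by (simp add: dist_norm)
    then show ?thesis by simp
  qed
  define \<alpha> where "\<alpha> = Arg (y e)"
  have "y e \<noteq> 0" using norm[of e] by auto
  then have cis\<alpha>: "y e = cis \<alpha>" using norm[of e] cis_Arg[of "y e"] by (simp add: \<alpha>_def sgn_div_norm)
  have \<alpha>: "\<bar>\<alpha>\<bar> \<le> pi" using Arg_bounded[of "y e"] by (auto simp: \<alpha>_def)
  have dyadic: "y (e / 2 ^ n) = cis (\<alpha> / 2 ^ n)" for n
  proof (induction n)
    case (Suc n)
    have "(y (e / 2 ^ Suc n))\<^sup>2 = y (e / 2 ^ n)"
      using mult[of "e / 2 ^ Suc n" "e / 2 ^ Suc n"] by (simp add: power2_eq_square)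
    then have 1: "csqrt (y (e / 2 ^ n)) = y (e / 2 ^ Suc n)"
      using Re_pos[of "Suc n"] by (intro csqrt_unique) auto
    show ?case
    proof (cases "n = 0")
      \<comment> \<open>The bound on the principal argument leaves \<open>pi\<close> possible at the
        first halving; positivity of the real part of \<open>y e\<close> rules it out.\<close>
      case True
      have "\<bar>\<alpha>\<bar> < pi"
      proof (rule ccontr)
        assume "\<not> \<bar>\<alpha>\<bar> < pi"
        then have "\<alpha> = pi \<or> \<alpha> = - pi" using \<alpha> by linarith
        then have "Re (y e) = -1" unfolding cis\<alpha> by auto
        with Re_pos[of 0] show False by simp
      qed
      then have "Re (cis (\<alpha> / 2)) > 0" by (simp add: cos_gt_zero_pi)
      moreover have "(cis (\<alpha> / 2))\<^sup>2 = y e" by (simp add: cis\<alpha> power2_eq_square cis_mult)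
      ultimately have "csqrt (y e) = cis (\<alpha> / 2)" by (intro csqrt_unique) auto
      with 1 True show ?thesis by simp
    next
      case False
      have "\<bar>\<alpha> / 2 ^ Suc n\<bar> \<le> pi / 4"
      proof -
        have "(2::real) ^ 2 \<le> 2 ^ Suc n" using False by (intro power_increasing) auto
        then have "\<bar>\<alpha>\<bar> / 2 ^ Suc n \<le> pi / 2 ^ 2" using \<alpha> by (intro frac_le) auto
        then show ?thesis by (simp add: abs_divide)
      qed
      then have "- (pi / 2) < \<alpha> / 2 ^ Suc n \<and> \<alpha> / 2 ^ Suc n < pi / 2" using pi_gt_zero by linarith
      then have "Re (cis (\<alpha> / 2 ^ Suc n)) > 0" by (simp add: cos_gt_zero_pi)
      moreover have "(cis (\<alpha> / 2 ^ Suc n))\<^sup>2 = y (e / 2 ^ n)" unfolding Suc power2_eq_square cis_mult by simp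
      ultimately have "csqrt (y (e / 2 ^ n)) = cis (\<alpha> / 2 ^ Suc n)" by (intro csqrt_unique) auto
      with 1 show ?thesis by simp
    qed
  qed (simp add: cis\<alpha>)
  define \<mu> where "\<mu> = \<alpha> / e"
  have power: "y (real k * u) = y u ^ k" for k u
  proof (induction k)
    case (Suc k)
    have "y (real (Suc k) * u) = y (u + real k * u)" by (simp add: algebra_simps)
    then show ?case by (simp add: mult Suc)
  qed (simp add: y0)
  have grid: "y (real k * (e / 2 ^ n)) = iexp (\<mu> * (real k * (e / 2 ^ n)))" for k n
  proof -
    have "y (real k * (e / 2 ^ n)) = cis (real k * (\<alpha> / 2 ^ n))" by (simp only: power dyadic Complex.DeMoivre)
    also have "real k * (\<alpha> / 2 ^ n) = \<mu> * (real k * (e / 2 ^ n))" using e(1) by (simp add: \<mu>_def)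
    finally show ?thesis by (simp only: cis_conv_exp)
  qed
  have pos: "y u = iexp (\<mu> * u)" if u: "u \<ge> 0" for u
  proof -
    define p where "p n = real (nat \<lfloor>u / e * 2 ^ n\<rfloor>) * (e / 2 ^ n)" for n :: nat
    have p: "p \<longlonglongrightarrow> u"
    proof (rule tendsto_sandwich)
      have nn: "u / e * 2 ^ n \<ge> 0" for n :: nat using u e(1) by simp
      have eq: "p n = of_int \<lfloor>u / e * 2 ^ n\<rfloor> * (e / 2 ^ n)" for n
        unfolding p_def using nn[of n] by simp
      show "\<forall>\<^sub>F n in sequentially. u - e / 2 ^ n \<le> p n"
      proof (intro always_eventually allI)
        fix n :: nat
        have "(u / e * 2 ^ n - 1) * (e / 2 ^ n) \<le> p n"
          unfolding eq using e(1) by (intro mult_right_mono) (linarith, simp)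
        moreover have "(u / e * 2 ^ n - 1) * (e / 2 ^ n) = u - e / 2 ^ n" using e(1) by (simp add: field_simps)
        ultimately show "u - e / 2 ^ n \<le> p n" by simp
      qed
      show "\<forall>\<^sub>F n in sequentially. p n \<le> u"
      proof (intro always_eventually allI)
        fix n :: nat
        have "p n \<le> (u / e * 2 ^ n) * (e / 2 ^ n)"
          unfolding eq using e(1) by (intro mult_right_mono) auto
        then show "p n \<le> u" using e(1) by simp
      qed
      show "(\<lambda>n. u - e / 2 ^ n) \<longlonglongrightarrow> u" by real_asymp
    qed simp
    have "(\<lambda>n. y (p n)) \<longlonglongrightarrow> y u" by (rule isCont_tendsto_compose[OF cont p])
    moreover have "(\<lambda>n. y (p n)) \<longlonglongrightarrow> iexp (\<mu> * u)"
      unfolding p_def grid unfolding p_def[symmetric] by (intro tendsto_intros p)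
    ultimately show ?thesis by (rule LIMSEQ_unique)
  qed
  have "y u = iexp (\<mu> * u)" for u
  proof (cases "u \<ge> 0")
    case False
    have "y u * y (- u) = 1" using mult[of u "- u"] y0 by simp
    then have "y u * iexp (\<mu> * (- u)) = 1" using pos[of "- u"] False by simp
    then have "y u * iexp (\<mu> * (- u)) * iexp (\<mu> * u) = iexp (\<mu> * u)" by simp
    then show ?thesis unfolding mult.assoc mult_exp_exp by simp
  qed (rule pos)
  then show ?thesis by (rule that)
qed

text \<open>The Mellin transform of the law on the imaginary axis, or the characteristic function of
  the logarithm. Scaling a positive variable multiplies it by a character.\<close>

definition log_char :: "real measure \<Rightarrow> real \<Rightarrow> complex" where
  "log_char N u = (CLINT x|N. iexp (u * ln x))"

lemma log_char_distr:
  assumes "X \<in> borel_measurable N"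
  shows "log_char (distr N borel X) u = (CLINT x|N. iexp (u * ln (X x)))"
  unfolding log_char_def using assms by (subst integral_distr) auto

lemma log_char_eq_char:
  assumes "sets N = sets borel"
  shows "log_char N = char (distr N borel ln)"
proof
  fix u
  have [measurable_cong]: "sets N = sets borel" by fact
  show "log_char N u = char (distr N borel ln) u"
    unfolding log_char_def char_def by (subst integral_distr) auto
qed

text \<open>Euler's integral for the Gamma function at a complex argument of real part
  \<open>a\<close>. As Gamma has no zeros, it is safe to divide by this transform.\<close>

lemma log_char_gamma_measure:
  assumes a: "a > 0"
  shows "log_char (gamma_measure a 1) u = Gamma (of_real a + \<i> * of_real u) / of_real (Gamma a)"
proof -
  define z where "z = of_real a + \<i> * complex_of_real u"
  have z: "Re z > 0" using a by (simp add: z_def)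
  define f where "f x = gamma_density a 1 x *\<^sub>R iexp (u * ln x)" for x
  have "log_char (gamma_measure a 1) u = (\<integral>x. f x \<partial>lborel)"
    unfolding log_char_def gamma_measure_def f_def
    by (subst integral_density) (auto simp: gamma_density_nonneg[OF a])
  also have "\<dots> = Gamma z / of_real (Gamma a)"
  proof (rule has_integral_unique)
    have "integrable lborel (gamma_density a 1)"
      using nn_integral_gamma_density[OF a, of 1] gamma_density_nonneg[OF a]
      by (intro integrableI_nonneg) auto
    then have "integrable lborel f"
      unfolding f_def by (rule Bochner_Integration.integrable_bound) (auto simp: gamma_density_nonneg[OF a])
    then show "(f has_integral (\<integral>x. f x \<partial>lborel)) UNIV" by (rule has_integral_integral_lborel)
    have "((\<lambda>t. (of_real t powr (z - 1) / of_real (exp t)) / of_real (Gamma a)) has_integral Gamma z / of_real (Gamma a)) {0<..}"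
      by (intro has_integral_divide Gamma_integral_complex' z)
    then have "((\<lambda>t. if t \<in> {0<..} then (of_real t powr (z - 1) / of_real (exp t)) / of_real (Gamma a) else 0) has_integral Gamma z / of_real (Gamma a)) UNIV"
      by (simp only: has_integral_restrict_UNIV)
    moreover have "(if t \<in> {0<..} then (of_real t powr (z - 1) / of_real (exp t)) / of_real (Gamma a) else 0) = f t" for t
    proof (cases "t > 0")
      case True
      have "complex_of_real t powr (z - 1) = exp ((of_real (a - 1) + \<i> * of_real u) * of_real (ln t))"
        using True by (simp add: powr_def z_def Ln_of_real algebra_simps)
      also have "\<dots> = of_real (t powr (a - 1)) * iexp (u * ln t)"
        using True by (simp add: powr_def exp_of_real[symmetric] exp_add[symmetric] algebra_simps)
      finally show ?thesis
        using True by (simp add: f_def gamma_density_def scaleR_conv_of_real exp_minus field_simps)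
    qed (simp add: f_def gamma_density_def)
    ultimately show "(f has_integral Gamma z / of_real (Gamma a)) UNIV" by simp
  qed
  finally show ?thesis unfolding z_def .
qed

lemma log_char_gamma_measure_nonzero:
  assumes a: "a > 0"
  shows "log_char (gamma_measure a 1) u \<noteq> 0"
proof -
  have "of_real a + \<i> * complex_of_real u \<notin> \<int>\<^sub>\<le>\<^sub>0"
    using a by (auto elim!: nonpos_Ints_cases simp: complex_eq_iff)
  then have "Gamma (of_real a + \<i> * complex_of_real u) \<noteq> 0" by (simp only: Gamma_eq_zero_iff not_False_eq_True)
  moreover have "complex_of_real (Gamma a) \<noteq> 0" using Gamma_real_pos[OF a] by (simp only: of_real_eq_0_iff less_imp_neq[symmetric] not_False_eq_True)
  ultimately show ?thesis
    unfolding log_char_gamma_measure[OF a] divide_eq_0_iff by blast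
qed

section \<open>The limiting triple\<close>

lemma emeasure_exponential_greaterThan:
  assumes s: "s \<ge> 0"
  shows "emeasure (gamma_measure 1 1) {s<..} = ennreal (exp (- s))"
proof -
  have "emeasure (gamma_measure 1 1) {s<..} = (\<integral>\<^sup>+x. ennreal (gamma_density 1 1 x) * indicator {s<..} x \<partial>lborel)"
    by (simp add: gamma_measure_def emeasure_density)
  also have "\<dots> = (\<integral>\<^sup>+x. ennreal (exp (- x)) * indicator {s..} x \<partial>lborel)"
    using s by (intro nn_integral_cong_AE eventually_mono[OF AE_lborel_singleton[of s]]) (auto simp: indicator_def gamma_density_def)
  also have "\<dots> = ennreal (0 - (- exp (- s)))"
  proof (rule nn_integral_FTC_atLeast)
    show "((\<lambda>x. - exp (- x)) \<longlongrightarrow> (0::real)) at_top" by real_asymp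
  qed (auto intro!: derivative_eq_intros)
  finally show ?thesis by simp
qed

lemma nn_integral_exponential_tail:
  assumes "r \<ge> 0" "t \<ge> 0"
  shows "(\<integral>\<^sup>+x. ennreal (exp (- t * x)) * indicator {r..} x \<partial>gamma_measure 1 1) = ennreal (exp (- (1 + t) * r) / (1 + t))"
proof -
  have "(\<integral>\<^sup>+x. ennreal (exp (- t * x)) * indicator {r..} x \<partial>gamma_measure 1 1)
    = (\<integral>\<^sup>+x. ennreal (gamma_density 1 1 x) * (ennreal (exp (- t * x)) * indicator {r..} x) \<partial>lborel)"
    by (rule nn_integral_gamma_measure) simp
  also have "\<dots> = (\<integral>\<^sup>+x. ennreal (exp (- (1 + t) * x)) * indicator {r..} x \<partial>lborel)"
    using assms(1)
    by (intro nn_integral_cong_AE eventually_mono[OF AE_lborel_singleton[of 0]])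
      (auto simp: indicator_def gamma_density_def ennreal_mult'[symmetric] exp_add[symmetric] algebra_simps)
  also have "\<dots> = ennreal (0 - (- exp (- (1 + t) * r) / (1 + t)))"
  proof (rule nn_integral_FTC_atLeast)
    have "((\<lambda>x. - exp (- (c * x)) / c) \<longlongrightarrow> 0) at_top" if "c > 0" for c :: real
      using that by real_asymp
    from this[of "1 + t"] show "((\<lambda>x. - exp (- (1 + t) * x) / (1 + t)) \<longlongrightarrow> 0) at_top" using assms by (simp only: minus_mult_left)
    have d: "((\<lambda>x. - exp (- c * x) / c) has_real_derivative exp (- c * x)) (at x)" if "c \<noteq> 0" for c x :: real
      using that by (auto intro!: derivative_eq_intros)
    show "((\<lambda>x. - exp (- (1 + t) * x) / (1 + t)) has_real_derivative exp (- (1 + t) * x)) (at x)" for x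
      by (rule d) (use assms in simp)
  qed simp_all
  finally show ?thesis by simp
qed

lemma nn_integral_gamma_exp:
  assumes a: "a > 0" and s: "s \<ge> 0"
  shows "(\<integral>\<^sup>+x. ennreal (exp (- s * x)) \<partial>gamma_measure a 1) = ennreal ((1 + s) powr (- a))"
proof -
  have "(\<integral>\<^sup>+x. ennreal (exp (- s * x)) \<partial>gamma_measure a 1) = (\<integral>\<^sup>+x. ennreal (gamma_density a 1 x) * ennreal (exp (- s * x)) \<partial>lborel)"
    by (rule nn_integral_gamma_measure) simp
  also have "\<dots> = (\<integral>\<^sup>+x. ennreal ((1 + s) powr (- a)) * ennreal (gamma_density a (1 + s) x) \<partial>lborel)"
  proof (intro nn_integral_cong)
    fix x
    have "gamma_density a 1 x * exp (- s * x) = (1 + s) powr (- a) * gamma_density a (1 + s) x"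
      using s by (auto simp: gamma_density_def powr_minus exp_add[symmetric] field_simps)
    then show "ennreal (gamma_density a 1 x) * ennreal (exp (- s * x)) = ennreal ((1 + s) powr (- a)) * ennreal (gamma_density a (1 + s) x)"
      using gamma_density_nonneg[OF a] by (simp add: ennreal_mult'[symmetric] ennreal_mult''[symmetric])
  qed
  also have "\<dots> = ennreal ((1 + s) powr (- a)) * (\<integral>\<^sup>+x. ennreal (gamma_density a (1 + s) x) \<partial>lborel)"
    by (rule nn_integral_cmult) simp
  also have "\<dots> = ennreal ((1 + s) powr (- a))"
    using s by (subst nn_integral_gamma_density[OF a]) auto
  finally show ?thesis .
qed

text \<open>
  With \<open>b = exp (- x / \<theta>)\<close> the integrand is the derivative of \<open>- (b / (1 + t b)) powr \<theta>\<close>.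
\<close>

lemma nn_integral_exponential_beta:
  assumes \<theta>: "\<theta> > 0" and t: "t > 0"
  shows "(\<integral>\<^sup>+x. ennreal ((1 + t * exp (- x / \<theta>)) powr (- \<theta> - 1)) \<partial>gamma_measure 1 1) = ennreal ((1 + t) powr (- \<theta>))"
proof -
  define F where "F x = - exp (- x) * (1 + t * exp (- x / \<theta>)) powr (- \<theta>)" for x :: real
  have pos: "1 + t * exp (- x / \<theta>) > 0" for x using t by (simp add: add_pos_pos)
  have "(\<integral>\<^sup>+x. ennreal ((1 + t * exp (- x / \<theta>)) powr (- \<theta> - 1)) \<partial>gamma_measure 1 1)
    = (\<integral>\<^sup>+x. ennreal (gamma_density 1 1 x) * ennreal ((1 + t * exp (- x / \<theta>)) powr (- \<theta> - 1)) \<partial>lborel)"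
    by (rule nn_integral_gamma_measure) simp
  also have "\<dots> = (\<integral>\<^sup>+x. ennreal (exp (- x) * (1 + t * exp (- x / \<theta>)) powr (- \<theta> - 1)) * indicator {0..} x \<partial>lborel)"
    by (intro nn_integral_cong_AE eventually_mono[OF AE_lborel_singleton[of 0]])
      (auto simp: indicator_def gamma_density_def ennreal_mult'[symmetric])
  also have "\<dots> = ennreal (0 - F 0)"
  proof (rule nn_integral_FTC_atLeast)
    fix x
    have "(F has_real_derivative exp (- x) * (1 + t * exp (- x / \<theta>)) powr (- \<theta>)
        - exp (- x) * ((- \<theta>) * (1 + t * exp (- x / \<theta>)) powr (- \<theta> - 1) * (t * (exp (- x / \<theta>) * (- 1 / \<theta>))))) (at x)"
      unfolding F_def using pos[of x] by (auto intro!: derivative_eq_intros)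
    moreover have "(1 + t * exp (- x / \<theta>)) powr (- \<theta>) = (1 + t * exp (- x / \<theta>)) powr (- \<theta> - 1) * (1 + t * exp (- x / \<theta>))"
      using pos[of x] by (simp add: powr_diff less_imp_le less_imp_neq[symmetric])
    moreover have "exp (- x) * (p * (1 + t * b)) - exp (- x) * ((- \<theta>) * p * (t * (b * (- 1 / \<theta>)))) = exp (- x) * p" for p b
      using \<theta> by (simp add: field_simps)
    ultimately show "(F has_real_derivative exp (- x) * (1 + t * exp (- x / \<theta>)) powr (- \<theta> - 1)) (at x)"
      by (simp only:)
    show "0 \<le> exp (- x) * (1 + t * exp (- x / \<theta>)) powr (- \<theta> - 1)" by simp
  next
    have "(F \<longlongrightarrow> - 0 * (1 + t * 0) powr (- \<theta>)) at_top"
      unfolding F_def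
    proof (intro tendsto_mult tendsto_minus tendsto_powr tendsto_add tendsto_const)
      show "((\<lambda>x. exp (- x)) \<longlongrightarrow> (0::real)) at_top" by real_asymp
      show "((\<lambda>x. exp (- x / \<theta>)) \<longlongrightarrow> 0) at_top" using \<theta> by real_asymp
    qed simp
    then show "(F \<longlongrightarrow> 0) at_top" by simp
  qed simp
  finally show ?thesis by (simp add: F_def)
qed

lemma (in pair_prob_space) integral_product:
  fixes f :: "'a \<Rightarrow> complex" and g :: "'b \<Rightarrow> complex"
  assumes [measurable]: "f \<in> borel_measurable M1" "g \<in> borel_measurable M2"
    and f: "\<And>x. norm (f x) \<le> 1" and g: "\<And>x. norm (g x) \<le> 1"
  shows "(\<integral>w. (case w of (x, y) \<Rightarrow> f x * g y) \<partial>(M1 \<Otimes>\<^sub>M M2)) = (\<integral>x. f x \<partial>M1) * (\<integral>y. g y \<partial>M2)"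
proof -
  have "integrable (M1 \<Otimes>\<^sub>M M2) (\<lambda>w. case w of (x, y) \<Rightarrow> f x * g y)"
    by (rule integrable_const_bound[of _ 1]) (use f g in \<open>auto simp: norm_mult intro!: AE_I2 mult_le_one split: prod.split\<close>)
  then have "(\<integral>w. (case w of (x, y) \<Rightarrow> f x * g y) \<partial>(M1 \<Otimes>\<^sub>M M2)) = (\<integral>x. \<integral>y. f x * g y \<partial>M2 \<partial>M1)"
    by (rule integral_fst'[symmetric, of "\<lambda>w. case w of (x, y) \<Rightarrow> f x * g y", unfolded prod.case])
  then show ?thesis by simp
qed

locale limiting_triple =
  fixes \<theta> :: real
  assumes \<theta>: "\<theta> > 0"
begin

text \<open>Modelled on a gamma process that jumps at time \<open>1\<close>: \<open>y\<close> is its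
  value before the jump and \<open>x\<close> the exponential jump. The next jump comes at time
  \<open>exp (v / \<theta>)\<close>, because no jump between \<open>1\<close> and \<open>s\<close>
  has probability s^(-\<theta>), and its size is an exponential \<open>z\<close> scaled by that
  time. This is the origin of the summand \<open>v / \<theta>\<close> in \<open>logZ\<close>;
  \<open>logR\<close> belongs to the value after the first jump.\<close>

definition Q :: "(real \<times> real \<times> real \<times> real) measure" where
  "Q = gamma_measure 1 1 \<Otimes>\<^sub>M gamma_measure \<theta> 1 \<Otimes>\<^sub>M gamma_measure 1 1 \<Otimes>\<^sub>M gamma_measure 1 1"

definition logY :: "real \<times> real \<times> real \<times> real \<Rightarrow> real" where "logY = (\<lambda>(v, y, x, z). ln y)"
definition logX :: "real \<times> real \<times> real \<times> real \<Rightarrow> real" where "logX = (\<lambda>(v, y, x, z). ln x)"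
definition logZ :: "real \<times> real \<times> real \<times> real \<Rightarrow> real" where "logZ = (\<lambda>(v, y, x, z). ln z + v / \<theta>)"
definition logR :: "real \<times> real \<times> real \<times> real \<Rightarrow> real" where "logR = (\<lambda>(v, y, x, z). ln (y + x))"

sublocale E: prob_space "gamma_measure 1 1" by (rule prob_space_gamma_measure) simp_all
sublocale G: prob_space "gamma_measure \<theta> 1" by (rule prob_space_gamma_measure) (simp_all add: \<theta>)
sublocale EE: pair_prob_space "gamma_measure 1 1" "gamma_measure 1 1" ..
sublocale GEE: pair_prob_space "gamma_measure \<theta> 1" "gamma_measure 1 1 \<Otimes>\<^sub>M gamma_measure 1 1" ..
sublocale EGEE: pair_prob_space "gamma_measure 1 1" "gamma_measure \<theta> 1 \<Otimes>\<^sub>M gamma_measure 1 1 \<Otimes>\<^sub>M gamma_measure 1 1" ..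

lemma prob_space_Q: "prob_space Q" unfolding Q_def by (rule EGEE.prob_space_axioms)

lemma sets_Q [measurable_cong]: "sets Q = sets (borel \<Otimes>\<^sub>M borel \<Otimes>\<^sub>M borel \<Otimes>\<^sub>M borel)"
  unfolding Q_def by (intro sets_pair_measure_cong sets_gamma_measure)

lemma space_Q [simp]: "space Q = UNIV" by (simp add: Q_def space_pair_measure)

lemma measurable_logs [measurable]: "logY \<in> borel_measurable Q" "logX \<in> borel_measurable Q"
  "logZ \<in> borel_measurable Q" "logR \<in> borel_measurable Q"
  unfolding logY_def logX_def logZ_def logR_def by measurable

lemma nn_integral_Q:
  assumes [measurable]: "f \<in> borel_measurable (borel \<Otimes>\<^sub>M borel \<Otimes>\<^sub>M borel \<Otimes>\<^sub>M borel)"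
  shows "(\<integral>\<^sup>+w. f w \<partial>Q) = (\<integral>\<^sup>+v. \<integral>\<^sup>+y. \<integral>\<^sup>+x. \<integral>\<^sup>+z. f (v, y, x, z) \<partial>gamma_measure 1 1 \<partial>gamma_measure 1 1 \<partial>gamma_measure \<theta> 1 \<partial>gamma_measure 1 1)"
proof -
  have [measurable_cong]: "sets (gamma_measure 1 1) = sets borel" "sets (gamma_measure \<theta> 1) = sets borel" by simp_all
  have "(\<integral>\<^sup>+w. f w \<partial>Q) = (\<integral>\<^sup>+v. \<integral>\<^sup>+w. f (v, w) \<partial>(gamma_measure \<theta> 1 \<Otimes>\<^sub>M gamma_measure 1 1 \<Otimes>\<^sub>M gamma_measure 1 1) \<partial>gamma_measure 1 1)"
    unfolding Q_def by (rule GEE.P.nn_integral_fst[symmetric]) measurable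
  also have "\<dots> = (\<integral>\<^sup>+v. \<integral>\<^sup>+y. \<integral>\<^sup>+w. f (v, y, w) \<partial>(gamma_measure 1 1 \<Otimes>\<^sub>M gamma_measure 1 1) \<partial>gamma_measure \<theta> 1 \<partial>gamma_measure 1 1)"
    by (intro nn_integral_cong EE.P.nn_integral_fst[symmetric]) measurable
  also have "\<dots> = (\<integral>\<^sup>+v. \<integral>\<^sup>+y. \<integral>\<^sup>+x. \<integral>\<^sup>+z. f (v, y, x, z) \<partial>gamma_measure 1 1 \<partial>gamma_measure 1 1 \<partial>gamma_measure \<theta> 1 \<partial>gamma_measure 1 1)"
    by (intro nn_integral_cong E.nn_integral_fst[symmetric]) measurable
  finally show ?thesis .
qed

text \<open>The variables are integrated out in the order \<open>z\<close>, \<open>x\<close>,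
  \<open>y\<close>, \<open>v\<close>. The first two leave an exponential in \<open>y\<close>, the
  gamma law turns it into a power, and \<open>nn_integral_exponential_beta\<close> does the last
  integral. The result factorises, as it must: the absence of Poisson points below and above a given
  point are independent events.\<close>

lemma prob_logs:
  "measure Q {w\<in>space Q. logY w - logX w \<le> a \<and> b < logZ w - logR w} = (1 + exp (- a)) powr (- \<theta>) * (1 + exp b) powr (- \<theta>)"
proof -
  define S where "S = {w\<in>space Q. logY w - logX w \<le> a \<and> b < logZ w - logR w}"
  have [measurable]: "S \<in> sets Q" unfolding S_def by measurable
  define \<rho> where "\<rho> = exp (- a)"
  define \<tau> where "\<tau> v = exp b * exp (- v / \<theta>)" for v
  have \<rho>: "\<rho> > 0" and \<tau>: "\<And>v. \<tau> v > 0" by (simp_all add: \<rho>_def \<tau>_def)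
  have memS: "indicator S (v, y, x, z) = (indicator {\<rho> * y..} x * indicator {\<tau> v * (y + x)<..} z :: ennreal)"
    if "y > 0" "x > 0" "z > 0" for v y x z
  proof -
    have "ln y - ln x \<le> a \<longleftrightarrow> ln (\<rho> * y) \<le> ln x"
      using that \<rho> by (auto simp: ln_mult \<rho>_def)
    then have 1: "ln y - ln x \<le> a \<longleftrightarrow> \<rho> * y \<le> x"
      using that \<rho> by simp
    have "b < ln z + v / \<theta> - ln (y + x) \<longleftrightarrow> ln (\<tau> v * (y + x)) < ln z"
      using that \<tau>[of v] by (auto simp: ln_mult \<tau>_def)
    then have 2: "b < ln z + v / \<theta> - ln (y + x) \<longleftrightarrow> \<tau> v * (y + x) < z"
      using that \<tau>[of v] by (simp add: add_pos_pos)
    show ?thesis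
      by (auto simp: S_def logY_def logX_def logZ_def logR_def indicator_def 1 2)
  qed
  have "emeasure Q S = (\<integral>\<^sup>+w. indicator S w \<partial>Q)" by simp
  also have "\<dots> = (\<integral>\<^sup>+v. \<integral>\<^sup>+y. \<integral>\<^sup>+x. \<integral>\<^sup>+z. indicator S (v, y, x, z) \<partial>gamma_measure 1 1 \<partial>gamma_measure 1 1 \<partial>gamma_measure \<theta> 1 \<partial>gamma_measure 1 1)"
    by (rule nn_integral_Q) measurable
  also have "\<dots> = (\<integral>\<^sup>+v. ennreal ((1 + \<rho>) powr (- \<theta>)) * ennreal ((1 + \<tau> v) powr (- \<theta> - 1)) \<partial>gamma_measure 1 1)"
  proof (rule nn_integral_cong)
    fix v
    define t where "t = \<tau> v"
    have t: "t > 0" using \<tau> by (simp add: t_def)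
    have "(\<integral>\<^sup>+y. \<integral>\<^sup>+x. \<integral>\<^sup>+z. indicator S (v, y, x, z) \<partial>gamma_measure 1 1 \<partial>gamma_measure 1 1 \<partial>gamma_measure \<theta> 1)
      = (\<integral>\<^sup>+y. ennreal (1 / (1 + t)) * ennreal (exp (- (t + (1 + t) * \<rho>) * y)) \<partial>gamma_measure \<theta> 1)"
    proof (intro nn_integral_cong_AE eventually_mono[OF AE_gamma_measure_pos])
      fix y :: real assume y: "y > 0"
      have "(\<integral>\<^sup>+x. \<integral>\<^sup>+z. indicator S (v, y, x, z) \<partial>gamma_measure 1 1 \<partial>gamma_measure 1 1)
        = (\<integral>\<^sup>+x. ennreal (exp (- t * y)) * (ennreal (exp (- t * x)) * indicator {\<rho> * y..} x) \<partial>gamma_measure 1 1)"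
      proof (intro nn_integral_cong_AE eventually_mono[OF AE_gamma_measure_pos])
        fix x :: real assume x: "x > 0"
        have "(\<integral>\<^sup>+z. indicator S (v, y, x, z) \<partial>gamma_measure 1 1)
          = (\<integral>\<^sup>+z. indicator {\<rho> * y..} x * indicator {t * (y + x)<..} z \<partial>gamma_measure 1 1)"
          unfolding t_def by (intro nn_integral_cong_AE eventually_mono[OF AE_gamma_measure_pos] memS x y)
        also have "\<dots> = indicator {\<rho> * y..} x * ennreal (exp (- (t * (y + x))))"
          using t x y by (subst nn_integral_cmult_indicator) (simp_all add: emeasure_exponential_greaterThan)
        also have "exp (- (t * (y + x))) = exp (- t * y) * exp (- t * x)"
          by (simp add: exp_add[symmetric] algebra_simps)
        finally show "(\<integral>\<^sup>+z. indicator S (v, y, x, z) \<partial>gamma_measure 1 1)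
          = ennreal (exp (- t * y)) * (ennreal (exp (- t * x)) * indicator {\<rho> * y..} x)"
          by (simp add: ennreal_mult mult_ac)
      qed
      also have "\<dots> = ennreal (exp (- t * y)) * (\<integral>\<^sup>+x. ennreal (exp (- t * x)) * indicator {\<rho> * y..} x \<partial>gamma_measure 1 1)"
        by (rule nn_integral_cmult) simp
      also have "(\<integral>\<^sup>+x. ennreal (exp (- t * x)) * indicator {\<rho> * y..} x \<partial>gamma_measure 1 1) = ennreal (exp (- (1 + t) * (\<rho> * y)) / (1 + t))"
        by (rule nn_integral_exponential_tail) (use \<rho> y t in auto)
      also have "ennreal (exp (- t * y)) * ennreal (exp (- (1 + t) * (\<rho> * y)) / (1 + t)) = ennreal (exp (- t * y) * (exp (- (1 + t) * (\<rho> * y)) / (1 + t)))"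
        using t by (intro ennreal_mult[symmetric]) auto
      also have "exp (- t * y) * (exp (- (1 + t) * (\<rho> * y)) / (1 + t)) = 1 / (1 + t) * exp (- (t + (1 + t) * \<rho>) * y)"
        by (simp add: exp_add[symmetric] algebra_simps)
      also have "ennreal (1 / (1 + t) * exp (- (t + (1 + t) * \<rho>) * y)) = ennreal (1 / (1 + t)) * ennreal (exp (- (t + (1 + t) * \<rho>) * y))"
        using t by (intro ennreal_mult) auto
      finally show "(\<integral>\<^sup>+x. \<integral>\<^sup>+z. indicator S (v, y, x, z) \<partial>gamma_measure 1 1 \<partial>gamma_measure 1 1)
        = ennreal (1 / (1 + t)) * ennreal (exp (- (t + (1 + t) * \<rho>) * y))" .
    qed
    also have "\<dots> = ennreal (1 / (1 + t)) * (\<integral>\<^sup>+y. ennreal (exp (- (t + (1 + t) * \<rho>) * y)) \<partial>gamma_measure \<theta> 1)"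
      by (rule nn_integral_cmult) simp
    also have "(\<integral>\<^sup>+y. ennreal (exp (- (t + (1 + t) * \<rho>) * y)) \<partial>gamma_measure \<theta> 1) = ennreal ((1 + (t + (1 + t) * \<rho>)) powr (- \<theta>))"
      by (rule nn_integral_gamma_exp[OF \<theta>]) (use t \<rho> in auto)
    also have "1 + (t + (1 + t) * \<rho>) = (1 + \<rho>) * (1 + t)" by (simp add: algebra_simps)
    also have "ennreal (1 / (1 + t)) * ennreal (((1 + \<rho>) * (1 + t)) powr (- \<theta>)) = ennreal (1 / (1 + t) * ((1 + \<rho>) * (1 + t)) powr (- \<theta>))"
      using t by (intro ennreal_mult[symmetric]) auto
    also have "1 / (1 + t) * ((1 + \<rho>) * (1 + t)) powr (- \<theta>) = (1 + \<rho>) powr (- \<theta>) * (1 + t) powr (- \<theta> - 1)"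
      using t \<rho> by (simp add: powr_mult powr_diff)
    also have "ennreal ((1 + \<rho>) powr (- \<theta>) * (1 + t) powr (- \<theta> - 1)) = ennreal ((1 + \<rho>) powr (- \<theta>)) * ennreal ((1 + t) powr (- \<theta> - 1))"
      by (intro ennreal_mult) auto
    finally show "(\<integral>\<^sup>+y. \<integral>\<^sup>+x. \<integral>\<^sup>+z. indicator S (v, y, x, z) \<partial>gamma_measure 1 1 \<partial>gamma_measure 1 1 \<partial>gamma_measure \<theta> 1)
      = ennreal ((1 + \<rho>) powr (- \<theta>)) * ennreal ((1 + \<tau> v) powr (- \<theta> - 1))"
      unfolding t_def .
  qed
  also have "\<dots> = ennreal ((1 + \<rho>) powr (- \<theta>)) * (\<integral>\<^sup>+v. ennreal ((1 + \<tau> v) powr (- \<theta> - 1)) \<partial>gamma_measure 1 1)"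
    unfolding \<tau>_def by (rule nn_integral_cmult) simp
  also have "(\<integral>\<^sup>+v. ennreal ((1 + \<tau> v) powr (- \<theta> - 1)) \<partial>gamma_measure 1 1) = ennreal ((1 + exp b) powr (- \<theta>))"
    unfolding \<tau>_def by (rule nn_integral_exponential_beta[OF \<theta>]) simp
  also have "ennreal ((1 + \<rho>) powr (- \<theta>)) * ennreal ((1 + exp b) powr (- \<theta>)) = ennreal ((1 + \<rho>) powr (- \<theta>) * (1 + exp b) powr (- \<theta>))"
    by (intro ennreal_mult[symmetric]) auto
  finally show ?thesis
    unfolding measure_def S_def[symmetric] \<rho>_def by (simp only:) simp
qed

lemma prob_logZ_pos: "measure Q {w\<in>space Q. b < logZ w - logR w} > 0"
proof -
  interpret Q: prob_space Q by (rule prob_space_Q)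
  have "0 < measure Q {w\<in>space Q. logY w - logX w \<le> 0 \<and> b < logZ w - logR w}"
    unfolding prob_logs by (simp add: add_pos_pos add_nonneg_eq_0_iff)
  also have "\<dots> \<le> measure Q {w\<in>space Q. b < logZ w - logR w}"
  proof (rule Q.finite_measure_mono)
    show "{w\<in>space Q. b < logZ w - logR w} \<in> Q.events" by measurable
  qed auto
  finally show ?thesis .
qed

lemma AE_Q_pos: "AE w in Q. case w of (v, y, x, z) \<Rightarrow> 0 < y \<and> 0 < x"
proof -
  define S where "S = {w\<in>space Q. \<not> (case w of (v, y, x, z) \<Rightarrow> 0 < y \<and> 0 < x)}"
  have [measurable]: "S \<in> sets Q" unfolding S_def by measurable
  have "(\<integral>\<^sup>+w. indicator S w \<partial>Q) = (\<integral>\<^sup>+v. \<integral>\<^sup>+y. \<integral>\<^sup>+x. \<integral>\<^sup>+z. indicator S (v, y, x, z) \<partial>gamma_measure 1 1 \<partial>gamma_measure 1 1 \<partial>gamma_measure \<theta> 1 \<partial>gamma_measure 1 1)"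
    by (rule nn_integral_Q) measurable
  also have "\<dots> = (\<integral>\<^sup>+v. \<integral>\<^sup>+y. \<integral>\<^sup>+x. \<integral>\<^sup>+z. 0 \<partial>gamma_measure 1 1 \<partial>gamma_measure 1 1 \<partial>gamma_measure \<theta> 1 \<partial>gamma_measure 1 1)"
    by (intro nn_integral_cong nn_integral_cong_AE eventually_mono[OF AE_gamma_measure_pos]) (auto simp: S_def indicator_def)
  finally have "emeasure Q S = 0" by simp
  then show ?thesis by (rule AE_I[of _ _ S, rotated]) (simp_all add: S_def[symmetric], simp add: S_def)
qed

lemma integral_logs:
  "(CLINT w|Q. iexp (u * logY w) * iexp (s * logX w) * iexp (t * logZ w))
    = log_char (gamma_measure \<theta> 1) u * log_char (gamma_measure 1 1) s * (log_char (gamma_measure 1 1) t * char (gamma_measure 1 1) (t / \<theta>))"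
proof -
  have iexp_add: "iexp (a + b) = iexp a * iexp b" for a b :: real
    by (simp add: exp_add[symmetric] distrib_left)
  have "(CLINT w|Q. iexp (u * logY w) * iexp (s * logX w) * iexp (t * logZ w))
    = (\<integral>w. (case w of (v, w') \<Rightarrow> iexp (t / \<theta> * v) * (case w' of (y, w'') \<Rightarrow> iexp (u * ln y) * (case w'' of (x, z) \<Rightarrow> iexp (s * ln x) * iexp (t * ln z)))) \<partial>Q)"
  proof (intro Bochner_Integration.integral_cong refl)
    fix w :: "real \<times> real \<times> real \<times> real"
    obtain v y x z where w: "w = (v, y, x, z)" by (cases w)
    have "t * (ln z + v / \<theta>) = t / \<theta> * v + t * ln z" by (simp add: distrib_left)
    then have "iexp (t * (ln z + v / \<theta>)) = iexp (t / \<theta> * v) * iexp (t * ln z)" by (simp only: iexp_add)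
    then show "iexp (u * logY w) * iexp (s * logX w) * iexp (t * logZ w)
      = (case w of (v, w') \<Rightarrow> iexp (t / \<theta> * v) * (case w' of (y, w'') \<Rightarrow> iexp (u * ln y) * (case w'' of (x, z) \<Rightarrow> iexp (s * ln x) * iexp (t * ln z))))"
      unfolding w logY_def logX_def logZ_def prod.case by (simp only: mult_ac)
  qed
  also have "\<dots> = (\<integral>v. iexp (t / \<theta> * v) \<partial>gamma_measure 1 1) * (\<integral>w'. (case w' of (y, w'') \<Rightarrow> iexp (u * ln y) * (case w'' of (x, z) \<Rightarrow> iexp (s * ln x) * iexp (t * ln z))) \<partial>(gamma_measure \<theta> 1 \<Otimes>\<^sub>M gamma_measure 1 1 \<Otimes>\<^sub>M gamma_measure 1 1))"
    unfolding Q_def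
  proof (rule EGEE.integral_product)
    show "cmod (case w' of (y, w'') \<Rightarrow> iexp (u * ln y) * (case w'' of (x, z) \<Rightarrow> iexp (s * ln x) * iexp (t * ln z))) \<le> 1" for w' :: "real \<times> real \<times> real"
      by (cases w') (simp only: prod.case norm_mult norm_exp_i_times mult_1_left order_refl)
    show "(\<lambda>v. iexp (t / \<theta> * v)) \<in> borel_measurable (gamma_measure 1 1)" by measurable
    show "(\<lambda>w'. case w' of (y, w'') \<Rightarrow> iexp (u * ln y) * (case w'' of (x, z) \<Rightarrow> iexp (s * ln x) * iexp (t * ln z)))
      \<in> borel_measurable (gamma_measure \<theta> 1 \<Otimes>\<^sub>M gamma_measure 1 1 \<Otimes>\<^sub>M gamma_measure 1 1)" by measurable
    show "cmod (iexp (t / \<theta> * v)) \<le> 1" for v by (simp only: norm_exp_i_times order_refl)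
  qed
  also have "(\<integral>w'. (case w' of (y, w'') \<Rightarrow> iexp (u * ln y) * (case w'' of (x, z) \<Rightarrow> iexp (s * ln x) * iexp (t * ln z))) \<partial>(gamma_measure \<theta> 1 \<Otimes>\<^sub>M gamma_measure 1 1 \<Otimes>\<^sub>M gamma_measure 1 1))
    = (\<integral>y. iexp (u * ln y) \<partial>gamma_measure \<theta> 1) * (\<integral>w''. (case w'' of (x, z) \<Rightarrow> iexp (s * ln x) * iexp (t * ln z)) \<partial>(gamma_measure 1 1 \<Otimes>\<^sub>M gamma_measure 1 1))"
  proof (rule GEE.integral_product)
    show "cmod (case w'' of (x, z) \<Rightarrow> iexp (s * ln x) * iexp (t * ln z)) \<le> 1" for w'' :: "real \<times> real"
      by (cases w'') (simp only: prod.case norm_mult norm_exp_i_times mult_1_left order_refl)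
    show "(\<lambda>y. iexp (u * ln y)) \<in> borel_measurable (gamma_measure \<theta> 1)" by measurable
    show "(\<lambda>w''. case w'' of (x, z) \<Rightarrow> iexp (s * ln x) * iexp (t * ln z)) \<in> borel_measurable (gamma_measure 1 1 \<Otimes>\<^sub>M gamma_measure 1 1)"
      by measurable
    show "cmod (iexp (u * ln y)) \<le> 1" for y by (simp only: norm_exp_i_times order_refl)
  qed
  also have "(\<integral>w''. (case w'' of (x, z) \<Rightarrow> iexp (s * ln x) * iexp (t * ln z)) \<partial>(gamma_measure 1 1 \<Otimes>\<^sub>M gamma_measure 1 1))
    = (\<integral>x. iexp (s * ln x) \<partial>gamma_measure 1 1) * (\<integral>z. iexp (t * ln z) \<partial>gamma_measure 1 1)"
  proof (rule EE.integral_product)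
    show "(\<lambda>x. iexp (s * ln x)) \<in> borel_measurable (gamma_measure 1 1)" by measurable
    show "(\<lambda>z. iexp (t * ln z)) \<in> borel_measurable (gamma_measure 1 1)" by measurable
  qed (simp_all only: norm_exp_i_times order_refl)
  finally show ?thesis unfolding char_def log_char_def by (simp only: mult_ac)
qed

end

section \<open>Identification of the law\<close>

lemma log_char_uminus: "log_char N (- u) = cnj (log_char N u)"
proof -
  have "log_char N (- u) = (CLINT x|N. cnj (iexp (u * ln x)))"
    unfolding log_char_def by (intro Bochner_Integration.integral_cong refl) (simp add: exp_cnj)
  then show ?thesis by (simp add: log_char_def)
qed

lemma real_distribution_distr_ln:
  assumes "real_distribution N"
  shows "real_distribution (distr N borel ln)"
proof -
  interpret N: real_distribution N by fact
  have "ln \<in> borel_measurable N" by measurable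
  then show ?thesis
    by (simp add: real_distribution_def real_distribution_axioms_def N.prob_space_distr)
qed

lemma isCont_log_char:
  assumes N: "real_distribution N"
  shows "isCont (log_char N) u"
proof -
  interpret N: real_distribution N by (rule N)
  interpret L: real_distribution "distr N borel ln" by (rule real_distribution_distr_ln[OF N])
  show ?thesis
    unfolding log_char_eq_char[OF N.events_eq_borel] by (rule L.isCont_char)
qed

lemma log_char_0:
  assumes N: "real_distribution N"
  shows "log_char N 0 = 1"
proof -
  interpret N: real_distribution N by (rule N)
  show ?thesis using N.prob_space by (simp add: log_char_def)
qed

lemma log_char_unique:
  assumes N: "real_distribution N" "AE x in N. x > 0" and L: "real_distribution L" "AE x in L. x > 0"
    and eq: "\<And>u. log_char N u = log_char L u"
  shows "N = L"
proof -
  have exp_ln: "distr (distr R borel ln) borel exp = R" if R: "real_distribution R" "AE x in R. x > 0" for R :: "real measure"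
  proof -
    interpret R: real_distribution R by (rule R)
    have [measurable_cong]: "sets R = sets borel" by simp
    have "distr (distr R borel ln) borel exp = distr R borel (\<lambda>x. exp (ln x))"
      by (subst distr_distr) (auto simp: comp_def)
    also have "\<dots> = distr R borel (\<lambda>x. x)"
      by (rule distr_cong_AE) (use R(2) in \<open>auto elim: eventually_mono\<close>)
    also have "\<dots> = R" by (rule distr_id2) simp
    finally show ?thesis .
  qed
  have s: "sets N = sets borel" "sets L = sets borel" using N(1) L(1) by (simp_all add: real_distribution.events_eq_borel)
  have "char (distr N borel ln) = char (distr L borel ln)"
    unfolding log_char_eq_char[OF s(1), symmetric] log_char_eq_char[OF s(2), symmetric] using eq by blast
  then have "distr N borel ln = distr L borel ln"
    by (intro Levy_uniqueness real_distribution_distr_ln N L)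
  then have "distr (distr N borel ln) borel exp = distr (distr L borel ln) borel exp" by (rule arg_cong)
  then show ?thesis unfolding exp_ln[OF N] exp_ln[OF L] .
qed

context limiting_triple
begin

text \<open>
  The ratios \<open>y / x\<close> and \<open>z / (x + y)\<close> of three independent positive variables determine their laws
  up to a common scale: the joint characteristic function of the logarithms of the ratios is a
  product of three functions at \<open>u\<close>, \<open>v\<close> and \<open>- u - v\<close>.
\<close>

lemma gamma_law:
  fixes M :: "'a measure" and Y :: "'a \<Rightarrow> real" and X Z :: "nat \<Rightarrow> 'a \<Rightarrow> real" and CX CZ :: "nat \<Rightarrow> real \<Rightarrow> complex"
  assumes M: "prob_space M"
    and Y: "Y \<in> borel_measurable M" and X: "\<And>n. X n \<in> borel_measurable M" and Z: "\<And>n. Z n \<in> borel_measurable M"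
    and J: "\<And>n. J n \<in> sets M" "\<And>n. measure M (J n) > 0"
    and pos: "\<And>n. AE \<omega> in M. \<omega> \<in> J n \<longrightarrow> 0 < Y \<omega> \<and> 0 < X n \<omega> \<and> 0 < Z n \<omega>" and Ypos: "AE \<omega> in M. 0 < Y \<omega>"
    and indep: "\<And>n u v w. (CLINT \<omega>|M. indicator (J n) \<omega> *\<^sub>R (iexp (u * ln (Y \<omega>)) * iexp (v * ln (X n \<omega>)) * iexp (w * ln (Z n \<omega>))))
        = log_char (distr M borel Y) u * CX n v * CZ n w"
    and conv: "\<And>a b. (\<lambda>n. measure M {\<omega>\<in>space M. \<omega> \<in> J n \<and> Y \<omega> \<le> exp a * X n \<omega> \<and> exp b * (Y \<omega> + X n \<omega>) < Z n \<omega>} / measure M (J n))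
        \<longlonglongrightarrow> (1 + exp (- a)) powr (- \<theta>) * (1 + exp b) powr (- \<theta>)"
  shows "\<exists>l>0. distr M borel Y = gamma_measure \<theta> l"
proof -
  interpret M: prob_space M by (rule M)
  note [measurable] = Y X Z J(1)
  define P where "P n = uniform_measure M (J n)" for n
  have Jpos: "emeasure M (J n) \<noteq> 0" for n using J(2)[of n] by (simp add: M.emeasure_eq_measure)
  have P: "prob_space (P n)" for n
    unfolding P_def by (rule prob_space_uniform_measure[OF Jpos]) simp
  have sets_P [measurable_cong]: "sets (P n) = sets M" for n by (simp add: P_def)
  have AE_P: "AE \<omega> in P n. 0 < Y \<omega> \<and> 0 < X n \<omega> \<and> 0 < Z n \<omega>" for n
    unfolding P_def by (rule AE_uniform_measureI[OF J(1) pos])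
  have int_P: "(\<integral>\<omega>. f \<omega> \<partial>P n) = (\<integral>\<omega>. indicator (J n) \<omega> *\<^sub>R f \<omega> \<partial>M) / of_real (measure M (J n))"
    if [measurable]: "f \<in> borel_measurable M" for f :: "'a \<Rightarrow> complex" and n
  proof -
    have "P n = density M (\<lambda>\<omega>. ennreal (indicator (J n) \<omega> / measure M (J n)))"
      unfolding P_def uniform_measure_def
      by (intro density_cong AE_I2) (auto simp: M.emeasure_eq_measure divide_ennreal[OF _ J(2), symmetric] indicator_def)
    then have "(\<integral>\<omega>. f \<omega> \<partial>P n) = (\<integral>\<omega>. (indicator (J n) \<omega> / measure M (J n)) *\<^sub>R f \<omega> \<partial>M)"
      by (simp add: integral_density)
    also have "\<dots> = (\<integral>\<omega>. (indicator (J n) \<omega> *\<^sub>R f \<omega>) / of_real (measure M (J n)) \<partial>M)"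
      by (intro Bochner_Integration.integral_cong refl) (simp add: scaleR_conv_of_real)
    finally show ?thesis by simp
  qed
  define A where "A n \<omega> = ln (Y \<omega>) - ln (X n \<omega>)" for n \<omega>
  define B where "B n \<omega> = ln (Z n \<omega>) - ln (Y \<omega> + X n \<omega>)" for n \<omega>
  have A [measurable]: "A n \<in> borel_measurable (P n)" and B [measurable]: "B n \<in> borel_measurable (P n)" for n
    unfolding A_def[abs_def] B_def[abs_def] by measurable
  have convP: "(\<lambda>n. measure (P n) {\<omega>\<in>space (P n). A n \<omega> \<le> a \<and> b < B n \<omega>}) \<longlonglongrightarrow>
      measure Q {w\<in>space Q. logY w - logX w \<le> a \<and> b < logZ w - logR w}" for a b
  proof -
    have "measure (P n) {\<omega>\<in>space (P n). A n \<omega> \<le> a \<and> b < B n \<omega>}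
      = measure M {\<omega>\<in>space M. \<omega> \<in> J n \<and> Y \<omega> \<le> exp a * X n \<omega> \<and> exp b * (Y \<omega> + X n \<omega>) < Z n \<omega>} / measure M (J n)" for n
    proof -
      have "measure (P n) {\<omega>\<in>space (P n). A n \<omega> \<le> a \<and> b < B n \<omega>}
        = measure (P n) {\<omega>\<in>space M. Y \<omega> \<le> exp a * X n \<omega> \<and> exp b * (Y \<omega> + X n \<omega>) < Z n \<omega>}"
      proof (rule measure_eq_AE)
        show "AE \<omega> in P n. \<omega> \<in> {\<omega>\<in>space (P n). A n \<omega> \<le> a \<and> b < B n \<omega>} \<longleftrightarrow>
          \<omega> \<in> {\<omega>\<in>space M. Y \<omega> \<le> exp a * X n \<omega> \<and> exp b * (Y \<omega> + X n \<omega>) < Z n \<omega>}"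
          using AE_P[of n]
        proof eventually_elim
          case (elim \<omega>)
          then have pos: "0 < Y \<omega>" "0 < X n \<omega>" "0 < Z n \<omega>" "0 < Y \<omega> + X n \<omega>" by auto
          have "A n \<omega> \<le> a \<longleftrightarrow> ln (Y \<omega>) \<le> ln (exp a * X n \<omega>)"
            using pos by (auto simp: A_def ln_mult)
          moreover have "b < B n \<omega> \<longleftrightarrow> ln (exp b * (Y \<omega> + X n \<omega>)) < ln (Z n \<omega>)"
            unfolding ln_mult_pos[OF exp_gt_zero pos(4)] by (auto simp: B_def)
          ultimately show ?case using pos by (simp add: P_def)
        qed
        show "{\<omega>\<in>space (P n). A n \<omega> \<le> a \<and> b < B n \<omega>} \<in> sets (P n)" by measurable
        show "{\<omega>\<in>space M. Y \<omega> \<le> exp a * X n \<omega> \<and> exp b * (Y \<omega> + X n \<omega>) < Z n \<omega>} \<in> sets (P n)"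
          unfolding sets_P by measurable
      qed
      also have "\<dots> = measure M (J n \<inter> {\<omega>\<in>space M. Y \<omega> \<le> exp a * X n \<omega> \<and> exp b * (Y \<omega> + X n \<omega>) < Z n \<omega>}) / measure M (J n)"
        unfolding P_def by (rule measure_uniform_measure[OF Jpos]) (simp, measurable)
      also have "J n \<inter> {\<omega>\<in>space M. Y \<omega> \<le> exp a * X n \<omega> \<and> exp b * (Y \<omega> + X n \<omega>) < Z n \<omega>}
        = {\<omega>\<in>space M. \<omega> \<in> J n \<and> Y \<omega> \<le> exp a * X n \<omega> \<and> exp b * (Y \<omega> + X n \<omega>) < Z n \<omega>}" by blast
      finally show ?thesis .
    qed
    then show ?thesis using conv[of a b] by (simp only: prob_logs)
  qed
  define \<psi> where "\<psi> = log_char (distr M borel Y)"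
  define \<gamma> where "\<gamma> a = log_char (gamma_measure a 1)" for a
  define \<zeta> where "\<zeta> w = \<gamma> 1 w * char (gamma_measure 1 1) (w / \<theta>)" for w
  have \<gamma>: "\<gamma> \<theta> u \<noteq> 0" "\<gamma> 1 u \<noteq> 0" for u
    unfolding \<gamma>_def by (intro log_char_gamma_measure_nonzero; simp add: \<theta>)+
  have \<zeta>: "\<zeta> w \<noteq> 0" for w
    unfolding \<zeta>_def using \<gamma>(2)[of w] char_gamma_measure_nonzero[of 1 1 "w / \<theta>"] by simp
  have main: "(\<lambda>n. \<psi> u * CX n v * CZ n w / of_real (measure M (J n))) \<longlonglongrightarrow> \<gamma> \<theta> u * \<gamma> 1 v * \<zeta> w"
    if w: "u + v + w = 0" for u v w
  proof -
    \<comment> \<open>For \<open>u + v + w = 0\<close> the sum u ln y + v ln x + w ln z does not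
      change under a common scale, so it depends on the two ratios only. Relative to ln (y + x), the
      logarithms of \<open>y\<close> and \<open>x\<close> are \<open>- ln (1 + exp (- a))\<close>
      and \<open>- ln (1 + exp a)\<close> with a = ln y - ln x.\<close>
    define g1 where "g1 a = iexp (- u * ln (1 + exp (- a)) - v * ln (1 + exp a))" for a
    define g2 where "g2 b = iexp (w * b)" for b :: real
    have p1: "1 + exp a \<noteq> (0::real)" for a using exp_gt_zero[of a] by linarith
    have g1c: "isCont g1 a" for a
      unfolding g1_def by (intro continuous_intros p1)
    have g2c: "isCont g2 b" for b
      unfolding g2_def by (intro continuous_intros)
    have g1g2: "g1 (ln y - ln x) * g2 (lz - ln (y + x)) = iexp (u * ln y) * iexp (v * ln x) * iexp (w * lz)"
      if "y > 0" "x > 0" for x y lz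
    proof -
      have "1 + exp (- (ln y - ln x)) = (y + x) / y" "1 + exp (ln y - ln x) = (y + x) / x"
        using that by (simp_all add: exp_diff field_simps)
      then have "ln (1 + exp (- (ln y - ln x))) = ln (y + x) - ln y" "ln (1 + exp (ln y - ln x)) = ln (y + x) - ln x"
        using that by (simp_all add: ln_div)
      then have "g1 (ln y - ln x) * g2 (lz - ln (y + x)) = iexp ((- u * (ln (y + x) - ln y) - v * (ln (y + x) - ln x)) + w * (lz - ln (y + x)))"
        unfolding g1_def g2_def by (simp only: of_real_add distrib_left exp_add)
      also have "(- u * (ln (y + x) - ln y) - v * (ln (y + x) - ln x)) + w * (lz - ln (y + x)) = u * ln y + v * ln x + w * lz - (u + v + w) * ln (y + x)"
        by (simp add: algebra_simps)
      also have "\<dots> = u * ln y + v * ln x + w * lz" unfolding w by simp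
      also have "iexp (u * ln y + v * ln x + w * lz) = iexp (u * ln y) * iexp (v * ln x) * iexp (w * lz)"
        by (simp only: of_real_add distrib_left exp_add)
      finally show ?thesis .
    qed
    have "(\<lambda>n. \<integral>\<omega>. g1 (A n \<omega>) * g2 (B n \<omega>) \<partial>P n) \<longlonglongrightarrow> (\<integral>w. g1 (logY w - logX w) * g2 (logZ w - logR w) \<partial>Q)"
    proof (rule tendsto_integral_product[OF P A B prob_space_Q _ _ convP prob_logZ_pos g1c _ g2c])
    qed (simp_all add: g1_def g2_def)
    moreover have "(\<integral>\<omega>. g1 (A n \<omega>) * g2 (B n \<omega>) \<partial>P n) = \<psi> u * CX n v * CZ n w / of_real (measure M (J n))" for n
    proof -
      have [measurable]: "g1 \<in> borel_measurable borel" "g2 \<in> borel_measurable borel"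
        by (intro borel_measurable_continuous_onI continuous_at_imp_continuous_on; simp add: g1c g2c)+
      have "(\<integral>\<omega>. g1 (A n \<omega>) * g2 (B n \<omega>) \<partial>P n)
        = (\<integral>\<omega>. iexp (u * ln (Y \<omega>)) * iexp (v * ln (X n \<omega>)) * iexp (w * ln (Z n \<omega>)) \<partial>P n)"
      proof (rule integral_cong_AE)
        show "AE \<omega> in P n. g1 (A n \<omega>) * g2 (B n \<omega>) = iexp (u * ln (Y \<omega>)) * iexp (v * ln (X n \<omega>)) * iexp (w * ln (Z n \<omega>))"
          using AE_P[of n]
        proof eventually_elim
          case (elim \<omega>)
          then show ?case unfolding A_def B_def by (intro g1g2) auto
        qed
      qed measurable
      also have "\<dots> = (\<integral>\<omega>. indicator (J n) \<omega> *\<^sub>R (iexp (u * ln (Y \<omega>)) * iexp (v * ln (X n \<omega>)) * iexp (w * ln (Z n \<omega>))) \<partial>M) / of_real (measure M (J n))"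
        by (rule int_P) measurable
      finally show ?thesis unfolding indep \<psi>_def .
    qed
    moreover have "(\<integral>w. g1 (logY w - logX w) * g2 (logZ w - logR w) \<partial>Q) = \<gamma> \<theta> u * \<gamma> 1 v * \<zeta> w"
    proof -
      have [measurable]: "g1 \<in> borel_measurable borel" "g2 \<in> borel_measurable borel"
        by (intro borel_measurable_continuous_onI continuous_at_imp_continuous_on; simp add: g1c g2c)+
      have "(\<integral>w. g1 (logY w - logX w) * g2 (logZ w - logR w) \<partial>Q) = (\<integral>x. iexp (u * logY x) * iexp (v * logX x) * iexp (w * logZ x) \<partial>Q)"
      proof (rule integral_cong_AE)
        have "AE x in Q. (case x of (_, y, x, _) \<Rightarrow> 0 < y \<and> 0 < x)"
          by (rule AE_Q_pos)
        then show "AE x in Q. g1 (logY x - logX x) * g2 (logZ x - logR x) = iexp (u * logY x) * iexp (v * logX x) * iexp (w * logZ x)"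
        proof eventually_elim
          case (elim x)
          obtain t y x' z where x: "x = (t, y, x', z)" by (cases x)
          show ?case
            using elim unfolding x logY_def logX_def logZ_def logR_def prod.case by (intro g1g2) auto
        qed
      qed measurable
      then show ?thesis unfolding integral_logs \<gamma>_def \<zeta>_def by (simp only: mult_ac)
    qed
    ultimately show ?thesis by (simp only:)
  qed
  \<comment> \<open>Quotients by the transforms of the reference triple, which turn the limits into
    \<open>1\<close>. Of the three only \<open>y\<close> is free of \<open>n\<close>.\<close>
  define y where "y u = \<psi> u / \<gamma> \<theta> u" for u
  define x where "x n v = CX n v / (\<gamma> 1 v * of_real (measure M (J n)))" for n v
  define z where "z n w = CZ n w / \<zeta> w" for n w
  have lim: "(\<lambda>n. y u * x n v * z n w) \<longlonglongrightarrow> 1" if w: "u + v + w = 0" for u v w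
  proof -
    have "(\<lambda>n. (\<psi> u * CX n v * CZ n w / of_real (measure M (J n))) / (\<gamma> \<theta> u * \<gamma> 1 v * \<zeta> w)) \<longlonglongrightarrow> (\<gamma> \<theta> u * \<gamma> 1 v * \<zeta> w) / (\<gamma> \<theta> u * \<gamma> 1 v * \<zeta> w)"
      by (intro tendsto_divide main w tendsto_const) (simp add: \<gamma> \<zeta>)
    moreover have "(\<psi> u * CX n v * CZ n w / of_real (measure M (J n))) / (\<gamma> \<theta> u * \<gamma> 1 v * \<zeta> w) = y u * x n v * z n w" for n
      unfolding y_def x_def z_def by (simp add: mult_ac)
    ultimately show ?thesis by (simp add: \<gamma> \<zeta>)
  qed
  have rd: "real_distribution (distr M borel Y)" "real_distribution (gamma_measure \<theta> 1)"
    by (simp_all add: real_distribution_def real_distribution_axioms_def M.prob_space_distr G.prob_space_axioms)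
  have y0: "y 0 = 1"
    unfolding y_def \<psi>_def \<gamma>_def log_char_0[OF rd(1)] log_char_0[OF rd(2)] by simp
  have mult: "y (a + b) = y a * y b" for a b
  proof -
    \<comment> \<open>Multiplying the relations at \<open>(a, 0, - a)\<close> and
      \<open>(b, - b, 0)\<close> and dividing by the one at \<open>(0, 0, 0)\<close> cancels
      \<open>x n 0\<close> and \<open>z n 0\<close>. Comparison with the relation at
      \<open>(a + b, - b, - a)\<close> gives multiplicativity, although \<open>x n\<close> and
      \<open>z n\<close> need not converge.\<close>
    have "(\<lambda>n. (y a * x n 0 * z n (- a)) * (y b * x n (- b) * z n 0) / (y 0 * x n 0 * z n 0)) \<longlonglongrightarrow> 1 * 1 / 1"
      by (intro tendsto_divide tendsto_mult lim) simp_all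
    moreover have "\<forall>\<^sub>F n in sequentially. y 0 * x n 0 * z n 0 \<noteq> 0"
      by (rule tendsto_imp_eventually_ne[OF lim]) simp_all
    then have "\<forall>\<^sub>F n in sequentially. (y a * x n 0 * z n (- a)) * (y b * x n (- b) * z n 0) / (y 0 * x n 0 * z n 0) = y a * y b * (x n (- b) * z n (- a))"
      by eventually_elim (simp add: y0)
    ultimately have 1: "(\<lambda>n. y a * y b * (x n (- b) * z n (- a))) \<longlonglongrightarrow> 1"
      by (simp add: tendsto_cong)
    have 2: "(\<lambda>n. y (a + b) * (x n (- b) * z n (- a))) \<longlonglongrightarrow> 1"
      using lim[of "a + b" "- b" "- a"] by (simp add: mult.assoc)
    have "(\<lambda>n. y (a + b) * (y a * y b * (x n (- b) * z n (- a)))) \<longlonglongrightarrow> y (a + b) * 1"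
      by (intro tendsto_mult tendsto_const 1)
    moreover have "(\<lambda>n. y a * y b * (y (a + b) * (x n (- b) * z n (- a)))) \<longlonglongrightarrow> y a * y b * 1"
      by (intro tendsto_mult tendsto_const 2)
    moreover have "y a * y b * (y (a + b) * (x n (- b) * z n (- a))) = y (a + b) * (y a * y b * (x n (- b) * z n (- a)))" for n
      by (simp only: mult_ac)
    ultimately show ?thesis by (simp only: LIMSEQ_unique mult_1_right)
  qed
  \<comment> \<open>As a quotient of transforms of real laws, \<open>y\<close> takes conjugate
    values at \<open>u\<close> and \<open>- u\<close>; multiplicativity makes these values inverse
    to each other.\<close>
  have norm: "norm (y u) = 1" for u
  proof -
    have "y (- u) = cnj (y u)" unfolding y_def \<psi>_def \<gamma>_def log_char_uminus by simp
    moreover have "y u * y (- u) = 1" using mult[of u "- u"] y0 by simp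
    ultimately have "y u * cnj (y u) = 1" by simp
    then have "complex_of_real ((norm (y u))\<^sup>2) = 1" by (simp only: complex_norm_square)
    then have "(norm (y u))\<^sup>2 = 1" by (simp only: of_real_eq_1_iff)
    then show ?thesis using norm_ge_zero[of "y u"] by (simp add: power2_eq_1_iff)
  qed
  have cont: "isCont y u" for u
    unfolding y_def \<psi>_def
    by (intro continuous_divide isCont_log_char rd) (use \<gamma>(1) in \<open>auto simp: \<gamma>_def isCont_log_char rd\<close>)
  obtain \<mu> where \<mu>: "\<And>u. y u = iexp (\<mu> * u)" by (rule continuous_character[OF cont mult norm]) blast
  \<comment> \<open>Multiplying the transform by the character with frequency \<mu> is a change of
    scale by \<open>exp \<mu>\<close>, hence the rate \<open>exp (- \<mu>)\<close>.\<close>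
  have l: "exp (- \<mu>) > 0" "real_distribution (gamma_measure \<theta> (exp (- \<mu>)))"
    using \<theta> by (auto intro!: real_distribution_gamma_measure)
  have "distr M borel Y = gamma_measure \<theta> (exp (- \<mu>))"
  proof (rule log_char_unique[OF rd(1) _ l(2) AE_gamma_measure_pos])
    show "AE x in distr M borel Y. 0 < x" using Ypos by (simp add: AE_distr_iff)
    fix u
    have eq: "gamma_measure \<theta> (exp (- \<mu>)) = distr (gamma_measure \<theta> 1) borel (\<lambda>x. exp \<mu> * x)"
      by (simp add: distr_mult_gamma_measure exp_minus inverse_eq_divide)
    have "log_char (gamma_measure \<theta> (exp (- \<mu>))) u = (CLINT x|gamma_measure \<theta> 1. iexp (u * ln (exp \<mu> * x)))"
      unfolding eq by (rule log_char_distr) simp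
    also have "\<dots> = (CLINT x|gamma_measure \<theta> 1. iexp (\<mu> * u) * iexp (u * ln x))"
    proof (rule integral_cong_AE)
      show "AE x in gamma_measure \<theta> 1. iexp (u * ln (exp \<mu> * x)) = iexp (\<mu> * u) * iexp (u * ln x)"
        using AE_gamma_measure_pos
        by eventually_elim (simp add: ln_mult exp_add[symmetric] distrib_left ac_simps)
    qed simp_all
    also have "\<dots> = y u * \<gamma> \<theta> u" by (simp add: \<mu> \<gamma>_def log_char_def)
    also have "\<dots> = log_char (distr M borel Y) u" using \<gamma>(1) by (simp add: y_def \<psi>_def)
    finally show "log_char (distr M borel Y) u = log_char (gamma_measure \<theta> (exp (- \<mu>))) u" by simp
  qed
  then show ?thesis using l by blast
qed

end

section \<open>Consecutive points of the range\<close>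

text \<open>Indices start at \<open>1\<close> since the increment at \<open>0\<close> is the jump
  conditioned upon, from which the next jump has to be independent. For a sequence without a later
  change the value is unspecified; \<open>next_value\<close> excludes this on regular paths.\<close>

definition first_change :: "(int \<Rightarrow> real) \<Rightarrow> nat" where
  "first_change x = (LEAST j. x (1 + int j) \<noteq> 0)"

definition next_jump :: "(int \<Rightarrow> real) \<Rightarrow> real" where
  "next_jump x = x (1 + int (first_change x))"

lemma measurable_next_jump:
  assumes K: "{1..} \<subseteq> K"
  shows "next_jump \<in> borel_measurable (PiM K (\<lambda>_. borel))"
proof -
  have c [measurable]: "(\<lambda>x::int \<Rightarrow> real. x (1 + int j)) \<in> borel_measurable (PiM K (\<lambda>_. borel))" for j
    using K by (intro measurable_component_singleton) auto
  have "first_change \<in> measurable (PiM K (\<lambda>_. borel)) (count_space UNIV)"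
    unfolding first_change_def[abs_def] by measurable
  then show ?thesis
    unfolding next_jump_def[abs_def] by (rule measurable_compose_countable[OF c])
qed

lemma next_jump_restrict: "{1..} \<subseteq> K \<Longrightarrow> next_jump (restrict x K) = next_jump x"
proof -
  assume K: "{1..} \<subseteq> K"
  have "restrict x K (1 + int j) = x (1 + int j)" for j
    using K by (intro restrict_apply') auto
  then show ?thesis by (simp only: next_jump_def first_change_def)
qed

text \<open>The first step jumps over \<open>{a<..1}\<close> into \<open>{1<..\<eta>}\<close>, and
  afterwards no value lies above the landing point and up to \<open>c\<close>. Stated through all
  later indices, this is a measurable condition on the sequence, to which
  \<open>nn_integral_count_future\<close> applies.\<close>

definition gap_set :: "real \<Rightarrow> real \<Rightarrow> real \<Rightarrow> (nat \<Rightarrow> real) set" where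
  "gap_set a \<eta> c = {x \<in> space (PiM UNIV (\<lambda>_. borel)). x 0 \<le> a \<and> 1 < x 1 \<and> x 1 \<le> \<eta> \<and> (\<forall>i. \<not> (x 1 < x (2 + i) \<and> x (2 + i) \<le> c))}"

lemma sets_gap_set: "gap_set a \<eta> c \<in> sets (PiM UNIV (\<lambda>_. borel))"
proof -
  have [measurable]: "(\<lambda>x::nat \<Rightarrow> real. x i) \<in> borel_measurable (PiM UNIV (\<lambda>_. borel))" for i
    by (rule measurable_component_singleton) simp
  show ?thesis unfolding gap_set_def by measurable
qed

lemma mem_gap_set: "x \<in> gap_set a \<eta> c \<longleftrightarrow> x 0 \<le> a \<and> 1 < x 1 \<and> x 1 \<le> \<eta> \<and> (\<forall>i. \<not> (x 1 < x (2 + i) \<and> x (2 + i) \<le> c))"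
  by (simp add: gap_set_def space_PiM)

definition gap_event :: "real \<Rightarrow> real \<Rightarrow> real \<Rightarrow> real set \<Rightarrow> bool" where
  "gap_event a \<eta> c S \<longleftrightarrow> S \<inter> {a<..1} = {} \<and> (\<exists>p\<le>\<eta>. S \<inter> {1<..c} = {p})"

context poisson_range
begin

definition Z :: "nat \<Rightarrow> 'a \<Rightarrow> real" where "Z n \<omega> = next_jump (\<lambda>i. dT n i \<omega>)"

lemma measurable_Z [measurable]: "Z n \<in> borel_measurable M"
proof -
  have "(\<lambda>\<omega> i. dT n i \<omega>) \<in> measurable M (PiM UNIV (\<lambda>_. borel))"
    by (rule measurable_PiM_single') auto
  then show ?thesis
    unfolding Z_def[abs_def] by (rule measurable_compose[OF _ measurable_next_jump]) simp
qed

text \<open>Divergence of the path forces a further change, and the least index at which one occurs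
  yields the first grid value above \<open>T (grid n 1)\<close>.\<close>

lemma next_value:
  assumes f: "regular_path (\<lambda>s. T s \<omega>)"
  obtains j where "\<And>i. i \<le> j \<Longrightarrow> T (grid n (1 + int i)) \<omega> = T (grid n 1) \<omega>"
    "T (grid n (2 + int j)) \<omega> = T (grid n 1) \<omega> + Z n \<omega>" "Z n \<omega> > 0"
proof -
  let ?x = "\<lambda>k. T (grid n k) \<omega>"
  have mono: "?x j \<le> ?x k" if "j \<le> k" for j k
    using regular_pathD(1)[OF f, of "grid n j" "grid n k"] that by simp
  have stay: "?x (1 + int i) = ?x 1" if "\<And>j. j < i \<Longrightarrow> dT n (1 + int j) \<omega> = 0" for i
    using that
  proof (induction i)
    case (Suc i)
    have "dT n (1 + int i) \<omega> = 0" by (rule Suc.prems) simp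
    then have "?x (1 + int (Suc i)) = ?x (1 + int i)" by (simp add: dT_def add_ac)
    then show ?case using Suc by simp
  qed simp
  have "\<exists>j. dT n (1 + int j) \<omega> \<noteq> 0"
  proof (rule ccontr)
    assume "\<not> ?thesis"
    then have const: "?x (1 + int i) = ?x 1" for i by (intro stay) blast
    obtain s0 where s0: "\<And>s. s \<ge> s0 \<Longrightarrow> T s \<omega> > ?x 1"
      using regular_pathD(4)[OF f] unfolding filterlim_at_top_dense eventually_at_top_linorder by blast
    obtain i :: nat where i: "log 2 (max 1 s0) < real i" using reals_Archimedean2 by blast
    have "s0 \<le> max 1 s0" by simp
    also have "max 1 s0 = 2 powr log 2 (max 1 s0)" by simp
    also have "\<dots> \<le> 2 powr real i" using i by (intro powr_mono) auto
    also have "\<dots> = grid n (int i * 2 ^ n)" by (simp add: grid_mult_power)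
    also have "\<dots> \<le> grid n (1 + int (i * 2 ^ n))" by simp
    finally have "?x (1 + int (i * 2 ^ n)) > ?x 1" by (rule s0)
    then show False using const[of "i * 2 ^ n"] by simp
  qed
  then have change: "dT n (1 + int (first_change (\<lambda>i. dT n i \<omega>))) \<omega> \<noteq> 0"
    unfolding first_change_def by (rule LeastI_ex)
  define j where "j = first_change (\<lambda>i. dT n i \<omega>)"
  have least: "dT n (1 + int i) \<omega> = 0" if "i < j" for i
    using not_less_Least that unfolding j_def first_change_def by blast
  have 1: "?x (1 + int i) = ?x 1" if "i \<le> j" for i
    using that by (intro stay least) simp
  have Z: "Z n \<omega> = dT n (1 + int j) \<omega>" by (simp add: Z_def next_jump_def j_def)
  then have 2: "?x (2 + int j) = ?x 1 + Z n \<omega>"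
    using 1[of j] by (simp add: dT_def add_ac)
  moreover have "?x 1 \<le> ?x (2 + int j)" by (rule mono) simp
  moreover have "Z n \<omega> \<noteq> 0" using change unfolding Z j_def .
  ultimately have "Z n \<omega> > 0" by simp
  with 1 2 show ?thesis by (rule that)
qed

lemma future_mem_gap_set:
  "future n k \<omega> \<in> gap_set a \<eta> c \<longleftrightarrow> T (grid n k) \<omega> \<le> a \<and> 1 < T (grid n (k + 1)) \<omega> \<and> T (grid n (k + 1)) \<omega> \<le> \<eta> \<and>
    (\<forall>i::nat. \<not> (T (grid n (k + 1)) \<omega> < T (grid n (k + 2 + int i)) \<omega> \<and> T (grid n (k + 2 + int i)) \<omega> \<le> c))"
  by (simp add: mem_gap_set future_def add_ac)

text \<open>At most one index qualifies, because up to it the path is at most \<open>a\<close> and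
  afterwards above \<open>1\<close>. If the grid values have the two gaps, the index sought is where
  the path enters the point \<open>p\<close>; it exists since the path starts from
  \<open>0\<close>.\<close>

lemma count_gap:
  assumes f: "regular_path (\<lambda>s. T s \<omega>)" and a: "0 < a" "a \<le> 1" "1 < \<eta>" "\<eta> \<le> c"
  shows "emeasure (count_space UNIV) {k. future n k \<omega> \<in> gap_set a \<eta> c}
    = of_bool (gap_event a \<eta> c (range (\<lambda>k. T (grid n k) \<omega>)))"
proof -
  let ?x = "\<lambda>k. T (grid n k) \<omega>"
  have mono: "?x j \<le> ?x k" if "j \<le> k" for j k
    using regular_pathD(1)[OF f, of "grid n j" "grid n k"] that by simp
  have unique: "j = k" if "future n j \<omega> \<in> gap_set a \<eta> c" "future n k \<omega> \<in> gap_set a \<eta> c" for j k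
  proof -
    have lt: False if "j < k" "1 < ?x (j + 1)" "?x k \<le> a" for j k
      using mono[of "j + 1" k] that a by simp
    show ?thesis
      using that lt[of j k] lt[of k j] unfolding future_mem_gap_set by (cases j k rule: linorder_cases) auto
  qed
  have event: "gap_event a \<eta> c (range ?x)" if k: "future n k \<omega> \<in> gap_set a \<eta> c" for k
  proof -
    have cases: "?x j \<le> a \<or> ?x j = ?x (k + 1) \<or> ?x j > c" for j
    proof -
      consider "j \<le> k" | "j = k + 1" | "j \<ge> k + 2" by linarith
      then show ?thesis
      proof cases
        case 1
        then show ?thesis using mono[of j k] k unfolding future_mem_gap_set by auto
      next
        case 3
        then obtain i :: nat where i: "j = k + 2 + int i" by (metis zle_iff_zadd)
        then have "?x (k + 1) \<le> ?x j" by (intro mono) simp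
        moreover have "\<not> (?x (k + 1) < ?x j \<and> ?x j \<le> c)" using k unfolding future_mem_gap_set i by blast
        ultimately show ?thesis by linarith
      qed simp
    qed
    have k': "1 < ?x (k + 1)" "?x (k + 1) \<le> \<eta>" using k unfolding future_mem_gap_set by auto
    have "\<not> (a < ?x j \<and> ?x j \<le> 1)" for j using cases[of j] k' a by linarith
    then have "range ?x \<inter> {a<..1} = {}" by auto
    moreover have "1 < ?x j \<and> ?x j \<le> c \<Longrightarrow> ?x j = ?x (k + 1)" for j using cases[of j] k' a by linarith
    then have "range ?x \<inter> {1<..c} = {?x (k + 1)}" using k' a by auto
    ultimately show ?thesis unfolding gap_event_def using k' by blast
  qed
  have hit: "\<exists>k. future n k \<omega> \<in> gap_set a \<eta> c" if e: "gap_event a \<eta> c (range ?x)"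
  proof -
    obtain p where p: "p \<le> \<eta>" "range ?x \<inter> {1<..c} = {p}" and emp: "range ?x \<inter> {a<..1} = {}"
      using e unfolding gap_event_def by (elim conjE exE) (rule that)
    have pmem: "p \<in> range ?x \<inter> {1<..c}" unfolding p(2) by simp
    then have p1: "1 < p" "p \<le> c" by simp_all
    obtain k0 where k0: "p = ?x k0" using pmem by (elim IntE imageE)
    have "\<exists>k. ?x k \<noteq> p \<and> ?x (k + 1) = p"
    proof (rule ccontr)
      assume "\<not> ?thesis"
      then have down: "?x k = p" if "?x (k + 1) = p" for k using that by blast
      have "?x (k0 - int i) = p" for i
      proof (induction i)
        case (Suc i)
        show ?case by (rule down) (use Suc in simp)
      qed (simp add: k0)
      moreover have "(\<lambda>i. ?x (k0 - int i)) \<longlonglongrightarrow> 0"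
      proof -
        have "filterlim (\<lambda>i. grid n (k0 - int i)) (at_right 0) sequentially"
          using tendsto_grid_at_bot by (auto simp: filterlim_at)
        then show ?thesis by (rule filterlim_compose[OF regular_pathD(3)[OF f]])
      qed
      ultimately have "p = 0" by (simp add: LIMSEQ_const_iff)
      with p1 show False by simp
    qed
    then obtain k where k: "?x k \<noteq> p" "?x (k + 1) = p" by blast
    have "?x k < p" using mono[of k "k + 1"] k by simp
    then have "?x k \<notin> {1<..c}" using p(2) by (metis IntI k(1) rangeI singletonD)
    then have "?x k \<le> 1" using \<open>?x k < p\<close> p1 by auto
    then have "?x k \<le> a" using emp by force
    moreover have "\<not> (p < ?x j \<and> ?x j \<le> c)" for j
    proof
      assume "p < ?x j \<and> ?x j \<le> c"
      then have "?x j \<in> range ?x \<inter> {1<..c}" using p1 by auto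
      then show False unfolding p(2) using \<open>p < ?x j \<and> ?x j \<le> c\<close> by simp
    qed
    ultimately have "future n k \<omega> \<in> gap_set a \<eta> c"
      unfolding future_mem_gap_set k(2) using p p1 by blast
    then show ?thesis by blast
  qed
  show ?thesis
  proof (cases "gap_event a \<eta> c (range ?x)")
    case True
    then obtain k where "future n k \<omega> \<in> gap_set a \<eta> c" using hit by blast
    then have "{k. future n k \<omega> \<in> gap_set a \<eta> c} = {k}" using unique by blast
    then show ?thesis using True by simp
  next
    case False
    then have "{k. future n k \<omega> \<in> gap_set a \<eta> c} = {}" using event by blast
    then show ?thesis using False by simp
  qed
qed

text \<open>Splitting \<open>{1<..c}\<close> at \<open>\<eta>\<close> expresses the event through
  the counts of three disjoint intervals, which are independent.\<close>

lemma gap_event_iff_count: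
  assumes fin: "locally_finite_range (\<lambda>s. T s \<omega>)" and a: "0 < a" "a \<le> 1" "1 < \<eta>" "\<eta> \<le> c"
  shows "gap_event a \<eta> c (process_range T \<omega>) \<longleftrightarrow> count {a<..1} \<omega> = 0 \<and> count {1<..\<eta>} \<omega> = 1 \<and> count {\<eta><..c} \<omega> = 0"
proof -
  let ?S = "process_range T \<omega>"
  have 0: "count A \<omega> = 0 \<longleftrightarrow> ?S \<inter> A = {}" for A
    unfolding point_count_def by (simp add: emeasure_count_space_eq_0)
  have "finite (?S \<inter> {1<..\<eta>})"
    using fin unfolding locally_finite_range_def process_range_def by simp
  then have 1: "count {1<..\<eta>} \<omega> = 1 \<longleftrightarrow> (\<exists>p. ?S \<inter> {1<..\<eta>} = {p})"
    by (simp add: point_count_def) (simp add: card_1_singleton_iff)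
  have "(\<exists>p\<le>\<eta>. ?S \<inter> {1<..c} = {p}) \<longleftrightarrow> (\<exists>p. ?S \<inter> {1<..\<eta>} = {p}) \<and> ?S \<inter> {\<eta><..c} = {}" (is "?l \<longleftrightarrow> ?r")
  proof
    assume ?l
    then obtain p where p: "p \<le> \<eta>" "?S \<inter> {1<..c} = {p}" by blast
    have "?S \<inter> {1<..\<eta>} = (?S \<inter> {1<..c}) \<inter> {..\<eta>}" using a by auto
    moreover have "?S \<inter> {\<eta><..c} = (?S \<inter> {1<..c}) \<inter> {\<eta><..}" using a by auto
    ultimately show ?r unfolding p(2) using p(1) by auto
  next
    assume ?r
    then obtain p where p: "?S \<inter> {1<..\<eta>} = {p}" "?S \<inter> {\<eta><..c} = {}" by blast
    have "?S \<inter> {1<..c} = (?S \<inter> {1<..\<eta>}) \<union> (?S \<inter> {\<eta><..c})" using a by auto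
    then have "?S \<inter> {1<..c} = {p}" unfolding p by simp
    moreover have "p \<in> ?S \<inter> {1<..\<eta>}" unfolding p(1) by simp
    then have "p \<le> \<eta>" by simp
    ultimately show ?l by blast
  qed
  then show ?thesis unfolding gap_event_def 0 1 by blast
qed

lemma sets_gap_event:
  assumes a: "0 < a" "a \<le> 1" "1 < \<eta>" "\<eta> \<le> c"
  shows "{\<omega>\<in>space M. count {a<..1} \<omega> = 0 \<and> count {1<..\<eta>} \<omega> = 1 \<and> count {\<eta><..c} \<omega> = 0} \<in> sets (completion M)"
proof -
  have "{\<omega>\<in>space M. count {a<..1} \<omega> = 0 \<and> count {1<..\<eta>} \<omega> = 1 \<and> count {\<eta><..c} \<omega> = 0}
    = {\<omega>\<in>space M. count {a<..1} \<omega> = 0} \<inter> {\<omega>\<in>space M. count {1<..\<eta>} \<omega> = 1} \<inter> {\<omega>\<in>space M. count {\<eta><..c} \<omega> = 0}" by blast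
  also have "\<dots> \<in> sets (completion M)"
    using a by (intro sets.Int sets_count) auto
  finally show ?thesis .
qed

lemma prob_gap_event:
  assumes a: "0 < a" "a \<le> 1" "1 < \<eta>" "\<eta> \<le> c"
  shows "C.prob {\<omega>\<in>space M. count {a<..1} \<omega> = 0 \<and> count {1<..\<eta>} \<omega> = 1 \<and> count {\<eta><..c} \<omega> = 0}
    = \<theta> * ln \<eta> * (a / c) powr \<theta>"
proof -
  define A where "A i = (if i = 0 then {a<..1} else if i = 1 then {1<..\<eta>} else {\<eta><..c})" for i :: nat
  define E :: "nat \<Rightarrow> ennreal set" where "E i = (if i = 1 then {1} else {0})" for i
  have A: "(\<forall>i<3. A i \<in> sets (scale_invariant_intensity \<theta>)) \<and> disjoint_family_on A {..<3}"
  proof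
    show "\<forall>i<3. A i \<in> sets (scale_invariant_intensity \<theta>)"
      using a by (auto simp: A_def sets_scale_invariant_intensity)
    show "disjoint_family_on A {..<3}"
      using a by (auto simp: A_def disjoint_family_on_def)
  qed
  have "C.indep_vars (\<lambda>_. borel) (\<lambda>i. count (A i)) {..<3}"
    using poisson A unfolding scale_invariant_poisson_process_def poisson_point_process_def by (elim conjE) blast
  then have "C.prob (\<Inter>i\<in>{..<3}. count (A i) -` E i \<inter> space (completion M)) = (\<Prod>i\<in>{..<3}. C.prob (count (A i) -` E i \<inter> space (completion M)))"
    by (rule C.indep_varsD) (auto simp: E_def lessThan_empty_iff bot_nat_def)
  moreover have three: "{..<3} = {0, 1, 2::nat}" by auto
  moreover have ev: "count (A i) -` E i \<inter> space (completion M) = {\<omega>\<in>space M. count (A i) \<omega> = of_nat (if i = 1 then 1 else 0)}" for i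
    by (auto simp: E_def)
  moreover have "(\<Inter>i\<in>{0, 1, 2}. {\<omega>\<in>space M. count (A i) \<omega> = of_nat (if i = 1 then 1 else 0)})
    = {\<omega>\<in>space M. count {a<..1} \<omega> = 0 \<and> count {1<..\<eta>} \<omega> = 1 \<and> count {\<eta><..c} \<omega> = 0}"
    by (auto simp: A_def)
  ultimately have "C.prob {\<omega>\<in>space M. count {a<..1} \<omega> = 0 \<and> count {1<..\<eta>} \<omega> = 1 \<and> count {\<eta><..c} \<omega> = 0}
    = (\<Prod>i\<in>{0, 1, 2}. C.prob {\<omega>\<in>space M. count (A i) \<omega> = of_nat (if i = 1 then 1 else 0)})"
    by (simp only:)
  also have "\<dots> = C.prob {\<omega>\<in>space M. count {a<..1} \<omega> = of_nat 0} * (C.prob {\<omega>\<in>space M. count {1<..\<eta>} \<omega> = of_nat 1} * C.prob {\<omega>\<in>space M. count {\<eta><..c} \<omega> = of_nat 0})"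
    by (simp add: A_def del: measure_completion)
  also have "C.prob {\<omega>\<in>space M. count {a<..1} \<omega> = of_nat 0} = exp (- (\<theta> * ln (1 / a)))"
    using a by (subst prob_count) auto
  also have "C.prob {\<omega>\<in>space M. count {1<..\<eta>} \<omega> = of_nat 1} = \<theta> * ln \<eta> * exp (- (\<theta> * ln \<eta>))"
    using a by (subst prob_count) auto
  also have "C.prob {\<omega>\<in>space M. count {\<eta><..c} \<omega> = of_nat 0} = exp (- (\<theta> * ln (c / \<eta>)))"
    using a by (subst prob_count) auto
  also have "exp (- (\<theta> * ln (1 / a))) * (\<theta> * ln \<eta> * exp (- (\<theta> * ln \<eta>)) * exp (- (\<theta> * ln (c / \<eta>))))
    = \<theta> * ln \<eta> * exp (- (\<theta> * ln (1 / a)) - \<theta> * ln \<eta> - \<theta> * ln (c / \<eta>))"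
    by (simp add: exp_add[symmetric] exp_diff exp_minus field_simps)
  \<comment> \<open>The exponents no longer see \<open>\<eta>\<close>, which survives only in the
    factor \<open>ln \<eta>\<close> of the single point.\<close>
  also have "- (\<theta> * ln (1 / a)) - \<theta> * ln \<eta> - \<theta> * ln (c / \<eta>) = \<theta> * ln (a / c)"
    using a by (simp add: ln_div algebra_simps)
  also have "exp (\<theta> * ln (a / c)) = (a / c) powr \<theta>"
    using a by (simp add: powr_def)
  finally show ?thesis .
qed

text \<open>The counts are \<open>0\<close> or \<open>1\<close>, so dominated convergence applies;
  on a locally finite path a fine grid shows the same points in \<open>{a<..c}\<close> as the whole
  range.\<close>

lemma tendsto_nn_integral_gap:
  assumes a: "0 < a" "a \<le> 1" "1 < \<eta>" "\<eta> \<le> c"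
  shows "(\<lambda>n. \<integral>\<^sup>+\<omega>. emeasure (count_space UNIV) {k. future n k \<omega> \<in> gap_set a \<eta> c} \<partial>M) \<longlonglongrightarrow> ennreal (\<theta> * ln \<eta> * (a / c) powr \<theta>)"
proof -
  define D where "D = {\<omega>\<in>space M. count {a<..1} \<omega> = 0 \<and> count {1<..\<eta>} \<omega> = 1 \<and> count {\<eta><..c} \<omega> = 0}"
  have D: "D \<in> sets (completion M)" unfolding D_def by (rule sets_gap_event[OF a])
  have "(\<lambda>n. \<integral>\<^sup>+\<omega>. emeasure (count_space UNIV) {k. future n k \<omega> \<in> gap_set a \<eta> c} \<partial>completion M)
    \<longlonglongrightarrow> (\<integral>\<^sup>+\<omega>. indicator D \<omega> \<partial>completion M)"
  proof (rule nn_integral_dominated_convergence[where w = "\<lambda>_. 1"])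
    show "(\<lambda>\<omega>. emeasure (count_space UNIV) {k. future n k \<omega> \<in> gap_set a \<eta> c}) \<in> borel_measurable (completion M)" for n
      by (intro measurable_completion measurable_count_future sets_gap_set)
    show "indicator D \<in> borel_measurable (completion M)" using D by simp
    show "AE \<omega> in completion M. emeasure (count_space UNIV) {k. future n k \<omega> \<in> gap_set a \<eta> c} \<le> 1" for n
      using AE_completion[OF AE_regular] by eventually_elim (simp add: count_gap[OF _ a] of_bool_def)
    show "AE \<omega> in completion M. (\<lambda>n. emeasure (count_space UNIV) {k. future n k \<omega> \<in> gap_set a \<eta> c}) \<longlonglongrightarrow> indicator D \<omega>"
      using AE_completion[OF AE_regular] AE_completion[OF AE_locally_finite] AE_space
    proof eventually_elim
      case (elim \<omega>)
      have "\<forall>\<^sub>F n in sequentially. range (\<lambda>k. T (grid n k) \<omega>) \<inter> {a<..c} = process_range T \<omega> \<inter> {a<..c}"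
        using eventually_grid_range_eq[OF elim(1,2), of a c] a by (simp add: process_range_def)
      then have "\<forall>\<^sub>F n in sequentially. emeasure (count_space UNIV) {k. future n k \<omega> \<in> gap_set a \<eta> c} = indicator D \<omega>"
      proof eventually_elim
        case (elim n)
        have "S \<inter> {a<..1} = (S \<inter> {a<..c}) \<inter> {a<..1}" "S \<inter> {1<..c} = (S \<inter> {a<..c}) \<inter> {1<..c}" for S
          using a by auto
        then have "gap_event a \<eta> c (range (\<lambda>k. T (grid n k) \<omega>)) \<longleftrightarrow> gap_event a \<eta> c (process_range T \<omega>)"
          unfolding gap_event_def using elim by metis
        then show ?case
          unfolding count_gap[OF \<open>regular_path _\<close> a] gap_event_iff_count[OF \<open>locally_finite_range _\<close> a]
          using \<open>\<omega> \<in> space _\<close> by (simp add: D_def indicator_def of_bool_def)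
      qed
      then show ?case by (rule tendsto_eventually)
    qed
  qed (simp_all add: emeasure_space_1)
  moreover have "(\<integral>\<^sup>+\<omega>. indicator D \<omega> \<partial>completion M) = ennreal (C.prob D)"
    unfolding nn_integral_indicator[OF D] by (rule C.emeasure_eq_measure)
  ultimately have "(\<lambda>n. \<integral>\<^sup>+\<omega>. emeasure (count_space UNIV) {k. future n k \<omega> \<in> gap_set a \<eta> c} \<partial>completion M) \<longlonglongrightarrow> ennreal (C.prob D)"
    by (simp only:)
  then show ?thesis unfolding D_def prob_gap_event[OF a] nn_integral_completion .
qed

end

section \<open>Gap probabilities at time 1\<close>

context poisson_range
begin

text \<open>The grid values after \<open>T (grid n 1)\<close> increase, so they avoid the interval
  up to \<open>c\<close> exactly when the first new one exceeds \<open>c\<close>.\<close>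

lemma scaled_future_mem_gap_set:
  assumes f: "regular_path (\<lambda>s. T s \<omega>)" and c: "\<eta> \<le> c"
  shows "scaled_future n k \<omega> \<in> gap_set a \<eta> c \<longleftrightarrow> grid n k * T 1 \<omega> \<le> a \<and> 1 < grid n k * T (grid n 1) \<omega> \<and>
    grid n k * T (grid n 1) \<omega> \<le> \<eta> \<and> c < grid n k * (T (grid n 1) \<omega> + Z n \<omega>)"
proof -
  define g where "g = grid n k"
  define R where "R = T (grid n 1) \<omega>"
  have g: "g > 0" by (simp add: g_def)
  obtain j where j: "\<And>i. i \<le> j \<Longrightarrow> T (grid n (1 + int i)) \<omega> = R" "T (grid n (2 + int j)) \<omega> = R + Z n \<omega>" "Z n \<omega> > 0"
    using next_value[OF f, of n] unfolding R_def by blast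
  have "(\<forall>i::nat. \<not> (g * R < g * T (grid n (2 + int i)) \<omega> \<and> g * T (grid n (2 + int i)) \<omega> \<le> c)) \<longleftrightarrow> c < g * (R + Z n \<omega>)"
  proof
    assume "\<forall>i::nat. \<not> (g * R < g * T (grid n (2 + int i)) \<omega> \<and> g * T (grid n (2 + int i)) \<omega> \<le> c)"
    then have "\<not> (g * R < g * (R + Z n \<omega>) \<and> g * (R + Z n \<omega>) \<le> c)" using j(2) by metis
    then show "c < g * (R + Z n \<omega>)" using j(3) g by simp
  next
    assume *: "c < g * (R + Z n \<omega>)"
    show "\<forall>i::nat. \<not> (g * R < g * T (grid n (2 + int i)) \<omega> \<and> g * T (grid n (2 + int i)) \<omega> \<le> c)"
    proof
      fix i :: nat
      show "\<not> (g * R < g * T (grid n (2 + int i)) \<omega> \<and> g * T (grid n (2 + int i)) \<omega> \<le> c)"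
      proof (cases "i < j")
        case True
        then have "T (grid n (1 + int (Suc i))) \<omega> = R" by (intro j) simp
        then show ?thesis by simp
      next
        case False
        then have "R + Z n \<omega> \<le> T (grid n (2 + int i)) \<omega>"
          unfolding j(2)[symmetric] by (intro regular_pathD(1)[OF f]) simp_all
        then have "g * (R + Z n \<omega>) \<le> g * T (grid n (2 + int i)) \<omega>" using g by simp
        then show ?thesis using * by linarith
      qed
    qed
  qed
  then show ?thesis
    unfolding mem_gap_set scaled_future_def g_def R_def by (simp add: add_ac)
qed

text \<open>In the letters of the overview \<open>T (grid n 1)\<close> is \<open>x + y\<close>; the
  bounds concern \<open>y / (x + y)\<close> and \<open>(x + y + z) / (x + y)\<close>.\<close>

definition gap_prob :: "nat \<Rightarrow> real \<Rightarrow> real \<Rightarrow> real" where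
  "gap_prob n \<alpha> \<gamma> = prob {\<omega>\<in>space M. T 1 \<omega> \<le> \<alpha> * T (grid n 1) \<omega> \<and> \<gamma> * T (grid n 1) \<omega> < T (grid n 1) \<omega> + Z n \<omega>}"

text \<open>The scale \<open>grid n k\<close> is known only up to the factor
  \<open>grid l 1\<close>, from the condition that it brings \<open>T (grid n 1)\<close> into
  \<open>{1<..grid l 1}\<close>. With the first bound tightened by this factor all
  \<open>2 ^ m\<close> admissible indices hit; a single hit implies the bounds with the second
  relaxed by it.\<close>

lemma gap_sandwich:
  fixes l m :: nat
  assumes a: "0 < a" and c: "grid l 1 \<le> c"
  defines "I \<equiv> \<integral>\<^sup>+\<omega>. emeasure (count_space UNIV) {k. future (l + m) k \<omega> \<in> gap_set a (grid l 1) c} \<partial>M"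
  shows "ennreal (2 ^ m * gap_prob (l + m) (a / grid l 1) c) \<le> I" "I \<le> ennreal (2 ^ m * gap_prob (l + m) a (c / grid l 1))"
proof -
  let ?n = "l + m" and ?\<eta> = "grid l 1"
  let ?R = "\<lambda>\<omega>. T (grid ?n 1) \<omega>"
  define E where "E \<alpha> \<gamma> = {\<omega>\<in>space M. T 1 \<omega> \<le> \<alpha> * ?R \<omega> \<and> \<gamma> * ?R \<omega> < ?R \<omega> + Z ?n \<omega>}" for \<alpha> \<gamma>
  have E [measurable]: "E \<alpha> \<gamma> \<in> sets M" for \<alpha> \<gamma> unfolding E_def by measurable
  have \<eta>: "?\<eta> > 0" by simp
  have c0: "c > 0" using \<eta> c by linarith
  have int_E: "(\<integral>\<^sup>+\<omega>. 2 ^ m * indicator (E \<alpha> \<gamma>) \<omega> \<partial>M) = ennreal (2 ^ m * gap_prob ?n \<alpha> \<gamma>)" for \<alpha> \<gamma>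
  proof -
    have "(\<integral>\<^sup>+\<omega>. 2 ^ m * indicator (E \<alpha> \<gamma>) \<omega> \<partial>M) = 2 ^ m * emeasure M (E \<alpha> \<gamma>)"
      by (rule nn_integral_cmult_indicator[OF E])
    then show ?thesis
      unfolding gap_prob_def E_def[symmetric]
      by (simp add: emeasure_eq_measure ennreal_mult' ennreal_power[symmetric])
  qed
  have I: "I = (\<integral>\<^sup>+\<omega>. emeasure (count_space UNIV) {k. scaled_future ?n k \<omega> \<in> gap_set a ?\<eta> c} \<partial>M)"
    unfolding I_def by (rule nn_integral_count_future[OF sets_gap_set])
  have bounds: "2 ^ m * indicator (E (a / ?\<eta>) c) \<omega> \<le> emeasure (count_space UNIV) {k. scaled_future ?n k \<omega> \<in> gap_set a ?\<eta> c} \<and>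
      emeasure (count_space UNIV) {k. scaled_future ?n k \<omega> \<in> gap_set a ?\<eta> c} \<le> 2 ^ m * indicator (E a (c / ?\<eta>)) \<omega>"
    if f: "regular_path (\<lambda>s. T s \<omega>)" and \<omega>: "\<omega> \<in> space M" for \<omega>
  proof -
    have R: "?R \<omega> > 0" and Y: "T 1 \<omega> > 0" using regular_pathD(5)[OF f] by simp_all
    have Z: "Z ?n \<omega> > 0" using next_value[OF f] by blast
    define V where "V = {k. 1 < grid ?n k * ?R \<omega> \<and> grid ?n k * ?R \<omega> \<le> ?\<eta>}"
    have V: "emeasure (count_space UNIV) V = 2 ^ m"
      unfolding V_def by (rule emeasure_count_grid[OF R])
    define H where "H = {k. scaled_future ?n k \<omega> \<in> gap_set a ?\<eta> c}"
    have H: "k \<in> H \<longleftrightarrow> grid ?n k * T 1 \<omega> \<le> a \<and> k \<in> V \<and> c < grid ?n k * (?R \<omega> + Z ?n \<omega>)" for k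
      unfolding H_def V_def by (auto simp: scaled_future_mem_gap_set[OF f c])
    have "H = V" if e: "\<omega> \<in> E (a / ?\<eta>) c"
    proof (intro equalityI subsetI)
      fix k assume k: "k \<in> V"
      then have k': "1 < grid ?n k * ?R \<omega>" "grid ?n k * ?R \<omega> \<le> ?\<eta>" by (auto simp: V_def)
      have e': "T 1 \<omega> \<le> a / ?\<eta> * ?R \<omega>" "c * ?R \<omega> < ?R \<omega> + Z ?n \<omega>" using e by (auto simp: E_def)
      have "grid ?n k * T 1 \<omega> \<le> grid ?n k * (a / ?\<eta> * ?R \<omega>)" using e'(1) by (rule mult_left_mono) (rule less_imp_le, rule grid_pos)
      also have "\<dots> = (a / ?\<eta>) * (grid ?n k * ?R \<omega>)" by (simp only: mult_ac)
      also have "\<dots> \<le> (a / ?\<eta>) * ?\<eta>" using k'(2) a \<eta> by (intro mult_left_mono) (auto intro!: divide_nonneg_nonneg less_imp_le[OF grid_pos])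
      finally have "grid ?n k * T 1 \<omega> \<le> a" using \<eta> by simp
      moreover have "c < grid ?n k * (?R \<omega> + Z ?n \<omega>)"
      proof -
        have "c * 1 < c * (grid ?n k * ?R \<omega>)" using k'(1) c0 by (rule mult_strict_left_mono)
        also have "\<dots> = grid ?n k * (c * ?R \<omega>)" by (simp only: mult_ac)
        also have "\<dots> < grid ?n k * (?R \<omega> + Z ?n \<omega>)" using e'(2) grid_pos by (rule mult_strict_left_mono)
        finally show ?thesis by simp
      qed
      ultimately show "k \<in> H" using k unfolding H by simp
    qed (simp add: H)
    moreover have "H \<subseteq> V" by (auto simp: H)
    then have "emeasure (count_space UNIV) H \<le> 2 ^ m" unfolding V[symmetric] by (intro emeasure_mono) auto
    moreover have "\<omega> \<in> E a (c / ?\<eta>)" if kH: "k \<in> H" for k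
    proof -
      have k: "grid ?n k * T 1 \<omega> \<le> a" "c < grid ?n k * (?R \<omega> + Z ?n \<omega>)" "1 < grid ?n k * ?R \<omega>" "grid ?n k * ?R \<omega> \<le> ?\<eta>"
        using kH unfolding H V_def by auto
      define g where "g = grid ?n k"
      have g: "g > 0" by (simp add: g_def)
      note k = k[folded g_def]
      have "a * 1 \<le> a * (g * ?R \<omega>)" using k(3) a by (intro mult_left_mono) auto
      then have "g * T 1 \<omega> \<le> g * (a * ?R \<omega>)" using k(1) by (simp add: mult_ac)
      then have 1: "T 1 \<omega> \<le> a * ?R \<omega>" using g by simp
      have "c * (g * ?R \<omega>) \<le> c * ?\<eta>" using k(4) c0 by (intro mult_left_mono) auto
      also have "\<dots> < (g * (?R \<omega> + Z ?n \<omega>)) * ?\<eta>" using k(2) \<eta> by (rule mult_strict_right_mono)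
      finally have "g * (c * ?R \<omega>) < g * ((?R \<omega> + Z ?n \<omega>) * ?\<eta>)" by (simp only: mult_ac)
      then have "c * ?R \<omega> < (?R \<omega> + Z ?n \<omega>) * ?\<eta>" using g by simp
      then have 2: "c / ?\<eta> * ?R \<omega> < ?R \<omega> + Z ?n \<omega>" using \<eta> by (simp add: pos_divide_less_eq)
      show ?thesis using 1 2 \<omega> by (simp add: E_def)
    qed
    then have "H = {}" if "\<omega> \<notin> E a (c / ?\<eta>)" using that by blast
    moreover have "V \<noteq> {}"
    proof
      assume "V = {}"
      with V show False by simp
    qed
    ultimately show ?thesis
      unfolding H_def[symmetric] using V by (auto simp: indicator_def)
  qed
  show "ennreal (2 ^ m * gap_prob ?n (a / ?\<eta>) c) \<le> I"
    unfolding I int_E[symmetric]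
    by (rule nn_integral_mono_AE, use AE_regular AE_space in eventually_elim) (use bounds in blast)
  show "I \<le> ennreal (2 ^ m * gap_prob ?n a (c / ?\<eta>))"
    unfolding I int_E[symmetric]
    by (rule nn_integral_mono_AE, use AE_regular AE_space in eventually_elim) (use bounds in blast)
qed

text \<open>The factor \<open>2 ^ l\<close> turns \<open>2 ^ m\<close> into \<open>2 ^ n\<close> and
  cancels the denominator of \<open>ln (grid l 1) = ln 2 / 2 ^ l\<close> in the limit.\<close>

lemma gap_limit:
  assumes a: "0 < a" "a \<le> 1" and c: "grid l 1 \<le> c"
  obtains i :: "nat \<Rightarrow> real" where "\<And>n. n \<ge> l \<Longrightarrow> 2 ^ n * gap_prob n (a / grid l 1) c \<le> i n"
    "\<And>n. n \<ge> l \<Longrightarrow> i n \<le> 2 ^ n * gap_prob n a (c / grid l 1)" "i \<longlonglongrightarrow> \<theta> * ln 2 * (a / c) powr \<theta>"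
proof -
  define I where "I n = (\<integral>\<^sup>+\<omega>. emeasure (count_space UNIV) {k. future n k \<omega> \<in> gap_set a (grid l 1) c} \<partial>M)" for n
  have \<eta>: "1 < grid l 1" using grid_less_iff[of l 0 1] by simp
  have ln\<eta>: "ln (grid l 1) = ln 2 / 2 ^ l" by (simp add: grid_def ln_powr)
  have "I \<longlonglongrightarrow> ennreal (\<theta> * ln (grid l 1) * (a / c) powr \<theta>)"
    unfolding I_def[abs_def] by (rule tendsto_nn_integral_gap[OF a \<eta> c])
  then have "(\<lambda>n. enn2real (I n)) \<longlonglongrightarrow> \<theta> * ln (grid l 1) * (a / c) powr \<theta>"
    by (rule tendsto_enn2real) (use \<theta> \<eta> in auto)
  then have lim: "(\<lambda>n. 2 ^ l * enn2real (I n)) \<longlonglongrightarrow> 2 ^ l * (\<theta> * ln (grid l 1) * (a / c) powr \<theta>)"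
    by (intro tendsto_mult tendsto_const)
  have g0: "0 \<le> gap_prob n \<alpha> \<gamma>" for n \<alpha> \<gamma> by (simp add: gap_prob_def)
  have lower: "2 ^ m * gap_prob (l + m) (a / grid l 1) c \<le> enn2real (I (l + m))"
    and upper: "enn2real (I (l + m)) \<le> 2 ^ m * gap_prob (l + m) a (c / grid l 1)" for m
  proof -
    have s: "ennreal (2 ^ m * gap_prob (l + m) (a / grid l 1) c) \<le> I (l + m)" "I (l + m) \<le> ennreal (2 ^ m * gap_prob (l + m) a (c / grid l 1))"
      unfolding I_def by (rule gap_sandwich[OF a(1) c])+
    have fin: "I (l + m) < \<top>" using s(2) by (rule le_less_trans) simp
    show "enn2real (I (l + m)) \<le> 2 ^ m * gap_prob (l + m) a (c / grid l 1)"
      using s(2) by (rule enn2real_leI[rotated]) (simp add: g0)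
    show "2 ^ m * gap_prob (l + m) (a / grid l 1) c \<le> enn2real (I (l + m))"
      using enn2real_mono[OF s(1) fin] by (simp add: g0)
  qed
  show ?thesis
  proof (rule that)
    fix n assume n: "n \<ge> l"
    then have nm: "n = l + (n - l)" by simp
    show "2 ^ n * gap_prob n (a / grid l 1) c \<le> 2 ^ l * enn2real (I n)"
      using mult_left_mono[OF lower[of "n - l"], of "2 ^ l"] n by (simp add: mult.assoc[symmetric] power_add[symmetric])
    show "2 ^ l * enn2real (I n) \<le> 2 ^ n * gap_prob n a (c / grid l 1)"
      using mult_left_mono[OF upper[of "n - l"], of "2 ^ l"] n by (simp add: mult.assoc[symmetric] power_add[symmetric])
  next
    have "2 ^ l * (\<theta> * ln (grid l 1) * (a / c) powr \<theta>) = \<theta> * ln 2 * (a / c) powr \<theta>"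
      by (simp add: ln\<eta>)
    then show "(\<lambda>n. 2 ^ l * enn2real (I n)) \<longlonglongrightarrow> \<theta> * ln 2 * (a / c) powr \<theta>" using lim by (simp only:)
  qed
qed

text \<open>The bounds of \<open>gap_sandwich\<close> close up as \<open>l\<close> tends to
  infinity, for then \<open>grid l 1\<close> tends to \<open>1\<close>.\<close>

lemma tendsto_gap_prob:
  assumes \<alpha>: "0 < \<alpha>" "\<alpha> < 1" and \<gamma>: "1 < \<gamma>"
  shows "(\<lambda>n. 2 ^ n * gap_prob n \<alpha> \<gamma>) \<longlonglongrightarrow> \<theta> * ln 2 * (\<alpha> / \<gamma>) powr \<theta>"
proof -
  have g1: "(\<lambda>l. grid l 1) \<longlonglongrightarrow> 1" unfolding grid_def by real_asymp
  show ?thesis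
  proof (rule order_tendstoI)
    fix y assume y: "y < \<theta> * ln 2 * (\<alpha> / \<gamma>) powr \<theta>"
    have "(\<lambda>l. \<theta> * ln 2 * (\<alpha> / (\<gamma> * grid l 1)) powr \<theta>) \<longlonglongrightarrow> \<theta> * ln 2 * (\<alpha> / (\<gamma> * 1)) powr \<theta>"
      using \<alpha> \<gamma> by (intro tendsto_intros g1) auto
    from order_tendstoD(1)[OF this, of y] y
    have "\<forall>\<^sub>F l in sequentially. y < \<theta> * ln 2 * (\<alpha> / (\<gamma> * grid l 1)) powr \<theta>" by simp
    then obtain l where l: "y < \<theta> * ln 2 * (\<alpha> / (\<gamma> * grid l 1)) powr \<theta>"
      using eventually_happens'[OF sequentially_bot] by blast
    have "1 * grid l 1 \<le> \<gamma> * grid l 1" using \<gamma> by (intro mult_right_mono) (auto intro: less_imp_le[OF grid_pos])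
    then have le: "grid l 1 \<le> \<gamma> * grid l 1" by simp
    \<comment> \<open>With \<open>c = \<gamma> * grid l 1\<close> the upper side of the sandwich is
      a multiple of \<open>gap_prob n \<alpha> \<gamma>\<close> itself, which yields the lower
      bound.\<close>
    obtain i where i: "\<And>n. n \<ge> l \<Longrightarrow> i n \<le> 2 ^ n * gap_prob n \<alpha> (\<gamma> * grid l 1 / grid l 1)"
      "i \<longlonglongrightarrow> \<theta> * ln 2 * (\<alpha> / (\<gamma> * grid l 1)) powr \<theta>"
      by (rule gap_limit[of \<alpha> l "\<gamma> * grid l 1"]) (use \<alpha> le in auto)
    show "\<forall>\<^sub>F n in sequentially. y < 2 ^ n * gap_prob n \<alpha> \<gamma>"
      using order_tendstoD(1)[OF i(2) l] eventually_ge_at_top[of l]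
    proof eventually_elim
      case (elim n)
      then show ?case using i(1)[of n] by simp
    qed
  next
    fix y assume y: "\<theta> * ln 2 * (\<alpha> / \<gamma>) powr \<theta> < y"
    have "(\<lambda>l. \<theta> * ln 2 * (\<alpha> * grid l 1 / \<gamma>) powr \<theta>) \<longlonglongrightarrow> \<theta> * ln 2 * (\<alpha> * 1 / \<gamma>) powr \<theta>"
      using \<alpha> \<gamma> by (intro tendsto_intros g1) auto
    from order_tendstoD(2)[OF this, of y] y
    have "\<forall>\<^sub>F l in sequentially. \<theta> * ln 2 * (\<alpha> * grid l 1 / \<gamma>) powr \<theta> < y" by simp
    moreover have "(\<lambda>l. \<alpha> * grid l 1) \<longlonglongrightarrow> \<alpha> * 1" by (intro tendsto_intros g1)
    then have "\<forall>\<^sub>F l in sequentially. \<alpha> * grid l 1 < 1" using \<alpha> by (intro order_tendstoD(2)) auto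
    moreover have "\<forall>\<^sub>F l in sequentially. grid l 1 < \<gamma>" using g1 \<gamma> by (rule order_tendstoD(2))
    ultimately have "\<forall>\<^sub>F l in sequentially. \<theta> * ln 2 * (\<alpha> * grid l 1 / \<gamma>) powr \<theta> < y \<and> \<alpha> * grid l 1 < 1 \<and> grid l 1 < \<gamma>"
      by eventually_elim blast
    then obtain l where l: "\<theta> * ln 2 * (\<alpha> * grid l 1 / \<gamma>) powr \<theta> < y" "\<alpha> * grid l 1 < 1" "grid l 1 < \<gamma>"
      using eventually_happens'[OF sequentially_bot] by blast
    \<comment> \<open>With \<open>a = \<alpha> * grid l 1\<close> the lower side involves
      \<open>gap_prob n \<alpha> \<gamma>\<close>. The strict bounds on \<alpha> and \<gamma> leave
      room for \<open>a \<le> 1\<close> and \<open>grid l 1 \<le> \<gamma>\<close>.\<close>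
    obtain i where i: "\<And>n. n \<ge> l \<Longrightarrow> 2 ^ n * gap_prob n (\<alpha> * grid l 1 / grid l 1) \<gamma> \<le> i n"
      "i \<longlonglongrightarrow> \<theta> * ln 2 * (\<alpha> * grid l 1 / \<gamma>) powr \<theta>"
      by (rule gap_limit[of "\<alpha> * grid l 1" l \<gamma>]) (use \<alpha> l in auto)
    show "\<forall>\<^sub>F n in sequentially. 2 ^ n * gap_prob n \<alpha> \<gamma> < y"
      using order_tendstoD(2)[OF i(2) l(1)] eventually_ge_at_top[of l]
    proof eventually_elim
      case (elim n)
      then show ?case using i(1)[of n] by simp
    qed
  qed
qed

text \<open>\<open>T 1\<close>, the jump and the next jump depend on the increments of negative
  index, of index \<open>0\<close> and of positive index, three disjoint blocks. The condition that
  a jump occurs belongs to the middle block and becomes part of its factor.\<close>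

lemma indep_triple:
  "(CLINT \<omega>|M. indicator {\<omega>\<in>space M. dT n 0 \<omega> \<noteq> 0} \<omega> *\<^sub>R (iexp (u * ln (T 1 \<omega>)) * iexp (v * ln (dT n 0 \<omega>)) * iexp (w * ln (Z n \<omega>))))
    = log_char (distr M borel (T 1)) u * (CLINT \<omega>|M. of_bool (dT n 0 \<omega> \<noteq> 0) * iexp (v * ln (dT n 0 \<omega>))) * (CLINT \<omega>|M. iexp (w * ln (Z n \<omega>)))"
proof -
  define K where "K j = (if j = 0 then {..<0} else if j = 1 then {0} else {1::int..})" for j :: nat
  define F where "F j x = (if j = 0 then iexp (u * ln (past_sum n 0 x)) else if j = 1 then of_bool (x 0 \<noteq> 0) * iexp (v * ln (x 0)) else iexp (w * ln (next_jump x)))" for j :: nat and x :: "int \<Rightarrow> real"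
  define G where "G j \<omega> = F j (restrict (\<lambda>i. dT n i \<omega>) (K j))" for j \<omega>
  have "disjoint_family_on K {0, 1, 2}" by (auto simp: K_def disjoint_family_on_def)
  then have "indep_vars (\<lambda>j. PiM (K j) (\<lambda>_. borel)) (\<lambda>j \<omega>. restrict (\<lambda>i. dT n i \<omega>) (K j)) {0, 1, 2}"
    by (intro indep_vars_restrict[OF indep_dT]) auto
  then have "indep_vars (\<lambda>_. borel) G {0, 1, 2}"
    unfolding G_def[abs_def]
  proof (rule indep_vars_compose2)
    fix j :: nat assume "j \<in> {0, 1, 2}"
    then consider "j = 0" | "j = 1" | "j = 2" by auto
    then show "F j \<in> borel_measurable (PiM (K j) (\<lambda>_. borel))"
    proof cases
      case 1
      have [measurable]: "past_sum n 0 \<in> borel_measurable (PiM {..<0} (\<lambda>_. borel))" by (rule measurable_past_sum) simp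
      show ?thesis unfolding F_def[abs_def] K_def 1 by simp
    next
      case 2
      have [measurable]: "(\<lambda>x::int \<Rightarrow> real. x 0) \<in> borel_measurable (PiM {0} (\<lambda>_. borel))" by (rule measurable_component_singleton) simp
      have "(\<lambda>x::int \<Rightarrow> real. of_bool (x 0 \<noteq> 0) * iexp (v * ln (x 0))) \<in> borel_measurable (PiM {0} (\<lambda>_. borel))"
        unfolding of_bool_def by measurable
      then show ?thesis unfolding F_def[abs_def] K_def 2 by simp
    next
      case 3
      have [measurable]: "next_jump \<in> borel_measurable (PiM {1..} (\<lambda>_. borel))" by (rule measurable_next_jump) simp
      show ?thesis unfolding F_def[abs_def] K_def 3 by simp
    qed
  qed
  moreover have Gm: "G j \<in> borel_measurable M" if "j \<in> {0, 1, 2}" for j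
    using calculation that unfolding indep_vars_def by blast
  moreover have Gb: "norm (G j \<omega>) \<le> 1" for j \<omega> by (simp add: G_def F_def of_bool_def norm_mult)
  ultimately have prod: "(\<integral>\<omega>. (\<Prod>j\<in>{0, 1, 2}. G j \<omega>) \<partial>M) = (\<Prod>j\<in>{0, 1, 2}. \<integral>\<omega>. G j \<omega> \<partial>M)"
    by (intro indep_vars_lebesgue_integral) (auto intro!: integrable_const_bound[of _ 1])
  have G1: "G 1 \<omega> = of_bool (dT n 0 \<omega> \<noteq> 0) * iexp (v * ln (dT n 0 \<omega>))" for \<omega>
    by (simp add: G_def F_def K_def)
  have G2: "G 2 \<omega> = iexp (w * ln (Z n \<omega>))" for \<omega>
    using next_jump_restrict[of "{1..}" "\<lambda>i. dT n i \<omega>"] by (simp add: G_def F_def K_def Z_def)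
  have G0: "AE \<omega> in M. G 0 \<omega> = iexp (u * ln (T 1 \<omega>))"
    using AE_past_sum
  proof eventually_elim
    case (elim \<omega>)
    have "T 1 \<omega> = past_sum n 0 (\<lambda>i. dT n i \<omega>)" using elim[rule_format, of n 0] by simp
    then show ?case
      using past_sum_restrict[of 0 "{..<0}" n "\<lambda>i. dT n i \<omega>"] by (simp add: G_def F_def K_def)
  qed
  have [measurable]: "G 0 \<in> borel_measurable M" "G 1 \<in> borel_measurable M" "G 2 \<in> borel_measurable M" by (intro Gm; simp)+
  have "(CLINT \<omega>|M. indicator {\<omega>\<in>space M. dT n 0 \<omega> \<noteq> 0} \<omega> *\<^sub>R (iexp (u * ln (T 1 \<omega>)) * iexp (v * ln (dT n 0 \<omega>)) * iexp (w * ln (Z n \<omega>))))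
    = (\<integral>\<omega>. (\<Prod>j\<in>{0, 1, 2}. G j \<omega>) \<partial>M)"
  proof (rule integral_cong_AE)
    show "AE \<omega> in M. indicator {\<omega>\<in>space M. dT n 0 \<omega> \<noteq> 0} \<omega> *\<^sub>R (iexp (u * ln (T 1 \<omega>)) * iexp (v * ln (dT n 0 \<omega>)) * iexp (w * ln (Z n \<omega>))) = (\<Prod>j\<in>{0, 1, 2}. G j \<omega>)"
      using G0 AE_space by eventually_elim (simp add: G1[unfolded One_nat_def] G2 indicator_def)
    have J: "{\<omega>\<in>space M. dT n 0 \<omega> \<noteq> 0} \<in> sets M" by measurable
    have [measurable]: "T 1 \<in> borel_measurable M" by simp
    show "(\<lambda>\<omega>. indicator {\<omega>\<in>space M. dT n 0 \<omega> \<noteq> 0} \<omega> *\<^sub>R (iexp (u * ln (T 1 \<omega>)) * iexp (v * ln (dT n 0 \<omega>)) * iexp (w * ln (Z n \<omega>)))) \<in> borel_measurable M"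
      by (intro borel_measurable_scaleR borel_measurable_indicator J) measurable
    show "(\<lambda>\<omega>. \<Prod>j\<in>{0, 1, 2}. G j \<omega>) \<in> borel_measurable M"
      by (intro borel_measurable_prod Gm)
  qed
  also have "\<dots> = (\<integral>\<omega>. G 0 \<omega> \<partial>M) * ((\<integral>\<omega>. G 1 \<omega> \<partial>M) * (\<integral>\<omega>. G 2 \<omega> \<partial>M))"
    unfolding prod by simp
  also have "(\<integral>\<omega>. G 0 \<omega> \<partial>M) = (CLINT \<omega>|M. iexp (u * ln (T 1 \<omega>)))"
  proof (rule integral_cong_AE)
    have [measurable]: "T 1 \<in> borel_measurable M" by simp
    show "(\<lambda>\<omega>. iexp (u * ln (T 1 \<omega>))) \<in> borel_measurable M" by measurable
    show "G 0 \<in> borel_measurable M" by (rule Gm) simp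
  qed (rule G0)
  also have "\<dots> = log_char (distr M borel (T 1)) u" by (rule log_char_distr[symmetric]) simp
  finally show ?thesis unfolding G1 G2 by (simp only: mult.assoc)
qed

theorem distr_gamma: "\<exists>l>0. distr M borel (T 1) = gamma_measure \<theta> l"
proof -
  interpret L: limiting_triple \<theta> by unfold_locales (rule \<theta>)
  define J where "J n = {\<omega>\<in>space M. dT n 0 \<omega> \<noteq> 0}" for n
  have J [measurable]: "J n \<in> sets M" for n unfolding J_def by measurable
  have q: "(\<lambda>n. 2 ^ n * prob (J n)) \<longlonglongrightarrow> \<theta> * ln 2" unfolding J_def by (rule tendsto_prob_jump)
  have \<theta>2: "\<theta> * ln 2 > 0" using \<theta> by simp
  \<comment> \<open>Conditioning needs events \<open>J n\<close> of positive probability, which the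
    limit guarantees from some \<open>N\<close> on.\<close>
  obtain N where "\<And>n. n \<ge> N \<Longrightarrow> 0 < 2 ^ n * prob (J n)"
    using order_tendstoD(1)[OF q \<theta>2] unfolding eventually_sequentially by blast
  then have N: "prob (J n) > 0" if "n \<ge> N" for n using that by (simp add: zero_less_mult_iff)
  show ?thesis
  proof (rule L.gamma_law[where J = "\<lambda>n. J (n + N)" and X = "\<lambda>n. dT (n + N) 0" and Z = "\<lambda>n. Z (n + N)"])
    show "prob_space M" by (rule prob_space_axioms)
    show "prob (J (n + N)) > 0" for n by (rule N) simp
    show "AE \<omega> in M. 0 < T 1 \<omega>"
      using AE_regular by eventually_elim (rule regular_pathD(5), simp_all)
    show "AE \<omega> in M. \<omega> \<in> J (n + N) \<longrightarrow> 0 < T 1 \<omega> \<and> 0 < dT (n + N) 0 \<omega> \<and> 0 < Z (n + N) \<omega>" for n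
      using AE_regular
    proof eventually_elim
      case (elim \<omega>)
      have "1 \<le> grid (n + N) 1" using grid_le_iff[of "n + N" 0 1] by simp
      then have "T 1 \<omega> \<le> T (grid (n + N) 1) \<omega>" by (intro regular_pathD(1)[OF elim]) simp_all
      moreover have "Z (n + N) \<omega> > 0" using next_value[OF elim] by blast
      moreover have "T 1 \<omega> > 0" using regular_pathD(5)[OF elim] by simp
      ultimately show ?case by (simp add: J_def dT_0)
    qed
    show "(CLINT \<omega>|M. indicator (J (n + N)) \<omega> *\<^sub>R (iexp (u * ln (T 1 \<omega>)) * iexp (v * ln (dT (n + N) 0 \<omega>)) * iexp (w * ln (Z (n + N) \<omega>))))
      = log_char (distr M borel (T 1)) u * (CLINT \<omega>|M. of_bool (dT (n + N) 0 \<omega> \<noteq> 0) * iexp (v * ln (dT (n + N) 0 \<omega>))) * (CLINT \<omega>|M. iexp (w * ln (Z (n + N) \<omega>)))" for n u v w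
      unfolding J_def by (rule indep_triple)
    fix a b :: real
    \<comment> \<open>\<open>y \<le> exp a * x\<close> is equivalent to
      \<open>y \<le> \<alpha> * (y + x)\<close>, and \<open>exp b * (y + x) < z\<close> to
      \<open>\<gamma> * (y + x) < y + x + z\<close>.\<close>
    define \<alpha> where "\<alpha> = exp a / (1 + exp a)"
    define \<gamma> where "\<gamma> = 1 + exp b"
    have p: "1 + exp a > 0" by (simp add: add_pos_pos)
    have \<alpha>: "0 < \<alpha>" "\<alpha> < 1" and \<gamma>: "1 < \<gamma>" using p by (simp_all add: \<alpha>_def \<gamma>_def)
    have ratio: "(\<alpha> / \<gamma>) powr \<theta> = (1 + exp (- a)) powr (- \<theta>) * (1 + exp b) powr (- \<theta>)"
    proof -
      have "\<alpha> = inverse (1 + exp (- a))" using p by (simp add: \<alpha>_def exp_minus field_simps)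
      then have "\<alpha> / \<gamma> = inverse ((1 + exp (- a)) * (1 + exp b))" by (simp add: \<gamma>_def field_simps)
      then show ?thesis by (simp add: powr_minus powr_mult inverse_powr add_nonneg_nonneg)
    qed
    have "(\<lambda>n. (2 ^ n * gap_prob n \<alpha> \<gamma>) / (2 ^ n * prob (J n))) \<longlonglongrightarrow> (\<theta> * ln 2 * (\<alpha> / \<gamma>) powr \<theta>) / (\<theta> * ln 2)"
      by (intro tendsto_divide tendsto_gap_prob \<alpha> \<gamma> q) (use \<theta> in simp)
    then have "(\<lambda>n. gap_prob n \<alpha> \<gamma> / prob (J n)) \<longlonglongrightarrow> (\<alpha> / \<gamma>) powr \<theta>" using \<theta> by simp
    then have "(\<lambda>n. gap_prob (n + N) \<alpha> \<gamma> / prob (J (n + N))) \<longlonglongrightarrow> (\<alpha> / \<gamma>) powr \<theta>"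
      by (rule LIMSEQ_ignore_initial_segment)
    moreover have "gap_prob n \<alpha> \<gamma> = prob {\<omega>\<in>space M. \<omega> \<in> J n \<and> T 1 \<omega> \<le> exp a * dT n 0 \<omega> \<and> exp b * (T 1 \<omega> + dT n 0 \<omega>) < Z n \<omega>}" for n
      unfolding gap_prob_def
    proof (rule measure_eq_AE)
      show "AE \<omega> in M. \<omega> \<in> {\<omega>\<in>space M. T 1 \<omega> \<le> \<alpha> * T (grid n 1) \<omega> \<and> \<gamma> * T (grid n 1) \<omega> < T (grid n 1) \<omega> + Z n \<omega>} \<longleftrightarrow>
        \<omega> \<in> {\<omega>\<in>space M. \<omega> \<in> J n \<and> T 1 \<omega> \<le> exp a * dT n 0 \<omega> \<and> exp b * (T 1 \<omega> + dT n 0 \<omega>) < Z n \<omega>}"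
        using AE_regular
      proof eventually_elim
        case (elim \<omega>)
        have Y: "T 1 \<omega> > 0" using regular_pathD(5)[OF elim] by simp
        have "T 1 \<omega> \<le> \<alpha> * T (grid n 1) \<omega> \<longleftrightarrow> (1 + exp a) * T 1 \<omega> \<le> exp a * T (grid n 1) \<omega>"
          using p by (simp add: \<alpha>_def pos_le_divide_eq mult.commute)
        then have 1: "T 1 \<omega> \<le> \<alpha> * T (grid n 1) \<omega> \<longleftrightarrow> T 1 \<omega> \<le> exp a * dT n 0 \<omega>"
          by (simp add: dT_0 algebra_simps)
        have 2: "\<gamma> * T (grid n 1) \<omega> < T (grid n 1) \<omega> + Z n \<omega> \<longleftrightarrow> exp b * (T 1 \<omega> + dT n 0 \<omega>) < Z n \<omega>"
          by (simp add: \<gamma>_def dT_0 algebra_simps)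
        \<comment> \<open>Membership in \<open>J n\<close> is implied: without a jump the first
          bound would read \<open>T 1 \<omega> \<le> 0\<close>.\<close>
        show ?case unfolding mem_Collect_eq 1 2 using Y by (auto simp: J_def)
      qed
    qed measurable
    ultimately show "(\<lambda>n. prob {\<omega>\<in>space M. \<omega> \<in> J (n + N) \<and> T 1 \<omega> \<le> exp a * dT (n + N) 0 \<omega> \<and> exp b * (T 1 \<omega> + dT (n + N) 0 \<omega>) < Z (n + N) \<omega>} / prob (J (n + N)))
      \<longlonglongrightarrow> (1 + exp (- a)) powr (- \<theta>) * (1 + exp b) powr (- \<theta>)"
      by (simp only: ratio)
  qed simp_all
qed

end

theorem theorem1p3:
  fixes M :: "'a measure" and T :: "real \<Rightarrow> 'a \<Rightarrow> real" and \<theta> :: real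
  assumes "prob_space M"
    and "\<theta> > 0"
    and "ssa_process M T"
    and "nondecreasing_process M T"
    and "no_drift M T"
  shows "scale_invariant_poisson_process M \<theta> (process_range T) \<longleftrightarrow>
         (\<exists>l>0. distributed M lborel (T 1) (\<lambda>x. ennreal (gamma_density \<theta> l x)))"
proof -
  interpret prob_space M by fact
  interpret nondecreasing_ssa M T by unfold_locales fact+
  have law: "distributed M lborel (T 1) (\<lambda>x. ennreal (gamma_density \<theta> l x)) \<longleftrightarrow> distr M borel (T 1) = gamma_measure \<theta> l" for l
  proof -
    have "distr M lborel (T 1) = distr M borel (T 1)" by (rule distr_cong) simp_all
    moreover have "T 1 \<in> measurable M lborel" by simp
    ultimately show ?thesis by (simp add: distributed_def gamma_measure_def)
  qed
  show ?thesis
    unfolding law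
  proof
    assume "scale_invariant_poisson_process M \<theta> (process_range T)"
    then interpret poisson_range M T \<theta> by unfold_locales (use assms in auto)
    show "\<exists>l>0. distr M borel (T 1) = gamma_measure \<theta> l" by (rule distr_gamma)
  next
    assume "\<exists>l>0. distr M borel (T 1) = gamma_measure \<theta> l"
    then obtain l where "l > 0" "distr M borel (T 1) = gamma_measure \<theta> l" by blast
    then interpret gamma_ssa M T \<theta> l by unfold_locales (use assms in auto)
    show "scale_invariant_poisson_process M \<theta> (process_range T)" by (rule range_poisson)
  qed
qed

end
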